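(* Let $m,n\in\mathbb Z_{>0}$ with $m>2n$, and let $\xi\in\mathcal H_n$. Define $f_{1,m,\xi}:\mathcal H_n\to\mathbb C$, $$f_{1,m,\xi}(z)=C_{m,n}^{-1}\,\det\left(\frac1{2i}\left(z-\overline\xi\right)\right)^{-m},$$ where (with $\Gamma(\cdot)$ denoting the gamma function) $$C_{m,n}=2^{\frac{n(n+3)}2}\pi^{\frac{n(n+1)}2}\prod_{r=1}^n\frac{\Gamma\left(m-\frac{n+r}2\right)}{\Gamma\left(m-\frac{r-1}2\right)}.$$ Let $\Gamma$ be a congruence subgroup of $\mathrm{Sp}_{2n}(\mathbb Z)$. Then the Poincaré series $$\Delta_{\Gamma,m,\xi}=P_\Gamma f_{1,m,\xi}=\sum_{\gamma\in\Gamma}f_{1,m,\xi}\big|_m\gamma$$ converges absolutely and uniformly on compact subsets of $\mathcal H_n$ and defines a Siegel cusp form $\Delta_{\Gamma,m,\xi}\in S_m(\Gamma)$ that satisfies $$\langle f,\Delta_{\Gamma,m,\xi}\rangle_{\Gamma\backslash\mathcal H_n}=f(\xi)\qquad\text{for all }f\in S_m(\Gamma).$$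
   Context: $\mathcal H_n=\{z=x+iy\in M_n(\mathbb C): z^\top=z,\ y>0\}$ is the Siegel upper half-space. The group $\mathrm{Sp}_{2n}(\mathbb R)=\{g\in\mathrm{GL}_{2n}(\mathbb R):g^\top J_ng=J_n\}$, $J_n=\begin{pmatrix}0&I_n\\-I_n&0\end{pmatrix}$, acts on $\mathcal H_n$ by $g.z=(Az+B)(Cz+D)^{-1}$ for $g=\begin{pmatrix}A&B\\C&D\end{pmatrix}$. For $f:\mathcal H_n\to\mathbb C$ put $(f|_mg)(z)=\det(Cz+D)^{-m}f(g.z)$. A congruence subgroup of $\mathrm{Sp}_{2n}(\mathbb Z)$ is a subgroup of $\mathrm{Sp}_{2n}(\mathbb Z)$ containing $\Gamma_n(N)=\{g\in\mathrm{Sp}_{2n}(\mathbb Z): g\equiv I_{2n}\pmod N\}$ for some $N\in\mathbb Z_{>0}$. $S_m(\Gamma)$ is the space of holomorphic $f:\mathcal H_n\to\mathbb C$ such that $f|_m\gamma=f$ for all $\gamma\in\Gamma$ and $\sup_{z=x+iy\in\mathcal H_n}|f(z)|(\det y)^{m/2}<\infty$, with the Petersson inner product $$\langle f_1,f_2\rangle_{\Gamma\backslash\mathcal H_n}=\frac1{|\Gamma\cap\{\pm I_{2n}\}|}\int_{\Gamma\backslash\mathcal H_n}f_1(z)\overline{f_2(z)}(\det y)^m\,d\mathsf v(z),\qquad d\mathsf v(z)=(\det y)^{-n-1}\prod_{1\le r\le s\le n}dx_{r,s}\,dy_{r,s}.$$ *)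

theory Defs
  imports "HOL-Analysis.Analysis" "HOL-Algebra.Group"
begin

text \<open>
  The degree \<open>n\<close> is the cardinality of the index type \<open>'n\<close>; matrices of size \<open>2n\<close> are indexed by
  \<open>'n + 'n\<close>, so that the four blocks are selected by \<open>Inl\<close> and \<open>Inr\<close>.
\<close>

type_synonym 'n cmat = "((complex, 'n) vec, 'n) vec"
type_synonym 'n sp_mat = "((real, 'n + 'n) vec, 'n + 'n) vec"

section \<open>The Siegel upper half-space and the symplectic group\<close>

definition pos_def_mat :: "real^'n::finite^'n \<Rightarrow> bool" where
  "pos_def_mat y \<longleftrightarrow> transpose y = y \<and> (\<forall>v. v \<noteq> 0 \<longrightarrow> 0 < v \<bullet> (y *v v))"

definition siegel_space :: "'n::finite cmat set" where
  "siegel_space = {z. transpose z = z \<and> pos_def_mat (map_matrix Im z)}"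

definition symplectic_J :: "'n::finite sp_mat" where
  "symplectic_J = (\<chi> i j. case (i, j) of
      (Inl r, Inr s) \<Rightarrow> if r = s then 1 else 0
    | (Inr r, Inl s) \<Rightarrow> if r = s then -1 else 0
    | _ \<Rightarrow> 0)"

definition Sp_real :: "'n::finite sp_mat set" where
  "Sp_real = {g. invertible g \<and> transpose g ** symplectic_J ** g = symplectic_J}"

definition block_A :: "'n::finite sp_mat \<Rightarrow> 'n cmat" where
  "block_A g = (\<chi> i j. of_real (g $ Inl i $ Inl j))"

definition block_B :: "'n::finite sp_mat \<Rightarrow> 'n cmat" where
  "block_B g = (\<chi> i j. of_real (g $ Inl i $ Inr j))"

definition block_C :: "'n::finite sp_mat \<Rightarrow> 'n cmat" where
  "block_C g = (\<chi> i j. of_real (g $ Inr i $ Inl j))"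

definition block_D :: "'n::finite sp_mat \<Rightarrow> 'n cmat" where
  "block_D g = (\<chi> i j. of_real (g $ Inr i $ Inr j))"

definition sp_act :: "'n::finite sp_mat \<Rightarrow> 'n cmat \<Rightarrow> 'n cmat" where
  "sp_act g z = (block_A g ** z + block_B g) ** matrix_inv (block_C g ** z + block_D g)"

definition slash ::
  "nat \<Rightarrow> ('n::finite cmat \<Rightarrow> complex) \<Rightarrow> 'n sp_mat \<Rightarrow> 'n cmat \<Rightarrow> complex" where
  "slash m f g z = det (block_C g ** z + block_D g) powi (- int m) * f (sp_act g z)"


section \<open>Congruence subgroups\<close>

definition Sp_int :: "'n::finite sp_mat set" where
  "Sp_int = {g \<in> Sp_real. \<forall>i j. g $ i $ j \<in> \<int>}"

definition Sp_int_group :: "'n::finite sp_mat monoid" where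
  "Sp_int_group = \<lparr>carrier = Sp_int, mult = (**), one = mat 1\<rparr>"

definition principal_congruence_subgroup :: "nat \<Rightarrow> 'n::finite sp_mat set" where
  "principal_congruence_subgroup N =
     {g \<in> Sp_int. \<forall>i j. \<exists>k::int. g $ i $ j - mat 1 $ i $ j = real N * of_int k}"

definition congruence_subgroup :: "'n::finite sp_mat set \<Rightarrow> bool" where
  "congruence_subgroup \<Gamma> \<longleftrightarrow>
     subgroup \<Gamma> Sp_int_group \<and> (\<exists>N>0. principal_congruence_subgroup N \<subseteq> \<Gamma>)"

lemma symplectic_J_squared: "symplectic_J ** symplectic_J = (- mat 1 :: 'n::finite sp_mat)"
proof -
  have UN: "(UNIV :: ('n + 'n) set) = range Inl \<union> range Inr"
    using UNIV_sum by blast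
  have *: "(\<Sum>k\<in>(UNIV::('n + 'n) set). h k) = (\<Sum>k\<in>UNIV. h (Inl k)) + (\<Sum>k\<in>UNIV. h (Inr k))"
    for h :: "'n + 'n \<Rightarrow> real"
    unfolding UN by (subst sum.union_disjoint) (auto simp: sum.reindex)
  have "(symplectic_J ** symplectic_J) $ i $ j = (- mat 1 :: 'n sp_mat) $ i $ j" for i j
    by (cases i; cases j)
       (simp_all add: matrix_matrix_mult_def symplectic_J_def mat_def *
          if_distrib[of "\<lambda>x. x * _"] cong: if_cong)
  then show ?thesis by (simp add: vec_eq_iff)
qed

lemma group_Sp_int: "group (Sp_int_group :: 'n::finite sp_mat monoid)"
proof (rule groupI)
  let ?G = "Sp_int_group :: 'n sp_mat monoid"
  let ?J = "symplectic_J :: 'n sp_mat"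
  have J_int: "?J $ i $ j \<in> \<int>" for i j
    by (auto simp: symplectic_J_def split: sum.splits)
  have mult_int: "(a ** b) $ i $ j \<in> \<int>" if "\<forall>i j. a $ i $ j \<in> \<int>" "\<forall>i j. b $ i $ j \<in> \<int>"
    for a b :: "'n sp_mat" and i j
    using that by (auto simp: matrix_matrix_mult_def)
  have mult_Sp: "a ** b \<in> Sp_real" if "a \<in> Sp_real" "b \<in> Sp_real"
    for a b :: "'n sp_mat"
  proof -
    have "transpose (a ** b) ** ?J ** (a ** b) = transpose b ** (transpose a ** ?J ** a) ** b"
      by (simp add: matrix_transpose_mul matrix_mul_assoc)
    then show ?thesis using that by (simp add: Sp_real_def invertible_mult)
  qed
  show "x \<otimes>\<^bsub>?G\<^esub> y \<in> carrier ?G" if "x \<in> carrier ?G" "y \<in> carrier ?G" for x y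
    using that mult_int mult_Sp by (auto simp: Sp_int_group_def Sp_int_def)
  show "\<one>\<^bsub>?G\<^esub> \<in> carrier ?G"
    by (auto simp: Sp_int_group_def Sp_int_def Sp_real_def invertible_def transpose_mat)
       (auto simp: mat_def)
  show "x \<otimes>\<^bsub>?G\<^esub> y \<otimes>\<^bsub>?G\<^esub> z = x \<otimes>\<^bsub>?G\<^esub> (y \<otimes>\<^bsub>?G\<^esub> z)" for x y z
    by (simp add: Sp_int_group_def matrix_mul_assoc)
  show "\<one>\<^bsub>?G\<^esub> \<otimes>\<^bsub>?G\<^esub> x = x" for x
    by (simp add: Sp_int_group_def)
  show "\<exists>y\<in>carrier ?G. y \<otimes>\<^bsub>?G\<^esub> x = \<one>\<^bsub>?G\<^esub>" if "x \<in> carrier ?G" for x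
  proof -
    have x: "transpose x ** ?J ** x = ?J" "\<forall>i j. x $ i $ j \<in> \<int>"
      using that by (auto simp: Sp_int_group_def Sp_int_def Sp_real_def)
    define y where "y = - (?J ** (transpose x ** ?J))"
    have neg: "(- a) ** b = - (a ** b)" for a b :: "'n sp_mat"
      by (simp add: vec_eq_iff matrix_matrix_mult_def sum_negf)
    have yx: "y ** x = mat 1"
    proof -
      have "y ** x = - (?J ** (transpose x ** ?J ** x))"
        by (simp add: y_def neg matrix_mul_assoc)
      then show ?thesis by (simp add: x symplectic_J_squared)
    qed
    then have xy: "x ** y = mat 1" by (simp add: matrix_left_right_inverse)
    have "transpose y ** ?J ** y = transpose y ** (transpose x ** ?J ** x) ** y"
      by (simp add: x)
    also have "\<dots> = transpose (x ** y) ** ?J ** (x ** y)"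
      by (simp add: matrix_transpose_mul matrix_mul_assoc)
    finally have "transpose y ** ?J ** y = ?J" by (simp add: xy transpose_mat)
    moreover have "invertible y" using xy yx invertible_def by blast
    moreover have "y $ i $ j \<in> \<int>" for i j
      unfolding y_def using mult_int J_int x(2) by (simp add: transpose_def)
    ultimately have "y \<in> carrier ?G" by (auto simp: Sp_int_group_def Sp_int_def Sp_real_def)
    with yx show ?thesis by (auto simp: Sp_int_group_def)
  qed
qed


section \<open>Cusp forms and the Petersson inner product\<close>

text \<open>
  Holomorphy as complex differentiability at every point. The Siegel space is open in the space of
  symmetric matrices, so the derivative within it sees symmetric directions only; any complex-linear
  functional on symmetric matrices extends to a complex-linear functional on all matrices.
\<close>

definition siegel_holomorphic :: "('n::finite cmat \<Rightarrow> complex) \<Rightarrow> bool" where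
  "siegel_holomorphic f \<longleftrightarrow>
     (\<forall>z\<in>siegel_space. \<exists>L. (f has_derivative L) (at z within siegel_space) \<and>
        (\<forall>c v. L (map_matrix (\<lambda>w. c * w) v) = c * L v))"

text \<open>
  Functions on the Siegel space are total functions on matrices, constrained on the Siegel space only.
\<close>

definition siegel_cusp_forms ::
  "nat \<Rightarrow> 'n::finite sp_mat set \<Rightarrow> ('n cmat \<Rightarrow> complex) set" where
  "siegel_cusp_forms m \<Gamma> = {f. siegel_holomorphic f \<and>
     (\<forall>\<gamma>\<in>\<Gamma>. \<forall>z\<in>siegel_space. slash m f \<gamma> z = f z) \<and>
     bdd_above ((\<lambda>z. cmod (f z) * det (map_matrix Im z) powr (real m / 2)) ` siegel_space)}"

text \<open>
  The measure \<open>\<Prod>\<^sub>r\<^sub>\<le>\<^sub>s dx\<^sub>r\<^sub>s dy\<^sub>r\<^sub>s\<close> on symmetric matrices: Lebesgue measure on \<open>\<complex>\<close> in each coordinate with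
  \<open>r \<le> s\<close>, transported to matrices by symmetric extension.
\<close>

definition sym_lborel :: "'n::{finite,linorder} cmat measure" where
  "sym_lborel = distr (\<Pi>\<^sub>M p\<in>{(r, s). r \<le> s}. (lborel :: complex measure)) borel
     (\<lambda>c. \<chi> r s. if r \<le> s then c (r, s) else c (s, r))"

definition siegel_measure :: "'n::{finite,linorder} cmat measure" where
  "siegel_measure = density sym_lborel
     (\<lambda>z. indicator siegel_space z * ennreal (det (map_matrix Im z) powi (- int CARD('n::{finite,linorder}) - 1)))"

text \<open>
  Integration over \<open>\<Gamma>\<setminus>H\<^sub>n\<close> is integration over a Borel set containing exactly one point of every
  \<open>\<Gamma>\<close>-orbit. Since \<open>\<Gamma>\<close> is countable and preserves the measure, the integral of a \<open>\<Gamma>\<close>-invariant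
  function does not depend on the chosen set.
\<close>

definition orbit_representatives ::
  "'n::finite sp_mat set \<Rightarrow> 'n cmat set \<Rightarrow> bool" where
  "orbit_representatives \<Gamma> F \<longleftrightarrow> F \<in> sets borel \<and> F \<subseteq> siegel_space \<and>
     (\<forall>z\<in>siegel_space. \<exists>!w. w \<in> F \<and> w \<in> (\<lambda>\<gamma>. sp_act \<gamma> z) ` \<Gamma>)"

definition quotient_integral ::
  "'n::{finite,linorder} sp_mat set \<Rightarrow> ('n::{finite,linorder} cmat \<Rightarrow> complex) \<Rightarrow> complex" where
  "quotient_integral \<Gamma> h = (LINT z:(SOME F. orbit_representatives \<Gamma> F)|siegel_measure. h z)"

definition petersson ::
  "nat \<Rightarrow> 'n::{finite,linorder} sp_mat set \<Rightarrow> ('n::{finite,linorder} cmat \<Rightarrow> complex) \<Rightarrow>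
    ('n::{finite,linorder} cmat \<Rightarrow> complex) \<Rightarrow> complex" where
  "petersson m \<Gamma> f\<^sub>1 f\<^sub>2 = 1 / of_nat (card (\<Gamma> \<inter> {mat 1, - mat 1})) *
     quotient_integral \<Gamma> (\<lambda>z. f\<^sub>1 z * cnj (f\<^sub>2 z) * of_real (det (map_matrix Im z) ^ m))"


section \<open>Poincare series\<close>

definition C_const :: "nat \<Rightarrow> nat \<Rightarrow> real" where
  "C_const m n = 2 powr (real (n * (n + 3)) / 2) * pi powr (real (n * (n + 1)) / 2) *
     (\<Prod>r = 1..n. Gamma (real m - real (n + r) / 2) / Gamma (real m - (real r - 1) / 2))"

definition f1 :: "nat \<Rightarrow> 'n::finite cmat \<Rightarrow> 'n cmat \<Rightarrow> complex" where
  "f1 m \<xi> z = inverse (of_real (C_const m CARD('n::finite))) *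
     det (map_matrix (\<lambda>w. 1 / (2 * \<i>) * w) (z - map_matrix cnj \<xi>)) powi (- int m)"

definition poincare_series ::
  "nat \<Rightarrow> 'n::finite sp_mat set \<Rightarrow> ('n cmat \<Rightarrow> complex) \<Rightarrow> 'n cmat \<Rightarrow> complex" where
  "poincare_series m \<Gamma> f z = (\<Sum>\<^sub>\<infinity>\<gamma>\<in>\<Gamma>. slash m f \<gamma> z)"

definition Delta ::
  "'n::finite sp_mat set \<Rightarrow> nat \<Rightarrow> 'n cmat \<Rightarrow> 'n cmat \<Rightarrow> complex" where
  "Delta \<Gamma> m \<xi> = poincare_series m \<Gamma> (f1 m \<xi>)"

end

theory Submission
  imports Defs "HOL-Complex_Analysis.Cauchy_Integral_Formula" "HOL-Probability.Distributions"
begin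

text \<open>
  The function \<open>|f\<^sub>1|\<^sub>m \<gamma>| (det y)^(m/2)\<close> is, up to a constant, the point-pair invariant
  \<open>|det (z - w\<^sup>*)|^(-m) (det Im z)^(m/2) (det Im w)^(m/2)\<close> at \<open>(\<gamma> z, \<xi>)\<close>, where \<open>w\<^sup>*\<close> is the complex conjugate
  of \<open>w\<close>. For \<open>m > 2 n\<close> it is integrable over the Siegel space by Hua's integral, which is computed by
  induction on the size of the matrices, splitting off Schur complements. Comparing the invariant with
  its averages over a compact neighbourhood of \<open>\<xi>\<close>, and unfolding, bounds the series uniformly on the whole
  space; this gives convergence, holomorphy and the growth condition.

  For the Petersson product, unfolding leaves the integral of \<open>f(z) f\<^sub>1(z)\<^sup>* (det y)\<^sup>m\<close> over the whole
  space. It is averaged over a circle group of rotations about \<open>\<xi>\<close>: along the orbit of \<open>z\<close> the integrand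
  is a factor depending on \<open>z\<close> only times a holomorphic function on the closed disc spanned by the orbit, so
  that the mean value property replaces \<open>f(z)\<close> by \<open>f(\<xi>)\<close>, and what remains is again Hua's integral.
\<close>


section \<open>The symplectic action on the half-space, and generators of the general linear
  group\<close>

section \<open>Complex matrices and the Siegel upper half-space\<close>

text \<open>Hua's integral is used with two exponents s. The invariant has s = m/2; the density (det
  y)^(-n-1) of the measure leaves (det y)^(s-n-1), and integrability at the boundary asks for s - n
  - 1 > -1, that is, m > 2 n. The integral that remains at the end has s = m, and its value is
  C_{m,n} up to a power of det Im \<xi> and the factor 4^(-nm), which the 1/(2i) in the definition
  of f_1 absorbs. The Petersson product integrates over a chosen set of orbit representatives, about
  which nothing is known until one Borel set of this kind has been constructed. Unfolding then
  counts almost every point with multiplicity |\<Gamma> \<inter> {1, -1}|, since any other element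
  of \<Gamma> has a null set of fixed points. The rotations need no bounded model. The Cayley
  transform centred at \<xi> is 1 - (\<xi> - cnj \<xi>) M, affine in M = (z - cnj \<xi>)^-1, so
  scaling it by \<zeta> is an affine combination of two inverse matrices; all work stays in the
  half-space.\<close>

lemma matrix_inv_left:
  fixes A :: "'a::semiring_1^'n^'n"
  assumes "invertible A" shows "matrix_inv A ** A = mat 1"
  using someI_ex[of "\<lambda>B. A ** B = mat 1 \<and> B ** A = mat 1"] assms
  unfolding matrix_inv_def invertible_def by auto

lemma matrix_inv_right:
  fixes A :: "'a::semiring_1^'n^'n"
  assumes "invertible A" shows "A ** matrix_inv A = mat 1"
  using someI_ex[of "\<lambda>B. A ** B = mat 1 \<and> B ** A = mat 1"] assms
  unfolding matrix_inv_def invertible_def by auto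

lemma matrix_diff_ldistrib:
  fixes A :: "'a::comm_ring_1^'n^'m"
  shows "A ** (B - C) = A ** B - A ** C"
  by (simp add: vec_eq_iff matrix_matrix_mult_def algebra_simps sum_subtractf)

lemma matrix_diff_rdistrib:
  fixes A :: "'a::comm_ring_1^'n^'m"
  shows "(A - B) ** C = A ** C - B ** C"
  by (simp add: vec_eq_iff matrix_matrix_mult_def algebra_simps sum_subtractf)

lemma matrix_add_rdistrib':
  fixes A :: "'a::comm_ring_1^'n^'m"
  shows "(A + B) ** C = A ** C + B ** C"
  by (simp add: vec_eq_iff matrix_matrix_mult_def algebra_simps sum.distrib)

lemma map_matrix_cnj_mult:
  "map_matrix cnj (A ** B) = map_matrix cnj A ** map_matrix cnj B"
  by (simp add: vec_eq_iff matrix_matrix_mult_def)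

lemma map_matrix_cnj_transpose: "map_matrix cnj (transpose A) = transpose (map_matrix cnj A)"
  by (simp add: vec_eq_iff transpose_def)

lemma map_matrix_cnj_add: "map_matrix cnj (A + B) = map_matrix cnj A + map_matrix cnj B"
  by (simp add: vec_eq_iff)

lemma map_matrix_cnj_cnj [simp]: "map_matrix cnj (map_matrix cnj A) = A"
  by (simp add: vec_eq_iff)

lemma det_map_cnj: "det (map_matrix cnj A) = cnj (det A)"
  by (simp add: det_def)

lemma det_map_of_real:
  "det (map_matrix complex_of_real A) = complex_of_real (det A)"
  by (simp add: det_def)

lemma transpose_add: "transpose (A + B) = transpose A + transpose B"
  by (simp add: vec_eq_iff transpose_def)

lemma transpose_diff: "transpose (A - B) = transpose A - transpose B"
  by (simp add: vec_eq_iff transpose_def)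

lemma det_scale: "det (map_matrix (\<lambda>w. c * w) A) = c ^ CARD('n) * det A"
  for A :: "'a::comm_ring_1^'n^'n"
proof -
  have "map_matrix (\<lambda>w. c * w) A = (\<chi> i. c *s (A $ i))"
    by (simp add: vec_eq_iff)
  then show ?thesis by (simp add: det_rows_mul)
qed

text \<open>Positivity of Im z is tested on complex vectors, because the invertibility of z - cnj w
  and of Cz + D is read off from their complex kernels.\<close>

definition herm :: "complex^'n \<Rightarrow> complex^'n \<Rightarrow> complex" where
  "herm v w = (\<Sum>i\<in>UNIV. cnj (v $ i) * w $ i)"

lemma herm_0 [simp]: "herm v 0 = 0" "herm 0 v = 0"
  by (simp_all add: herm_def)

lemma herm_diff_right: "herm v (w - u) = herm v w - herm v u"
  by (simp add: herm_def algebra_simps sum_subtractf)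

lemma herm_add_right: "herm v (w + u) = herm v w + herm v u"
  by (simp add: herm_def algebra_simps sum.distrib)

lemma herm_matrix:
  "herm (A *v v) w = herm v (transpose (map_matrix cnj A) *v w)"
proof -
  have "herm (A *v v) w = (\<Sum>i\<in>UNIV. \<Sum>j\<in>UNIV. cnj (A $ i $ j) * cnj (v $ j) * w $ i)"
    by (simp add: herm_def matrix_vector_mult_def sum_distrib_right)
  also have "\<dots> = (\<Sum>j\<in>UNIV. \<Sum>i\<in>UNIV. cnj (A $ i $ j) * cnj (v $ j) * w $ i)"
    by (rule sum.swap)
  also have "\<dots> = herm v (transpose (map_matrix cnj A) *v w)"
    unfolding herm_def matrix_vector_mult_def transpose_def
    by (simp add: sum_distrib_left mult_ac)
  finally show ?thesis .
qed

lemma herm_cnj: "cnj (herm v w) = herm w v"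
  by (simp add: herm_def mult.commute)

lemma norm_herm_le: "cmod (herm v w) \<le> norm v * norm w"
proof -
  have "cmod (herm v w) \<le> (\<Sum>i\<in>UNIV. \<bar>cmod (v $ i)\<bar> * \<bar>cmod (w $ i)\<bar>)"
    unfolding herm_def by (rule order_trans[OF norm_sum]) (simp add: norm_mult)
  also have "\<dots> \<le> L2_set (\<lambda>i. cmod (v $ i)) UNIV * L2_set (\<lambda>i. cmod (w $ i)) UNIV"
    by (rule L2_set_mult_ineq)
  finally show ?thesis by (simp add: norm_vec_def)
qed

definition re_vec :: "complex^'n \<Rightarrow> real^'n" where "re_vec v = (\<chi> i. Re (v $ i))"
definition im_vec :: "complex^'n \<Rightarrow> real^'n" where "im_vec v = (\<chi> i. Im (v $ i))"

lemma re_im_vec_0: "re_vec v = 0 \<Longrightarrow> im_vec v = 0 \<Longrightarrow> v = 0"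
  by (simp add: vec_eq_iff re_vec_def im_vec_def complex_eq_iff)

text \<open>For v = a + ib, the cross terms of a and b against Re z cancel by symmetry, and only the
  values of the real form of Im z at a and at b remain.\<close>

lemma Im_herm_symmetric:
  assumes "transpose z = z"
  shows "Im (herm v (z *v v)) =
    re_vec v \<bullet> (map_matrix Im z *v re_vec v) + im_vec v \<bullet> (map_matrix Im z *v im_vec v)"
proof -
  let ?a = "\<lambda>i. Re (v $ i)" and ?b = "\<lambda>i. Im (v $ i)"
  have sym: "z $ i $ j = z $ j $ i" for i j
    using assms by (metis transpose_def vec_lambda_beta)
  have "Im (herm v (z *v v)) = (\<Sum>i\<in>UNIV. \<Sum>j\<in>UNIV. Im (cnj (v $ i) * (z $ i $ j * v $ j)))"
    by (simp add: herm_def matrix_vector_mult_def sum_distrib_left)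
  also have "\<dots> = (\<Sum>i\<in>UNIV. \<Sum>j\<in>UNIV. (?a i * ?a j + ?b i * ?b j) * Im (z $ i $ j)) +
      ((\<Sum>i\<in>UNIV. \<Sum>j\<in>UNIV. ?a i * ?b j * Re (z $ i $ j)) -
       (\<Sum>i\<in>UNIV. \<Sum>j\<in>UNIV. ?b i * ?a j * Re (z $ i $ j)))"
    unfolding sum.distrib[symmetric] sum_subtractf[symmetric]
    by (intro sum.cong refl) (simp add: algebra_simps)
  also have "(\<Sum>i\<in>UNIV. \<Sum>j\<in>UNIV. ?b i * ?a j * Re (z $ i $ j)) =
      (\<Sum>j\<in>UNIV. \<Sum>i\<in>UNIV. ?a j * ?b i * Re (z $ j $ i))"
    by (subst sum.swap) (intro sum.cong refl, simp, metis sym mult.commute)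
  finally show ?thesis
    by (simp add: inner_vec_def matrix_vector_mult_def re_vec_def im_vec_def sum_distrib_left
        sum.distrib algebra_simps)
qed

lemma siegel_space_iff:
  "z \<in> siegel_space \<longleftrightarrow> transpose z = z \<and> (\<forall>v. v \<noteq> 0 \<longrightarrow> 0 < Im (herm v (z *v v)))"
proof
  assume z: "z \<in> siegel_space"
  then have sym: "transpose z = z" and pd: "pos_def_mat (map_matrix Im z)"
    by (auto simp: siegel_space_def)
  have "0 < Im (herm v (z *v v))" if "v \<noteq> 0" for v
  proof -
    have ge: "0 \<le> u \<bullet> (map_matrix Im z *v u)" for u
      using pd by (cases "u = 0") (auto simp: pos_def_mat_def less_imp_le)
    have "re_vec v \<noteq> 0 \<or> im_vec v \<noteq> 0" using that re_im_vec_0 by blast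
    then show ?thesis
      unfolding Im_herm_symmetric[OF sym]
      using pd ge[of "re_vec v"] ge[of "im_vec v"]
      by (auto simp: pos_def_mat_def intro: add_pos_nonneg add_nonneg_pos)
  qed
  with sym show "transpose z = z \<and> (\<forall>v. v \<noteq> 0 \<longrightarrow> 0 < Im (herm v (z *v v)))" by blast
next
  assume *: "transpose z = z \<and> (\<forall>v. v \<noteq> 0 \<longrightarrow> 0 < Im (herm v (z *v v)))"
  then have sym: "transpose z = z" by blast
  have "transpose (map_matrix Im z) = map_matrix Im z"
    using sym by (simp add: vec_eq_iff transpose_def)
  moreover have "0 < u \<bullet> (map_matrix Im z *v u)" if "u \<noteq> 0" for u
  proof -
    define v :: "complex^'a" where "v = (\<chi> i. of_real (u $ i))"
    have "re_vec v = u" "im_vec v = 0" "v \<noteq> 0"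
      using that by (auto simp: v_def re_vec_def im_vec_def vec_eq_iff)
    then show ?thesis using * Im_herm_symmetric[OF sym, of v] by auto
  qed
  ultimately show "z \<in> siegel_space" using sym by (simp add: siegel_space_def pos_def_mat_def)
qed

lemma siegel_space_transpose: "z \<in> siegel_space \<Longrightarrow> transpose z = z"
  by (simp add: siegel_space_def)

lemma siegel_space_sym: "z \<in> siegel_space \<Longrightarrow> z $ i $ j = z $ j $ i"
  by (metis siegel_space_transpose transpose_def vec_lambda_beta)

lemma siegel_space_pos: "z \<in> siegel_space \<Longrightarrow> v \<noteq> 0 \<Longrightarrow> 0 < Im (herm v (z *v v))"
  by (simp add: siegel_space_iff)

lemma siegel_space_pos_ge: "z \<in> siegel_space \<Longrightarrow> 0 \<le> Im (herm v (z *v v))"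
  by (cases "v = 0") (auto intro: less_imp_le siegel_space_pos)

text \<open>For symmetric w the conjugate of w is its adjoint, so the two forms are conjugate and
  subtraction adds the imaginary parts. This gives the invertibility of z - cnj w and later the
  bound on its inverse.\<close>

lemma Im_herm_diff_cnj:
  assumes "transpose w = w"
  shows "Im (herm v ((z - map_matrix cnj w) *v v)) = Im (herm v (z *v v)) + Im (herm v (w *v v))"
proof -
  have "herm v (map_matrix cnj w *v v) = herm (w *v v) v"
    by (subst herm_matrix) (simp add: map_matrix_cnj_transpose[symmetric] assms)
  then have "Im (herm v (map_matrix cnj w *v v)) = - Im (herm v (w *v v))"
    by (metis cnj.sel(2) herm_cnj)
  then show ?thesis by (simp add: matrix_vector_mult_diff_rdistrib herm_diff_right)
qed

lemma invertible_if_kernel_0: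
  fixes A :: "complex^'n^'n"
  assumes "\<And>v. A *v v = 0 \<Longrightarrow> v = 0"
  shows "invertible A"
  using assms matrix_left_invertible_ker[of A] by (auto simp: invertible_left_inverse)

lemma invertible_diff_cnj:
  assumes "z \<in> siegel_space" "w \<in> siegel_space"
  shows "invertible (z - map_matrix cnj w)"
proof (rule invertible_if_kernel_0, rule ccontr)
  fix v assume v: "(z - map_matrix cnj w) *v v = 0" "v \<noteq> 0"
  then have "0 < Im (herm v ((z - map_matrix cnj w) *v v))"
    using assms siegel_space_pos by (subst Im_herm_diff_cnj)
      (auto intro: add_pos_pos siegel_space_transpose)
  with v show False by simp
qed

lemma det_diff_cnj_nz:
  "z \<in> siegel_space \<Longrightarrow> w \<in> siegel_space \<Longrightarrow> det (z - map_matrix cnj w) \<noteq> 0"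
  using invertible_diff_cnj invertible_det_nz by blast

section \<open>The action of the symplectic group\<close>

definition aut_num :: "'n::finite sp_mat \<Rightarrow> 'n cmat \<Rightarrow> 'n cmat" where
  "aut_num g z = block_A g ** z + block_B g"

definition aut_den :: "'n::finite sp_mat \<Rightarrow> 'n cmat \<Rightarrow> 'n cmat" where
  "aut_den g z = block_C g ** z + block_D g"

lemma sp_act_eq: "sp_act g z = aut_num g z ** matrix_inv (aut_den g z)"
  by (simp add: sp_act_def aut_num_def aut_den_def)

lemma slash_eq: "slash m f g z = det (aut_den g z) powi (- int m) * f (sp_act g z)"
  by (simp add: slash_def aut_den_def)

lemma sum_UNIV_sum:
  fixes h :: "'n::finite + 'n \<Rightarrow> 'a::comm_monoid_add"
  shows "(\<Sum>k\<in>UNIV. h k) = (\<Sum>k\<in>UNIV. h (Inl k)) + (\<Sum>k\<in>UNIV. h (Inr k))"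
proof -
  have UN: "(UNIV :: ('n + 'n) set) = range Inl \<union> range Inr"
    using UNIV_sum by blast
  show ?thesis unfolding UN by (subst sum.union_disjoint) (auto simp: sum.reindex)
qed

lemma block_mult:
  "block_A (g ** h) = block_A g ** block_A h + block_B g ** block_C h"
  "block_B (g ** h) = block_A g ** block_B h + block_B g ** block_D h"
  "block_C (g ** h) = block_C g ** block_A h + block_D g ** block_C h"
  "block_D (g ** h) = block_C g ** block_B h + block_D g ** block_D h"
  by (simp_all add: vec_eq_iff block_A_def block_B_def block_C_def block_D_def
      matrix_matrix_mult_def sum_UNIV_sum)

lemma block_mat_1 [simp]:
  "block_A (mat 1) = mat 1" "block_B (mat 1) = 0" "block_C (mat 1) = 0" "block_D (mat 1) = mat 1"
  by (simp_all add: vec_eq_iff block_A_def block_B_def block_C_def block_D_def mat_def)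

lemma block_real:
  "map_matrix cnj (block_A g) = block_A g" "map_matrix cnj (block_B g) = block_B g"
  "map_matrix cnj (block_C g) = block_C g" "map_matrix cnj (block_D g) = block_D g"
  by (simp_all add: vec_eq_iff block_A_def block_B_def block_C_def block_D_def)

lemma block_J:
  fixes J :: "'n::finite sp_mat" defines "J \<equiv> symplectic_J"
  shows "block_A J = 0" "block_B J = mat 1" "block_C J = - mat 1" "block_D J = 0"
  by (simp_all add: J_def vec_eq_iff block_A_def block_B_def block_C_def block_D_def
      symplectic_J_def mat_def)

lemma block_transpose:
  "block_A (transpose g) = transpose (block_A g)" "block_B (transpose g) = transpose (block_C g)"
  "block_C (transpose g) = transpose (block_B g)" "block_D (transpose g) = transpose (block_D g)"
  by (simp_all add: vec_eq_iff block_A_def block_B_def block_C_def block_D_def transpose_def)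

lemma block_eqI:
  assumes "block_A g = block_A h" "block_B g = block_B h" "block_C g = block_C h"
    "block_D g = block_D h"
  shows "g = h"
proof -
  have "g $ i $ j = h $ i $ j" for i j
    using assms by (cases i; cases j)
      (auto simp: vec_eq_iff block_A_def block_B_def block_C_def block_D_def)
  then show ?thesis by (simp add: vec_eq_iff)
qed

lemma symplectic_iff_block:
  "transpose g ** symplectic_J ** g = symplectic_J \<longleftrightarrow>
    transpose (block_A g) ** block_C g = transpose (block_C g) ** block_A g \<and>
    transpose (block_B g) ** block_D g = transpose (block_D g) ** block_B g \<and>
    transpose (block_A g) ** block_D g - transpose (block_C g) ** block_B g = mat 1"
    (is "?l = symplectic_J \<longleftrightarrow> ?r")
proof -
  have neg: "A ** (- mat 1) = - A" "(- A) ** B = - (A ** B)" for A B :: "'a cmat"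
    by (simp_all add: vec_eq_iff matrix_matrix_mult_def mat_def sum_negf if_distrib
        cong: if_cong)
  have blocks:
    "block_A ?l = transpose (block_A g) ** block_C g - transpose (block_C g) ** block_A g"
    "block_B ?l = transpose (block_A g) ** block_D g - transpose (block_C g) ** block_B g"
    "block_C ?l = transpose (block_B g) ** block_C g - transpose (block_D g) ** block_A g"
    "block_D ?l = transpose (block_B g) ** block_D g - transpose (block_D g) ** block_B g"
    by (simp_all add: block_mult block_transpose block_J neg)
  \<comment> \<open>\<open>?l\<close> is antisymmetric like J, so its lower left block is minus the
    transpose of the upper right one, and three block equations suffice.\<close>
  have tr: "transpose (block_C ?l) = - block_B ?l"
    unfolding blocks by (simp add: transpose_diff matrix_transpose_mul)
  have tr': "block_C ?l = - mat 1" if "block_B ?l = mat 1"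
  proof -
    have "transpose (transpose (block_C ?l)) = transpose (- mat 1)" using tr that by simp
    then show ?thesis by (simp add: vec_eq_iff transpose_def mat_def)
  qed
  show ?thesis
  proof
    assume l: "?l = symplectic_J"
    show ?r using blocks(1,2,4) unfolding l block_J by simp
  next
    assume r: ?r
    then have "block_B ?l = mat 1" by (simp only: blocks)
    with tr' have "block_C ?l = - mat 1" by blast
    with r show "?l = symplectic_J"
      by (intro block_eqI) (simp_all only: block_J blocks(1,2,4), simp_all)
  qed
qed

lemma Sp_real_block:
  assumes "g \<in> Sp_real"
  shows "transpose (block_A g) ** block_C g = transpose (block_C g) ** block_A g"
    "transpose (block_B g) ** block_D g = transpose (block_D g) ** block_B g"
    "transpose (block_A g) ** block_D g - transpose (block_C g) ** block_B g = mat 1"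
    "transpose (block_D g) ** block_A g - transpose (block_B g) ** block_C g = mat 1"
proof -
  have *: "transpose g ** symplectic_J ** g = symplectic_J"
    using assms by (simp add: Sp_real_def)
  show "transpose (block_A g) ** block_C g = transpose (block_C g) ** block_A g"
    "transpose (block_B g) ** block_D g = transpose (block_D g) ** block_B g"
    and 3: "transpose (block_A g) ** block_D g - transpose (block_C g) ** block_B g = mat 1"
    using * unfolding symplectic_iff_block by blast+
  have "transpose (transpose (block_A g) ** block_D g - transpose (block_C g) ** block_B g) = mat 1"
    unfolding 3 by simp
  then show "transpose (block_D g) ** block_A g - transpose (block_B g) ** block_C g = mat 1"
    by (simp add: transpose_diff matrix_transpose_mul)
qed

lemma symplectic_left_inverse:
  fixes g :: "'n::finite sp_mat"
  assumes "transpose g ** symplectic_J ** g = symplectic_J"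
  shows "- (symplectic_J ** transpose g ** symplectic_J) ** g = mat 1"
proof -
  have neg: "(- a) ** b = - (a ** b)" for a b :: "'n sp_mat"
    by (simp add: vec_eq_iff matrix_matrix_mult_def sum_negf)
  have "- (symplectic_J ** transpose g ** symplectic_J) ** g
      = - (symplectic_J ** (transpose g ** symplectic_J ** g))"
    by (simp add: neg matrix_mul_assoc)
  then show ?thesis by (simp add: assms symplectic_J_squared)
qed

lemma Sp_realI:
  "transpose g ** symplectic_J ** g = symplectic_J \<Longrightarrow> g \<in> Sp_real"
  using symplectic_left_inverse[of g] by (auto simp: Sp_real_def invertible_left_inverse)

lemma Sp_real_mult: "a \<in> Sp_real \<Longrightarrow> b \<in> Sp_real \<Longrightarrow> a ** b \<in> Sp_real"
proof -
  assume "a \<in> Sp_real" "b \<in> Sp_real"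
  moreover have "transpose (a ** b) ** symplectic_J ** (a ** b) =
      transpose b ** (transpose a ** symplectic_J ** a) ** b"
    by (simp add: matrix_transpose_mul matrix_mul_assoc)
  ultimately show ?thesis by (simp add: Sp_real_def invertible_mult)
qed

lemma Sp_real_inverse:
  assumes g: "g \<in> Sp_real"
  obtains h where "h \<in> Sp_real" "h ** g = mat 1" "g ** h = mat 1"
proof -
  from g have "invertible g" and s: "transpose g ** symplectic_J ** g = symplectic_J"
    by (auto simp: Sp_real_def)
  then obtain h where h: "h ** g = mat 1" "g ** h = mat 1" by (auto simp: invertible_def)
  have "transpose h ** symplectic_J ** h = transpose h ** (transpose g ** symplectic_J ** g) ** h"
    by (simp add: s)
  also have "\<dots> = transpose (g ** h) ** symplectic_J ** (g ** h)"
    by (simp add: matrix_transpose_mul matrix_mul_assoc)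
  finally have "h \<in> Sp_real" using h by (intro Sp_realI) simp
  with h that show ?thesis by blast
qed

text \<open>Invariance of the symplectic form, evaluated on the columns (w; 1) and (z; 1). The
  points are arbitrary matrices, so one of them may be the conjugate of a point of the
  half-space.\<close>

lemma aut_pair:
  assumes g: "g \<in> Sp_real"
  shows "transpose (aut_num g w) ** aut_den g z - transpose (aut_den g w) ** aut_num g z
    = transpose w - z"
proof -
  note b = Sp_real_block[OF g]
  have "transpose (aut_num g w) ** aut_den g z - transpose (aut_den g w) ** aut_num g z =
     transpose w ** (transpose (block_A g) ** block_C g - transpose (block_C g) ** block_A g) ** z
   + transpose w ** (transpose (block_A g) ** block_D g - transpose (block_C g) ** block_B g)
   - (transpose (block_D g) ** block_A g - transpose (block_B g) ** block_C g) ** z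
   + (transpose (block_B g) ** block_D g - transpose (block_D g) ** block_B g)"
    by (simp add: aut_num_def aut_den_def transpose_add matrix_transpose_mul matrix_add_ldistrib
        matrix_add_rdistrib' matrix_diff_ldistrib matrix_diff_rdistrib matrix_mul_assoc)
  then show ?thesis using b by simp
qed

lemma map_cnj_aut:
  "map_matrix cnj (aut_num g z) = aut_num g (map_matrix cnj z)"
  "map_matrix cnj (aut_den g z) = aut_den g (map_matrix cnj z)"
  by (simp_all add: aut_num_def aut_den_def map_matrix_cnj_add map_matrix_cnj_mult block_real)

text \<open>This is \<open>aut_pair\<close> with the first point conjugated. It shows at once that
  Cz + D has no kernel and, after dividing by Cz + D, that the image point has positive imaginary
  part.\<close>

lemma aut_den_pos:
  assumes g: "g \<in> Sp_real" and z: "z \<in> siegel_space"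
  shows "Im (herm (aut_den g z *v v) (aut_num g z *v v)) = Im (herm v (z *v v))"
proof -
  let ?P = "aut_num g z" and ?Q = "aut_den g z"
  have zs: "transpose z = z" using z by (rule siegel_space_transpose)
  have zc: "transpose (map_matrix cnj z) = map_matrix cnj z"
    by (metis map_matrix_cnj_transpose zs)
  have pair: "transpose (map_matrix cnj ?P) ** ?Q - transpose (map_matrix cnj ?Q) ** ?P
      = map_matrix cnj z - z"
    unfolding map_cnj_aut aut_pair[OF g] zc ..
  have "herm (?P *v v) (?Q *v v) - herm (?Q *v v) (?P *v v) =
      herm v ((transpose (map_matrix cnj ?P) ** ?Q - transpose (map_matrix cnj ?Q) ** ?P) *v v)"
    unfolding herm_matrix matrix_vector_mul_assoc
    by (simp add: herm_diff_right matrix_vector_mult_diff_rdistrib)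
  also have "\<dots> = herm v (map_matrix cnj z *v v) - herm v (z *v v)"
    unfolding pair by (simp add: herm_diff_right matrix_vector_mult_diff_rdistrib)
  also have "herm v (map_matrix cnj z *v v) = cnj (herm v (z *v v))"
    unfolding herm_cnj herm_matrix by (simp add: zc del: transpose_matrix_vector)
  also have "herm (?P *v v) (?Q *v v) = cnj (herm (?Q *v v) (?P *v v))"
    by (simp only: herm_cnj)
  finally have "Im (cnj (herm (?Q *v v) (?P *v v)) - herm (?Q *v v) (?P *v v)) =
      Im (cnj (herm v (z *v v)) - herm v (z *v v))" by simp
  then show ?thesis by simp
qed

lemma invertible_aut_den:
  assumes g: "g \<in> Sp_real" and z: "z \<in> siegel_space"
  shows "invertible (aut_den g z)"
proof (rule invertible_if_kernel_0, rule ccontr)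
  fix v assume v: "aut_den g z *v v = 0" "v \<noteq> 0"
  then show False using aut_den_pos[OF g z, of v] siegel_space_pos[OF z v(2)] by simp
qed

lemma det_aut_den_nz: "g \<in> Sp_real \<Longrightarrow> z \<in> siegel_space \<Longrightarrow> det (aut_den g z) \<noteq> 0"
  using invertible_aut_den invertible_det_nz by blast

lemma sp_act_mult_den:
  assumes g: "g \<in> Sp_real" and z: "z \<in> siegel_space"
  shows "sp_act g z ** aut_den g z = aut_num g z"
  by (simp add: sp_act_eq matrix_mul_assoc[symmetric] matrix_inv_left invertible_aut_den[OF assms])

lemma sp_actI:
  assumes g: "g \<in> Sp_real" and z: "z \<in> siegel_space" and "w ** aut_den g z = aut_num g z"
  shows "sp_act g z = w"
  by (simp add: sp_act_eq assms(3)[symmetric] matrix_mul_assoc[symmetric] matrix_inv_right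
      invertible_aut_den[OF g z])

text \<open>Symmetry comes from \<open>aut_pair\<close> with both points equal to z, positivity from
  \<open>aut_den_pos\<close> after substituting v = (Cz + D) u.\<close>

lemma sp_act_in_siegel:
  assumes g: "g \<in> Sp_real" and z: "z \<in> siegel_space"
  shows "sp_act g z \<in> siegel_space"
proof -
  let ?P = "aut_num g z" and ?Q = "aut_den g z" and ?w = "sp_act g z"
  have wQ: "?w ** ?Q = ?P" by (rule sp_act_mult_den[OF assms])
  obtain R where R: "?Q ** R = mat 1" "R ** ?Q = mat 1"
    using invertible_aut_den[OF assms] by (auto simp: invertible_def)
  have "transpose ?P ** ?Q - transpose ?Q ** ?P = 0"
    using aut_pair[OF g, of z z] siegel_space_transpose[OF z] by simp
  then have "transpose ?Q ** (transpose ?w ** ?Q) = transpose ?Q ** (?w ** ?Q)"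
    by (simp add: wQ[symmetric] matrix_transpose_mul matrix_mul_assoc)
  then have "transpose R ** (transpose ?Q ** (transpose ?w ** ?Q)) ** R =
      transpose R ** (transpose ?Q ** (?w ** ?Q)) ** R" by simp
  then have "transpose (?Q ** R) ** transpose ?w ** (?Q ** R) =
      transpose (?Q ** R) ** ?w ** (?Q ** R)"
    by (simp add: matrix_transpose_mul matrix_mul_assoc)
  then have "transpose ?w = ?w" by (simp add: R)
  moreover have "0 < Im (herm v (?w *v v))" if "v \<noteq> 0" for v
  proof -
    define u where "u = R *v v"
    have v: "v = ?Q *v u" by (simp add: u_def matrix_vector_mul_assoc R)
    then have "u \<noteq> 0" using that by auto
    have "?w *v v = ?P *v u" by (simp add: v matrix_vector_mul_assoc wQ)
    then have "Im (herm v (?w *v v)) = Im (herm u (z *v u))"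
      using aut_den_pos[OF assms, of u] by (simp add: v)
    then show ?thesis using siegel_space_pos[OF z \<open>u \<noteq> 0\<close>] by simp
  qed
  ultimately show ?thesis by (simp add: siegel_space_iff)
qed

text \<open>The matrix h sends the column (z; 1) to (h.z; 1)(Cz + D), and a further g acts on the
  left only. The composition laws of the action and of the slash operator follow from this cocycle
  relation.\<close>

lemma aut_mult:
  assumes h: "h \<in> Sp_real" and z: "z \<in> siegel_space"
  shows "aut_num (g ** h) z = aut_num g (sp_act h z) ** aut_den h z"
    and "aut_den (g ** h) z = aut_den g (sp_act h z) ** aut_den h z"
proof -
  have *: "X ** sp_act h z ** aut_den h z = X ** aut_num h z" for X
    by (simp add: matrix_mul_assoc[symmetric] sp_act_mult_den[OF assms])
  show "aut_num (g ** h) z = aut_num g (sp_act h z) ** aut_den h z"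
    unfolding aut_num_def[of g] matrix_add_rdistrib' *
    by (simp add: aut_num_def aut_den_def block_mult matrix_add_rdistrib' matrix_add_ldistrib
        matrix_mul_assoc)
  show "aut_den (g ** h) z = aut_den g (sp_act h z) ** aut_den h z"
    unfolding aut_den_def[of g] matrix_add_rdistrib' *
    by (simp add: aut_num_def aut_den_def block_mult matrix_add_rdistrib' matrix_add_ldistrib
        matrix_mul_assoc)
qed

lemma sp_act_mult:
  assumes g: "g \<in> Sp_real" and h: "h \<in> Sp_real" and z: "z \<in> siegel_space"
  shows "sp_act (g ** h) z = sp_act g (sp_act h z)"
  by (intro sp_actI Sp_real_mult assms)
     (simp add: aut_mult[OF h z] matrix_mul_assoc sp_act_mult_den[OF g sp_act_in_siegel[OF h z]])

lemma Sp_real_1 [simp]: "mat 1 \<in> Sp_real"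
  by (intro Sp_realI) (simp add: transpose_mat)

lemma sp_act_1 [simp]: "z \<in> siegel_space \<Longrightarrow> sp_act (mat 1) z = z"
  by (intro sp_actI) (simp_all add: aut_num_def aut_den_def)

lemma slash_mult:
  assumes g: "g \<in> Sp_real" and h: "h \<in> Sp_real" and z: "z \<in> siegel_space"
  shows "slash m f (g ** h) z = slash m (slash m f g) h z"
  by (simp add: slash_eq sp_act_mult[OF assms] aut_mult[OF h z] det_mul power_int_mult_distrib)

text \<open>\<open>aut_pair\<close> at the conjugate of w, divided by the denominators on both
  sides. Its determinant gives the covariance of the kernel, and for w = z the transformation of det
  Im z.\<close>

lemma sp_act_diff_cnj:
  assumes g: "g \<in> Sp_real" and z: "z \<in> siegel_space" and w: "w \<in> siegel_space"
  shows "transpose (map_matrix cnj (aut_den g w)) **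
      (sp_act g z - map_matrix cnj (sp_act g w)) ** aut_den g z = z - map_matrix cnj w"
proof -
  let ?Q = "aut_den g"
  have wc: "transpose (map_matrix cnj w) = map_matrix cnj w"
    by (metis map_matrix_cnj_transpose siegel_space_transpose[OF w])
  have ac: "transpose (map_matrix cnj (sp_act g w)) = map_matrix cnj (sp_act g w)"
    by (metis map_matrix_cnj_transpose siegel_space_transpose[OF sp_act_in_siegel[OF g w]])
  have "transpose (map_matrix cnj (?Q w)) ** map_matrix cnj (sp_act g w) =
      transpose (map_matrix cnj (sp_act g w ** ?Q w))"
    by (simp add: map_matrix_cnj_mult matrix_transpose_mul ac)
  also have "\<dots> = transpose (aut_num g (map_matrix cnj w))"
    by (simp add: sp_act_mult_den[OF g w] map_cnj_aut)
  finally have "transpose (map_matrix cnj (?Q w)) **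
      (sp_act g z - map_matrix cnj (sp_act g w)) ** ?Q z =
      transpose (aut_den g (map_matrix cnj w)) ** aut_num g z -
      transpose (aut_num g (map_matrix cnj w)) ** aut_den g z"
    by (simp add: matrix_diff_ldistrib matrix_diff_rdistrib matrix_mul_assoc[symmetric]
        sp_act_mult_den[OF g z] map_cnj_aut)
  also have "\<dots> = z - map_matrix cnj w"
    using aut_pair[OF g, of "map_matrix cnj w" z] by (simp add: wc algebra_simps)
  finally show ?thesis .
qed

lemma det_sp_act_diff_cnj:
  assumes g: "g \<in> Sp_real" and z: "z \<in> siegel_space" and w: "w \<in> siegel_space"
  shows "cnj (det (aut_den g w)) * det (sp_act g z - map_matrix cnj (sp_act g w)) * det (aut_den g z)
    = det (z - map_matrix cnj w)"
  using arg_cong[OF sp_act_diff_cnj[OF assms], of det]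
  by (simp add: det_mul det_map_cnj)

lemma diff_cnj_Im:
  "z - map_matrix cnj z = map_matrix (\<lambda>w. 2 * \<i> * w) (map_matrix complex_of_real (map_matrix Im z))"
  by (simp add: vec_eq_iff complex_eq_iff)

lemma det_diff_cnj_Im:
  "det (z - map_matrix cnj z) = (2 * \<i>) ^ CARD('n) * complex_of_real (det (map_matrix Im z))"
  for z :: "'n::finite cmat"
  unfolding diff_cnj_Im det_scale det_map_of_real ..

lemma det_Im_sp_act:
  assumes g: "g \<in> Sp_real" and z: "z \<in> siegel_space"
  shows "(cmod (det (aut_den g z)))\<^sup>2 * det (map_matrix Im (sp_act g z)) = det (map_matrix Im z)"
proof -
  have "complex_of_real ((cmod (det (aut_den g z)))\<^sup>2 * det (map_matrix Im (sp_act g z))) =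
      complex_of_real (det (map_matrix Im z))"
    using det_sp_act_diff_cnj[OF g z z] unfolding det_diff_cnj_Im of_real_mult complex_norm_square
    by (simp add: mult_ac)
  then show ?thesis by (simp only: of_real_eq_iff)
qed

section \<open>Elementary matrices\<close>

text \<open>With \<open>w $ b = 0\<close> this is a product of commuting transvections that clears a
  whole column in one step, the form in which Schur complements are split off below.\<close>

definition col_elem :: "'a::comm_ring_1^'n \<Rightarrow> 'n \<Rightarrow> 'a^'n^'n" where
  "col_elem w b = (\<chi> i j. (if i = j then 1 else 0) + (if j = b then w $ i else 0))"

definition diag_mat :: "('n \<Rightarrow> 'a::comm_ring_1) \<Rightarrow> 'a^'n^'n" where
  "diag_mat d = (\<chi> i j. if i = j then d i else 0)"

lemma diag_mat_mult_left: "(diag_mat d ** A) $ i $ j = d i * A $ i $ j"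
  by (simp add: diag_mat_def matrix_matrix_mult_def if_distrib[of "\<lambda>x. x * _"] cong: if_cong)

lemma diag_mat_mult_right: "(A ** diag_mat d) $ i $ j = A $ i $ j * d j"
  by (simp add: diag_mat_def matrix_matrix_mult_def if_distrib cong: if_cong)

lemma diag_mat_mult: "diag_mat d ** diag_mat e = diag_mat (\<lambda>i. d i * e i)"
  by (simp add: vec_eq_iff diag_mat_mult_left) (simp add: diag_mat_def)

lemma diag_mat_1: "diag_mat (\<lambda>_. 1) = mat 1"
  by (simp add: diag_mat_def mat_def)

lemma transpose_diag_mat [simp]: "transpose (diag_mat d) = diag_mat d"
  by (auto simp: vec_eq_iff transpose_def diag_mat_def)

lemma det_diag_mat: "det (diag_mat d) = (\<Prod>i\<in>UNIV. d i)"
  by (subst det_diagonal) (auto simp: diag_mat_def)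

lemma col_elem_mult_left: "(col_elem w b ** A) $ i $ j = A $ i $ j + w $ i * A $ b $ j"
  by (simp add: col_elem_def matrix_matrix_mult_def algebra_simps sum.distrib
      if_distrib[of "\<lambda>x. x * _"] if_distrib[of "\<lambda>x. _ * x"] cong: if_cong)

lemma col_elem_mult_right:
  "(A ** col_elem w b) $ i $ j = A $ i $ j + (if j = b then (A *v w) $ i else 0)"
  by (simp add: col_elem_def matrix_matrix_mult_def matrix_vector_mult_def algebra_simps sum.distrib
      if_distrib[of "\<lambda>x. x * _"] if_distrib[of "\<lambda>x. _ * x"] cong: if_cong)

lemma transpose_col_elem_mult_right:
  "(A ** transpose (col_elem w b)) $ i $ j = A $ i $ j + A $ i $ b * w $ j"
  by (simp add: col_elem_def transpose_def matrix_matrix_mult_def algebra_simps sum.distrib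
      if_distrib[of "\<lambda>x. x * _"] if_distrib[of "\<lambda>x. _ * x"] cong: if_cong)

lemma col_elem_0 [simp]: "col_elem 0 b = mat 1"
  by (simp add: vec_eq_iff col_elem_def mat_def)

lemma col_elem_add:
  assumes "w $ b = 0" "u $ b = 0"
  shows "col_elem w b ** col_elem u b = col_elem (w + u) b"
  by (simp add: vec_eq_iff col_elem_mult_left) (use assms in \<open>auto simp: col_elem_def\<close>)

lemma det_col_elem:
  fixes w :: "'a::field^'n"
  assumes "w $ b = 0" shows "det (col_elem w b) = 1"
proof -
  have "col_elem w b =
      (\<chi> i j. if j = b then ((mat 1 :: 'a^'n^'n) *v (axis b 1 + w)) $ i else (mat 1 :: 'a^'n^'n) $ i $ j)"
    unfolding matrix_vector_mul_lid by (auto simp: vec_eq_iff col_elem_def mat_def axis_def)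
  then have "det (col_elem w b) = (axis b 1 + w) $ b * det (mat 1 :: 'a^'n^'n)"
    by (simp only: cramer_lemma)
  then show ?thesis using assms by (simp add: axis_def)
qed

lemma matrix_mult_axis: "(A *v axis j 1) $ i = (A :: 'a::semiring_1^'n^'m) $ i $ j"
  by (simp add: matrix_vector_mult_def axis_def if_distrib cong: if_cong)

text \<open>Gaussian elimination. The matrices in the induction agree with the identity outside
  the index set \<open>A\<close>.\<close>

lemma induct_invertible_matrix_on:
  fixes P :: "'a::field^'n^'n \<Rightarrow> bool"
  assumes mult: "\<And>U V. P U \<Longrightarrow> P V \<Longrightarrow> P (U ** V)"
    and diag: "\<And>d. (\<And>i. d i \<noteq> 0) \<Longrightarrow> P (diag_mat d)"
    and col: "\<And>w b. w $ b = 0 \<Longrightarrow> P (col_elem w b)"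
    and row: "\<And>w b. w $ b = 0 \<Longrightarrow> P (transpose (col_elem w b))"
  assumes "finite A" "det U \<noteq> 0"
    "\<And>i j. i \<notin> A \<or> j \<notin> A \<Longrightarrow> U $ i $ j = (if i = j then 1 else 0)"
  shows "P U"
  using assms(5-7)
proof (induction A arbitrary: U rule: finite_induct)
  case empty
  then have "U = diag_mat (\<lambda>_. 1)" by (simp add: vec_eq_iff diag_mat_def)
  then show ?case using diag[of "\<lambda>_. 1"] by simp
next
  case (insert b A)
  \<comment> \<open>With a nonzero pivot, U is a column operation times a diagonal matrix times V
    times a row operation, where V agrees with the identity outside the smaller index set.\<close>
  have pivot: "P U" if nz: "U $ b $ b \<noteq> 0" and det: "det U \<noteq> 0"
    and out: "\<And>i j. i \<notin> insert b A \<or> j \<notin> insert b A \<Longrightarrow> U $ i $ j = (if i = j then 1 else 0)"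
    for U
  proof -
    define p where "p = U $ b $ b"
    define w :: "'a^'n" where "w = (\<chi> i. if i = b then 0 else U $ i $ b / p)"
    define r :: "'a^'n" where "r = (\<chi> j. if j = b then 0 else U $ b $ j / p)"
    define V :: "'a^'n^'n" where
      "V = (\<chi> i j. if i = b \<or> j = b then (if i = j then 1 else 0) else U $ i $ j - U $ i $ b * U $ b $ j / p)"
    define D :: "'a^'n^'n" where "D = diag_mat (\<lambda>i. if i = b then p else 1)"
    have p: "p \<noteq> 0" using nz by (simp add: p_def)
    have "U $ i $ j = (col_elem w b ** (D ** V) ** transpose (col_elem r b)) $ i $ j" for i j
      unfolding transpose_col_elem_mult_right col_elem_mult_left D_def diag_mat_mult_left
      using p by (simp add: V_def w_def r_def field_simps) (auto simp: p_def)
    then have U: "U = col_elem w b ** (D ** V) ** transpose (col_elem r b)"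
      by (simp add: vec_eq_iff)
    have "det V \<noteq> 0" using det unfolding U by (auto simp: det_mul)
    moreover have "V $ i $ j = (if i = j then 1 else 0)" if "i \<notin> A \<or> j \<notin> A" for i j
      using that out[of i j] out[of i b] out[of b j] by (auto simp: V_def)
    ultimately have "P V" using insert.IH by blast
    then show ?thesis
      unfolding U D_def using p
      by (intro mult col row diag) (auto simp: w_def r_def)
  qed
  show ?case
  proof (cases "U $ b $ b = 0")
    case False
    with insert.prems pivot show ?thesis by blast
  next
    case True
    have "row b U \<noteq> 0" using insert.prems(1) det_zero_row by blast
    then obtain j where j: "U $ b $ j \<noteq> 0" by (auto simp: vec_eq_iff row_def)
    then have jb: "j \<noteq> b" using True by auto
    have jA: "j \<in> insert b A" using insert.prems(2)[of b j] j jb by auto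
    \<comment> \<open>With a zero pivot, column j is added to column b to create a nonzero one, and
      is subtracted again at the end.\<close>
    define e :: "'a^'n" where "e = axis j 1"
    have eb: "e $ b = 0" using jb by (simp add: e_def axis_def)
    have Ue: "(U *v e) $ i = U $ i $ j" for i
      by (simp add: e_def matrix_mult_axis)
    have "P (U ** col_elem e b)"
    proof (rule pivot)
      show "(U ** col_elem e b) $ b $ b \<noteq> 0" by (simp add: col_elem_mult_right Ue True j)
      show "det (U ** col_elem e b) \<noteq> 0" using insert.prems(1) by (simp add: det_mul det_col_elem eb)
      show "(U ** col_elem e b) $ i $ k = (if i = k then 1 else 0)"
        if "i \<notin> insert b A \<or> k \<notin> insert b A" for i k
        using that insert.prems(2)[of i k] insert.prems(2)[of i j] jA
        by (auto simp: col_elem_mult_right Ue)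
    qed
    then have "P (U ** col_elem e b ** col_elem (- e) b)"
      by (rule mult) (simp add: col eb)
    then show ?thesis by (simp add: matrix_mul_assoc[symmetric] col_elem_add eb)
  qed
qed

lemma induct_invertible_matrix [consumes 1, case_names mult diag col row]:
  fixes P :: "'a::field^'n^'n \<Rightarrow> bool"
  assumes "det U \<noteq> 0"
    and "\<And>U V. P U \<Longrightarrow> P V \<Longrightarrow> P (U ** V)"
    and "\<And>d. (\<And>i. d i \<noteq> 0) \<Longrightarrow> P (diag_mat d)"
    and "\<And>w b. w $ b = 0 \<Longrightarrow> P (col_elem w b)"
    and "\<And>w b. w $ b = 0 \<Longrightarrow> P (transpose (col_elem w b))"
  shows "P U"
  using induct_invertible_matrix_on[of P UNIV U] assms by auto

section \<open>Topology, Lebesgue measure and the invariant measure on the half-space\<close>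

section \<open>Topology and measurability of the Siegel space\<close>

lemma borel_measurable_vecI:
  fixes f :: "'a \<Rightarrow> 'b::euclidean_space^'n"
  assumes "\<And>i. (\<lambda>x. f x $ i) \<in> borel_measurable M"
  shows "f \<in> borel_measurable M"
proof (subst borel_measurable_euclidean_space, rule ballI)
  fix b :: "'b^'n" assume "b \<in> Basis"
  then obtain i c where b: "b = axis i c" by (auto simp: Basis_vec_def)
  show "(\<lambda>x. f x \<bullet> b) \<in> borel_measurable M"
    unfolding b inner_axis using assms[of i] by measurable
qed

lemma borel_measurable_vec_nth [measurable (raw)]:
  fixes f :: "'a \<Rightarrow> 'b::euclidean_space^'n"
  assumes "f \<in> borel_measurable M"
  shows "(\<lambda>x. f x $ i) \<in> borel_measurable M"
proof -
  have "(\<lambda>v::'b^'n. v $ i) \<in> borel_measurable borel"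
    by (intro borel_measurable_continuous_onI continuous_intros)
  from measurable_compose[OF assms this] show ?thesis .
qed

lemma continuous_on_map_matrix:
  assumes "continuous_on S f" "\<And>T. continuous_on T h"
  shows "continuous_on S (\<lambda>x. map_matrix h (f x))"
  unfolding map_matrix_def
  by (intro continuous_on_vec_lambda continuous_on_compose2[OF assms(2)[of UNIV]] continuous_intros
      assms(1) subset_UNIV)

lemma continuous_on_matrix_mult [continuous_intros]:
  fixes f :: "'a::topological_space \<Rightarrow> 'b::real_normed_field^'n^'m"
  assumes "continuous_on S f" "continuous_on S g"
  shows "continuous_on S (\<lambda>x. f x ** g x)"
  unfolding matrix_matrix_mult_def by (intro continuous_intros assms)

lemma continuous_on_transpose [continuous_intros]:
  fixes f :: "'a::topological_space \<Rightarrow> 'b::topological_space^'n^'m"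
  assumes "continuous_on S f" 
  shows "continuous_on S (\<lambda>x. transpose (f x))"
  unfolding transpose_def by (intro continuous_intros assms)

lemma continuous_on_matrix_vector_mult [continuous_intros]:
  fixes f :: "'a::topological_space \<Rightarrow> 'b::real_normed_field^'n^'m"
  assumes "continuous_on S f" "continuous_on S g"
  shows "continuous_on S (\<lambda>x. f x *v g x)"
  unfolding matrix_vector_mult_def by (intro continuous_intros assms)

lemma continuous_on_det [continuous_intros]:
  fixes f :: "'a::topological_space \<Rightarrow> 'b::real_normed_field^'n^'n"
  assumes "continuous_on S f"
  shows "continuous_on S (\<lambda>x. det (f x))"
  unfolding det_def by (intro continuous_intros assms)

lemma continuous_on_herm [continuous_intros]:
  assumes "continuous_on S f" "continuous_on S g"
  shows "continuous_on S (\<lambda>x. herm (f x) (g x))"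
  unfolding herm_def by (intro continuous_intros assms)

text \<open>Cramer's rule displays the entries of the inverse as quotients of determinants; its
  continuity, and later its holomorphy along discs, rest on this form.\<close>

lemma matrix_inv_component:
  fixes A :: "'a::field^'n^'n"
  assumes "det A \<noteq> 0"
  shows "matrix_inv A $ i $ j =
    det (\<chi> k l. if l = i then (if k = j then 1 else 0) else A $ k $ l) / det A"
proof -
  have "A *v (matrix_inv A *v axis j 1) = axis j 1"
    using assms by (simp add: matrix_vector_mul_assoc matrix_inv_right invertible_det_nz)
  then have "matrix_inv A *v axis j 1 =
      (\<chi> k. det (\<chi> i l. if l = k then axis j 1 $ i else A $ i $ l) / det A)"
    using cramer[OF assms] by blast
  then have "(matrix_inv A *v axis j 1) $ i = det (\<chi> k l. if l = i then axis j 1 $ k else A $ k $ l) / det A"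
    by simp
  also have "(matrix_inv A *v axis j 1) $ i = matrix_inv A $ i $ j"
    by (simp add: matrix_mult_axis)
  also have "(\<chi> k l. if l = i then axis j 1 $ k else A $ k $ l) =
      (\<chi> k l. if l = i then (if k = j then 1 else 0) else A $ k $ l)"
    by (auto simp: vec_eq_iff axis_def)
  finally show ?thesis .
qed

lemma continuous_on_matrix_inv:
  fixes f :: "'a::topological_space \<Rightarrow> 'b::real_normed_field^'n^'n"
  assumes "continuous_on S f" "\<And>x. x \<in> S \<Longrightarrow> det (f x) \<noteq> 0"
  shows "continuous_on S (\<lambda>x. matrix_inv (f x))"
proof -
  have "continuous_on S (\<lambda>x. \<chi> i j.
      det (\<chi> k l. if l = i then (if k = j then 1 else 0) else f x $ k $ l) / det (f x))"
  proof (intro continuous_intros assms(1))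
    show "continuous_on S (\<lambda>x. if l = i then if k = j then 1 else 0 else f x $ k $ l)" for i j k l
      using assms(1) by (cases "l = i") (auto intro!: continuous_intros)
  qed (use assms(2) in auto)
  then show ?thesis
    by (rule continuous_on_eq) (use assms(2) in \<open>simp add: vec_eq_iff matrix_inv_component\<close>)
qed

lemma continuous_on_sp_act:
  assumes "g \<in> Sp_real" shows "continuous_on siegel_space (sp_act g)"
  unfolding sp_act_eq[abs_def]
  using det_aut_den_nz[OF assms] unfolding aut_den_def aut_num_def
  by (intro continuous_intros continuous_on_matrix_inv) auto

text \<open>The last condition says that Im z is at least 1/k. It is a closed condition, which gives
  compactness, and it is stated as coercivity of the form, ready for bounding the inverse of z - cnj
  w.\<close>

definition siegel_compact :: "nat \<Rightarrow> 'n::finite cmat set" where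
  "siegel_compact k = {z. transpose z = z \<and> norm z \<le> real k \<and>
     (\<forall>v. (norm v)\<^sup>2 \<le> real k * Im (herm v (z *v v)))}"

lemma compact_siegel_compact: "compact (siegel_compact k :: 'n::finite cmat set)"
proof -
  have *: "siegel_compact k = cball 0 (real k) \<inter> {z. transpose z = z} \<inter>
     (\<Inter>v. {z::'n cmat. (norm v)\<^sup>2 \<le> real k * Im (herm v (z *v v))})"
    by (auto simp: siegel_compact_def)
  have "closed {z::'n cmat. transpose z = z}"
    by (intro closed_Collect_eq continuous_intros)
  moreover have "closed {z::'n cmat. (norm v)\<^sup>2 \<le> real k * Im (herm v (z *v v))}" for v
    by (intro closed_Collect_le continuous_intros)
  ultimately show ?thesis unfolding *
    by (intro compact_Int_closed closed_INT compact_cball) auto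
qed

lemma siegel_compact_subset: "siegel_compact k \<subseteq> (siegel_space :: 'n::finite cmat set)"
proof
  fix z :: "'n cmat" assume z: "z \<in> siegel_compact k"
  have "0 < Im (herm v (z *v v))" if "v \<noteq> 0" for v
  proof -
    have "0 < (norm v)\<^sup>2" using that by simp
    also have "\<dots> \<le> real k * Im (herm v (z *v v))" using z by (simp add: siegel_compact_def)
    finally show ?thesis by (auto simp: zero_less_mult_iff)
  qed
  with z show "z \<in> siegel_space" by (simp add: siegel_compact_def siegel_space_iff)
qed

lemma siegel_compact_mono: "k \<le> l \<Longrightarrow> siegel_compact k \<subseteq> (siegel_compact l :: 'n::finite cmat set)"
proof
  fix z :: "'n cmat" assume kl: "k \<le> l" and z: "z \<in> siegel_compact k"
  then have zs: "z \<in> siegel_space" using siegel_compact_subset by blast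
  have "(norm v)\<^sup>2 \<le> real l * Im (herm v (z *v v))" for v
  proof -
    have "(norm v)\<^sup>2 \<le> real k * Im (herm v (z *v v))" using z by (simp add: siegel_compact_def)
    also have "\<dots> \<le> real l * Im (herm v (z *v v))"
      using kl by (intro mult_right_mono siegel_space_pos_ge zs) auto
    finally show ?thesis .
  qed
  with z kl show "z \<in> siegel_compact l" by (auto simp: siegel_compact_def)
qed

lemma matrix_vector_mult_scaleR_complex: "(A::complex^'n^'m) *v (c *\<^sub>R v) = c *\<^sub>R (A *v v)"
  by (simp add: vec_eq_iff matrix_vector_mult_def scaleR_sum_right)

lemma herm_scaleR: "herm (c *\<^sub>R v) (d *\<^sub>R w) = (c * d) *\<^sub>R herm v w"
  by (simp add: herm_def scaleR_sum_right mult_ac)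

text \<open>The form attains a positive minimum m on K times the unit sphere; by homogeneity any k
  above 1/m and above the norms of the elements of K will do.\<close>

lemma compact_subset_siegel_compact:
  fixes K :: "'n::finite cmat set"
  assumes K: "compact K" "K \<subseteq> siegel_space"
  obtains k where "K \<subseteq> siegel_compact k"
proof (cases "K = {}")
  case False
  let ?S = "K \<times> sphere (0::complex^'n) 1"
  have c: "compact ?S" by (intro compact_Times K compact_sphere)
  have ne: "?S \<noteq> {}"
  proof -
    have "axis undefined 1 \<in> sphere (0::complex^'n) 1" by simp
    with False show ?thesis by blast
  qed
  have "continuous_on ?S (\<lambda>p. Im (herm (snd p) (fst p *v snd p)))"
    by (intro continuous_intros)
  from continuous_attains_inf[OF c ne this] obtain p where p: "p \<in> ?S"
    and min: "\<And>q. q \<in> ?S \<Longrightarrow> Im (herm (snd p) (fst p *v snd p)) \<le> Im (herm (snd q) (fst q *v snd q))"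
    by blast
  define m where "m = Im (herm (snd p) (fst p *v snd p))"
  have m: "m > 0"
  proof -
    have "fst p \<in> siegel_space" "snd p \<noteq> 0" using p K by (auto simp: mem_Times_iff)
    then show ?thesis unfolding m_def by (rule siegel_space_pos)
  qed
  obtain B where B: "\<And>z. z \<in> K \<Longrightarrow> norm z \<le> B"
    using compact_imp_bounded[OF K(1)] by (auto simp: bounded_iff)
  obtain k :: nat where k: "max B (1 / m) \<le> real k" using real_arch_simple by blast
  have "K \<subseteq> siegel_compact k"
  proof
    fix z assume z: "z \<in> K"
    have "(norm v)\<^sup>2 \<le> real k * Im (herm v (z *v v))" for v
    proof (cases "v = 0")
      case False
      define u where "u = (1 / norm v) *\<^sub>R v"
      have v: "v = norm v *\<^sub>R u" using False by (simp add: u_def)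
      have "(z, u) \<in> ?S" using z False by (simp add: u_def)
      then have mu: "m \<le> Im (herm u (z *v u))" using min[of "(z, u)"] by (simp add: m_def)
      have "1 \<le> real k * m" using k m by (simp add: field_simps)
      also have "\<dots> \<le> real k * Im (herm u (z *v u))" using mu by (intro mult_left_mono) auto
      finally have "(norm v)\<^sup>2 * 1 \<le> (norm v)\<^sup>2 * (real k * Im (herm u (z *v u)))"
        by (intro mult_left_mono) auto
      also have "\<dots> = real k * Im (herm v (z *v v))"
        by (subst (2 3) v) (simp add: matrix_vector_mult_scaleR_complex herm_scaleR power2_eq_square)
      finally show ?thesis by simp
    qed simp
    moreover have "norm z \<le> real k" using B[OF z] k by simp
    moreover have "transpose z = z" using z K siegel_space_transpose by blast
    ultimately show "z \<in> siegel_compact k" by (simp add: siegel_compact_def)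
  qed
  then show ?thesis by (rule that)
qed (use that in auto)

lemma siegel_space_eq_UN: "(siegel_space :: 'n::finite cmat set) = (\<Union>k. siegel_compact k)"
proof
  show "siegel_space \<subseteq> (\<Union>k. siegel_compact k :: 'n cmat set)"
  proof
    fix z :: "'n cmat" assume "z \<in> siegel_space"
    then obtain k where "{z} \<subseteq> siegel_compact k"
      using compact_subset_siegel_compact[of "{z}"] by auto
    then show "z \<in> (\<Union>k. siegel_compact k)" by auto
  qed
qed (use siegel_compact_subset in auto)

lemma siegel_compact_borel [measurable]: "siegel_compact k \<in> sets borel"
  using compact_siegel_compact borel_compact by blast

lemma siegel_space_borel [measurable]: "siegel_space \<in> sets borel"
  unfolding siegel_space_eq_UN by measurable

text \<open>The segment from y to the identity stays positive definite, so the determinant never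
  vanishes on it and keeps the sign that it has at the identity.\<close>

lemma det_Im_pos:
  assumes "z \<in> siegel_space" shows "0 < det (map_matrix Im z)"
proof -
  define y where "y = map_matrix Im z"
  define p where "p t = (1 - t) *\<^sub>R y + t *\<^sub>R mat 1" for t :: real
  have nz: "det (p t) \<noteq> 0" if t: "0 \<le> t" "t \<le> 1" for t
  proof -
    have pd: "pos_def_mat y" using assms by (simp add: siegel_space_def y_def)
    have "v = 0" if "p t *v v = 0" for v
    proof (rule ccontr)
      assume v: "v \<noteq> 0"
      have "v \<bullet> (p t *v v) = (1 - t) * (v \<bullet> (y *v v)) + t * (v \<bullet> v)"
        by (simp add: p_def matrix_vector_mult_add_rdistrib scaleR_matrix_vector_assoc[symmetric]
            inner_add_right)
      also have "\<dots> > 0"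
        using pd v t by (cases "t = 1") (auto simp: pos_def_mat_def intro!: add_pos_nonneg)
      finally show False using \<open>p t *v v = 0\<close> by simp
    qed
    then have "invertible (p t)" by (simp add: invertible_left_inverse matrix_left_invertible_ker)
    then show ?thesis by (simp add: invertible_det_nz)
  qed
  have cont: "continuous_on {0..1} (\<lambda>t. det (p t))"
    unfolding p_def by (intro continuous_intros)
  show ?thesis
  proof (rule ccontr)
    assume "\<not> ?thesis"
    then have "det (p 0) \<le> 0" by (simp add: p_def y_def)
    moreover have "0 \<le> det (p 1)" by (simp add: p_def)
    ultimately obtain t where "0 \<le> t" "t \<le> 1" "det (p t) = 0"
      using IVT'[of "\<lambda>t. det (p t)" 0 0 1] cont by auto
    with nz show False by blast
  qed
qed

section \<open>Real coordinates on symmetric matrices\<close>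

text \<open>The change of variables theorem is available for vectors over a well-ordered index type, hence
  a type of indices for the real and imaginary parts of the entries on and above the diagonal.\<close>

typedef (overloaded) ('n::"{finite,linorder}") sym_idx = "{(r::'n, s::'n, b::bool). r \<le> s}"
  by auto

instance sym_idx :: ("{finite,linorder}") finite
proof
  show "finite (UNIV :: 'a sym_idx set)"
    unfolding type_definition.Abs_image[OF type_definition_sym_idx, symmetric] by simp
qed

instantiation sym_idx :: ("{finite,linorder}") wellorder
begin

text \<open>An arbitrary enumeration: the formula for the change of variables wants some well-order
  on the coordinates, and no property of the order enters.\<close>

definition sym_idx_code :: "'a sym_idx \<Rightarrow> nat" where
  "sym_idx_code = (SOME f. inj f)"

lemma inj_sym_idx_code: "inj (sym_idx_code :: 'a sym_idx \<Rightarrow> nat)"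
  unfolding sym_idx_code_def using ex_inj by (rule someI_ex)

definition less_eq_sym_idx :: "'a sym_idx \<Rightarrow> 'a sym_idx \<Rightarrow> bool" where
  "less_eq_sym_idx x y \<longleftrightarrow> sym_idx_code x \<le> sym_idx_code y"

definition less_sym_idx :: "'a sym_idx \<Rightarrow> 'a sym_idx \<Rightarrow> bool" where
  "less_sym_idx x y \<longleftrightarrow> sym_idx_code x < sym_idx_code y"

instance
proof
  fix P and a :: "'a sym_idx"
  assume step: "\<And>x::'a sym_idx. (\<And>y. y < x \<Longrightarrow> P y) \<Longrightarrow> P x"
  show "P a"
    by (induction a rule: measure_induct_rule[of sym_idx_code]) (rule step, simp add: less_sym_idx_def)
qed (use inj_sym_idx_code in \<open>auto simp: less_eq_sym_idx_def less_sym_idx_def inj_def\<close>)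

end

text \<open>Sorting the pair makes the index symmetric in r and s, so every coordinate vector yields
  a symmetric matrix without a case distinction.\<close>

definition sym_idx :: "'n::{finite,linorder} \<Rightarrow> 'n \<Rightarrow> bool \<Rightarrow> 'n sym_idx" where
  "sym_idx r s b = Abs_sym_idx (min r s, max r s, b)"

definition sym_of :: "real^'n::{finite,linorder} sym_idx \<Rightarrow> 'n cmat" where
  "sym_of x = (\<chi> r s. Complex (x $ sym_idx r s False) (x $ sym_idx r s True))"

definition sym_coords :: "'n::{finite,linorder} cmat \<Rightarrow> real^'n sym_idx" where
  "sym_coords z = (\<chi> i. case Rep_sym_idx i of (r, s, b) \<Rightarrow> if b then Im (z $ r $ s) else Re (z $ r $ s))"

lemma Rep_sym_idx_sym_idx: "Rep_sym_idx (sym_idx r s b) = (min r s, max r s, b)"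
  unfolding sym_idx_def by (subst Abs_sym_idx_inverse) (auto simp: min_def max_def)

lemma sym_idx_cases:
  obtains r s b where "r \<le> s" "i = sym_idx r s b"
proof -
  obtain r s b where i: "Rep_sym_idx i = (r, s, b)" by (metis prod_cases3)
  with Rep_sym_idx[of i] have "r \<le> s" by simp
  moreover have "i = sym_idx r s b"
    using i \<open>r \<le> s\<close> Rep_sym_idx_inverse[of i] by (simp add: sym_idx_def)
  ultimately show ?thesis by (rule that)
qed

lemma sym_idx_commute: "sym_idx r s b = sym_idx s r b"
  by (simp add: sym_idx_def min.commute max.commute)

lemma sym_coords_sym_idx [simp]:
  "r \<le> s \<Longrightarrow> sym_coords z $ sym_idx r s b = (if b then Im (z $ r $ s) else Re (z $ r $ s))"
  by (simp add: sym_coords_def Rep_sym_idx_sym_idx)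

lemma sym_coords_sym_of [simp]: "sym_coords (sym_of x) = x"
proof (subst vec_eq_iff, rule allI)
  fix i show "sym_coords (sym_of x) $ i = x $ i"
    by (rule sym_idx_cases[of i]) (simp add: sym_of_def)
qed

lemma transpose_sym_of [simp]: "transpose (sym_of x) = sym_of x"
  by (simp add: vec_eq_iff transpose_def sym_of_def sym_idx_commute)

lemma sym_of_sym_coords:
  assumes "transpose z = z" shows "sym_of (sym_coords z) = z"
proof -
  have s: "z $ r $ s = z $ s $ r" for r s using assms by (metis transpose_def vec_lambda_beta)
  have "sym_of (sym_coords z) $ r $ s = z $ r $ s" for r s
  proof (cases "r \<le> s")
    case True then show ?thesis by (simp add: sym_of_def)
  next
    case False
    then show ?thesis
      by (simp add: sym_of_def sym_idx_commute[of r s] complex_eq_iff s[of r s])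
  qed
  then show ?thesis by (simp add: vec_eq_iff)
qed

lemma linear_sym_of: "linear sym_of"
  by (rule linearI) (simp_all add: vec_eq_iff sym_of_def complex_eq_iff)

lemma linear_sym_coords: "linear sym_coords"
  by (rule linearI) (simp_all add: vec_eq_iff sym_coords_def split: prod.split)

lemma bounded_linear_sym_of: "bounded_linear sym_of"
  using linear_sym_of linear_conv_bounded_linear by blast

lemma bounded_linear_sym_coords: "bounded_linear sym_coords"
  using linear_sym_coords linear_conv_bounded_linear by blast

lemma sym_of_measurable [measurable]: "sym_of \<in> borel_measurable borel"
  by (intro borel_measurable_continuous_onI linear_continuous_on bounded_linear_sym_of)

lemma sym_coords_measurable [measurable]: "sym_coords \<in> borel_measurable borel"
  by (intro borel_measurable_continuous_onI linear_continuous_on bounded_linear_sym_coords)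

definition sym_extend :: "('n::{finite,linorder} \<times> 'n \<Rightarrow> 'a) \<Rightarrow> (('a, 'n) vec, 'n) vec" where
  "sym_extend c = (\<chi> r s. if r \<le> s then c (r, s) else c (s, r))"

lemma sym_extend_measurable [measurable]:
  "sym_extend \<in> borel_measurable (\<Pi>\<^sub>M p\<in>{(r, s). r \<le> s}. (lborel :: 'a::euclidean_space measure))"
proof (intro borel_measurable_vecI)
  fix r s :: "'n::{finite,linorder}"
  show "(\<lambda>c. sym_extend c $ r $ s) \<in>
      borel_measurable (\<Pi>\<^sub>M p\<in>{(r, s). r \<le> s}. (lborel :: 'a measure))"
    unfolding sym_extend_def
    by (cases "r \<le> s") (auto intro!: measurable_compose[OF measurable_component_singleton])
qed

lemma sym_lborel_eq_sym_extend:
  "sym_lborel = distr (\<Pi>\<^sub>M p\<in>{(r, s). r \<le> s}. (lborel :: complex measure)) borel sym_extend"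
  by (simp add: sym_lborel_def sym_extend_def[abs_def])

lemma prod_sym_idx:
  fixes f :: "'n::{finite,linorder} sym_idx \<Rightarrow> 'a::comm_monoid_mult"
  shows "(\<Prod>i\<in>UNIV. f i) = (\<Prod>(r, s)\<in>{(r, s). r \<le> s}. f (sym_idx r s False) * f (sym_idx r s True))"
proof -
  let ?P = "{(r::'n, s::'n). r \<le> s}"
  have bij: "bij_betw (\<lambda>((r, s), b). sym_idx r s b) (?P \<times> UNIV) UNIV"
    unfolding bij_betw_def
  proof
    show "inj_on (\<lambda>((r, s), b). sym_idx r s b) (?P \<times> UNIV)"
    proof (rule inj_onI, clarify)
      fix r s b r' s' b' assume "r \<le> s" "r' \<le> s'" "sym_idx r s b = sym_idx r' s' (b'::bool)"
      then have "(min r s, max r s, b) = (min r' s', max r' s', b')"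
        by (simp only: Rep_sym_idx_sym_idx[symmetric])
      with \<open>r \<le> s\<close> \<open>r' \<le> s'\<close> show "(r, s) = (r', s') \<and> b = b'"
        by (simp add: min_def max_def)
    qed
    have "i \<in> (\<lambda>((r, s), b). sym_idx r s b) ` (?P \<times> UNIV)" for i :: "'n sym_idx"
      by (rule sym_idx_cases[of i]) force
    then show "(\<lambda>((r, s), b). sym_idx r s b) ` (?P \<times> UNIV) = UNIV" by blast
  qed
  have "(\<Prod>i\<in>UNIV. f i) = (\<Prod>q\<in>?P \<times> UNIV. f ((\<lambda>((r, s), b). sym_idx r s b) q))"
    by (rule prod.reindex_bij_betw[OF bij, symmetric])
  also have "\<dots> = (\<Prod>p\<in>?P. \<Prod>b\<in>UNIV. f (sym_idx (fst p) (snd p) b))"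
    by (subst prod.cartesian_product) (intro prod.cong refl, auto simp: split_beta)
  also have "\<dots> = (\<Prod>(r, s)\<in>?P. f (sym_idx r s False) * f (sym_idx r s True))"
    by (intro prod.cong refl) (auto simp: UNIV_bool mult.commute)
  finally show ?thesis .
qed

lemma box_complex_iff: "w \<in> box a b \<longleftrightarrow> Re a < Re w \<and> Re w < Re b \<and> Im a < Im w \<and> Im w < Im b"
  by (auto simp: mem_box Basis_complex_def)

text \<open>Lebesgue measure is determined by its values on boxes. A box pulls back to a product of
  open rectangles in the complex plane, one for each pair r \<le> s, and their areas multiply to its
  volume.\<close>

lemma distr_sym_coords: "distr sym_lborel borel sym_coords = (lborel :: (real^'n::{finite,linorder} sym_idx) measure)"
proof (rule lborel_eqI[symmetric])
  fix l u :: "real^'n sym_idx"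
  assume lu: "\<And>b. b \<in> Basis \<Longrightarrow> l \<bullet> b \<le> u \<bullet> b"
  have le: "l $ i \<le> u $ i" for i
    using lu[of "axis i 1"] by (simp add: inner_axis axis_in_Basis_iff)
  let ?P = "{(r::'n, s::'n). r \<le> s}"
  let ?M = "\<Pi>\<^sub>M p\<in>?P. (lborel :: complex measure)"
  let ?b = "\<lambda>x p. Complex (x $ sym_idx (fst p) (snd p) False) (x $ sym_idx (fst p) (snd p) True)"
  interpret product_sigma_finite "\<lambda>p. lborel :: complex measure" ..
  have eq: "(sym_coords \<circ> sym_extend) -` box l u \<inter> space ?M = Pi\<^sub>E ?P (\<lambda>p. box (?b l p) (?b u p))"
  proof (rule Set.set_eqI)
    fix c :: "'n \<times> 'n \<Rightarrow> complex"
    have "sym_coords (sym_extend c) \<in> box l u \<longleftrightarrow>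
        (\<forall>i. l $ i < sym_coords (sym_extend c) $ i \<and> sym_coords (sym_extend c) $ i < u $ i)"
      by (simp add: mem_box_cart)
    also have "\<dots> \<longleftrightarrow> (\<forall>r s b. r \<le> s \<longrightarrow>
        l $ sym_idx r s b < sym_coords (sym_extend c) $ sym_idx r s b \<and>
        sym_coords (sym_extend c) $ sym_idx r s b < u $ sym_idx r s b)"
      by (metis sym_idx_cases)
    also have "\<dots> \<longleftrightarrow> (\<forall>p\<in>?P. c p \<in> box (?b l p) (?b u p))"
      by (simp add: box_complex_iff sym_extend_def all_bool_eq) (auto simp: all_bool_eq)
    finally have *: "sym_coords (sym_extend c) \<in> box l u \<longleftrightarrow> (\<forall>p\<in>?P. c p \<in> box (?b l p) (?b u p))" .
    show "c \<in> (sym_coords \<circ> sym_extend) -` box l u \<inter> space ?M \<longleftrightarrow>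
        c \<in> Pi\<^sub>E ?P (\<lambda>p. box (?b l p) (?b u p))"
      unfolding vimage_eq Int_iff o_apply * space_PiM PiE_iff by auto
  qed
  have "emeasure (distr sym_lborel borel sym_coords) (box l u) =
      emeasure (distr ?M borel (sym_coords \<circ> sym_extend)) (box l u)"
    unfolding sym_lborel_eq_sym_extend by (subst distr_distr) auto
  also have "\<dots> = emeasure ?M (Pi\<^sub>E ?P (\<lambda>p. box (?b l p) (?b u p)))"
    by (subst emeasure_distr) (auto simp: eq[symmetric])
  also have "\<dots> = (\<Prod>p\<in>?P. emeasure lborel (box (?b l p) (?b u p)))"
    by (rule emeasure_PiM) auto
  also have "\<dots> = (\<Prod>p\<in>?P. ennreal ((u - l) $ sym_idx (fst p) (snd p) False * (u - l) $ sym_idx (fst p) (snd p) True))"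
    by (intro prod.cong refl, subst emeasure_lborel_box) (auto simp: Basis_complex_def le)
  also have "\<dots> = ennreal (\<Prod>p\<in>?P. (u - l) $ sym_idx (fst p) (snd p) False * (u - l) $ sym_idx (fst p) (snd p) True)"
    by (rule prod_ennreal) (simp add: le)
  also have "(\<Prod>p\<in>?P. (u - l) $ sym_idx (fst p) (snd p) False * (u - l) $ sym_idx (fst p) (snd p) True) =
      (\<Prod>i\<in>UNIV. (u - l) $ i)"
    unfolding prod_sym_idx by (intro prod.cong refl) auto
  also have "\<dots> = (\<Prod>b\<in>Basis. (u - l) \<bullet> b)"
  proof -
    have B: "(Basis :: (real^'n sym_idx) set) = (\<lambda>i. axis i 1) ` UNIV"
      by (auto simp: Basis_vec_def)
    have inj: "inj (\<lambda>i. axis i (1::real) :: real^'n sym_idx)"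
      by (auto simp: inj_def axis_eq_axis)
    show ?thesis unfolding B prod.reindex[OF inj] o_def inner_axis by simp
  qed
  finally show "emeasure (distr sym_lborel borel sym_coords) (box l u) = ennreal (\<Prod>b\<in>Basis. (u - l) \<bullet> b)" .
qed simp

lemma transpose_sym_extend [simp]: "transpose (sym_extend c) = sym_extend c"
  by (auto simp: vec_eq_iff transpose_def sym_extend_def)

lemma sym_lborel_eq_sym_of: "sym_lborel = distr lborel borel sym_of"
proof -
  have "distr lborel borel sym_of = distr sym_lborel borel (sym_of \<circ> sym_coords)"
    unfolding distr_sym_coords[symmetric] by (rule distr_distr) (auto simp: sym_lborel_def)
  also have "\<dots> = distr (\<Pi>\<^sub>M p\<in>{(r, s). r \<le> s}. lborel) borel ((sym_of \<circ> sym_coords) \<circ> sym_extend)"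
    unfolding sym_lborel_eq_sym_extend by (rule distr_distr) auto
  also have "(sym_of \<circ> sym_coords) \<circ> sym_extend = sym_extend"
    by (simp add: fun_eq_iff sym_of_sym_coords)
  finally show ?thesis unfolding sym_lborel_eq_sym_extend by (rule sym)
qed

lemma sets_sym_lborel [simp, measurable_cong]: "sets sym_lborel = sets borel"
  by (simp add: sym_lborel_def)

lemma space_sym_lborel [simp]: "space sym_lborel = UNIV"
  by (simp add: sym_lborel_def)

lemma nn_integral_sym_lborel:
  "f \<in> borel_measurable borel \<Longrightarrow> (\<integral>\<^sup>+z. f z \<partial>sym_lborel) = (\<integral>\<^sup>+x. f (sym_of x) \<partial>lborel)"
  unfolding sym_lborel_eq_sym_of by (subst nn_integral_distr) auto

section \<open>The determinant of congruence on symmetric matrices\<close>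

definition sym_conj :: "'n::{finite,linorder} cmat \<Rightarrow> real^'n sym_idx \<Rightarrow> real^'n sym_idx" where
  "sym_conj U x = sym_coords (U ** sym_of x ** transpose U)"

lemma matrix_scaleR_right: "(A::complex^'n^'m) ** (c *\<^sub>R B) = c *\<^sub>R (A ** B)"
  by (simp add: vec_eq_iff matrix_matrix_mult_def scaleR_sum_right)

lemma matrix_scaleR_left: "(c *\<^sub>R (A::complex^'n^'m)) ** B = c *\<^sub>R (A ** B)"
  by (simp add: vec_eq_iff matrix_matrix_mult_def scaleR_sum_right)

lemma linear_sym_conj: "linear (sym_conj U)"
  by (rule linearI) (simp_all add: sym_conj_def linear_add[OF linear_sym_of]
      linear_add[OF linear_sym_coords] linear_scale[OF linear_sym_of] linear_scale[OF linear_sym_coords]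
      matrix_add_ldistrib matrix_add_rdistrib' matrix_scaleR_left matrix_scaleR_right)

lemma transpose_congruence: "transpose S = S \<Longrightarrow> transpose (U ** S ** transpose U) = U ** S ** transpose (U::'a::comm_ring_1^'n^'n)"
  by (simp add: matrix_transpose_mul matrix_mul_assoc)

lemma sym_conj_mult: "sym_conj (U ** V) = sym_conj U \<circ> sym_conj V"
  by (simp add: fun_eq_iff sym_conj_def sym_of_sym_coords transpose_congruence matrix_transpose_mul
      matrix_mul_assoc)

lemma sym_conj_1: "sym_conj (mat 1) = id"
  by (simp add: fun_eq_iff sym_conj_def)

text \<open>The Jacobian factor of the congruence by U. It is multiplicative in U, hence determined
  by its values on diagonal matrices and transvections.\<close>

definition sym_det :: "'n::{finite,linorder} cmat \<Rightarrow> real" where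
  "sym_det U = \<bar>det (matrix (sym_conj U))\<bar>"

lemma sym_det_mult: "sym_det (U ** V) = sym_det U * sym_det V"
  unfolding sym_det_def sym_conj_mult
  by (simp add: matrix_compose linear_sym_conj det_mul abs_mult)

lemma sym_det_1: "sym_det (mat 1) = 1"
  by (simp add: sym_det_def sym_conj_1)

lemma sym_det_nz:
  assumes "det U \<noteq> 0" shows "sym_det U \<noteq> 0"
proof -
  obtain V where "U ** V = mat 1" using assms by (auto simp: invertible_det_nz[symmetric] invertible_def)
  then have "sym_det U * sym_det V = 1" by (metis sym_det_mult sym_det_1)
  then show ?thesis by auto
qed

text \<open>A transvection is conjugate to its square, by a diagonal matrix.\<close>

lemma sym_det_col_elem:
  assumes "w $ b = 0" shows "sym_det (col_elem w b) = 1" "sym_det (transpose (col_elem w b)) = 1"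
proof -
  define d :: "'a \<Rightarrow> complex" where "d i = (if i = b then 1 / 2 else 1)" for i
  define e :: "'a \<Rightarrow> complex" where "e i = (if i = b then 2 else 1)" for i
  have de: "diag_mat d ** diag_mat e = mat 1" "diag_mat e ** diag_mat d = mat 1"
    by (auto simp: diag_mat_mult d_def e_def if_distrib diag_mat_1[symmetric] intro!: arg_cong[of _ _ diag_mat])
  have sq: "diag_mat d ** col_elem w b ** diag_mat e = col_elem w b ** col_elem w b"
    using assms by (simp add: vec_eq_iff diag_mat_mult_right diag_mat_mult_left col_elem_add)
      (auto simp: col_elem_def d_def e_def)
  have 1: "sym_det (diag_mat d) * sym_det (diag_mat e) = 1"
    by (metis de(1) sym_det_mult sym_det_1)
  have "sym_det (col_elem w b) * sym_det (col_elem w b) = sym_det (col_elem w b)"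
    using arg_cong[OF sq, of sym_det] 1 by (simp add: sym_det_mult mult_ac)
  moreover have "sym_det (col_elem w b) \<noteq> 0"
    using assms by (intro sym_det_nz) (simp add: det_col_elem)
  ultimately show "sym_det (col_elem w b) = 1" by simp
  have "diag_mat e ** transpose (col_elem w b) ** diag_mat d =
      transpose (col_elem w b) ** transpose (col_elem w b)"
    using arg_cong[OF sq, of transpose] by (simp add: matrix_transpose_mul matrix_mul_assoc)
  from arg_cong[OF this, of sym_det] 1
  have "sym_det (transpose (col_elem w b)) * sym_det (transpose (col_elem w b)) = sym_det (transpose (col_elem w b))"
    by (simp add: sym_det_mult mult_ac)
  moreover have "sym_det (transpose (col_elem w b)) \<noteq> 0"
    using assms by (intro sym_det_nz) (simp add: det_col_elem)
  ultimately show "sym_det (transpose (col_elem w b)) = 1" by simp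
qed

text \<open>The product of t_r t_s over r \<le> s equals that over s \<le> r, and multiplied
  together they cover all pairs once and the diagonal once more: the n-th powers of two copies of
  the full product, times two further copies.\<close>

lemma prod_le_pairs:
  fixes t :: "'n::{finite,linorder} \<Rightarrow> real"
  shows "(\<Prod>(r, s)\<in>{(r, s). r \<le> s}. t r * t s * (t r * t s)) = (\<Prod>i\<in>UNIV. t i) ^ (2 * (CARD('n) + 1))"
proof -
  let ?f = "\<lambda>(r, s). t r * t s"
  let ?L = "{(r::'n, s). r \<le> s}" and ?G = "{(r::'n, s). s \<le> r}"
  have swap: "prod ?f ?L = prod ?f ?G"
    by (rule prod.reindex_bij_witness[of _ "\<lambda>(r, s). (s, r)" "\<lambda>(r, s). (s, r)"]) auto
  have "prod ?f ?L * prod ?f ?G = prod ?f (?L \<union> ?G) * prod ?f (?L \<inter> ?G)"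
    by (rule prod.union_inter[symmetric]) auto
  also have "?L \<union> ?G = UNIV \<times> UNIV" by auto
  also have "prod ?f (UNIV \<times> UNIV) = (\<Prod>r\<in>UNIV. \<Prod>s\<in>UNIV. t r * t s)"
    by (rule prod.cartesian_product[symmetric])
  also have "\<dots> = (\<Prod>i\<in>UNIV. t i) ^ CARD('n) * (\<Prod>i\<in>UNIV. t i) ^ CARD('n)"
    by (simp add: prod.distrib prod_power_distrib)
  also have "?L \<inter> ?G = (\<lambda>r. (r, r)) ` UNIV" by auto
  also have "prod ?f ((\<lambda>r. (r, r)) ` UNIV) = (\<Prod>i\<in>UNIV. t i) * (\<Prod>i\<in>UNIV. t i)"
    by (subst prod.reindex) (auto simp: inj_on_def prod.distrib)
  finally have "prod ?f ?L * prod ?f ?L = (\<Prod>i\<in>UNIV. t i) ^ (2 * (CARD('n) + 1))"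
    by (simp add: swap[symmetric] power_add power_mult power2_eq_square power_mult_distrib algebra_simps)
  then show ?thesis by (simp add: prod.distrib[symmetric] split_beta)
qed

lemma sym_det_diag_real:
  "sym_det (diag_mat (\<lambda>i. complex_of_real (t i)) :: 'n::{finite,linorder} cmat) =
    \<bar>\<Prod>i\<in>UNIV. t i\<bar> ^ (2 * (CARD('n) + 1))"
proof -
  let ?U = "diag_mat (\<lambda>i. complex_of_real (t i)) :: 'n cmat"
  define c where "c i = (case Rep_sym_idx i of (r, s, b) \<Rightarrow> t r * t s)" for i :: "'n sym_idx"
  have c: "c (sym_idx r s b) = t r * t s" if "r \<le> s" for r s b
    using that by (simp add: c_def Rep_sym_idx_sym_idx)
  have conj: "sym_conj ?U x $ i = c i * x $ i" for x i
    by (rule sym_idx_cases[of i])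
       (simp add: sym_conj_def diag_mat_mult_right diag_mat_mult_left c sym_of_def)
  have "matrix (sym_conj ?U) $ i $ j = (if i = j then c i else 0)" for i j
    by (simp add: matrix_def conj axis_def)
  then have "matrix (sym_conj ?U) = diag_mat c"
    by (simp add: vec_eq_iff diag_mat_def)
  then have "sym_det ?U = \<bar>\<Prod>i\<in>UNIV. c i\<bar>" by (simp add: sym_det_def det_diag_mat)
  also have "(\<Prod>i\<in>UNIV. c i) = (\<Prod>(r, s)\<in>{(r, s). r \<le> s}. t r * t s * (t r * t s))"
    unfolding prod_sym_idx by (intro prod.cong refl) (auto simp: c)
  finally show ?thesis by (simp only: prod_le_pairs power_abs)
qed

text \<open>Conjugating with entrywise complex conjugation shows that a diagonal matrix of complex
  numbers of modulus 1 and its inverse have the same \<open>sym_det\<close>.\<close>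

lemma sym_det_diag_unit:
  assumes "\<And>i. cmod (u i) = 1"
  shows "sym_det (diag_mat u) = 1"
proof -
  define K :: "real^'a sym_idx \<Rightarrow> real^'a sym_idx" where "K x = sym_coords (map_matrix cnj (sym_of x))" for x
  have linK: "linear K"
  proof (rule linearI)
    have *: "map_matrix cnj (A + B) = map_matrix cnj A + map_matrix cnj B"
      "map_matrix cnj (c *\<^sub>R A) = c *\<^sub>R map_matrix cnj A" for A B :: "'a cmat" and c
      by (simp_all add: vec_eq_iff)
    show "K (x + y) = K x + K y" "K (c *\<^sub>R x) = c *\<^sub>R K x" for x y c
      by (simp_all add: K_def linear_add[OF linear_sym_of] linear_scale[OF linear_sym_of] *
          linear_add[OF linear_sym_coords] linear_scale[OF linear_sym_coords])
  qed
  have sym: "transpose (map_matrix cnj (sym_of x)) = map_matrix cnj (sym_of x)" for x :: "real^'a sym_idx"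
    by (simp add: map_matrix_cnj_transpose[symmetric])
  have KK: "K \<circ> K = id" by (simp add: fun_eq_iff K_def sym_of_sym_coords sym)
  have KU: "K \<circ> sym_conj U \<circ> K = sym_conj (map_matrix cnj U)" for U :: "'a cmat"
  proof
    fix x
    have "transpose (U ** map_matrix cnj (sym_of x) ** transpose U) = U ** map_matrix cnj (sym_of x) ** transpose U"
      by (rule transpose_congruence) (rule sym)
    then show "(K \<circ> sym_conj U \<circ> K) x = sym_conj (map_matrix cnj U) x"
      by (simp add: K_def sym_conj_def sym_of_sym_coords sym map_matrix_cnj_mult map_matrix_cnj_transpose)
  qed
  have "\<bar>det (matrix K)\<bar> * \<bar>det (matrix K)\<bar> = 1"
    using arg_cong[OF KK, of "\<lambda>f. \<bar>det (matrix f)\<bar>"]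
    by (simp add: matrix_compose linK det_mul abs_mult del: abs_mult_self_eq)
  then have cnj: "sym_det (map_matrix cnj U) = sym_det U" for U :: "'a cmat"
    unfolding sym_det_def KU[symmetric]
    by (simp add: matrix_compose linear_compose linK linear_sym_conj det_mul abs_mult mult_ac del: abs_mult_self_eq)
  have "map_matrix cnj (diag_mat u) = diag_mat (\<lambda>i. cnj (u i))"
    by (simp add: vec_eq_iff diag_mat_def)
  moreover have "diag_mat (\<lambda>i. cnj (u i)) ** diag_mat u = mat 1"
    using assms by (simp add: diag_mat_mult diag_mat_1[symmetric] mult.commute[of "cnj _"] complex_norm_square[symmetric])
  ultimately have "sym_det (diag_mat u) * sym_det (diag_mat u) = 1"
    by (metis cnj sym_det_mult sym_det_1)
  moreover have "sym_det (diag_mat u) \<ge> 0" by (simp add: sym_det_def)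
  ultimately show ?thesis
    by (metis abs_of_nonneg abs_square_eq_1 power2_eq_square)
qed

text \<open>As a complex linear map, congruence on symmetric matrices has determinant (det U)^(n+1);
  the real Jacobian is the square of its modulus.\<close>

lemma sym_det_eq:
  fixes U :: "'n::{finite,linorder} cmat"
  assumes "det U \<noteq> 0"
  shows "sym_det U = cmod (det U) ^ (2 * (CARD('n) + 1))"
  using assms
proof (induction U rule: induct_invertible_matrix)
  case (mult U V)
  then show ?case by (simp add: sym_det_mult det_mul norm_mult power_mult_distrib)
next
  case (diag d)
  let ?u = "\<lambda>i. d i / cmod (d i)"
  \<comment> \<open>Entrywise polar decomposition: the positive part scales each coordinate, and the
    part of modulus 1 contributes nothing.\<close>
  have "diag_mat d = diag_mat (\<lambda>i. complex_of_real (cmod (d i))) ** diag_mat ?u"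
    using diag by (simp add: diag_mat_mult)
  moreover have "sym_det (diag_mat ?u) = 1"
    using diag by (intro sym_det_diag_unit) (simp add: norm_divide)
  ultimately have "sym_det (diag_mat d) = \<bar>\<Prod>i\<in>UNIV. cmod (d i)\<bar> ^ (2 * (CARD('n) + 1))"
    by (simp only: sym_det_mult sym_det_diag_real mult_1_right)
  then show ?case by (simp only: det_diag_mat prod_norm abs_norm_cancel)
next
  case (col w b)
  then show ?case by (simp add: sym_det_col_elem det_col_elem)
next
  case (row w b)
  then show ?case by (simp add: sym_det_col_elem det_col_elem)
qed

section \<open>Invariance of the measure\<close>

text \<open>The finiteness assumption allows passing to absolutely integrable functions and back; an
  exhaustion by sets of finite measure later compensates for it. The values are embedded in
  \<open>real ^ 1\<close> to match the vector-valued transformation formula.\<close>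

lemma nn_integral_change_of_variables:
  fixes f :: "real^'m::{finite,wellorder} \<Rightarrow> real" and g :: "real^'m::_ \<Rightarrow> real^'m::_"
  assumes S: "S \<in> sets borel" "g ` S \<in> sets borel"
    and der_g: "\<And>x. x \<in> S \<Longrightarrow> (g has_derivative g' x) (at x within S)"
    and inj: "inj_on g S"
    and f: "f \<in> borel_measurable borel" "\<And>x. 0 \<le> f x"
    and fin: "(\<integral>\<^sup>+x. ennreal (f x) * indicator (g ` S) x \<partial>lborel) < \<infinity>"
  shows "(\<integral>\<^sup>+x. ennreal (\<bar>det (matrix (g' x))\<bar> * f (g x)) * indicator S x \<partial>lborel)
    = (\<integral>\<^sup>+x. ennreal (f x) * indicator (g ` S) x \<partial>lborel)"
proof -
  let ?h = "\<lambda>x. f x * indicator (g ` S) x"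
  obtain r where r: "(\<integral>\<^sup>+x. ennreal (f x) * indicator (g ` S) x \<partial>lborel) = ennreal r" "0 \<le> r"
    using fin by (cases "\<integral>\<^sup>+x. ennreal (f x) * indicator (g ` S) x \<partial>lborel") auto
  have "(?h has_integral r) UNIV"
  proof (rule nn_integral_has_integral)
    show "?h \<in> borel_measurable borel" using f(1) S(2) by measurable
    have "ennreal (?h x) = ennreal (f x) * indicator (g ` S) x" for x
      by (auto simp: indicator_def)
    then show "(\<integral>\<^sup>+x. ennreal (?h x) \<partial>lborel) = ennreal r" using r by simp
  qed (use f r in auto)
  then have "((\<lambda>x. if x \<in> g ` S then f x else 0) has_integral r) UNIV"
    by (rule has_integral_eq[rotated]) (auto simp: indicator_def)
  then have hi: "(f has_integral r) (g ` S)" by (simp only: has_integral_restrict_UNIV)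
  then have ab: "f absolutely_integrable_on (g ` S)" "integral (g ` S) f = r"
    using f(2) by (auto intro!: nonnegative_absolutely_integrable_1 simp: has_integral_iff)
  have "(\<lambda>x. \<bar>det (matrix (g' x))\<bar> *\<^sub>R vec (f (g x)) :: real ^ 1) absolutely_integrable_on S \<and>
      integral S (\<lambda>x. \<bar>det (matrix (g' x))\<bar> *\<^sub>R vec (f (g x))) = (vec r :: real ^ 1)
      \<longleftrightarrow> (\<lambda>x. vec (f x) :: real ^ 1) absolutely_integrable_on (g ` S) \<and>
        integral (g ` S) (\<lambda>x. vec (f x)) = (vec r :: real ^ 1)"
    using S(1) der_g inj by (intro has_absolute_integral_change_of_variables) auto
  then have "(\<lambda>x. \<bar>det (matrix (g' x))\<bar> * f (g x)) absolutely_integrable_on S \<and>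
      integral S (\<lambda>x. \<bar>det (matrix (g' x))\<bar> * f (g x)) = r"
    using ab by (simp add: absolutely_integrable_on_1_iff integral_on_1_eq)
  then have "((\<lambda>x. \<bar>det (matrix (g' x))\<bar> * f (g x)) has_integral r) S"
    by (auto simp: has_integral_iff set_lebesgue_integral_eq_integral(1))
  then have "(\<integral>\<^sup>+x. ennreal (\<bar>det (matrix (g' x))\<bar> * f (g x)) * indicator S x \<partial>lborel) = ennreal r"
    by (intro nn_integral_has_integral_lebesgue') (auto simp: f(2))
  then show ?thesis using r by simp
qed

lemma has_derivative_vecI:
  fixes f :: "'a::real_normed_vector \<Rightarrow> 'b::euclidean_space^'n"
  assumes "\<And>i. ((\<lambda>x. f x $ i) has_derivative (\<lambda>h. f' h $ i)) (at x within S)"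
  shows "(f has_derivative f') (at x within S)"
proof (subst has_derivative_componentwise_within, rule ballI)
  fix b :: "'b^'n" assume "b \<in> Basis"
  then obtain i c where b: "b = axis i c" by (auto simp: Basis_vec_def)
  show "((\<lambda>x. f x \<bullet> b) has_derivative (\<lambda>x. f' x \<bullet> b)) (at x within S)"
    unfolding b inner_axis by (intro derivative_intros assms)
qed

text \<open>The first factor need only be continuous: replacing a w by a z costs o(1) times l (w -
  z). Together with an exact difference formula this avoids differentiating a matrix
  inverse.\<close>

lemma has_derivative_mult_diff:
  fixes a :: "'a::real_normed_vector \<Rightarrow> 'b::real_normed_algebra"
  assumes a: "continuous (at z within S) a" and l: "bounded_linear l"
  shows "((\<lambda>w. a w * l (w - z)) has_derivative (\<lambda>h. a z * l h)) (at z within S)"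
proof -
  obtain K where K: "\<And>x. norm (l x) \<le> norm x * K" "0 < K"
    using bounded_linear.pos_bounded[OF l] by blast
  have "((\<lambda>w. norm (a w - a z) * K) \<longlongrightarrow> norm (a z - a z) * K) (at z within S)"
    using a by (intro tendsto_intros) (simp add: continuous_within)
  then have lim: "((\<lambda>w. norm (a w - a z) * K) \<longlongrightarrow> 0) (at z within S)" by simp
  have "((\<lambda>w. (1 / norm (w - z)) *\<^sub>R (a w * l (w - z) - (a z * l (z - z) + a z * l (w - z)))) \<longlongrightarrow> 0) (at z within S)"
  proof (rule Lim_null_comparison[OF _ lim], rule always_eventually, rule allI)
    fix w
    define X where "X = a w * l (w - z) - (a z * l (z - z) + a z * l (w - z))"
    have "norm X = norm ((a w - a z) * l (w - z))"
      by (simp add: X_def algebra_simps linear_0[OF bounded_linear.linear[OF l]])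
    also have "\<dots> \<le> norm (a w - a z) * (norm (w - z) * K)"
      by (rule order_trans[OF norm_mult_ineq]) (intro mult_left_mono K norm_ge_zero)
    finally show "norm ((1 / norm (w - z)) *\<^sub>R (a w * l (w - z) - (a z * l (z - z) + a z * l (w - z)))) \<le> norm (a w - a z) * K"
      unfolding X_def[symmetric] using K(2) by (cases "w = z") (auto simp: divide_simps mult_ac)
  qed
  moreover have "bounded_linear (\<lambda>h. a z * l h)"
    by (rule bounded_linear_const_mult[OF l])
  ultimately show ?thesis by (simp add: has_derivative_within)
qed

text \<open>\<open>aut_pair\<close> divided by both denominators. The difference is exact, so the
  derivative of the action needs only the continuity of (Cw + D)^-1.\<close>

lemma sp_act_diff:
  assumes g: "g \<in> Sp_real" and z: "z \<in> siegel_space" and w: "w \<in> siegel_space"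
  shows "sp_act g w - sp_act g z =
    transpose (matrix_inv (aut_den g w)) ** (w - z) ** matrix_inv (aut_den g z)"
proof -
  let ?Q = "aut_den g"
  note inv = invertible_aut_den[OF g]
  have "transpose (?Q w) ** (sp_act g w - sp_act g z) ** ?Q z =
      transpose (sp_act g w ** ?Q w) ** ?Q z - transpose (?Q w) ** (sp_act g z ** ?Q z)"
    by (simp add: matrix_diff_ldistrib matrix_diff_rdistrib matrix_transpose_mul matrix_mul_assoc
        siegel_space_transpose[OF sp_act_in_siegel[OF g w]])
  also have "\<dots> = w - z"
    unfolding sp_act_mult_den[OF g w] sp_act_mult_den[OF g z] aut_pair[OF g]
    by (simp add: siegel_space_transpose[OF w])
  finally have eq: "transpose (?Q w) ** (sp_act g w - sp_act g z) ** ?Q z = w - z" .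
  have "transpose (matrix_inv (?Q w)) ** (w - z) ** matrix_inv (?Q z) =
      transpose (?Q w ** matrix_inv (?Q w)) ** (sp_act g w - sp_act g z) ** (?Q z ** matrix_inv (?Q z))"
    unfolding eq[symmetric] matrix_transpose_mul by (simp only: matrix_mul_assoc)
  then show ?thesis by (simp add: matrix_inv_right inv z w)
qed

lemma has_derivative_sp_act:
  assumes g: "g \<in> Sp_real" and z: "z \<in> siegel_space"
  defines "R \<equiv> matrix_inv (aut_den g z)"
  shows "(sp_act g has_derivative (\<lambda>h. transpose R ** h ** R)) (at z within siegel_space)"
proof -
  define F where "F w = transpose (matrix_inv (aut_den g w))" for w
  have F: "continuous (at z within siegel_space) (\<lambda>w. F w $ i $ j)" for i j
  proof -
    have "continuous_on siegel_space (\<lambda>w. F w $ i $ j)"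
      unfolding F_def using det_aut_den_nz[OF g]
      unfolding aut_den_def by (intro continuous_intros continuous_on_matrix_inv) auto
    with z show ?thesis by (simp add: continuous_on_eq_continuous_within)
  qed
  have ent: "(A ** h ** B) $ i $ j = (\<Sum>l\<in>UNIV. \<Sum>k\<in>UNIV. A $ i $ k * B $ l $ j * h $ k $ l)"
    for A h B :: "'a cmat" and i j
    by (simp add: matrix_matrix_mult_def sum_distrib_left sum_distrib_right mult_ac)
  have bl: "bounded_linear (\<lambda>h::'a cmat. h $ k $ l)" for k l
    by (rule bounded_linear_compose[OF bounded_linear_vec_nth bounded_linear_vec_nth])
  have "((\<lambda>w. F w ** (w - z) ** R) has_derivative (\<lambda>h. transpose R ** h ** R)) (at z within siegel_space)"
  proof (intro has_derivative_vecI)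
    fix i j
    have "((\<lambda>w. \<Sum>l\<in>UNIV. \<Sum>k\<in>UNIV. F w $ i $ k * R $ l $ j * (w - z) $ k $ l) has_derivative
      (\<lambda>h. \<Sum>l\<in>UNIV. \<Sum>k\<in>UNIV. F z $ i $ k * R $ l $ j * h $ k $ l)) (at z within siegel_space)"
      by (intro has_derivative_sum has_derivative_mult_diff continuous_intros F bl)
    then show "((\<lambda>w. (F w ** (w - z) ** R) $ i $ j) has_derivative
        (\<lambda>h. (transpose R ** h ** R) $ i $ j)) (at z within siegel_space)"
      unfolding ent by (simp add: F_def R_def)
  qed
  then have "((\<lambda>w. F w ** (w - z) ** R + sp_act g z) has_derivative (\<lambda>h. transpose R ** h ** R)) (at z within siegel_space)"
    by (rule has_derivative_add_const)
  then show ?thesis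
  proof (rule has_derivative_transform[OF z, rotated])
    show "sp_act g w = F w ** (w - z) ** R + sp_act g z" if "w \<in> siegel_space" for w
      using sp_act_diff[OF g z that] by (simp add: F_def R_def algebra_simps)
  qed
qed

definition siegel_weight :: "'n::finite cmat \<Rightarrow> real" where
  "siegel_weight z = det (map_matrix Im z) powi (- int CARD('n) - 1)"

lemma det_Im_measurable [measurable]: "(\<lambda>z. det (map_matrix Im z)) \<in> borel_measurable borel"
  by (intro borel_measurable_continuous_onI continuous_intros continuous_on_map_matrix)

lemma power_int_measurable [measurable]:
  "f \<in> borel_measurable M \<Longrightarrow> (\<lambda>x. (f x :: 'a::{real_normed_field,second_countable_topology}) powi k) \<in> borel_measurable M"
  by (cases k rule: int_cases4) (simp_all add: power_int_minus)

lemma siegel_weight_measurable [measurable]: "siegel_weight \<in> borel_measurable borel"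
  unfolding siegel_weight_def[abs_def] by measurable

lemma siegel_weight_pos: "z \<in> siegel_space \<Longrightarrow> 0 < siegel_weight z"
  unfolding siegel_weight_def by (intro zero_less_power_int det_Im_pos)

lemma siegel_measure_eq:
  "siegel_measure = density sym_lborel (\<lambda>z. indicator siegel_space z * ennreal (siegel_weight z))"
  by (simp add: siegel_measure_def siegel_weight_def[abs_def])

lemma sets_siegel_measure [simp, measurable_cong]: "sets siegel_measure = sets borel"
  by (simp add: siegel_measure_eq)

lemma space_siegel_measure [simp]: "space siegel_measure = UNIV"
  by (simp add: siegel_measure_eq)

lemma nn_integral_siegel_measure:
  assumes [measurable]: "f \<in> borel_measurable borel"
  shows "(\<integral>\<^sup>+z. f z \<partial>siegel_measure) =
    (\<integral>\<^sup>+z. indicator siegel_space z * ennreal (siegel_weight z) * f z \<partial>sym_lborel)"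
  unfolding siegel_measure_eq by (subst nn_integral_density) auto

text \<open>The Jacobian is |det (Cz + D)|^(-2(n+1)), and det Im z changes by |det (Cz + D)|^(-2);
  the exponent -(n+1) of the density is the one for which the two cancel.\<close>

lemma siegel_weight_sp_act:
  fixes z :: "'n::{finite,linorder} cmat"
  assumes g: "g \<in> Sp_real" and z: "z \<in> siegel_space"
  shows "sym_det (transpose (matrix_inv (aut_den g z))) * siegel_weight (sp_act g z) = siegel_weight z"
proof -
  let ?j = "cmod (det (aut_den g z))" and ?N = "CARD('n) + 1"
  let ?y = "det (map_matrix Im (sp_act g z))"
  have j: "?j > 0" using det_aut_den_nz[OF g z] by simp
  have y: "?y > 0" by (intro det_Im_pos sp_act_in_siegel g z)
  have "det (matrix_inv (aut_den g z)) * det (aut_den g z) = 1"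
    unfolding det_mul[symmetric] by (simp add: matrix_inv_left invertible_aut_den g z)
  then have inv: "cmod (det (matrix_inv (aut_den g z))) * ?j = 1"
    by (metis norm_mult norm_one)
  then have "cmod (det (matrix_inv (aut_den g z))) = inverse ?j"
    using j by (simp add: field_simps)
  moreover have "det (transpose (matrix_inv (aut_den g z))) \<noteq> 0" using inv by auto
  ultimately have sd: "sym_det (transpose (matrix_inv (aut_den g z))) = inverse (?j ^ (2 * ?N))"
    by (simp add: sym_det_eq power_inverse)
  have w: "siegel_weight v = inverse (det (map_matrix Im v) ^ ?N)" for v :: "'n cmat"
  proof -
    have "- int CARD('n) - 1 = - int ?N" by simp
    then show ?thesis by (simp only: siegel_weight_def power_int_minus power_int_of_nat)
  qed
  have "siegel_weight z = inverse ((?j\<^sup>2 * ?y) ^ ?N)"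
    unfolding w det_Im_sp_act[OF g z] ..
  also have "\<dots> = inverse (?j ^ (2 * ?N)) * inverse (?y ^ ?N)"
    by (simp only: power_mult_distrib power_mult inverse_mult_distrib)
  finally show ?thesis unfolding sd w by simp
qed

text \<open>Extension by zero makes the action a Borel map on the space of all matrices, where the
  measure lives; almost everywhere it is the action itself.\<close>

definition sp_act0 :: "'n::finite sp_mat \<Rightarrow> 'n cmat \<Rightarrow> 'n cmat" where
  "sp_act0 g z = (if z \<in> siegel_space then sp_act g z else 0)"

lemma sp_act0_measurable [measurable]:
  "g \<in> Sp_real \<Longrightarrow> sp_act0 g \<in> borel_measurable borel"
  unfolding sp_act0_def[abs_def]
  by (intro borel_measurable_continuous_on_if continuous_on_sp_act continuous_intros) auto

lemma siegel_weight_bounded: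
  "\<exists>B. \<forall>z\<in>siegel_compact k. siegel_weight (z :: 'n::finite cmat) \<le> B"
proof -
  have "continuous_on (siegel_compact k) (\<lambda>z::'n cmat. siegel_weight z)"
    unfolding siegel_weight_def
    by (intro continuous_intros continuous_on_map_matrix)
       (use det_Im_pos siegel_compact_subset in force)
  then have "bounded (siegel_weight ` (siegel_compact k :: 'n cmat set))"
    by (intro compact_imp_bounded compact_continuous_image compact_siegel_compact)
  then obtain B where "\<forall>x\<in>siegel_weight ` (siegel_compact k :: 'n cmat set). norm x \<le> B"
    by (auto simp: bounded_iff)
  then show ?thesis by (intro exI[of _ B]) auto
qed

lemma emeasure_siegel_compact_finite:
  "emeasure siegel_measure (siegel_compact k :: 'n::{finite,linorder} cmat set) < \<infinity>"
proof -
  obtain B where B: "\<And>z. z \<in> siegel_compact k \<Longrightarrow> siegel_weight (z :: 'n cmat) \<le> B"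
    using siegel_weight_bounded by blast
  have bd: "bounded (sym_of -` (siegel_compact k :: 'n cmat set))"
  proof -
    have "sym_of -` (siegel_compact k :: 'n cmat set) \<subseteq> sym_coords ` siegel_compact k"
      by (auto simp: image_def) (metis sym_coords_sym_of)
    moreover have "bounded (sym_coords ` (siegel_compact k :: 'n cmat set))"
      by (intro bounded_linear_image bounded_linear_sym_coords compact_imp_bounded compact_siegel_compact)
    ultimately show ?thesis by (rule bounded_subset[rotated])
  qed
  have "emeasure siegel_measure (siegel_compact k :: 'n cmat set) =
      (\<integral>\<^sup>+z. indicator siegel_space z * ennreal (siegel_weight z) * indicator (siegel_compact k) z \<partial>(sym_lborel :: 'n cmat measure))"
    by (subst nn_integral_siegel_measure[symmetric]) auto
  also have "\<dots> \<le> (\<integral>\<^sup>+z. ennreal B * indicator (siegel_compact k) z \<partial>(sym_lborel :: 'n cmat measure))"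
    by (intro nn_integral_mono) (auto simp: indicator_def intro!: ennreal_leI B)
  also have "\<dots> = (\<integral>\<^sup>+x. ennreal B * indicator (siegel_compact k) (sym_of x :: 'n cmat) \<partial>lborel)"
    by (rule nn_integral_sym_lborel) measurable
  also have "\<dots> = ennreal B * emeasure lborel (sym_of -` (siegel_compact k :: 'n cmat set))"
  proof -
    have "sym_of -` (siegel_compact k :: 'n cmat set) \<inter> space borel \<in> sets borel"
      by (rule measurable_sets[OF sym_of_measurable]) simp
    then have m: "sym_of -` (siegel_compact k :: 'n cmat set) \<in> sets lborel" by simp
    have "(\<integral>\<^sup>+x. ennreal B * indicator (siegel_compact k) (sym_of x :: 'n cmat) \<partial>lborel) =
        (\<integral>\<^sup>+x. ennreal B * indicator (sym_of -` (siegel_compact k :: 'n cmat set)) x \<partial>lborel)"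
      by (intro nn_integral_cong) (auto simp: indicator_def)
    also have "\<dots> = ennreal B * emeasure lborel (sym_of -` (siegel_compact k :: 'n cmat set))"
      using m by (simp add: nn_integral_cmult)
    finally show ?thesis .
  qed
  also have "\<dots> < \<infinity>"
    using emeasure_bounded_finite[OF bd] by (simp add: ennreal_mult_less_top)
  finally show ?thesis .
qed

text \<open>The change of variables in real coordinates on symmetric matrices: the action permutes
  the coordinates of points of the half-space, with derivative a congruence. Finite measure of E
  feeds the transformation formula.\<close>

lemma emeasure_siegel_sp_act_aux:
  fixes E :: "'n::{finite,linorder} cmat set"
  assumes g: "g \<in> Sp_real" and E [measurable]: "E \<in> sets borel"
    and fin: "emeasure siegel_measure E < \<infinity>"
  shows "emeasure siegel_measure {z \<in> siegel_space. sp_act g z \<in> E} = emeasure siegel_measure (E \<inter> siegel_space)"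
proof -
  define S :: "(real^'n sym_idx) set" where "S = sym_of -` siegel_space"
  define G where "G x = sym_coords (sp_act g (sym_of x))" for x :: "real^'n sym_idx"
  define G' where "G' x = sym_conj (transpose (matrix_inv (aut_den g (sym_of x))))" for x :: "real^'n sym_idx"
  define f where "f x = indicator (E \<inter> siegel_space) (sym_of x) * siegel_weight (sym_of x)" for x :: "real^'n sym_idx"
  have S_sub: "sym_of x \<in> siegel_space" if "x \<in> S" for x using that by (simp add: S_def)
  have S_borel [measurable]: "S \<in> sets borel"
    using measurable_sets[OF sym_of_measurable siegel_space_borel] by (simp add: S_def)
  have sG: "sym_of (G x) = sp_act g (sym_of x)" if "x \<in> S" for x
    unfolding G_def by (intro sym_of_sym_coords siegel_space_transpose sp_act_in_siegel g S_sub that)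
  obtain h where h: "h \<in> Sp_real" "h ** g = mat 1" "g ** h = mat 1" using Sp_real_inverse[OF g] .
  have inj: "inj_on G S"
  proof (rule inj_onI)
    fix x y assume "x \<in> S" "y \<in> S" "G x = G y"
    then have "sp_act h (sp_act g (sym_of x)) = sp_act h (sp_act g (sym_of y))" by (metis sG)
    then have "sym_of x = sym_of y"
      using \<open>x \<in> S\<close> \<open>y \<in> S\<close> by (simp add: sp_act_mult[OF h(1) g, symmetric] S_sub h(2))
    then show "x = y" by (metis sym_coords_sym_of)
  qed
  have img: "G ` S = S"
  proof
    show "G ` S \<subseteq> S" by (auto simp: S_def[symmetric]) (auto simp: S_def sG[unfolded S_def] intro: sp_act_in_siegel g)
    show "S \<subseteq> G ` S"
    proof
      fix y assume y: "y \<in> S"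
      define x where "x = sym_coords (sp_act h (sym_of y))"
      have sx: "sym_of x = sp_act h (sym_of y)"
        unfolding x_def by (intro sym_of_sym_coords siegel_space_transpose sp_act_in_siegel h S_sub y)
      then have "x \<in> S" using sp_act_in_siegel[OF h(1) S_sub[OF y]] by (simp add: S_def)
      moreover have "G x = y"
        by (simp add: G_def sx sp_act_mult[OF g h(1), symmetric] S_sub y h(3))
      ultimately show "y \<in> G ` S" by blast
    qed
  qed
  have der: "(G has_derivative G' x) (at x within S)" if "x \<in> S" for x
  proof -
    have 1: "(sym_of has_derivative sym_of) (at x within S)"
      by (rule bounded_linear_imp_has_derivative[OF bounded_linear_sym_of])
    have 2: "(sp_act g has_derivative (\<lambda>h. transpose (matrix_inv (aut_den g (sym_of x))) ** h ** matrix_inv (aut_den g (sym_of x))))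
        (at (sym_of x) within sym_of ` S)"
      by (rule has_derivative_subset[OF has_derivative_sp_act[OF g S_sub[OF that]]]) (auto simp: S_def)
    from has_derivative_in_compose[OF 1 2]
    have "((\<lambda>x. sp_act g (sym_of x)) has_derivative
        (\<lambda>v. transpose (matrix_inv (aut_den g (sym_of x))) ** sym_of v ** matrix_inv (aut_den g (sym_of x)))) (at x within S)" .
    from bounded_linear.has_derivative[OF bounded_linear_sym_coords this]
    show ?thesis unfolding G_def[abs_def] G'_def sym_conj_def[abs_def] by simp
  qed
  have f0: "0 \<le> f x" for x
    using siegel_weight_pos[of "sym_of x"] by (auto simp: f_def indicator_def)
  have fm: "f \<in> borel_measurable borel" unfolding f_def[abs_def] by measurable
  have measE: "emeasure siegel_measure A = (\<integral>\<^sup>+x. ennreal (indicator (A \<inter> siegel_space) (sym_of x) * siegel_weight (sym_of x)) \<partial>lborel)"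
    if [measurable]: "A \<in> sets borel" for A
  proof -
    have "emeasure siegel_measure A = (\<integral>\<^sup>+z. indicator siegel_space z * ennreal (siegel_weight z) * indicator A z \<partial>sym_lborel)"
      by (subst nn_integral_siegel_measure[symmetric]) auto
    also have "\<dots> = (\<integral>\<^sup>+x. indicator siegel_space (sym_of x) * ennreal (siegel_weight (sym_of x)) * indicator A (sym_of x) \<partial>lborel)"
      by (rule nn_integral_sym_lborel) measurable
    also have "\<dots> = (\<integral>\<^sup>+x. ennreal (indicator (A \<inter> siegel_space) (sym_of x) * siegel_weight (sym_of x)) \<partial>lborel)"
      by (intro nn_integral_cong) (auto simp: indicator_def)
    finally show ?thesis .
  qed
  have fS: "ennreal (f x) * indicator S x = ennreal (f x)" for x
    by (auto simp: f_def S_def indicator_def)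
  have E': "{z \<in> siegel_space. sp_act g z \<in> E} \<in> sets borel"
  proof -
    have "{z \<in> siegel_space. sp_act g z \<in> E} = siegel_space \<inter> (sp_act0 g -` E \<inter> space borel)"
      by (auto simp: sp_act0_def)
    also have "\<dots> \<in> sets borel"
      by (intro sets.Int siegel_space_borel measurable_sets[OF sp_act0_measurable[OF g] E])
    finally show ?thesis .
  qed
  have "(\<integral>\<^sup>+x. ennreal (\<bar>det (matrix (G' x))\<bar> * f (G x)) * indicator S x \<partial>lborel)
      = (\<integral>\<^sup>+x. ennreal (f x) * indicator (G ` S) x \<partial>lborel)"
  proof (rule nn_integral_change_of_variables)
    have "(\<integral>\<^sup>+x. ennreal (f x) \<partial>lborel) = emeasure siegel_measure E"
      by (simp add: measE f_def)
    then show "(\<integral>\<^sup>+x. ennreal (f x) * indicator (G ` S) x \<partial>lborel) < \<infinity>"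
      unfolding img fS using fin by simp
  qed (use der inj img f0 fm in auto)
  also have "\<dots> = emeasure siegel_measure (E \<inter> siegel_space)"
    unfolding img fS by (simp add: measE f_def Int_assoc)
  also have "(\<integral>\<^sup>+x. ennreal (\<bar>det (matrix (G' x))\<bar> * f (G x)) * indicator S x \<partial>lborel) =
      (\<integral>\<^sup>+x. ennreal (indicator ({z \<in> siegel_space. sp_act g z \<in> E} \<inter> siegel_space) (sym_of x) * siegel_weight (sym_of x)) \<partial>lborel)"
  proof (intro nn_integral_cong)
    fix x :: "real^'n sym_idx"
    show "ennreal (\<bar>det (matrix (G' x))\<bar> * f (G x)) * indicator S x =
      ennreal (indicator ({z \<in> siegel_space. sp_act g z \<in> E} \<inter> siegel_space) (sym_of x) * siegel_weight (sym_of x))"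
    proof (cases "x \<in> S")
      case True
      have "\<bar>det (matrix (G' x))\<bar> * siegel_weight (sp_act g (sym_of x)) = siegel_weight (sym_of x)"
        unfolding G'_def sym_det_def[symmetric] by (rule siegel_weight_sp_act[OF g S_sub[OF True]])
      then show ?thesis
        using True S_sub[OF True] sp_act_in_siegel[OF g S_sub[OF True]]
        by (simp add: f_def sG indicator_def)
    qed (simp add: S_def)
  qed
  also have "\<dots> = emeasure siegel_measure {z \<in> siegel_space. sp_act g z \<in> E}"
    by (rule measE[OF E', symmetric])
  finally show ?thesis .
qed

lemma sp_act0_vimage_borel:
  assumes "g \<in> Sp_real" "E \<in> sets borel"
  shows "{z \<in> siegel_space. sp_act g z \<in> E} \<in> sets borel"
proof -
  have "{z \<in> siegel_space. sp_act g z \<in> E} = siegel_space \<inter> (sp_act0 g -` E \<inter> space borel)"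
    by (auto simp: sp_act0_def)
  also have "\<dots> \<in> sets borel"
    by (intro sets.Int siegel_space_borel measurable_sets[OF sp_act0_measurable[OF assms(1)] assms(2)])
  finally show ?thesis .
qed

lemma AE_siegel_space: "AE z in siegel_measure. z \<in> siegel_space"
  unfolding siegel_measure_eq by (subst AE_density) (auto simp: indicator_def)

lemma emeasure_siegel_Int: "E \<in> sets borel \<Longrightarrow> emeasure siegel_measure (E \<inter> siegel_space) = emeasure siegel_measure E"
  using AE_siegel_space by (intro emeasure_eq_AE) auto

text \<open>Intersecting E with the compact exhaustion produces sets of finite measure, and both
  sides are continuous along the increasing union.\<close>

lemma emeasure_siegel_sp_act:
  fixes E :: "'n::{finite,linorder} cmat set"
  assumes g: "g \<in> Sp_real" and E [measurable]: "E \<in> sets borel"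
  shows "emeasure siegel_measure {z \<in> siegel_space. sp_act g z \<in> E} = emeasure siegel_measure E"
proof -
  let ?E = "\<lambda>k. E \<inter> siegel_compact k"
  let ?F = "\<lambda>k. {z \<in> siegel_space. sp_act g z \<in> ?E k}"
  have inc: "incseq ?E" using siegel_compact_mono by (fastforce simp: incseq_def)
  then have incF: "incseq ?F" by (auto simp: incseq_def)
  have Fb: "?F k \<in> sets borel" for k
    by (rule sp_act0_vimage_borel[OF g]) measurable
  have fin: "emeasure siegel_measure (?E k) < \<infinity>" for k
    by (rule order.strict_trans1[OF emeasure_mono emeasure_siegel_compact_finite[of k]]) auto
  have eq: "emeasure siegel_measure (?F k) = emeasure siegel_measure (?E k)" for k
    using emeasure_siegel_sp_act_aux[OF g _ fin, of k] emeasure_siegel_Int[of "?E k"] by simp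
  have "{z \<in> siegel_space. sp_act g z \<in> E} = (\<Union>k. ?F k)"
    using sp_act_in_siegel[OF g] siegel_space_eq_UN by fastforce
  then have "emeasure siegel_measure {z \<in> siegel_space. sp_act g z \<in> E} = (SUP k. emeasure siegel_measure (?F k))"
    using Fb by (subst SUP_emeasure_incseq) (use incF in auto)
  also have "\<dots> = (SUP k. emeasure siegel_measure (?E k))"
    by (simp only: eq)
  also have "\<dots> = emeasure siegel_measure (\<Union>k. ?E k)"
    by (intro SUP_emeasure_incseq inc) auto
  also have "(\<Union>k. ?E k) = E \<inter> siegel_space" by (auto simp: siegel_space_eq_UN)
  finally show ?thesis by (simp add: emeasure_siegel_Int)
qed

lemma distr_siegel_sp_act:
  assumes g: "g \<in> Sp_real"
  shows "distr siegel_measure borel (sp_act0 g) = (siegel_measure :: 'n::{finite,linorder} cmat measure)"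
proof (rule measure_eqI)
  fix E :: "'n cmat set" assume "E \<in> sets (distr siegel_measure borel (sp_act0 g))"
  then have E [measurable]: "E \<in> sets borel" by simp
  have "emeasure (distr siegel_measure borel (sp_act0 g)) E = emeasure siegel_measure (sp_act0 g -` E)"
    using g by (subst emeasure_distr) auto
  also have "\<dots> = emeasure siegel_measure {z \<in> siegel_space. sp_act g z \<in> E}"
  proof (rule emeasure_eq_AE)
    show "AE z in siegel_measure. z \<in> sp_act0 g -` E \<longleftrightarrow> z \<in> {z \<in> siegel_space. sp_act g z \<in> E}"
      using AE_siegel_space by eventually_elim (auto simp: sp_act0_def)
    show "sp_act0 g -` E \<in> sets siegel_measure"
      using measurable_sets[OF sp_act0_measurable[OF g] E] by simp
  qed (use sp_act0_vimage_borel[OF g E] in simp)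
  finally show "emeasure (distr siegel_measure borel (sp_act0 g)) E = emeasure siegel_measure E"
    by (simp add: emeasure_siegel_sp_act[OF g E])
qed simp

lemma nn_integral_siegel_sp_act:
  assumes g: "g \<in> Sp_real" and [measurable]: "h \<in> borel_measurable borel"
  shows "(\<integral>\<^sup>+z. h (sp_act g z) \<partial>siegel_measure) = (\<integral>\<^sup>+z. h z \<partial>siegel_measure)"
proof -
  have "(\<integral>\<^sup>+z. h z \<partial>siegel_measure) = (\<integral>\<^sup>+z. h z \<partial>distr siegel_measure borel (sp_act0 g))"
    by (simp only: distr_siegel_sp_act[OF g])
  also have "\<dots> = (\<integral>\<^sup>+z. h (sp_act0 g z) \<partial>siegel_measure)"
    using g by (subst nn_integral_distr) auto
  also have "\<dots> = (\<integral>\<^sup>+z. h (sp_act g z) \<partial>siegel_measure)"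
    by (rule nn_integral_cong_AE, use AE_siegel_space in eventually_elim) (simp add: sp_act0_def)
  finally show ?thesis by simp
qed

lemma integral_siegel_sp_act:
  fixes h :: "'n::{finite,linorder} cmat \<Rightarrow> 'b::{banach,second_countable_topology}"
  assumes g: "g \<in> Sp_real" and [measurable]: "h \<in> borel_measurable borel"
  shows "integrable siegel_measure (\<lambda>z. h (sp_act0 g z)) \<longleftrightarrow> integrable siegel_measure h"
    and "(LINT z|siegel_measure. h (sp_act0 g z)) = (LINT z|siegel_measure. h z)"
proof -
  have m: "sp_act0 g \<in> siegel_measure \<rightarrow>\<^sub>M borel" using g by simp
  show "integrable siegel_measure (\<lambda>z. h (sp_act0 g z)) \<longleftrightarrow> integrable siegel_measure h"
    using integrable_distr_eq[OF m, of h] unfolding distr_siegel_sp_act[OF g] by simp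
  show "(LINT z|siegel_measure. h (sp_act0 g z)) = (LINT z|siegel_measure. h z)"
    using integral_distr[OF m, of h] unfolding distr_siegel_sp_act[OF g] by simp
qed

section \<open>Evaluation of Hua's integral\<close>

section \<open>One-dimensional integrals\<close>

lemma nn_integral_Gamma_scaled:
  assumes a: "a > 0" and c: "c > 0"
  shows "(\<integral>\<^sup>+t. ennreal (indicator {0..} t * (t powr (a - 1) * exp (- (c * t)))) \<partial>lborel)
    = ennreal (Gamma a * c powr (- a))"
proof -
  have "ennreal (Gamma a) = (\<integral>\<^sup>+t. ennreal (indicator {0..} t * t powr (a - 1) / exp t) \<partial>lborel)"
    by (rule Gamma_conv_nn_integral_real[OF a])
  also have "\<dots> = ennreal \<bar>c\<bar> * (\<integral>\<^sup>+t. ennreal (indicator {0..} (0 + c * t) * (0 + c * t) powr (a - 1) / exp (0 + c * t)) \<partial>lborel)"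
    using c by (intro nn_integral_real_affine) auto
  also have "(\<integral>\<^sup>+t. ennreal (indicator {0..} (0 + c * t) * (0 + c * t) powr (a - 1) / exp (0 + c * t)) \<partial>lborel)
     = (\<integral>\<^sup>+t. ennreal (c powr (a - 1)) * ennreal (indicator {0..} t * (t powr (a - 1) * exp (- (c * t)))) \<partial>lborel)"
    using c by (intro nn_integral_cong)
      (auto simp: indicator_def zero_le_mult_iff powr_mult exp_minus field_simps simp flip: ennreal_mult')
  also have "\<dots> = ennreal (c powr (a - 1)) * (\<integral>\<^sup>+t. ennreal (indicator {0..} t * (t powr (a - 1) * exp (- (c * t)))) \<partial>lborel)"
    by (rule nn_integral_cmult) measurable
  also have "ennreal \<bar>c\<bar> * (ennreal (c powr (a - 1)) * (\<integral>\<^sup>+t. ennreal (indicator {0..} t * (t powr (a - 1) * exp (- (c * t)))) \<partial>lborel))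
      = ennreal (\<bar>c\<bar> * c powr (a - 1)) * (\<integral>\<^sup>+t. ennreal (indicator {0..} t * (t powr (a - 1) * exp (- (c * t)))) \<partial>lborel)"
    by (simp only: mult.assoc[symmetric] ennreal_mult'[OF abs_ge_zero, symmetric])
  also have "\<bar>c\<bar> * c powr (a - 1) = c powr a"
    using c by (simp add: powr_diff)
  finally have *: "ennreal (Gamma a) = ennreal (c powr a) * (\<integral>\<^sup>+t. ennreal (indicator {0..} t * (t powr (a - 1) * exp (- (c * t)))) \<partial>lborel)" .
  have "ennreal (c powr (- a)) * ennreal (Gamma a) =
      ennreal (c powr (- a)) * ennreal (c powr a) * (\<integral>\<^sup>+t. ennreal (indicator {0..} t * (t powr (a - 1) * exp (- (c * t)))) \<partial>lborel)"
    unfolding * by (simp only: mult.assoc)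
  also have "ennreal (c powr (- a)) * ennreal (c powr a) = 1"
    using c by (simp add: ennreal_mult'[symmetric] powr_add[symmetric])
  finally show ?thesis using Gamma_real_pos[OF a] by (simp add: ennreal_mult mult.commute)
qed

text \<open>A negative power becomes a Laplace integral, which turns a power of a sum into a product
  of exponentials. Tonelli then reduces the integrals over the line and the half-line to Gaussian
  and Gamma integrals.\<close>

lemma powr_neg_eq_Gamma_integral:
  assumes a: "a > 0" and c: "c > 0"
  shows "ennreal (c powr (- a)) =
    ennreal (1 / Gamma a) * (\<integral>\<^sup>+t. ennreal (indicator {0..} t * (t powr (a - 1) * exp (- (c * t)))) \<partial>lborel)"
  unfolding nn_integral_Gamma_scaled[OF assms]
  using Gamma_real_pos[OF a] by (simp add: ennreal_mult'[symmetric])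

lemma nn_integral_gaussian:
  assumes t: "t > 0"
  shows "(\<integral>\<^sup>+v. ennreal (exp (- (t * (v + l)\<^sup>2))) \<partial>lborel) = ennreal (sqrt pi * t powr (- 1 / 2))"
proof -
  define \<sigma> where "\<sigma> = sqrt (1 / (2 * t))"
  have s: "\<sigma> > 0" "\<sigma>\<^sup>2 = 1 / (2 * t)" using t by (auto simp: \<sigma>_def)
  have d: "exp (- (t * (v + l)\<^sup>2)) = sqrt (pi / t) * normal_density (- l) \<sigma> v" for v
    unfolding normal_density_def s(2) using t by (simp add: field_simps)
  have "(\<integral>\<^sup>+v. ennreal (normal_density (- l) \<sigma> v) \<partial>lborel) = 1"
    by (subst nn_integral_eq_integral) (auto simp: s(1))
  then have "(\<integral>\<^sup>+v. ennreal (exp (- (t * (v + l)\<^sup>2))) \<partial>lborel) = ennreal (sqrt (pi / t))"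
    unfolding d using t by (simp add: ennreal_mult nn_integral_cmult)
  also have "sqrt (pi / t) = sqrt pi * t powr (- 1 / 2)"
    using t by (simp add: real_sqrt_divide powr_minus_divide powr_half_sqrt)
  finally show ?thesis .
qed

text \<open>The integral of (1 + v^2)^(-a) over the real line.\<close>

definition line_const :: "real \<Rightarrow> real" where
  "line_const a = sqrt pi * Gamma (a - 1 / 2) / Gamma a"

lemma line_const_pos: "a > 1 / 2 \<Longrightarrow> line_const a > 0"
  by (simp add: line_const_def Gamma_real_pos)

lemma nn_integral_line:
  assumes a: "a > 1 / 2" and K: "K > 0" and \<kappa>: "\<kappa> > 0"
  shows "(\<integral>\<^sup>+v. ennreal ((K + \<kappa> * (v + l)\<^sup>2) powr (- a)) \<partial>lborel)
    = ennreal (line_const a * K powr (1 / 2 - a) * \<kappa> powr (- 1 / 2))"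
proof -
  let ?f = "\<lambda>t v. ennreal (indicator {0..} t * (t powr (a - 1) * exp (- ((K + \<kappa> * (v + l)\<^sup>2) * t))))"
  have a0: "a > 0" using a by simp
  have pos: "K + \<kappa> * (v + l)\<^sup>2 > 0" for v using K \<kappa> by (simp add: add_pos_nonneg)
  have "(\<integral>\<^sup>+v. ennreal ((K + \<kappa> * (v + l)\<^sup>2) powr (- a)) \<partial>lborel) =
      (\<integral>\<^sup>+v. ennreal (1 / Gamma a) * (\<integral>\<^sup>+t. ?f t v \<partial>lborel) \<partial>lborel)"
    by (simp only: powr_neg_eq_Gamma_integral[OF a0 pos])
  also have "\<dots> = ennreal (1 / Gamma a) * (\<integral>\<^sup>+v. (\<integral>\<^sup>+t. ?f t v \<partial>lborel) \<partial>lborel)"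
    by (rule nn_integral_cmult) measurable
  also have "(\<integral>\<^sup>+v. (\<integral>\<^sup>+t. ?f t v \<partial>lborel) \<partial>lborel) = (\<integral>\<^sup>+t. (\<integral>\<^sup>+v. ?f t v \<partial>lborel) \<partial>lborel)"
    by (rule lborel_pair.Fubini') measurable
  also have "\<dots> = (\<integral>\<^sup>+t. ennreal (sqrt pi * \<kappa> powr (- 1 / 2)) *
      ennreal (indicator {0..} t * (t powr (a - 1 / 2 - 1) * exp (- (K * t)))) \<partial>lborel)"
  proof (rule nn_integral_cong)
    fix t :: real
    show "(\<integral>\<^sup>+v. ?f t v \<partial>lborel) = ennreal (sqrt pi * \<kappa> powr (- 1 / 2)) *
      ennreal (indicator {0..} t * (t powr (a - 1 / 2 - 1) * exp (- (K * t))))"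
    proof (cases "t > 0")
      case True
      have "(\<integral>\<^sup>+v. ?f t v \<partial>lborel) =
          (\<integral>\<^sup>+v. ennreal (t powr (a - 1) * exp (- (K * t))) * ennreal (exp (- (t * \<kappa> * (v + l)\<^sup>2))) \<partial>lborel)"
        using True by (intro nn_integral_cong)
          (simp add: ennreal_mult'[symmetric] exp_add[symmetric] algebra_simps)
      also have "\<dots> = ennreal (t powr (a - 1) * exp (- (K * t))) * (\<integral>\<^sup>+v. ennreal (exp (- (t * \<kappa> * (v + l)\<^sup>2))) \<partial>lborel)"
        by (rule nn_integral_cmult) measurable
      also have "(\<integral>\<^sup>+v. ennreal (exp (- (t * \<kappa> * (v + l)\<^sup>2))) \<partial>lborel) = ennreal (sqrt pi * (t * \<kappa>) powr (- 1 / 2))"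
        using True \<kappa> by (intro nn_integral_gaussian) simp
      also have "ennreal (t powr (a - 1) * exp (- (K * t))) * ennreal (sqrt pi * (t * \<kappa>) powr (- 1 / 2)) =
          ennreal (sqrt pi * \<kappa> powr (- 1 / 2)) * ennreal (t powr (a - 1) * t powr (- 1 / 2) * exp (- (K * t)))"
        using True \<kappa> by (simp add: ennreal_mult'[symmetric] powr_mult mult_ac)
      also have "t powr (a - 1) * t powr (- 1 / 2) = t powr (a - 1 / 2 - 1)"
        by (simp add: powr_add[symmetric])
      finally show ?thesis using True by simp
    next
      \<comment> \<open>At t = 0 both integrands vanish because \<open>0 powr _\<close> is 0, and
        below 0 because of the indicator.\<close>
      case False then show ?thesis by (cases "t = 0") auto
    qed
  qed
  also have "\<dots> = ennreal (sqrt pi * \<kappa> powr (- 1 / 2)) * (\<integral>\<^sup>+t. ennreal (indicator {0..} t * (t powr (a - 1 / 2 - 1) * exp (- (K * t)))) \<partial>lborel)"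
    by (rule nn_integral_cmult) measurable
  also have "\<dots> = ennreal (sqrt pi * \<kappa> powr (- 1 / 2)) * ennreal (Gamma (a - 1 / 2) * K powr (- (a - 1 / 2)))"
    using a K by (subst nn_integral_Gamma_scaled) auto
  also have "ennreal (1 / Gamma a) * \<dots> = ennreal (line_const a * K powr (1 / 2 - a) * \<kappa> powr (- 1 / 2))"
    using Gamma_real_pos[OF a0] Gamma_real_pos[of "a - 1 / 2"] a
    by (simp add: ennreal_mult'[symmetric] line_const_def mult_ac)
  finally show ?thesis .
qed

text \<open>Euler's Beta integral on the half-line, with p scaled in. After inserting the Laplace
  integral for (v + p)^(-(x+y)), the inner integral over v and then the one over t are both of Gamma
  type.\<close>

lemma nn_integral_half_line:
  assumes x: "x > 0" and y: "y > 0" and p: "p > 0"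
  shows "(\<integral>\<^sup>+v. ennreal (indicator {0..} v * (v powr (x - 1) * (v + p) powr (- (x + y)))) \<partial>lborel)
    = ennreal (Beta x y * p powr (- y))"
proof -
  let ?f = "\<lambda>t v. ennreal (indicator {0..} v * v powr (x - 1)) * ennreal (indicator {0..} t * (t powr (x + y - 1) * exp (- ((v + p) * t))))"
  have xy: "x + y > 0" using x y by simp
  have "(\<integral>\<^sup>+v. ennreal (indicator {0..} v * (v powr (x - 1) * (v + p) powr (- (x + y)))) \<partial>lborel) =
      (\<integral>\<^sup>+v. ennreal (1 / Gamma (x + y)) * (\<integral>\<^sup>+t. ?f t v \<partial>lborel) \<partial>lborel)"
  proof (rule nn_integral_cong)
    fix v :: real
    show "ennreal (indicator {0..} v * (v powr (x - 1) * (v + p) powr (- (x + y)))) =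
        ennreal (1 / Gamma (x + y)) * (\<integral>\<^sup>+t. ?f t v \<partial>lborel)"
    proof (cases "v \<ge> 0")
      case True
      then have "v + p > 0" using p by simp
      then have "ennreal (indicator {0..} v * v powr (x - 1)) * ennreal ((v + p) powr (- (x + y))) =
        ennreal (indicator {0..} v * v powr (x - 1)) *
          (ennreal (1 / Gamma (x + y)) * (\<integral>\<^sup>+t. ennreal (indicator {0..} t * (t powr (x + y - 1) * exp (- ((v + p) * t)))) \<partial>lborel))"
        by (simp only: powr_neg_eq_Gamma_integral[OF xy])
      moreover have "(\<integral>\<^sup>+t. ?f t v \<partial>lborel) = ennreal (indicator {0..} v * v powr (x - 1)) *
          (\<integral>\<^sup>+t. ennreal (indicator {0..} t * (t powr (x + y - 1) * exp (- ((v + p) * t)))) \<partial>lborel)"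
        by (rule nn_integral_cmult) measurable
      moreover have "ennreal (indicator {0..} v * (v powr (x - 1) * (v + p) powr (- (x + y)))) =
          ennreal (indicator {0..} v * v powr (x - 1)) * ennreal ((v + p) powr (- (x + y)))"
        by (simp add: ennreal_mult'[symmetric] mult.assoc)
      ultimately show ?thesis by (simp only: mult.left_commute)
    qed simp
  qed
  also have "\<dots> = ennreal (1 / Gamma (x + y)) * (\<integral>\<^sup>+v. (\<integral>\<^sup>+t. ?f t v \<partial>lborel) \<partial>lborel)"
    by (rule nn_integral_cmult) measurable
  also have "(\<integral>\<^sup>+v. (\<integral>\<^sup>+t. ?f t v \<partial>lborel) \<partial>lborel) = (\<integral>\<^sup>+t. (\<integral>\<^sup>+v. ?f t v \<partial>lborel) \<partial>lborel)"
    by (rule lborel_pair.Fubini') measurable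
  also have "\<dots> = (\<integral>\<^sup>+t. ennreal (Gamma x) * ennreal (indicator {0..} t * (t powr (y - 1) * exp (- (p * t)))) \<partial>lborel)"
  proof (rule nn_integral_cong)
    fix t :: real
    show "(\<integral>\<^sup>+v. ?f t v \<partial>lborel) = ennreal (Gamma x) * ennreal (indicator {0..} t * (t powr (y - 1) * exp (- (p * t))))"
    proof (cases "t > 0")
      case True
      have "(\<integral>\<^sup>+v. ?f t v \<partial>lborel) =
          (\<integral>\<^sup>+v. ennreal (t powr (x + y - 1) * exp (- (p * t))) * ennreal (indicator {0..} v * (v powr (x - 1) * exp (- (t * v)))) \<partial>lborel)"
        using True by (intro nn_integral_cong)
          (auto simp: ennreal_mult'[symmetric] exp_add[symmetric] algebra_simps indicator_def)
      also have "\<dots> = ennreal (t powr (x + y - 1) * exp (- (p * t))) * (\<integral>\<^sup>+v. ennreal (indicator {0..} v * (v powr (x - 1) * exp (- (t * v)))) \<partial>lborel)"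
        by (rule nn_integral_cmult) measurable
      also have "\<dots> = ennreal (t powr (x + y - 1) * exp (- (p * t))) * ennreal (Gamma x * t powr (- x))"
        by (simp only: nn_integral_Gamma_scaled[OF x True])
      also have "\<dots> = ennreal (Gamma x) * ennreal (t powr (x + y - 1) * t powr (- x) * exp (- (p * t)))"
        using Gamma_real_pos[OF x] by (simp add: ennreal_mult'[symmetric] mult_ac)
      also have "t powr (x + y - 1) * t powr (- x) = t powr (y - 1)"
        by (simp add: powr_add[symmetric])
      finally show ?thesis using True by simp
    next
      case False then show ?thesis by (cases "t = 0") auto
    qed
  qed
  also have "\<dots> = ennreal (Gamma x) * (\<integral>\<^sup>+t. ennreal (indicator {0..} t * (t powr (y - 1) * exp (- (p * t)))) \<partial>lborel)"
    by (rule nn_integral_cmult) measurable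
  also have "\<dots> = ennreal (Gamma x) * ennreal (Gamma y * p powr (- y))"
    by (simp only: nn_integral_Gamma_scaled[OF y p])
  also have "ennreal (1 / Gamma (x + y)) * \<dots> = ennreal (Beta x y * p powr (- y))"
    using Gamma_real_pos[OF xy] Gamma_real_pos[OF x] Gamma_real_pos[OF y]
    by (simp add: ennreal_mult'[symmetric] Beta_def mult_ac)
  finally show ?thesis .
qed

section \<open>Schur complements\<close>

text \<open>The Schur complement of the entry \<open>(b, b)\<close>, with the row and column \<open>b\<close> refilled by \<open>c\<close> on the
  diagonal. Matrices of smaller size are represented by matrices that agree with a multiple of the
  identity outside an index set.\<close>

definition schur :: "'a::field \<Rightarrow> 'n \<Rightarrow> 'a^'n^'n \<Rightarrow> 'a^'n^'n" where
  "schur c b M = (\<chi> i j. if i = b \<or> j = b then (if i = j then c else 0)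
     else M $ i $ j - M $ i $ b * M $ b $ j / M $ b $ b)"

definition pivot_vec :: "'a::field^'n^'n \<Rightarrow> 'n \<Rightarrow> 'a^'n" where
  "pivot_vec M b = (\<chi> i. if i = b then 0 else M $ i $ b / M $ b $ b)"

lemma schur_decomp:
  fixes M :: "'a::field^'n^'n"
  assumes nz: "M $ b $ b \<noteq> 0"
  shows "M = col_elem (pivot_vec M b) b ** schur (M $ b $ b) b M **
    transpose (col_elem (pivot_vec (transpose M) b) b)"
proof -
  have "M $ i $ j = (col_elem (pivot_vec M b) b ** schur (M $ b $ b) b M **
    transpose (col_elem (pivot_vec (transpose M) b) b)) $ i $ j" for i j
    unfolding transpose_col_elem_mult_right col_elem_mult_left
    using nz by (auto simp: schur_def pivot_vec_def transpose_def)
  then show ?thesis unfolding vec_eq_iff by blast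
qed

text \<open>The filler c scales a single row, so it is free: 1 is the choice for real positive
  definite matrices, \<i> for matrices x + i y whose imaginary part is padded by the
  identity.\<close>

lemma det_schur:
  fixes M :: "'a::field^'n^'n"
  assumes "M $ b $ b \<noteq> 0"
  shows "c * det M = M $ b $ b * det (schur c b M)"
proof -
  have "det M = det (schur (M $ b $ b) b M)"
    by (subst schur_decomp[OF assms]) (simp add: det_mul det_col_elem pivot_vec_def)
  moreover have sc: "schur e b M = diag_mat (\<lambda>i. if i = b then e else 1) ** schur 1 b M" for e
    by (simp add: vec_eq_iff diag_mat_mult_left) (auto simp: schur_def)
  moreover have "det (schur e b M) = e * det (schur 1 b M)" for e
    by (subst sc) (simp add: det_mul det_diag_mat)
  ultimately show ?thesis by (metis mult.left_commute)
qed

text \<open>Completing the square in the coordinate b. The summand t makes the dependence on that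
  coordinate explicit, since it is the variable that will be integrated out.\<close>

lemma quadratic_schur:
  fixes M :: "real^'n^'n"
  assumes nz: "M $ b $ b \<noteq> 0" and sym: "transpose M = M"
  shows "(u + t *\<^sub>R axis b 1) \<bullet> (M *v (u + t *\<^sub>R axis b 1)) =
    M $ b $ b * (u $ b + t + pivot_vec M b \<bullet> u)\<^sup>2 + (u - (u $ b) *\<^sub>R axis b 1) \<bullet> (schur c b M *v (u - (u $ b) *\<^sub>R axis b 1))"
proof -
  define e :: "real^'n" where "e = axis b 1"
  have eb: "e $ b = 1" and ie: "x \<bullet> e = x $ b" "e \<bullet> x = x $ b" for x
    by (simp_all add: e_def inner_axis inner_axis')
  define w where "w = pivot_vec M b"
  define u' where "u' = u - (u $ b) *\<^sub>R e"
  define x where "x = u + t *\<^sub>R e"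
  define S where "S = schur (M $ b $ b) b M"
  have dec: "M = col_elem w b ** S ** transpose (col_elem w b)"
    using schur_decomp[OF nz] by (simp add: sym w_def S_def)
  have Etx: "transpose (col_elem w b) *v x = u' + (u $ b + t + w \<bullet> u) *\<^sub>R e"
  proof -
    have "(transpose (col_elem w b) *v x) $ i = x $ i + (if i = b then w \<bullet> x else 0)" for i
      by (simp add: matrix_vector_mult_def transpose_def col_elem_def inner_vec_def algebra_simps sum.distrib
          if_distrib[of "\<lambda>x. x * _"] if_distrib[of "\<lambda>x. _ * x"] cong: if_cong) 
    moreover have "w \<bullet> e = 0" by (simp add: w_def e_def inner_axis pivot_vec_def)
    ultimately show ?thesis
      by (simp add: vec_eq_iff x_def u'_def inner_add_right) (simp add: e_def axis_def)
  qed
  have "(S *v e) $ i = S $ i $ b" for i by (simp add: e_def matrix_mult_axis)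
  then have Se: "S *v e = (M $ b $ b) *\<^sub>R e"
    by (simp add: vec_eq_iff) (simp add: e_def S_def schur_def axis_def)
  have u'b: "u' $ b = 0" by (simp add: u'_def e_def axis_def)
  have Su'b: "(S *v u') $ b = 0"
    unfolding matrix_vector_mult_def S_def schur_def by (simp add: if_distrib[of "\<lambda>x. x * _"] u'b cong: if_cong)
  have Su: "S *v u' = schur c b M *v u'"
  proof -
    have "S $ i $ j * u' $ j = schur c b M $ i $ j * u' $ j" for i j
      using u'b by (auto simp: S_def schur_def)
    then show ?thesis by (simp only: matrix_vector_mult_def)
  qed
  have "x \<bullet> (M *v x) = (transpose (col_elem w b) *v x) \<bullet> (S *v (transpose (col_elem w b) *v x))"
  proof -
    have adj: "(transpose A *v x) \<bullet> y = x \<bullet> (A *v y)" for A :: "real^'n^'n" and x y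
      by (simp add: dot_lmul_matrix)
    show ?thesis
      unfolding adj by (subst dec) (simp only: matrix_vector_mul_assoc matrix_mul_assoc)
  qed
  also have "\<dots> = M $ b $ b * (u $ b + t + w \<bullet> u)\<^sup>2 + u' \<bullet> (S *v u')"
    unfolding Etx using u'b Su'b
    by (simp add: matrix_vector_right_distrib matrix_vector_mult_scaleR Se inner_add_left inner_add_right power2_eq_square)
       (simp add: ie eb algebra_simps)
  finally show ?thesis by (simp add: x_def u'_def e_def w_def Su[unfolded u'_def e_def])
qed

lemma pos_def_diag_pos: "pos_def_mat M \<Longrightarrow> 0 < M $ b $ b"
proof -
  assume "pos_def_mat M"
  then have "0 < axis b 1 \<bullet> (M *v axis b 1)" by (simp add: pos_def_mat_def)
  then show ?thesis by (simp add: inner_axis' matrix_mult_axis)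
qed

lemma transpose_schur: "transpose M = M \<Longrightarrow> transpose (schur c b M) = schur c b M"
proof -
  assume "transpose M = M"
  then have "M $ i $ j = M $ j $ i" for i j by (metis transpose_def vec_lambda_beta)
  then show ?thesis by (auto simp: vec_eq_iff transpose_def schur_def)
qed

lemma schur_quadratic_corner:
  fixes M :: "real^'n^'n"
  shows "v \<bullet> (schur c b M *v v) = c * (v $ b)\<^sup>2 +
    (v - (v $ b) *\<^sub>R axis b 1) \<bullet> (schur c b M *v (v - (v $ b) *\<^sub>R axis b 1))"
proof -
  define e :: "real^'n" where "e = axis b 1"
  have eb: "e $ b = 1" and ie: "x \<bullet> e = x $ b" "e \<bullet> x = x $ b" for x
    by (simp_all add: e_def inner_axis inner_axis')
  define u where "u = v - (v $ b) *\<^sub>R e"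
  have v: "v = u + (v $ b) *\<^sub>R e" by (simp add: u_def)
  have ub: "u $ b = 0" by (simp add: u_def e_def axis_def)
  have "(schur c b M *v e) $ i = schur c b M $ i $ b" for i by (simp add: e_def matrix_mult_axis)
  then have Se: "schur c b M *v e = c *\<^sub>R e"
    by (simp add: vec_eq_iff) (simp add: e_def schur_def axis_def)
  have Sub: "(schur c b M *v u) $ b = 0"
    unfolding matrix_vector_mult_def schur_def by (simp add: if_distrib[of "\<lambda>x. x * _"] ub cong: if_cong)
  have "v \<bullet> (schur c b M *v v) = (u + (v $ b) *\<^sub>R e) \<bullet> (schur c b M *v (u + (v $ b) *\<^sub>R e))"
    by (simp only: v[symmetric])
  also have "\<dots> = c * (v $ b)\<^sup>2 + u \<bullet> (schur c b M *v u)"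
    using ub Sub
    by (simp add: matrix_vector_right_distrib matrix_vector_mult_scaleR Se inner_add_left inner_add_right power2_eq_square)
       (simp add: ie eb algebra_simps)
  finally show ?thesis by (simp add: u_def e_def)
qed

lemma pos_def_schur_iff:
  fixes M :: "real^'n^'n"
  assumes sym: "transpose M = M"
  shows "pos_def_mat M \<longleftrightarrow> 0 < M $ b $ b \<and> pos_def_mat (schur 1 b M)"
proof
  assume M: "pos_def_mat M"
  then have p: "0 < M $ b $ b" by (rule pos_def_diag_pos)
  have "0 < v \<bullet> (schur 1 b M *v v)" if "v \<noteq> 0" for v
  proof -
    define u where "u = v - (v $ b) *\<^sub>R axis b 1"
    have ub: "u $ b = 0" by (simp add: u_def axis_def)
    \<comment> \<open>The value of the coordinate b at which the square vanishes, so that M takes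
      the value of the Schur form.\<close>
    define t where "t = - (pivot_vec M b \<bullet> u)"
    have "(u + t *\<^sub>R axis b 1) \<bullet> (M *v (u + t *\<^sub>R axis b 1)) = u \<bullet> (schur 1 b M *v u)"
      using quadratic_schur[of M b u t 1] p sym ub by (simp add: t_def)
    moreover have "u + t *\<^sub>R axis b 1 \<noteq> 0" if "u \<noteq> 0"
    proof
      assume 0: "u + t *\<^sub>R axis b 1 = 0"
      have "u $ i = 0" for i using arg_cong[OF 0, of "\<lambda>x. x $ i"] ub by (cases "i = b") (auto simp: axis_def)
      with that show False by (simp add: vec_eq_iff)
    qed
    ultimately have q: "u \<noteq> 0 \<Longrightarrow> 0 < u \<bullet> (schur 1 b M *v u)"
      using M by (metis pos_def_mat_def)
    have "v \<bullet> (schur 1 b M *v v) = (v $ b)\<^sup>2 + u \<bullet> (schur 1 b M *v u)"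
      unfolding schur_quadratic_corner[of v] u_def by simp
    moreover have "u \<noteq> 0 \<or> v $ b \<noteq> 0" using that by (auto simp: u_def)
    ultimately show ?thesis using q by (cases "u = 0") (auto intro: add_nonneg_pos)
  qed
  with p show "0 < M $ b $ b \<and> pos_def_mat (schur 1 b M)"
    by (simp add: pos_def_mat_def transpose_schur sym)
next
  assume *: "0 < M $ b $ b \<and> pos_def_mat (schur 1 b M)"
  have "0 < v \<bullet> (M *v v)" if "v \<noteq> 0" for v
  proof -
    define u where "u = v - (v $ b) *\<^sub>R axis b 1"
    have eq: "v \<bullet> (M *v v) = M $ b $ b * (v $ b + pivot_vec M b \<bullet> v)\<^sup>2 + u \<bullet> (schur 1 b M *v u)"
      using quadratic_schur[of M b v 0 1] * sym by (simp add: u_def)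
    show ?thesis
    proof (cases "u = 0")
      case False
      then show ?thesis unfolding eq using * by (intro add_nonneg_pos) (auto simp: pos_def_mat_def)
    next
      case True
      then have v: "v = (v $ b) *\<^sub>R axis b 1" by (simp add: u_def)
      then have vb: "v $ b \<noteq> 0" using that by auto
      have "pivot_vec M b \<bullet> v = 0"
        by (subst v) (simp add: inner_axis pivot_vec_def)
      then show ?thesis unfolding eq using True * vb by simp
    qed
  qed
  then show "pos_def_mat M" using sym by (simp add: pos_def_mat_def)
qed

lemma det_pos_if_pos_def:
  fixes y :: "real^'n::finite^'n"
  assumes "pos_def_mat y" shows "0 < det y"
proof -
  define z :: "'n cmat" where "z = map_matrix (\<lambda>t. \<i> * complex_of_real t) y"
  have y: "map_matrix Im z = y" by (simp add: vec_eq_iff z_def)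
  have "transpose z = z"
    using assms by (simp add: pos_def_mat_def vec_eq_iff z_def transpose_def)
  then have "z \<in> siegel_space" using assms by (simp add: siegel_space_def y)
  from det_Im_pos[OF this] show ?thesis by (simp add: y)
qed

section \<open>Integrals over symmetric matrices\<close>

interpretation real_prod: product_sigma_finite "\<lambda>_. lborel :: real measure" ..

lemma nn_integral_lborel_shift:
  fixes d :: real
  assumes [measurable]: "f \<in> borel_measurable borel"
  shows "(\<integral>\<^sup>+x. f (x + d) \<partial>lborel) = (\<integral>\<^sup>+x. f x \<partial>lborel)"
  using nn_integral_real_affine[OF assms, of 1 d] by (simp add: add.commute)

lemma nn_integral_PiM_shift:
  fixes d :: "'i \<Rightarrow> real"
  assumes "finite I" "F \<in> borel_measurable (PiM I (\<lambda>_. lborel))"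
  shows "(\<integral>\<^sup>+c. F (\<lambda>i\<in>I. c i + d i) \<partial>PiM I (\<lambda>_. lborel)) = (\<integral>\<^sup>+c. F c \<partial>PiM I (\<lambda>_. lborel))"
  using assms
proof (induction I arbitrary: F rule: finite_induct)
  case empty
  show ?case by (simp only: real_prod.nn_integral_empty zero_le) (simp add: restrict_def)
next
  case (insert i I)
  let ?P = "\<lambda>I. PiM I (\<lambda>_::'i. lborel :: real measure)"
  have m [measurable]: "(\<lambda>c. \<lambda>i\<in>J. c i + d i) \<in> ?P J \<rightarrow>\<^sub>M ?P J" for J
    by (rule measurable_restrict) simp
  have Fm: "F \<in> borel_measurable (?P (insert i I))" using insert.prems .
  have upd: "(\<lambda>x. f (x(i := y))) \<in> borel_measurable (?P I)" if "f \<in> borel_measurable (?P (insert i I))" for f y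
    by (rule measurable_compose[OF _ that]) (intro measurable_fun_upd[where J = I], auto)
  have eq: "(\<lambda>j\<in>insert i I. (x(i := y)) j + d j) = (\<lambda>j\<in>I. x j + d j)(i := y + d i)" for x y
    using insert.hyps by (auto simp: fun_eq_iff)
  have Fc: "(\<lambda>c. F (\<lambda>j\<in>insert i I. c j + d j)) \<in> borel_measurable (?P (insert i I))"
    by (rule measurable_compose[OF m Fm])
  have "(\<integral>\<^sup>+c. F (\<lambda>j\<in>insert i I. c j + d j) \<partial>?P (insert i I)) =
      (\<integral>\<^sup>+y. (\<integral>\<^sup>+x. F ((\<lambda>j\<in>I. x j + d j)(i := y + d i)) \<partial>?P I) \<partial>lborel)"
    by (subst real_prod.product_nn_integral_insert_rev[OF insert.hyps(1,2) Fc]) (simp only: eq)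
  also have "\<dots> = (\<integral>\<^sup>+y. (\<integral>\<^sup>+x. F (x(i := y + d i)) \<partial>?P I) \<partial>lborel)"
    by (intro nn_integral_cong insert.IH upd Fm)
  also have "\<dots> = (\<integral>\<^sup>+y. (\<integral>\<^sup>+x. F (x(i := y)) \<partial>?P I) \<partial>lborel)"
  proof (rule nn_integral_lborel_shift[where f = "\<lambda>y. \<integral>\<^sup>+x. F (x(i := y)) \<partial>?P I"])
    interpret I: sigma_finite_measure "?P I"
      by (rule real_prod.sigma_finite[OF insert.hyps(1)])
    have "(\<lambda>p. F ((snd p)(i := fst p))) \<in> borel_measurable (lborel \<Otimes>\<^sub>M ?P I)"
      by (rule measurable_compose[OF _ Fm]) (intro measurable_fun_upd[where J = I], auto)
    then show "(\<lambda>y. \<integral>\<^sup>+x. F (x(i := y)) \<partial>?P I) \<in> borel_measurable borel"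
      using I.borel_measurable_nn_integral[of "\<lambda>y x. F (x(i := y))" lborel] by (simp add: case_prod_beta)
  qed
  also have "\<dots> = (\<integral>\<^sup>+c. F c \<partial>?P (insert i I))"
    by (rule real_prod.product_nn_integral_insert_rev[OF insert.hyps(1,2) Fm, symmetric])
  finally show ?case .
qed

text \<open>The map e names the variables: the border of a symmetric matrix consists of variables
  indexed by pairs, which are read here as the entries of a vector.\<close>

definition vec_pad :: "('n \<Rightarrow> 'i) \<Rightarrow> 'n set \<Rightarrow> ('i \<Rightarrow> real) \<Rightarrow> real^'n" where
  "vec_pad e A c = (\<chi> i. if i \<in> A then c (e i) else 0)"

abbreviation (input) PiR :: "'i set \<Rightarrow> ('i \<Rightarrow> real) measure" where
  "PiR I \<equiv> PiM I (\<lambda>_. lborel)"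

lemma vec_pad_measurable [measurable]: "vec_pad e A \<in> borel_measurable (PiR (e ` A))"
proof (intro borel_measurable_vecI)
  fix i show "(\<lambda>x. vec_pad e A x $ i) \<in> borel_measurable (PiR (e ` A))"
    by (cases "i \<in> A") (auto simp: vec_pad_def intro!: measurable_component_singleton)
qed

lemma nn_integral_vec_pad_insert:
  fixes g :: "real^'n \<Rightarrow> ennreal"
  assumes A: "finite A" "b \<notin> A" "inj_on e (insert b A)" and g: "g \<in> borel_measurable borel"
  shows "(\<integral>\<^sup>+c. g (vec_pad e (insert b A) c) \<partial>PiR (e ` insert b A)) =
    (\<integral>\<^sup>+c. (\<integral>\<^sup>+t. g (vec_pad e A c + t *\<^sub>R axis b 1) \<partial>lborel) \<partial>PiR (e ` A))"
proof -
  have eb: "e b \<notin> e ` A" using A by auto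
  have fe: "finite (e ` A)" using A(1) by simp
  have m: "(\<lambda>c. g (vec_pad e (insert b A) c)) \<in> borel_measurable (PiR (insert (e b) (e ` A)))"
    using measurable_compose[OF vec_pad_measurable g, of e "insert b A"] by simp
  have eq: "vec_pad e (insert b A) (c(e b := t)) = vec_pad e A c + t *\<^sub>R axis b 1" for c t
  proof -
    have "e i \<noteq> e b" if "i \<in> A" for i using eb that by (metis imageI)
    then show ?thesis using A(2) by (auto simp: vec_eq_iff vec_pad_def axis_def)
  qed
  show ?thesis
    unfolding image_insert by (subst real_prod.product_nn_integral_insert[OF fe eb m]) (simp only: eq)
qed

lemma nn_integral_vec_pad_shift:
  fixes g :: "real^'n \<Rightarrow> ennreal"
  assumes A: "finite A" "inj_on e A" and g: "g \<in> borel_measurable borel"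
    and d: "\<And>i. i \<notin> A \<Longrightarrow> d $ i = 0"
  shows "(\<integral>\<^sup>+c. g (vec_pad e A c + d) \<partial>PiR (e ` A)) = (\<integral>\<^sup>+c. g (vec_pad e A c) \<partial>PiR (e ` A))"
proof -
  have eq: "vec_pad e A c + d = vec_pad e A (\<lambda>p\<in>e ` A. c p + d $ inv_into A e p)" for c
    using A d by (auto simp: vec_eq_iff vec_pad_def)
  show ?thesis unfolding eq
    by (rule nn_integral_PiM_shift[where F = "\<lambda>c. g (vec_pad e A c)"])
       (use A(1) measurable_compose[OF vec_pad_measurable g] in auto)
qed

definition padded :: "'n set \<Rightarrow> real^'n^'n \<Rightarrow> bool" where
  "padded A M \<longleftrightarrow> (\<forall>i j. i \<notin> A \<or> j \<notin> A \<longrightarrow> M $ i $ j = (if i = j then 1 else 0))"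

lemma padded_empty: "padded {} M \<Longrightarrow> M = mat 1"
  by (simp add: padded_def vec_eq_iff mat_def)

lemma padded_schur: "padded (insert b A) M \<Longrightarrow> padded A (schur 1 b M)"
proof -
  assume M: "padded (insert b A) M"
  have "M $ i $ b = 0" "M $ b $ i = 0" if "i \<notin> A" "i \<noteq> b" for i
    using M that by (auto simp: padded_def)
  with M show ?thesis
    unfolding padded_def by (auto simp: schur_def)
qed

text \<open>The integral of (1 + |v|^2)^(-a) over k-dimensional space.\<close>

definition vec_const :: "nat \<Rightarrow> real \<Rightarrow> real" where
  "vec_const k a = pi powr (real k / 2) * Gamma (a - real k / 2) / Gamma a"

lemma vec_const_pos: "a > real k / 2 \<Longrightarrow> vec_const k a > 0"
  by (simp add: vec_const_def Gamma_real_pos)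

lemma vec_const_0: "a > 0 \<Longrightarrow> vec_const 0 a = 1"
  by (simp add: vec_const_def) (metis Gamma_real_pos less_irrefl)

lemma vec_const_Suc:
  assumes "a > real (Suc k) / 2"
  shows "vec_const (Suc k) a = line_const a * vec_const k (a - 1 / 2)"
proof -
  have "Gamma (a - 1 / 2) > 0" using assms by (intro Gamma_real_pos) auto
  moreover have "pi powr (real (Suc k) / 2) = sqrt pi * pi powr (real k / 2)"
    by (simp add: powr_half_sqrt[symmetric] powr_add[symmetric] add_divide_distrib)
  moreover have g: "a - 1 / 2 - real k / 2 = a - real (Suc k) / 2" by (simp add: add_divide_distrib)
  moreover have "Gamma a > 0" using assms by (intro Gamma_real_pos) auto
  ultimately show ?thesis unfolding vec_const_def line_const_def g by simp
qed

text \<open>After completing the square, integration over one coordinate leaves the same integrand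
  with one dimension less: the Schur complement in place of Q and the exponent a - 1/2.\<close>

lemma nn_integral_quadratic:
  fixes Q :: "real^'n^'n"
  assumes "finite A" "inj_on e A" "pos_def_mat Q" "padded A Q" "K > 0" "\<kappa> > 0" "a > real (card A) / 2"
  shows "(\<integral>\<^sup>+c. ennreal ((K + \<kappa> * (vec_pad e A c \<bullet> (Q *v vec_pad e A c))) powr (- a)) \<partial>PiR (e ` A)) =
    ennreal (vec_const (card A) a * K powr (real (card A) / 2 - a) * \<kappa> powr (- real (card A) / 2) * det Q powr (- 1 / 2))"
  using assms
proof (induction A arbitrary: Q a rule: finite_induct)
  case empty
  then show ?case
    using padded_empty[OF empty(3)]
    by (simp only: real_prod.nn_integral_empty zero_le image_empty) (simp add: vec_pad_def vec_const_0 zero_vec_def[symmetric])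
next
  case (insert b A)
  note hyps = insert.hyps and prems = insert.prems
  let ?k = "real (card A)"
  define S where "S = schur 1 b Q"
  define q where "q = Q $ b $ b"
  have card: "real (card (insert b A)) = ?k + 1" using hyps by simp
  have sym: "transpose Q = Q" using prems(2) by (simp add: pos_def_mat_def)
  have q: "q > 0" and S: "pos_def_mat S" "padded A S"
    using prems(2) pos_def_schur_iff[OF sym, of b] padded_schur[OF prems(3)] by (auto simp: q_def S_def)
  have detQ: "det Q = q * det S" using det_schur[of Q b 1] q by (simp add: q_def S_def)
  have detS: "det S > 0" using S(1) by (rule det_pos_if_pos_def)
  have a: "a > 1 / 2" "a - 1 / 2 > ?k / 2" using prems(6) card by auto
  have Snn: "0 \<le> u \<bullet> (S *v u)" for u
    using S(1) by (cases "u = 0") (auto simp: pos_def_mat_def less_imp_le)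
  have m: "(\<lambda>v. ennreal ((K + \<kappa> * (v \<bullet> (Q *v v))) powr (- a))) \<in> borel_measurable borel"
  proof -
    have [measurable]: "(\<lambda>v. v \<bullet> (Q *v v)) \<in> borel_measurable borel"
      by (intro borel_measurable_continuous_onI continuous_intros)
    show ?thesis by measurable
  qed
  have quad: "(u + t *\<^sub>R axis b 1) \<bullet> (Q *v (u + t *\<^sub>R axis b 1)) = q * (t + pivot_vec Q b \<bullet> u)\<^sup>2 + u \<bullet> (S *v u)"
    if "u $ b = 0" for u t
    using quadratic_schur[of Q b u t 1] q sym that by (simp add: q_def S_def)
  have "(\<integral>\<^sup>+c. ennreal ((K + \<kappa> * (vec_pad e (insert b A) c \<bullet> (Q *v vec_pad e (insert b A) c))) powr (- a)) \<partial>PiR (e ` insert b A))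
    = (\<integral>\<^sup>+c. (\<integral>\<^sup>+t. ennreal ((K + \<kappa> * ((vec_pad e A c + t *\<^sub>R axis b 1) \<bullet> (Q *v (vec_pad e A c + t *\<^sub>R axis b 1)))) powr (- a)) \<partial>lborel) \<partial>PiR (e ` A))"
    by (rule nn_integral_vec_pad_insert[OF hyps(1,2) prems(1) m])
  also have "\<dots> = (\<integral>\<^sup>+c. ennreal (line_const a * (\<kappa> * q) powr (- 1 / 2)) *
      ennreal ((K + \<kappa> * (vec_pad e A c \<bullet> (S *v vec_pad e A c))) powr (- (a - 1 / 2))) \<partial>PiR (e ` A))"
  proof (rule nn_integral_cong)
    fix c
    let ?u = "vec_pad e A c"
    have ub: "?u $ b = 0" using hyps by (simp add: vec_pad_def)
    have K': "K + \<kappa> * (?u \<bullet> (S *v ?u)) > 0" using prems(4,5) Snn by (intro add_pos_nonneg mult_nonneg_nonneg) auto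
    have "(\<integral>\<^sup>+t. ennreal ((K + \<kappa> * ((?u + t *\<^sub>R axis b 1) \<bullet> (Q *v (?u + t *\<^sub>R axis b 1)))) powr (- a)) \<partial>lborel) =
        (\<integral>\<^sup>+t. ennreal (((K + \<kappa> * (?u \<bullet> (S *v ?u))) + (\<kappa> * q) * (t + pivot_vec Q b \<bullet> ?u)\<^sup>2) powr (- a)) \<partial>lborel)"
      unfolding quad[OF ub] by (simp only: distrib_left add_ac mult.assoc)
    also have "\<dots> = ennreal (line_const a * (K + \<kappa> * (?u \<bullet> (S *v ?u))) powr (1 / 2 - a) * (\<kappa> * q) powr (- 1 / 2))"
      using q prems(5) by (intro nn_integral_line a K') simp
    also have "\<dots> = ennreal (line_const a * (\<kappa> * q) powr (- 1 / 2)) * ennreal ((K + \<kappa> * (?u \<bullet> (S *v ?u))) powr (- (a - 1 / 2)))"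
      using line_const_pos[OF a(1)] by (simp add: ennreal_mult'[symmetric] mult_ac)
    finally show "(\<integral>\<^sup>+t. ennreal ((K + \<kappa> * ((?u + t *\<^sub>R axis b 1) \<bullet> (Q *v (?u + t *\<^sub>R axis b 1)))) powr (- a)) \<partial>lborel) =
        ennreal (line_const a * (\<kappa> * q) powr (- 1 / 2)) * ennreal ((K + \<kappa> * (?u \<bullet> (S *v ?u))) powr (- (a - 1 / 2)))" .
  qed
  also have "\<dots> = ennreal (line_const a * (\<kappa> * q) powr (- 1 / 2)) *
      (\<integral>\<^sup>+c. ennreal ((K + \<kappa> * (vec_pad e A c \<bullet> (S *v vec_pad e A c))) powr (- (a - 1 / 2))) \<partial>PiR (e ` A))"
  proof (rule nn_integral_cmult)
    have [measurable]: "(\<lambda>v. v \<bullet> (S *v v)) \<in> borel_measurable borel"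
      by (intro borel_measurable_continuous_onI continuous_intros)
    have "(\<lambda>v. ennreal ((K + \<kappa> * (v \<bullet> (S *v v))) powr (- (a - 1 / 2)))) \<in> borel_measurable borel"
      by measurable
    from measurable_compose[OF vec_pad_measurable this]
    show "(\<lambda>c. ennreal ((K + \<kappa> * (vec_pad e A c \<bullet> (S *v vec_pad e A c))) powr (- (a - 1 / 2)))) \<in> borel_measurable (PiR (e ` A))" .
  qed
  also have "(\<integral>\<^sup>+c. ennreal ((K + \<kappa> * (vec_pad e A c \<bullet> (S *v vec_pad e A c))) powr (- (a - 1 / 2))) \<partial>PiR (e ` A)) =
    ennreal (vec_const (card A) (a - 1 / 2) * K powr (?k / 2 - (a - 1 / 2)) * \<kappa> powr (- ?k / 2) * det S powr (- 1 / 2))"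
    using prems(1) S prems(4,5) a by (intro insert.IH) auto
  also have "ennreal (line_const a * (\<kappa> * q) powr (- 1 / 2)) * \<dots> =
    ennreal (line_const a * (\<kappa> * q) powr (- 1 / 2) * (vec_const (card A) (a - 1 / 2) * K powr (?k / 2 - (a - 1 / 2)) * \<kappa> powr (- ?k / 2) * det S powr (- 1 / 2)))"
    using line_const_pos[OF a(1)] by (intro ennreal_mult'[symmetric]) simp
  also have "line_const a * (\<kappa> * q) powr (- 1 / 2) * (vec_const (card A) (a - 1 / 2) * K powr (?k / 2 - (a - 1 / 2)) * \<kappa> powr (- ?k / 2) * det S powr (- 1 / 2))
    = vec_const (card (insert b A)) a * K powr (real (card (insert b A)) / 2 - a) * \<kappa> powr (- real (card (insert b A)) / 2) * det Q powr (- 1 / 2)"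
  proof -
    have 1: "vec_const (card (insert b A)) a = line_const a * vec_const (card A) (a - 1 / 2)"
      using vec_const_Suc[of "card A" a] prems(6) hyps by simp
    have 2: "\<kappa> powr (- real (card (insert b A)) / 2) = \<kappa> powr (- 1 / 2) * \<kappa> powr (- ?k / 2)"
      unfolding card by (simp add: powr_add[symmetric] field_simps)
    have 3: "real (card (insert b A)) / 2 - a = ?k / 2 - (a - 1 / 2)" unfolding card by (simp add: field_simps)
    show ?thesis
      unfolding 1 2 3 detQ using q detS prems(5) by (simp add: powr_mult mult_ac)
  qed
  finally show ?case .
qed

subsection \<open>Symmetric coordinates indexed by subsets\<close>

definition pairs_on :: "'n::linorder set \<Rightarrow> ('n \<times> 'n) set" where
  "pairs_on A = {(r, s). r \<in> A \<and> s \<in> A \<and> r \<le> s}"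

text \<open>Zero outside A, so that adding a symmetric matrix supported on A is a translation of the
  variables alone; the diagonal padding is supplied by the other summand, \<open>off_id\<close> or a
  padded matrix.\<close>

definition sym_pad :: "'n::{finite,linorder} set \<Rightarrow> ('n \<times> 'n \<Rightarrow> real) \<Rightarrow> ((real, 'n) vec, 'n) vec" where
  "sym_pad A c = (\<chi> r s. if r \<in> A \<and> s \<in> A then (if r \<le> s then c (r, s) else c (s, r)) else 0)"

definition pair_with :: "'n::linorder \<Rightarrow> 'n \<Rightarrow> 'n \<times> 'n" where
  "pair_with b i = (min i b, max i b)"

definition border :: "'n \<Rightarrow> real^'n \<Rightarrow> real \<Rightarrow> real^'n^'n" where
  "border b v t = (\<chi> i j. if i = b then (if j = b then t else v $ j) else if j = b then v $ i else 0)"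

lemma finite_pairs_on: "finite (pairs_on (A :: 'n::{finite,linorder} set))"
  by simp

lemma pairs_on_insert:
  "pairs_on (insert b A) = insert (b, b) (pair_with b ` A \<union> pairs_on A)"
proof (intro subset_antisym subsetI)
  fix p assume "p \<in> pairs_on (insert b A)"
  then obtain r s where p: "p = (r, s)" "r \<in> insert b A" "s \<in> insert b A" "r \<le> s"
    by (auto simp: pairs_on_def)
  have "p = pair_with b s" if "r = b" using p that by (simp add: pair_with_def min_def max_def)
  moreover have "p = pair_with b r" if "s = b" using p that by (simp add: pair_with_def min_def max_def)
  ultimately show "p \<in> insert (b, b) (pair_with b ` A \<union> pairs_on A)"
    using p by (cases "r = b"; cases "s = b") (auto simp: pairs_on_def)
qed (auto simp: pairs_on_def pair_with_def min_def max_def)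

lemma inj_on_pair_with: "inj_on (pair_with b) A"
proof (rule inj_onI)
  fix x y assume "pair_with b x = pair_with b y"
  then have m: "min x b = min y b" "max x b = max y b" by (simp_all add: pair_with_def)
  show "x = y"
    using m by (cases "x \<le> b"; cases "y \<le> b") (auto simp: min_def max_def split: if_splits)
qed

lemma pair_with_disjoint: "b \<notin> A \<Longrightarrow> pair_with b ` A \<inter> pairs_on A = {}"
  by (auto simp: pair_with_def pairs_on_def min_def max_def split: if_splits)

lemma sym_pad_sym: "sym_pad A c $ i $ j = sym_pad A c $ j $ i"
  by (auto simp: sym_pad_def)

lemma sym_pad_upd_measurable:
  assumes "\<And>p. p \<in> pairs_on A \<Longrightarrow> p \<in> I \<or> (\<exists>y. \<forall>x. h x p = y)"
    and "\<And>p x. p \<in> I \<Longrightarrow> p \<in> pairs_on A \<Longrightarrow> h x p = x p \<or> (\<exists>y. \<forall>x. h x p = y)"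
    and h: "\<And>p. p \<in> pairs_on A \<Longrightarrow> (\<lambda>x. h x p) \<in> borel_measurable (PiR I)"
  shows "(\<lambda>x. sym_pad A (h x)) \<in> borel_measurable (PiR I)"
proof (intro borel_measurable_vecI)
  fix r s show "(\<lambda>x. sym_pad A (h x) $ r $ s) \<in> borel_measurable (PiR I)"
    using h[of "(r, s)"] h[of "(s, r)"]
    by (cases "r \<in> A \<and> s \<in> A"; cases "r \<le> s") (auto simp: sym_pad_def pairs_on_def)
qed

lemma sym_pad_measurable [measurable]: "sym_pad A \<in> borel_measurable (PiR (pairs_on A))"
  using sym_pad_upd_measurable[of A "pairs_on A" "\<lambda>x. x"] by (auto intro!: measurable_component_singleton)

text \<open>The new variables form a corner t and a border vector. The old block is integrated
  innermost, where the induction hypothesis applies for fixed border and corner; then the border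
  goes, and a one-dimensional integral remains.\<close>

lemma nn_integral_sym_pad_insert:
  fixes g :: "((real, 'n::{finite,linorder}) vec, 'n) vec \<Rightarrow> ennreal"
  assumes b: "b \<notin> A" and g: "g \<in> borel_measurable borel"
  shows "(\<integral>\<^sup>+c. g (sym_pad (insert b A) c) \<partial>PiR (pairs_on (insert b A))) =
    (\<integral>\<^sup>+t. (\<integral>\<^sup>+u. (\<integral>\<^sup>+x. g (sym_pad A x + border b (vec_pad (pair_with b) A u) t) \<partial>PiR (pairs_on A)) \<partial>PiR (pair_with b ` A)) \<partial>lborel)"
proof -
  let ?I = "pair_with b ` A" and ?J = "pairs_on A"
  have bb: "(b, b) \<notin> ?I \<union> ?J" using b by (auto simp: pairs_on_def pair_with_def min_def max_def split: if_splits)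
  have m: "(\<lambda>c. g (sym_pad (insert b A) c)) \<in> borel_measurable (PiR (insert (b, b) (?I \<union> ?J)))"
    using measurable_compose[OF sym_pad_measurable g, of "insert b A"] by (simp only: pairs_on_insert)
  have m2: "(\<lambda>c. g (sym_pad (insert b A) (c((b, b) := t)))) \<in> borel_measurable (PiR (?I \<union> ?J))" for t
  proof (rule measurable_compose[OF sym_pad_upd_measurable g])
    show "(\<lambda>x. (x((b, b) := t)) p) \<in> borel_measurable (PiR (?I \<union> ?J))" if "p \<in> pairs_on (insert b A)" for p
      using that unfolding pairs_on_insert
      by (cases "p = (b, b)") (auto intro!: measurable_component_singleton)
  qed (auto simp: pairs_on_insert)
  have eq: "sym_pad (insert b A) ((merge ?I ?J (u, x))((b, b) := t)) = sym_pad A x + border b (vec_pad (pair_with b) A u) t"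
    for u x t
  proof -
    have "sym_pad (insert b A) ((merge ?I ?J (u, x))((b, b) := t)) $ i $ j =
        (sym_pad A x + border b (vec_pad (pair_with b) A u) t) $ i $ j" if "i \<le> j" for i j
    proof -
      have A1: "(i, j) = pair_with b j" if "i = b" "j \<noteq> b" using that \<open>i \<le> j\<close> by (auto simp: pair_with_def min_def max_def)
      have A2: "(i, j) = pair_with b i" if "j = b" "i \<noteq> b" using that \<open>i \<le> j\<close> by (auto simp: pair_with_def min_def max_def)
      consider "i = b" "j = b" | "i = b" "j \<noteq> b" "j \<in> A" | "i = b" "j \<notin> A" "j \<noteq> b"
        | "j = b" "i \<noteq> b" "i \<in> A" | "j = b" "i \<notin> A" "i \<noteq> b" | "i \<noteq> b" "j \<noteq> b" "i \<in> A" "j \<in> A" | "i \<noteq> b" "j \<noteq> b" "\<not> (i \<in> A \<and> j \<in> A)"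
        by blast
      then show ?thesis
      proof cases
        case 1 with b show ?thesis by (simp add: sym_pad_def border_def)
      next
        case 2
        then have "(b, j) = pair_with b j" using A1 by simp
        then have "merge ?I ?J (u, x) (b, j) = u (pair_with b j)"
          using 2 by (simp only: merge_def) auto
        with 2 b that show ?thesis by (simp add: sym_pad_def border_def vec_pad_def)
      next
        case 3 with b show ?thesis by (simp add: sym_pad_def border_def vec_pad_def)
      next
        case 4
        then have "(i, b) = pair_with b i" using A2 by simp
        then have "merge ?I ?J (u, x) (i, b) = u (pair_with b i)"
          using 4 by (simp only: merge_def) auto
        with 4 b that show ?thesis by (simp add: sym_pad_def border_def vec_pad_def)
      next
        case 5 with b show ?thesis by (simp add: sym_pad_def border_def vec_pad_def)
      next
        case 6
        then have "(i, j) \<in> ?J" using that by (simp add: pairs_on_def)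
        moreover then have "(i, j) \<notin> ?I" using pair_with_disjoint[OF b] by blast
        ultimately show ?thesis using 6 that by (simp add: sym_pad_def border_def merge_def)
      next
        case 7 then show ?thesis by (auto simp: sym_pad_def border_def)
      qed
    qed
    moreover have "(sym_pad A x + border b (vec_pad (pair_with b) A u) t) $ i $ j = (sym_pad A x + border b (vec_pad (pair_with b) A u) t) $ j $ i" for i j
      by (simp add: border_def sym_pad_sym[of A x i j])
    ultimately have "sym_pad (insert b A) ((merge ?I ?J (u, x))((b, b) := t)) $ i $ j =
        (sym_pad A x + border b (vec_pad (pair_with b) A u) t) $ i $ j" for i j
      by (cases "i \<le> j") (metis linorder_le_cases sym_pad_sym)+
    then show ?thesis unfolding vec_eq_iff by blast
  qed
  have "(\<integral>\<^sup>+c. g (sym_pad (insert b A) c) \<partial>PiR (pairs_on (insert b A))) =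
      (\<integral>\<^sup>+t. (\<integral>\<^sup>+c. g (sym_pad (insert b A) (c((b, b) := t))) \<partial>PiR (?I \<union> ?J)) \<partial>lborel)"
    unfolding pairs_on_insert by (rule real_prod.product_nn_integral_insert_rev[OF _ bb m]) simp
  also have "\<dots> = (\<integral>\<^sup>+t. (\<integral>\<^sup>+u. (\<integral>\<^sup>+x. g (sym_pad (insert b A) ((merge ?I ?J (u, x))((b, b) := t))) \<partial>PiR ?J) \<partial>PiR ?I) \<partial>lborel)"
    by (intro nn_integral_cong real_prod.product_nn_integral_fold[OF pair_with_disjoint[OF b] _ _ m2]) simp_all
  finally show ?thesis by (simp only: eq)
qed

lemma nn_integral_sym_pad_shift:
  fixes g :: "((real, 'n::{finite,linorder}) vec, 'n) vec \<Rightarrow> ennreal"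
  assumes g: "g \<in> borel_measurable borel"
    and T: "\<And>i j. T $ i $ j = T $ j $ i" "\<And>i j. i \<notin> A \<Longrightarrow> T $ i $ j = 0"
  shows "(\<integral>\<^sup>+x. g (sym_pad A x + T) \<partial>PiR (pairs_on A)) = (\<integral>\<^sup>+x. g (sym_pad A x) \<partial>PiR (pairs_on A))"
proof -
  have T2: "T $ i $ j = 0" if "j \<notin> A" for i j using T(1)[of i j] T(2)[OF that] by simp
  have eq: "sym_pad A x + T = sym_pad A (\<lambda>p\<in>pairs_on A. x p + T $ fst p $ snd p)" for x
    using T(2) T2 by (auto simp: vec_eq_iff sym_pad_def pairs_on_def intro: T(1))
  show ?thesis unfolding eq
    by (rule nn_integral_PiM_shift[where F = "\<lambda>c. g (sym_pad A c)"])
       (use finite_pairs_on measurable_compose[OF sym_pad_measurable g] in auto)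
qed

section \<open>Rank-one perturbations\<close>

definition outer :: "'a::comm_ring_1^'m \<Rightarrow> 'a^'n \<Rightarrow> 'a^'n^'m" where
  "outer v w = (\<chi> i j. v $ i * w $ j)"

lemma matrix_mult_outer: "A ** outer v w = outer (A *v v) w"
  by (simp add: vec_eq_iff outer_def matrix_matrix_mult_def matrix_vector_mult_def sum_distrib_right mult.assoc)

lemma outer_mult_matrix: "outer v w ** A = outer v (transpose A *v w)"
  by (simp add: vec_eq_iff outer_def matrix_matrix_mult_def matrix_vector_mult_def transpose_def
      sum_distrib_left mult_ac del: transpose_matrix_vector)

text \<open>Conjugation by E takes the covector w to a multiple of the coordinate covector at b. The
  matrix then differs from the identity in one column only, where Cramer's lemma gives the
  determinant.\<close>

lemma det_1_plus_outer:
  fixes v w :: "'a::field^'n"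
  shows "det (mat 1 + outer v w) = 1 + (\<Sum>i\<in>UNIV. v $ i * w $ i)"
proof (cases "w = 0")
  case True then show ?thesis by (simp add: outer_def zero_vec_def[symmetric])
next
  case False
  then obtain b where b: "w $ b \<noteq> 0" by (auto simp: vec_eq_iff)
  define r where "r = (\<chi> j. if j = b then 0 else w $ j / w $ b)"
  define E where "E = transpose (col_elem r b)"
  define v' where "v' = E *v v"
  have rb: "r $ b = 0" by (simp add: r_def)
  have w: "w = col_elem r b *v (w $ b *s axis b 1)"
    using b by (auto simp: vec_eq_iff matrix_vector_mult_def col_elem_def r_def axis_def algebra_simps
        sum.distrib if_distrib cong: if_cong)
  have "E ** (mat 1 + outer v w) = E + outer v' (col_elem r b *v (w $ b *s axis b 1))"
    by (subst w) (simp add: matrix_add_ldistrib matrix_mult_outer v'_def)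
  also have "\<dots> = (mat 1 + outer v' (w $ b *s axis b 1)) ** E"
    by (simp add: matrix_add_rdistrib' outer_mult_matrix E_def del: transpose_matrix_vector)
  finally have "det (E ** (mat 1 + outer v w)) = det ((mat 1 + outer v' (w $ b *s axis b 1)) ** E)"
    by simp
  then have "det (mat 1 + outer v w) = det (mat 1 + outer v' (w $ b *s axis b 1))"
    by (simp add: det_mul E_def det_col_elem rb)
  also have "mat 1 + outer v' (w $ b *s axis b 1) =
      (\<chi> i j. if j = b then ((mat 1 :: 'a^'n^'n) *v (axis b 1 + w $ b *s v')) $ i else (mat 1 :: 'a^'n^'n) $ i $ j)"
    unfolding matrix_vector_mul_lid by (auto simp: vec_eq_iff outer_def mat_def axis_def)
  also have "det \<dots> = (axis b 1 + w $ b *s v') $ b"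
    by (simp only: cramer_lemma det_I mult_1_right)
  also have "\<dots> = 1 + w $ b * (E *v v) $ b" by (simp add: v'_def axis_def)
  also have "(E *v v) $ b = v $ b + (\<Sum>i\<in>UNIV. r $ i * v $ i)"
    by (simp add: E_def matrix_vector_mult_def transpose_def col_elem_def algebra_simps
        sum.distrib if_distrib[of "\<lambda>x. x * _"] if_distrib[of "\<lambda>x. _ * x"] cong: if_cong del: transpose_matrix_vector)
  also have "w $ b * (v $ b + (\<Sum>i\<in>UNIV. r $ i * v $ i)) = (\<Sum>i\<in>UNIV. v $ i * w $ i)"
  proof -
    have "w $ b * (r $ i * v $ i) = (if i = b then 0 else v $ i * w $ i)" for i
      using b by (simp add: r_def)
    then have "w $ b * (\<Sum>i\<in>UNIV. r $ i * v $ i) = (\<Sum>i\<in>UNIV - {b}. v $ i * w $ i)"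
      by (simp add: sum_distrib_left sum.If_cases Diff_eq Compl_eq)
    then show ?thesis by (simp add: distrib_left sum.remove[of UNIV b] mult.commute)
  qed
  finally show ?thesis .
qed

lemma det_rank_one_update:
  fixes P :: "real^'n^'n"
  assumes "det P \<noteq> 0"
  shows "det (P + \<kappa> *\<^sub>R outer u u) = det P * (1 + \<kappa> * (u \<bullet> (matrix_inv P *v u)))"
proof -
  have inv: "P ** matrix_inv P = mat 1"
    using assms by (intro matrix_inv_right) (simp add: invertible_det_nz)
  have "P ** (mat 1 + outer (matrix_inv P *v (\<kappa> *\<^sub>R u)) u) = P + outer (\<kappa> *\<^sub>R u) u"
    by (simp add: matrix_add_ldistrib matrix_mult_outer matrix_vector_mul_assoc inv)
  also have "outer (\<kappa> *\<^sub>R u) u = \<kappa> *\<^sub>R outer u u"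
    by (simp add: vec_eq_iff outer_def)
  finally have "det (P + \<kappa> *\<^sub>R outer u u) = det P * det (mat 1 + outer (matrix_inv P *v (\<kappa> *\<^sub>R u)) u)"
    by (metis det_mul)
  then show ?thesis
    unfolding det_1_plus_outer
    by (simp add: inner_vec_def matrix_vector_mult_scaleR sum_distrib_left mult_ac)
qed

lemma quadratic_outer:
  fixes u v :: "real^'n"
  shows "v \<bullet> ((\<kappa> *\<^sub>R outer u u) *v v) = \<kappa> * (u \<bullet> v)\<^sup>2"
proof -
  have "outer u u *v v = (u \<bullet> v) *\<^sub>R u"
    by (simp add: vec_eq_iff outer_def matrix_vector_mult_def inner_vec_def sum_distrib_left mult_ac)
  then show ?thesis
    by (simp add: scaleR_matrix_vector_assoc[symmetric] power2_eq_square inner_commute)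
qed

lemma pos_def_rank_one_update:
  assumes P: "pos_def_mat P" and "\<kappa> \<ge> 0"
  shows "pos_def_mat (P + \<kappa> *\<^sub>R outer u u)"
proof -
  have "transpose (P + \<kappa> *\<^sub>R outer u u) = P + \<kappa> *\<^sub>R outer u u"
    using P by (simp add: pos_def_mat_def vec_eq_iff transpose_def outer_def mult_ac)
  moreover have "0 < v \<bullet> ((P + \<kappa> *\<^sub>R outer u u) *v v)" if "v \<noteq> 0" for v
  proof -
    have "0 < v \<bullet> (P *v v)" using P that by (simp add: pos_def_mat_def)
    then show ?thesis
      using \<open>\<kappa> \<ge> 0\<close> by (simp only: matrix_vector_mult_add_rdistrib inner_add_right quadratic_outer)
        (simp add: add_pos_nonneg)
  qed
  ultimately show ?thesis by (simp add: pos_def_mat_def)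
qed

lemma padded_rank_one_update:
  assumes "padded A P" "\<And>i. i \<notin> A \<Longrightarrow> u $ i = 0"
  shows "padded A (P + \<kappa> *\<^sub>R outer u u)"
  using assms unfolding padded_def by (auto simp: outer_def)

lemma pos_def_matrix_inv:
  assumes P: "pos_def_mat P"
  shows "pos_def_mat (matrix_inv P)"
proof -
  have det: "det P \<noteq> 0" using det_pos_if_pos_def[OF P] by simp
  have inv: "P ** matrix_inv P = mat 1" "matrix_inv P ** P = mat 1"
    using det by (auto intro: matrix_inv_right matrix_inv_left simp: invertible_det_nz)
  have sP: "transpose P = P" using P by (simp add: pos_def_mat_def)
  have "transpose (matrix_inv P) ** P = mat 1"
    using arg_cong[OF inv(1), of transpose] by (simp add: matrix_transpose_mul sP)
  then have "transpose (matrix_inv P) ** (P ** matrix_inv P) = matrix_inv P"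
    by (simp add: matrix_mul_assoc)
  then have "transpose (matrix_inv P) = matrix_inv P" by (simp add: inv)
  moreover have "0 < v \<bullet> (matrix_inv P *v v)" if "v \<noteq> 0" for v
  proof -
    define w where "w = matrix_inv P *v v"
    have v: "v = P *v w" by (simp add: w_def matrix_vector_mul_assoc inv)
    then have "w \<noteq> 0" using that by auto
    then have "0 < w \<bullet> (P *v w)" using P by (simp add: pos_def_mat_def)
    then show ?thesis by (simp add: v[symmetric] w_def[symmetric] inner_commute)
  qed
  ultimately show ?thesis by (simp add: pos_def_mat_def)
qed

lemma padded_matrix_inv:
  assumes P: "pos_def_mat P" and pad: "padded A P"
  shows "padded A (matrix_inv P)"
proof -
  have det: "det P \<noteq> 0" using det_pos_if_pos_def[OF P] by simp
  have inv: "matrix_inv P ** P = mat 1"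
    using det by (auto intro: matrix_inv_left simp: invertible_det_nz)
  have sym: "matrix_inv P $ i $ j = matrix_inv P $ j $ i" for i j
  proof -
    have "transpose (matrix_inv P) = matrix_inv P" using pos_def_matrix_inv[OF P] by (simp add: pos_def_mat_def)
    from arg_cong[OF this, of "\<lambda>M. M $ i $ j"] show ?thesis by (simp add: transpose_def)
  qed
  have col: "matrix_inv P $ i $ j = (if i = j then 1 else 0)" if "j \<notin> A" for i j
  proof -
    have "P *v axis j 1 = axis j 1"
      using pad that by (simp add: vec_eq_iff matrix_mult_axis padded_def) (simp add: axis_def)
    then have "matrix_inv P *v axis j 1 = matrix_inv P *v (P *v axis j 1)" by simp
    also have "\<dots> = axis j 1" by (simp add: matrix_vector_mul_assoc inv)
    finally have "(matrix_inv P *v axis j 1) $ i = axis j 1 $ i" by simp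
    then show ?thesis by (simp add: matrix_mult_axis) (simp add: axis_def)
  qed
  have row: "matrix_inv P $ j $ i = (if j = i then 1 else 0)" if "j \<notin> A" for i j
    using col[OF that, of i] sym[of i j] by (simp add: eq_commute)
  show ?thesis unfolding padded_def using col row by blast
qed

lemma det_matrix_inv:
  fixes P :: "real^'n^'n"
  assumes "det P \<noteq> 0" shows "det (matrix_inv P) = inverse (det P)"
proof -
  have "det P * det (matrix_inv P) = 1"
    using assms by (simp add: det_mul[symmetric] matrix_inv_right invertible_det_nz)
  then show ?thesis using assms by (simp add: field_simps)
qed

text \<open>The border integral for both the real and the imaginary part. Translation removes d, and
  the rank-one determinant formula turns the determinant into 1 + \<kappa> times the quadratic form
  of the inverse of P.\<close>

lemma nn_integral_rank_one_update:
  fixes P :: "real^'n^'n"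
  assumes A: "finite A" "inj_on e A" and P: "pos_def_mat P" "padded A P" and \<kappa>: "\<kappa> > 0"
    and a: "a > real (card A) / 2" and d: "\<And>i. i \<notin> A \<Longrightarrow> d $ i = 0"
  shows "(\<integral>\<^sup>+c. ennreal (det (P + \<kappa> *\<^sub>R outer (vec_pad e A c - d) (vec_pad e A c - d)) powr (- a)) \<partial>PiR (e ` A)) =
    ennreal (vec_const (card A) a * \<kappa> powr (- real (card A) / 2) * det P powr (1 / 2 - a))"
proof -
  let ?Q = "matrix_inv P" and ?k = "real (card A)"
  have det: "det P > 0" by (rule det_pos_if_pos_def[OF P(1)])
  have Q: "pos_def_mat ?Q" "padded A ?Q" using P by (auto intro: pos_def_matrix_inv padded_matrix_inv)
  have m: "(\<lambda>v. ennreal (det (P + \<kappa> *\<^sub>R outer v v) powr (- a))) \<in> borel_measurable borel"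
  proof -
    have [measurable]: "(\<lambda>v. det (P + \<kappa> *\<^sub>R outer v v)) \<in> borel_measurable borel"
      unfolding outer_def by (intro borel_measurable_continuous_onI continuous_intros)
    show ?thesis by measurable
  qed
  have Qnn: "0 \<le> u \<bullet> (?Q *v u)" for u
    using Q(1) by (cases "u = 0") (auto simp: pos_def_mat_def less_imp_le)
  have "(\<integral>\<^sup>+c. ennreal (det (P + \<kappa> *\<^sub>R outer (vec_pad e A c - d) (vec_pad e A c - d)) powr (- a)) \<partial>PiR (e ` A)) =
      (\<integral>\<^sup>+c. ennreal (det (P + \<kappa> *\<^sub>R outer (vec_pad e A c) (vec_pad e A c)) powr (- a)) \<partial>PiR (e ` A))"
    using nn_integral_vec_pad_shift[OF A m, of "- d"] d by simp
  also have "\<dots> = (\<integral>\<^sup>+c. ennreal (det P powr (- a)) * ennreal ((1 + \<kappa> * (vec_pad e A c \<bullet> (?Q *v vec_pad e A c))) powr (- a)) \<partial>PiR (e ` A))"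
  proof (rule nn_integral_cong)
    fix c
    let ?u = "vec_pad e A c"
    have "det P \<noteq> 0" "1 + \<kappa> * (?u \<bullet> (?Q *v ?u)) > 0" using det Qnn \<kappa> by (auto intro: add_pos_nonneg)
    then show "ennreal (det (P + \<kappa> *\<^sub>R outer ?u ?u) powr (- a)) =
        ennreal (det P powr (- a)) * ennreal ((1 + \<kappa> * (?u \<bullet> (?Q *v ?u))) powr (- a))"
      using det by (simp add: det_rank_one_update powr_mult ennreal_mult'[symmetric])
  qed
  also have "\<dots> = ennreal (det P powr (- a)) * (\<integral>\<^sup>+c. ennreal ((1 + \<kappa> * (vec_pad e A c \<bullet> (?Q *v vec_pad e A c))) powr (- a)) \<partial>PiR (e ` A))"
  proof (rule nn_integral_cmult)
    have [measurable]: "(\<lambda>v. v \<bullet> (?Q *v v)) \<in> borel_measurable borel"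
      by (intro borel_measurable_continuous_onI continuous_intros)
    have "(\<lambda>v. ennreal ((1 + \<kappa> * (v \<bullet> (?Q *v v))) powr (- a))) \<in> borel_measurable borel"
      by measurable
    from measurable_compose[OF vec_pad_measurable this]
    show "(\<lambda>c. ennreal ((1 + \<kappa> * (vec_pad e A c \<bullet> (?Q *v vec_pad e A c))) powr (- a))) \<in> borel_measurable (PiR (e ` A))" .
  qed
  also have "(\<integral>\<^sup>+c. ennreal ((1 + \<kappa> * (vec_pad e A c \<bullet> (?Q *v vec_pad e A c))) powr (- a)) \<partial>PiR (e ` A)) =
      ennreal (vec_const (card A) a * 1 powr (?k / 2 - a) * \<kappa> powr (- ?k / 2) * det ?Q powr (- 1 / 2))"
    by (rule nn_integral_quadratic[OF A Q _ \<kappa> a]) simp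
  also have "ennreal (det P powr (- a)) * \<dots> =
      ennreal (det P powr (- a) * (vec_const (card A) a * 1 powr (?k / 2 - a) * \<kappa> powr (- ?k / 2) * det ?Q powr (- 1 / 2)))"
    by (rule ennreal_mult'[symmetric]) simp
  also have "det ?Q powr (- 1 / 2) = det P powr (1 / 2)"
    using det by (simp add: det_matrix_inv powr_def ln_inverse)
  also have "det P powr (- a) * (vec_const (card A) a * 1 powr (?k / 2 - a) * \<kappa> powr (- ?k / 2) * det P powr (1 / 2)) =
      vec_const (card A) a * \<kappa> powr (- ?k / 2) * (det P powr (- a) * det P powr (1 / 2))" by simp
  also have "det P powr (- a) * det P powr (1 / 2) = det P powr (1 / 2 - a)"
    by (simp add: powr_add[symmetric])
  finally show ?thesis .
qed

section \<open>The integral over the real part\<close>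

definition cpl :: "real^'n^'n \<Rightarrow> real^'n^'n \<Rightarrow> complex^'n^'n" where
  "cpl x y = (\<chi> i j. Complex (x $ i $ j) (y $ i $ j))"

text \<open>The value of the real-part integral for P = 1. The factor \<open>vec_const\<close> comes
  from the border of size k, the factor \<open>line_const\<close> from the corner.\<close>

fun re_const :: "nat \<Rightarrow> real \<Rightarrow> real" where
  "re_const 0 s = 1"
| "re_const (Suc k) s = re_const k s * vec_const k (2 * s - real (k + 1) / 2) * line_const (s - real k / 2)"

lemma re_const_pos: "s > real k / 2 \<Longrightarrow> re_const k s > 0"
proof (induction k)
  case (Suc k)
  have "vec_const k (2 * s - real (k + 1) / 2) > 0" using Suc.prems by (intro vec_const_pos) (simp add: field_simps)
  moreover have "line_const (s - real k / 2) > 0" using Suc.prems by (intro line_const_pos) auto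
  ultimately show ?case using Suc by simp
qed simp

lemma measurable_cpl_det [measurable]: "(\<lambda>x. cmod (det (cpl x y))) \<in> borel_measurable borel"
proof -
  have c: "continuous_on UNIV (\<lambda>x::real^'n^'n. Complex (x $ i $ j) t)" for i j t
    unfolding Complex_eq by (intro continuous_intros)
  show ?thesis unfolding cpl_def
    by (intro borel_measurable_continuous_onI continuous_intros c)
qed

text \<open>The pivot t + i p comes out of the determinant as a factor. In its Schur complement the
  real part is only translated and the imaginary part changes by a rank-one term in the border, so
  the statement reproduces itself and leaves a border and a corner integral.\<close>

lemma nn_integral_re_part:
  fixes P :: "((real, 'n::{finite,linorder}) vec, 'n) vec"
  assumes "finite A" "pos_def_mat P" "padded A P" "s > real (card A) / 2"
  shows "(\<integral>\<^sup>+c. ennreal (cmod (det (cpl (sym_pad A c) P)) powr (- 2 * s)) \<partial>PiR (pairs_on A)) =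
    ennreal (re_const (card A) s * det P powr (real (card A + 1) / 2 - 2 * s))"
  using assms
proof (induction A arbitrary: P rule: finite_induct)
  case empty
  have P: "P = mat 1" using padded_empty[OF empty(2)] .
  have "cpl (sym_pad {} c) P = diag_mat (\<lambda>_. \<i>)" for c
    by (simp add: P vec_eq_iff cpl_def sym_pad_def diag_mat_def mat_def complex_eq_iff)
  then show ?case
    by (simp add: P det_diag_mat norm_power pairs_on_def real_prod.nn_integral_empty del: nn_integral_const)
next
  case (insert b A)
  note hyps = insert.hyps and prems = insert.prems
  let ?k = "real (card A)"
  define S where "S = schur 1 b P"
  define p where "p = P $ b $ b"
  define w where "w = pivot_vec P b"
  \<comment> \<open>The induction hypothesis leaves det R to the power -e for the border
    integral.\<close>
  define e where "e = 2 * s - real (card A + 1) / 2"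
  have card: "card (insert b A) = card A + 1" using hyps by simp
  have sym: "transpose P = P" using prems(1) by (simp add: pos_def_mat_def)
  have Psym: "P $ i $ j = P $ j $ i" for i j using sym by (metis transpose_def vec_lambda_beta)
  have p: "p > 0" and S: "pos_def_mat S" "padded A S"
    using prems(1) pos_def_schur_iff[OF sym, of b] padded_schur[OF prems(2)] by (auto simp: p_def S_def)
  have detP: "det P = p * det S" using det_schur[of P b 1] p by (simp add: p_def S_def)
  have detS: "det S > 0" using S(1) by (rule det_pos_if_pos_def)
  have e: "e > ?k / 2" and sk: "s - ?k / 2 > 1 / 2" "s > ?k / 2" using prems(3) card by (auto simp: e_def field_simps)
  have w0: "w $ i = 0" if "i \<notin> A" for i
    using that prems(2) by (cases "i = b") (auto simp: w_def pivot_vec_def padded_def)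
  have Pw: "P $ i $ b = p * w $ i" if "i \<noteq> b" for i using that p by (simp add: w_def pivot_vec_def p_def)
  have S_ij: "S $ i $ j = P $ i $ j - p * w $ i * w $ j" if "i \<noteq> b" "j \<noteq> b" for i j
    using that p Pw[OF that(1)] Pw[OF that(2)] Psym[of b j] by (simp add: S_def schur_def p_def[symmetric])
  have gm: "(\<lambda>x. ennreal (cmod (det (cpl x Y)) powr (- 2 * s))) \<in> borel_measurable borel" for Y :: "((real, 'n) vec, 'n) vec"
    by measurable
  have inner: "(\<integral>\<^sup>+x. ennreal (cmod (det (cpl (sym_pad A x + border b v t) P)) powr (- 2 * s)) \<partial>PiR (pairs_on A)) =
      ennreal (re_const (card A) s * (t\<^sup>2 + p\<^sup>2) powr (- s)) * ennreal (det (S + (p / (t\<^sup>2 + p\<^sup>2)) *\<^sub>R outer (v - t *\<^sub>R w) (v - t *\<^sub>R w)) powr (- e))"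
    if v0: "\<And>i. i \<notin> A \<Longrightarrow> v $ i = 0" for v t
  proof -
    define D where "D = t\<^sup>2 + p\<^sup>2"
    have D: "D > 0" using p by (simp add: D_def add_nonneg_pos)
    \<comment> \<open>The border column is v + i p w = u + z w with z = t + i p. In (u + z w)(u + z
      w)^T / z only the term u u^T / z keeps a denominator.\<close>
    define u where "u = v - t *\<^sub>R w"
    have u0: "u $ i = 0" if "i \<notin> A" for i using v0[OF that] w0[OF that] by (simp add: u_def)
    \<comment> \<open>T collects the real parts of the subtracted terms and does not involve x. On
      the imaginary side z w w^T turns P into S, and -1/z contributes p/D, which gives R.\<close>
    define T where "T = - ((t / D) *\<^sub>R outer u u + outer u w + outer w u + t *\<^sub>R outer w w)"
    define R where "R = S + (p / D) *\<^sub>R outer u u"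
    define z where "z = Complex t p"
    have z: "z \<noteq> 0" using p by (simp add: z_def complex_eq_iff)
    have zD: "cmod z = sqrt D" by (simp add: z_def D_def complex_norm)
    have R: "pos_def_mat R" "padded A R"
      unfolding R_def using S D p u0 by (auto intro!: pos_def_rank_one_update padded_rank_one_update)
    have schur_eq: "schur \<i> b (cpl (sym_pad A x + border b v t) P) = cpl (sym_pad A x + T) R" for x
    proof -
      let ?M = "cpl (sym_pad A x + border b v t) P"
      have Mbb: "?M $ b $ b = z"
        using hyps by (simp add: cpl_def sym_pad_def border_def z_def p_def)
      have Mib: "?M $ i $ b = u $ i + z * w $ i" if "i \<noteq> b" for i
        using that hyps by (simp add: cpl_def sym_pad_def border_def z_def complex_eq_iff u_def Pw)
      have Mbi: "?M $ b $ i = u $ i + z * w $ i" if "i \<noteq> b" for i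
        using that hyps Psym[of b i] by (simp add: cpl_def sym_pad_def border_def z_def complex_eq_iff u_def Pw)
      have "schur \<i> b ?M $ i $ j = cpl (sym_pad A x + T) R $ i $ j" for i j
      proof (cases "i = b \<or> j = b")
        case True
        then have 1: "sym_pad A x $ i $ j = 0" "outer u u $ i $ j = 0" "outer u w $ i $ j = 0" "outer w u $ i $ j = 0" "outer w w $ i $ j = 0"
          using hyps u0 w0 by (auto simp: sym_pad_def outer_def)
        have "S $ i $ j = (if i = j then 1 else 0)" using True by (auto simp: S_def schur_def)
        then show ?thesis using True 1 by (auto simp: schur_def cpl_def T_def R_def complex_eq_iff)
      next
        case False
        have "?M $ i $ j - ?M $ i $ b * ?M $ b $ j / ?M $ b $ b =
            Complex (sym_pad A x $ i $ j) (P $ i $ j) - (u $ i + z * w $ i) * (u $ j + z * w $ j) / z"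
          using False by (simp add: Mbb Mib Mbi) (simp add: cpl_def border_def)
        also have "(u $ i + z * w $ i) * (u $ j + z * w $ j) / z =
            u $ i * u $ j / z + (u $ i * w $ j + w $ i * u $ j) + z * (w $ i * w $ j)"
          using z by (simp add: field_simps)
        also have "u $ i * u $ j / z = Complex (t / D * (u $ i * u $ j)) (- (p / D * (u $ i * u $ j)))"
          by (simp add: complex_eq_iff z_def Re_divide Im_divide D_def)
        also have "Complex (sym_pad A x $ i $ j) (P $ i $ j) - (Complex (t / D * (u $ i * u $ j)) (- (p / D * (u $ i * u $ j)))
            + (u $ i * w $ j + w $ i * u $ j) + z * (w $ i * w $ j)) = cpl (sym_pad A x + T) R $ i $ j"
          using False by (simp add: complex_eq_iff cpl_def T_def R_def outer_def S_ij z_def)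
        finally show ?thesis using False by (simp add: schur_def)
      qed
      then show ?thesis by (simp add: vec_eq_iff)
    qed
    have det_eq: "cmod (det (cpl (sym_pad A x + border b v t) P)) = sqrt D * cmod (det (cpl (sym_pad A x + T) R))" for x
    proof -
      let ?M = "cpl (sym_pad A x + border b v t) P"
      have Mbb: "?M $ b $ b = z"
        using hyps by (simp add: cpl_def sym_pad_def border_def z_def p_def)
      have "\<i> * det ?M = z * det (cpl (sym_pad A x + T) R)"
        using det_schur[of ?M b \<i>] z unfolding Mbb schur_eq by blast
      then have "cmod (\<i> * det ?M) = cmod (z * det (cpl (sym_pad A x + T) R))" by simp
      then show ?thesis by (simp add: norm_mult zD)
    qed
    have sqD: "sqrt D powr (- 2 * s) = D powr (- s)"
      using D by (simp add: powr_half_sqrt[symmetric] powr_powr)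
    have "(\<integral>\<^sup>+x. ennreal (cmod (det (cpl (sym_pad A x + border b v t) P)) powr (- 2 * s)) \<partial>PiR (pairs_on A)) =
        (\<integral>\<^sup>+x. ennreal (D powr (- s)) * ennreal (cmod (det (cpl (sym_pad A x + T) R)) powr (- 2 * s)) \<partial>PiR (pairs_on A))"
      unfolding det_eq using D by (simp add: powr_mult sqD[simplified] ennreal_mult'[symmetric])
    also have "\<dots> = (\<integral>\<^sup>+x. ennreal (D powr (- s)) * ennreal (cmod (det (cpl (sym_pad A x) R)) powr (- 2 * s)) \<partial>PiR (pairs_on A))"
      by (rule nn_integral_sym_pad_shift[where g = "\<lambda>x. ennreal (D powr (- s)) * ennreal (cmod (det (cpl x R)) powr (- 2 * s))"])
         (measurable, auto simp: T_def outer_def u0 w0)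
    also have "\<dots> = ennreal (D powr (- s)) * (\<integral>\<^sup>+x. ennreal (cmod (det (cpl (sym_pad A x) R)) powr (- 2 * s)) \<partial>PiR (pairs_on A))"
      by (rule nn_integral_cmult, rule measurable_compose[OF sym_pad_measurable gm])
    also have "\<dots> = ennreal (D powr (- s)) * ennreal (re_const (card A) s * det R powr (real (card A + 1) / 2 - 2 * s))"
      using R sk by (subst insert.IH) auto
    also have "\<dots> = ennreal (re_const (card A) s * D powr (- s)) * ennreal (det R powr (- e))"
      using re_const_pos[OF sk(2)] by (simp add: ennreal_mult'[symmetric] e_def mult_ac)
    finally show ?thesis unfolding D_def R_def u_def .
  qed
  have gm': "(\<lambda>v. ennreal (det (S + \<kappa> *\<^sub>R outer (v - d) (v - d)) powr (- e))) \<in> borel_measurable borel" for \<kappa> d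
  proof -
    have [measurable]: "(\<lambda>v. det (S + \<kappa> *\<^sub>R outer (v - d) (v - d))) \<in> borel_measurable borel"
      unfolding outer_def by (intro borel_measurable_continuous_onI continuous_intros)
    show ?thesis by measurable
  qed
  define C where "C = re_const (card A) s * vec_const (card A) e * p powr (- ?k / 2) * det S powr (1 / 2 - e)"
  have C0: "C \<ge> 0"
    using re_const_pos[OF sk(2)] vec_const_pos[OF e] by (simp add: C_def)
  have "(\<integral>\<^sup>+c. ennreal (cmod (det (cpl (sym_pad (insert b A) c) P)) powr (- 2 * s)) \<partial>PiR (pairs_on (insert b A))) =
    (\<integral>\<^sup>+t. (\<integral>\<^sup>+u. (\<integral>\<^sup>+x. ennreal (cmod (det (cpl (sym_pad A x + border b (vec_pad (pair_with b) A u) t) P)) powr (- 2 * s)) \<partial>PiR (pairs_on A)) \<partial>PiR (pair_with b ` A)) \<partial>lborel)"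
    by (rule nn_integral_sym_pad_insert[OF hyps(2) gm])
  \<comment> \<open>The weight p/D of the rank-one term contributes (p/D)^(-k/2), so D = t^2 + p^2
    remains with exponent -(s - k/2). The factor 1 and the summand 0 fit the shape of
    \<open>nn_integral_line\<close>.\<close>
  also have "\<dots> = (\<integral>\<^sup>+t. ennreal C * ennreal ((p\<^sup>2 + 1 * (t + 0)\<^sup>2) powr (- (s - ?k / 2))) \<partial>lborel)"
  proof (rule nn_integral_cong)
    fix t :: real
    define D where "D = t\<^sup>2 + p\<^sup>2"
    have D: "D > 0" using p by (simp add: D_def add_nonneg_pos)
    have "(\<integral>\<^sup>+u. (\<integral>\<^sup>+x. ennreal (cmod (det (cpl (sym_pad A x + border b (vec_pad (pair_with b) A u) t) P)) powr (- 2 * s)) \<partial>PiR (pairs_on A)) \<partial>PiR (pair_with b ` A)) =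
        (\<integral>\<^sup>+u. ennreal (re_const (card A) s * D powr (- s)) * ennreal (det (S + (p / D) *\<^sub>R outer (vec_pad (pair_with b) A u - t *\<^sub>R w) (vec_pad (pair_with b) A u - t *\<^sub>R w)) powr (- e)) \<partial>PiR (pair_with b ` A))"
      unfolding D_def by (intro nn_integral_cong inner) (simp add: vec_pad_def)
    also have "\<dots> = ennreal (re_const (card A) s * D powr (- s)) * (\<integral>\<^sup>+u. ennreal (det (S + (p / D) *\<^sub>R outer (vec_pad (pair_with b) A u - t *\<^sub>R w) (vec_pad (pair_with b) A u - t *\<^sub>R w)) powr (- e)) \<partial>PiR (pair_with b ` A))"
      by (rule nn_integral_cmult, rule measurable_compose[OF vec_pad_measurable gm'])
    also have "\<dots> = ennreal (re_const (card A) s * D powr (- s)) * ennreal (vec_const (card A) e * (p / D) powr (- ?k / 2) * det S powr (1 / 2 - e))"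
      using hyps(1) inj_on_pair_with S p D e w0 by (subst nn_integral_rank_one_update) auto
    also have "\<dots> = ennreal (re_const (card A) s * D powr (- s) * (vec_const (card A) e * (p / D) powr (- ?k / 2) * det S powr (1 / 2 - e)))"
      using re_const_pos[OF sk(2)] by (intro ennreal_mult'[symmetric]) simp
    also have "re_const (card A) s * D powr (- s) * (vec_const (card A) e * (p / D) powr (- ?k / 2) * det S powr (1 / 2 - e)) = C * (D powr (- s) * D powr (?k / 2))"
      using p D by (simp add: C_def powr_divide powr_minus_divide mult_ac)
    also have "D powr (- s) * D powr (?k / 2) = D powr (- (s - ?k / 2))"
      by (simp add: powr_add[symmetric])
    also have "ennreal (C * D powr (- (s - ?k / 2))) = ennreal C * ennreal ((p\<^sup>2 + 1 * (t + 0)\<^sup>2) powr (- (s - ?k / 2)))"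
      using C0 by (simp add: D_def add.commute ennreal_mult')
    finally show "(\<integral>\<^sup>+u. (\<integral>\<^sup>+x. ennreal (cmod (det (cpl (sym_pad A x + border b (vec_pad (pair_with b) A u) t) P)) powr (- 2 * s)) \<partial>PiR (pairs_on A)) \<partial>PiR (pair_with b ` A)) =
      ennreal C * ennreal ((p\<^sup>2 + 1 * (t + 0)\<^sup>2) powr (- (s - ?k / 2)))" .
  qed
  also have "\<dots> = ennreal C * (\<integral>\<^sup>+t. ennreal ((p\<^sup>2 + 1 * (t + 0)\<^sup>2) powr (- (s - ?k / 2))) \<partial>lborel)"
    by (rule nn_integral_cmult) measurable
  also have "\<dots> = ennreal C * ennreal (line_const (s - ?k / 2) * (p\<^sup>2) powr (1 / 2 - (s - ?k / 2)) * 1 powr (- 1 / 2))"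
    using sk p by (subst nn_integral_line) auto
  also have "\<dots> = ennreal (C * (line_const (s - ?k / 2) * (p\<^sup>2) powr (1 / 2 - (s - ?k / 2)) * 1 powr (- 1 / 2)))"
    using C0 by (rule ennreal_mult'[symmetric])
  also have "C * (line_const (s - ?k / 2) * (p\<^sup>2) powr (1 / 2 - (s - ?k / 2)) * 1 powr (- 1 / 2)) =
      re_const (card (insert b A)) s * det P powr (real (card (insert b A) + 1) / 2 - 2 * s)"
  proof -
    have 1: "(p\<^sup>2) powr (1 / 2 - (s - ?k / 2)) = p powr (1 - 2 * s + ?k)"
    proof -
      have "p\<^sup>2 = p powr 2" using p by simp
      then show ?thesis by (simp only: powr_powr) (simp add: algebra_simps)
    qed
    have 2: "p powr (- ?k / 2) * p powr (1 - 2 * s + ?k) = p powr (real (card (insert b A) + 1) / 2 - 2 * s)"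
      unfolding card by (simp add: powr_add[symmetric] field_simps)
    have 3: "1 / 2 - e = real (card (insert b A) + 1) / 2 - 2 * s"
      unfolding card e_def by (simp add: field_simps)
    have "C * (line_const (s - ?k / 2) * (p\<^sup>2) powr (1 / 2 - (s - ?k / 2)) * 1 powr (- 1 / 2)) =
      re_const (card A) s * vec_const (card A) e * line_const (s - ?k / 2) * ((p powr (- ?k / 2) * p powr (1 - 2 * s + ?k)) * det S powr (1 / 2 - e))"
      unfolding C_def 1 by simp
    then show ?thesis
      unfolding 2 3 detP using p detS by (simp add: card e_def powr_mult)
  qed
  finally show ?case .
qed

section \<open>The integral over the imaginary part\<close>

definition off_id :: "'n set \<Rightarrow> real^'n^'n" where
  "off_id A = (\<chi> i j. if i = j \<and> i \<notin> A then 1 else 0)"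

text \<open>The Beta integral over positive definite matrices, (det y)^\<alpha> against (det (y +
  1))^(-\<beta>). Each step contributes a border integral and a scalar Beta integral for the
  corner.\<close>

fun im_const :: "nat \<Rightarrow> real \<Rightarrow> real \<Rightarrow> real" where
  "im_const 0 \<alpha> \<beta> = 1"
| "im_const (Suc k) \<alpha> \<beta> = im_const k \<alpha> \<beta> * vec_const k (\<beta> - \<alpha> - real (k + 1) / 2) *
     Beta (\<alpha> + real k / 2 + 1) (\<beta> - \<alpha> - real k - 1)"

lemma Beta_real_pos: "(a::real) > 0 \<Longrightarrow> b > 0 \<Longrightarrow> Beta a b > 0"
  by (simp add: Beta_def Gamma_real_pos)

lemma im_const_pos: "\<alpha> > -1 \<Longrightarrow> \<beta> - \<alpha> > real k \<Longrightarrow> im_const k \<alpha> \<beta> > 0"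
proof (induction k)
  case (Suc k)
  have "vec_const k (\<beta> - \<alpha> - real (k + 1) / 2) > 0"
    using Suc.prems by (intro vec_const_pos) (simp add: field_simps)
  moreover have "Beta (\<alpha> + real k / 2 + 1) (\<beta> - \<alpha> - real k - 1) > 0"
    using Suc.prems by (intro Beta_real_pos) auto
  ultimately show ?case using Suc by simp
qed simp

lemma pos_def_mat_borel: "{y :: real^'n::finite^'n. pos_def_mat y} \<in> sets borel"
proof -
  define h :: "real^'n^'n \<Rightarrow> 'n cmat" where "h y = (\<chi> i j. Complex 0 (y $ i $ j))" for y
  have "continuous_on UNIV h"
    unfolding h_def Complex_eq by (intro continuous_intros)
  then have h: "h \<in> borel_measurable borel" by (rule borel_measurable_continuous_onI)
  have "{y :: real^'n^'n. pos_def_mat y} = h -` siegel_space \<inter> space borel"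
  proof -
    have "map_matrix Im (h y) = y" for y by (simp add: vec_eq_iff h_def)
    moreover have "transpose (h y) = h y \<longleftrightarrow> transpose y = y" for y
      by (simp add: vec_eq_iff h_def transpose_def)
    ultimately show ?thesis by (auto simp: siegel_space_def pos_def_mat_def)
  qed
  also have "\<dots> \<in> sets borel" by (rule measurable_sets[OF h siegel_space_borel])
  finally show ?thesis .
qed

text \<open>The matrices y and y + P are reduced at the same index, with pivots t and t + p. One
  translation normalises the Schur complement of y, and the difference of the two complements is
  again a positive definite R free of the remaining variables, so the shape of the integrand
  persists.\<close>

lemma nn_integral_im_part:
  fixes P :: "((real, 'n::{finite,linorder}) vec, 'n) vec"
  assumes "finite A" "pos_def_mat P" "padded A P" and \<alpha>: "\<alpha> > -1" and "\<beta> - \<alpha> > real (card A)"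
  shows "(\<integral>\<^sup>+c. ennreal (indicator {y. pos_def_mat y} (sym_pad A c + off_id A) *
      (det (sym_pad A c + off_id A) powr \<alpha> * det (sym_pad A c + P) powr (- \<beta>))) \<partial>PiR (pairs_on A)) =
    ennreal (im_const (card A) \<alpha> \<beta> * det P powr (\<alpha> - \<beta> + real (card A + 1) / 2))"
  using assms(1-3,5)
proof (induction A arbitrary: P rule: finite_induct)
  case empty
  have P: "P = mat 1" using padded_empty[OF empty(2)] .
  have "sym_pad {} c + off_id {} = mat 1" "sym_pad {} c = 0" for c :: "'n \<times> 'n \<Rightarrow> real"
    by (simp_all add: vec_eq_iff sym_pad_def off_id_def mat_def)
  moreover have "pos_def_mat (mat 1 :: ((real, 'n) vec, 'n) vec)"
    using empty(1) P by simp
  ultimately show ?case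
    by (simp add: P pairs_on_def real_prod.nn_integral_empty del: nn_integral_const)
next
  case (insert b A)
  note hyps = insert.hyps and prems = insert.prems
  let ?k = "real (card A)"
  define S where "S = schur 1 b P"
  define p where "p = P $ b $ b"
  define w where "w = pivot_vec P b"
  define e where "e = \<beta> - \<alpha> - real (card A + 1) / 2"
  define g where "g B Q y = ennreal (indicator {y. pos_def_mat y} (y + off_id B) *
      (det (y + off_id B) powr \<alpha> * det (y + Q) powr (- \<beta>)))" for B and Q y :: "((real, 'n) vec, 'n) vec"
  have card: "card (insert b A) = card A + 1" using hyps by simp
  have sym: "transpose P = P" using prems(1) by (simp add: pos_def_mat_def)
  have Psym: "P $ i $ j = P $ j $ i" for i j
    using arg_cong[OF sym, of "\<lambda>M. M $ i $ j"] by (simp add: transpose_def)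
  have p: "p > 0" and S: "pos_def_mat S" "padded A S"
    using prems(1) pos_def_schur_iff[OF sym, of b] padded_schur[OF prems(2)] by (auto simp: p_def S_def)
  have detP: "det P = p * det S" using det_schur[of P b 1] p by (simp add: p_def S_def)
  have detS: "det S > 0" using S(1) by (rule det_pos_if_pos_def)
  have \<beta>: "\<beta> - \<alpha> > ?k + 1" using prems(3) card by simp
  have e: "e > ?k / 2" using \<beta> by (simp add: e_def field_simps)
  have imc: "im_const (card A) \<alpha> \<beta> > 0" using \<alpha> \<beta> by (intro im_const_pos) auto
  have w0: "w $ i = 0" if "i \<notin> A" for i
    using that prems(2) by (cases "i = b") (auto simp: w_def pivot_vec_def padded_def)
  have Pw: "P $ i $ b = p * w $ i" if "i \<noteq> b" for i using that p by (simp add: w_def pivot_vec_def p_def)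
  have S_ij: "S $ i $ j = P $ i $ j - p * w $ i * w $ j" if "i \<noteq> b" "j \<noteq> b" for i j
    using that p Pw[OF that(1)] Pw[OF that(2)] Psym[of b j] by (simp add: S_def schur_def p_def[symmetric])
  have gm: "g B Q \<in> borel_measurable borel" for B Q
  proof -
    have [measurable]: "(\<lambda>y. det (y + Q)) \<in> borel_measurable borel" for Q :: "((real, 'n) vec, 'n) vec"
      by (intro borel_measurable_continuous_onI continuous_intros)
    have ind: "(\<lambda>y. indicator {y. pos_def_mat y} (y + off_id B) :: real) \<in> borel_measurable borel"
      by (rule measurable_compose[OF _ borel_measurable_indicator[OF pos_def_mat_borel]])
         (intro borel_measurable_continuous_onI continuous_intros)
    show ?thesis unfolding g_def[abs_def] using ind by measurable
  qed
  have inner: "(\<integral>\<^sup>+x. g (insert b A) P (sym_pad A x + border b v t) \<partial>PiR (pairs_on A)) =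
      ennreal (indicator {0<..} t * (im_const (card A) \<alpha> \<beta> * t powr \<alpha> * (t + p) powr (- \<beta>))) *
      ennreal (det (S + (p / (t * (t + p))) *\<^sub>R outer (v - t *\<^sub>R w) (v - t *\<^sub>R w)) powr (- e))"
    if v0: "\<And>i. i \<notin> A \<Longrightarrow> v $ i = 0" for v t
  proof (cases "t > 0")
    case False
    have "\<not> pos_def_mat (sym_pad A x + border b v t + off_id (insert b A))" for x
    proof
      assume "pos_def_mat (sym_pad A x + border b v t + off_id (insert b A))"
      from pos_def_diag_pos[OF this, of b] False hyps show False
        by (simp add: sym_pad_def border_def off_id_def)
    qed
    then show ?thesis using False by (simp add: g_def)
  next
    case True
    \<comment> \<open>From the identity a^2/t + p b^2 - (a + p b)^2/(t + p) = p (a - t b)^2/(t (t +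
      p)), polarised, with the entries of v and w for a and b.\<close>
    define \<kappa> where "\<kappa> = p / (t * (t + p))"
    have \<kappa>: "\<kappa> > 0" using p True by (simp add: \<kappa>_def)
    define u where "u = v - t *\<^sub>R w"
    have u0: "u $ i = 0" if "i \<notin> A" for i using v0[OF that] w0[OF that] by (simp add: u_def)
    define T where "T = - ((1 / t) *\<^sub>R outer v v)"
    define R where "R = S + \<kappa> *\<^sub>R outer u u"
    have R: "pos_def_mat R" "padded A R"
      unfolding R_def using S \<kappa> u0 by (auto intro!: pos_def_rank_one_update padded_rank_one_update)
    have eq: "g (insert b A) P (sym_pad A x + border b v t) =
        ennreal (t powr \<alpha> * (t + p) powr (- \<beta>)) * g A R (sym_pad A x + T)" for x
    proof -
      let ?X = "sym_pad A x"
      let ?M = "?X + border b v t + off_id (insert b A)" and ?N = "?X + border b v t + P"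
      have Mbb: "?M $ b $ b = t" and Nbb: "?N $ b $ b = t + p"
        using hyps by (auto simp: sym_pad_def border_def off_id_def p_def)
      have Mib: "?M $ i $ b = v $ i" "?M $ b $ i = v $ i" "?N $ i $ b = v $ i + p * w $ i" "?N $ b $ i = v $ i + p * w $ i" if "i \<noteq> b" for i
        using that hyps Psym[of b i] by (auto simp: sym_pad_def border_def off_id_def Pw)
      have symM: "transpose ?M = ?M"
        by (auto simp: vec_eq_iff transpose_def border_def off_id_def sym_pad_sym[of A x])
      have schM: "schur 1 b ?M = ?X + T + off_id A"
      proof -
        have "schur 1 b ?M $ i $ j = (?X + T + off_id A) $ i $ j" for i j
          using hyps v0 True by (cases "i = b \<or> j = b")
            (auto simp: schur_def Mbb Mib T_def outer_def, auto simp: off_id_def border_def sym_pad_def)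
        then show ?thesis unfolding vec_eq_iff by blast
      qed
      have schN: "schur 1 b ?N = ?X + T + R"
      proof -
        have "schur 1 b ?N $ i $ j = (?X + T + R) $ i $ j" for i j
        proof (cases "i = b \<or> j = b")
          case True
          have "S $ i $ j = (if i = j then 1 else 0)" using True by (auto simp: S_def schur_def)
          then show ?thesis using True hyps v0 u0
            by (auto simp: schur_def T_def R_def outer_def sym_pad_def)
        next
          case False
          have key: "P $ i $ j - (v $ i + p * w $ i) * (v $ j + p * w $ j) / (t + p) =
              - (v $ i * v $ j / t) + (P $ i $ j - p * w $ i * w $ j + \<kappa> * ((v $ i - t * w $ i) * (v $ j - t * w $ j)))"
            using True p by (simp add: \<kappa>_def field_simps add_pos_pos less_imp_neq[symmetric])
          have ib: "i \<noteq> b" and jb: "j \<noteq> b" using False by auto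
          have "schur 1 b ?N $ i $ j = ?N $ i $ j - ?N $ i $ b * ?N $ b $ j / ?N $ b $ b"
            using ib jb by (simp add: schur_def)
          also have "\<dots> = ?N $ i $ j - (v $ i + p * w $ i) * (v $ j + p * w $ j) / (t + p)"
            by (simp only: Nbb Mib(3)[OF ib] Mib(4)[OF jb])
          also have "?N $ i $ j = ?X $ i $ j + P $ i $ j"
            using ib jb by (simp add: border_def)
          also have "?X $ i $ j + P $ i $ j - (v $ i + p * w $ i) * (v $ j + p * w $ j) / (t + p) =
              ?X $ i $ j + (P $ i $ j - (v $ i + p * w $ i) * (v $ j + p * w $ j) / (t + p))" by simp
          also have "\<dots> = (?X + T + R) $ i $ j"
            unfolding key by (simp add: T_def R_def outer_def u_def S_ij[OF ib jb])
          finally show ?thesis .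
        qed
        then show ?thesis unfolding vec_eq_iff by blast
      qed
      have "pos_def_mat ?M \<longleftrightarrow> pos_def_mat (?X + T + off_id A)"
        using pos_def_schur_iff[OF symM, of b] True unfolding Mbb schM by simp
      moreover have "det ?M = t * det (?X + T + off_id A)"
        using det_schur[of ?M b 1] True unfolding Mbb schM by simp
      moreover have "det ?N = (t + p) * det (?X + T + R)"
        using det_schur[of ?N b 1] True p unfolding Nbb schN by simp
      ultimately show ?thesis
        unfolding g_def by (simp add: powr_mult ennreal_mult'[symmetric] indicator_def)
    qed
    have "(\<integral>\<^sup>+x. g (insert b A) P (sym_pad A x + border b v t) \<partial>PiR (pairs_on A)) =
        (\<integral>\<^sup>+x. ennreal (t powr \<alpha> * (t + p) powr (- \<beta>)) * g A R (sym_pad A x) \<partial>PiR (pairs_on A))"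
      unfolding eq
      by (rule nn_integral_sym_pad_shift[where g = "\<lambda>x. ennreal (t powr \<alpha> * (t + p) powr (- \<beta>)) * g A R x"])
         (use gm in measurable, auto simp: T_def outer_def v0)
    also have "\<dots> = ennreal (t powr \<alpha> * (t + p) powr (- \<beta>)) * (\<integral>\<^sup>+x. g A R (sym_pad A x) \<partial>PiR (pairs_on A))"
      by (rule nn_integral_cmult, rule measurable_compose[OF sym_pad_measurable gm])
    also have "(\<integral>\<^sup>+x. g A R (sym_pad A x) \<partial>PiR (pairs_on A)) = ennreal (im_const (card A) \<alpha> \<beta> * det R powr (\<alpha> - \<beta> + real (card A + 1) / 2))"
      unfolding g_def using R \<beta> by (intro insert.IH) auto
    also have "\<alpha> - \<beta> + real (card A + 1) / 2 = - e" by (simp add: e_def)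
    also have "ennreal (t powr \<alpha> * (t + p) powr (- \<beta>)) * ennreal (im_const (card A) \<alpha> \<beta> * det R powr (- e)) =
        ennreal (indicator {0<..} t * (im_const (card A) \<alpha> \<beta> * t powr \<alpha> * (t + p) powr (- \<beta>))) * ennreal (det R powr (- e))"
      using imc True by (simp add: ennreal_mult'[symmetric] mult_ac)
    finally show ?thesis unfolding R_def \<kappa>_def u_def .
  qed
  have gm': "(\<lambda>v. ennreal (det (S + \<kappa> *\<^sub>R outer (v - d) (v - d)) powr (- e))) \<in> borel_measurable borel" for \<kappa> d
  proof -
    have [measurable]: "(\<lambda>v. det (S + \<kappa> *\<^sub>R outer (v - d) (v - d))) \<in> borel_measurable borel"
      unfolding outer_def by (intro borel_measurable_continuous_onI continuous_intros)
    show ?thesis by measurable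
  qed
  define C where "C = im_const (card A) \<alpha> \<beta> * vec_const (card A) e * p powr (- ?k / 2) * det S powr (1 / 2 - e)"
  have C0: "C \<ge> 0" using imc vec_const_pos[OF e] by (simp add: C_def)
  \<comment> \<open>Parameters of the corner integral: t^(x-1) is t^\<alpha> times the t^(k/2) from
    \<kappa>^(-k/2), and x + y is \<beta> lowered by k/2 for the same reason.\<close>
  define x where "x = \<alpha> + ?k / 2 + 1"
  define y where "y = \<beta> - \<alpha> - ?k - 1"
  have xy: "x > 0" "y > 0" "x + y = \<beta> - ?k / 2" using \<alpha> \<beta> by (auto simp: x_def y_def add_nonneg_pos)
  have "(\<integral>\<^sup>+c. g (insert b A) P (sym_pad (insert b A) c) \<partial>PiR (pairs_on (insert b A))) =
    (\<integral>\<^sup>+t. (\<integral>\<^sup>+u. (\<integral>\<^sup>+x. g (insert b A) P (sym_pad A x + border b (vec_pad (pair_with b) A u) t) \<partial>PiR (pairs_on A)) \<partial>PiR (pair_with b ` A)) \<partial>lborel)"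
    by (rule nn_integral_sym_pad_insert[OF hyps(2) gm])
  also have "\<dots> = (\<integral>\<^sup>+t. ennreal C * ennreal (indicator {0..} t * (t powr (x - 1) * (t + p) powr (- (x + y)))) \<partial>lborel)"
  proof (rule nn_integral_cong)
    fix t :: real
    let ?c = "ennreal (indicator {0<..} t * (im_const (card A) \<alpha> \<beta> * t powr \<alpha> * (t + p) powr (- \<beta>)))"
    let ?F = "\<lambda>u. ennreal (det (S + (p / (t * (t + p))) *\<^sub>R outer (vec_pad (pair_with b) A u - t *\<^sub>R w) (vec_pad (pair_with b) A u - t *\<^sub>R w)) powr (- e))"
    have "(\<integral>\<^sup>+u. (\<integral>\<^sup>+x. g (insert b A) P (sym_pad A x + border b (vec_pad (pair_with b) A u) t) \<partial>PiR (pairs_on A)) \<partial>PiR (pair_with b ` A)) =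
        (\<integral>\<^sup>+u. ?c * ?F u \<partial>PiR (pair_with b ` A))"
      by (intro nn_integral_cong inner) (simp add: vec_pad_def)
    also have "\<dots> = ?c * (\<integral>\<^sup>+u. ?F u \<partial>PiR (pair_with b ` A))"
      by (rule nn_integral_cmult, rule measurable_compose[OF vec_pad_measurable gm'])
    also have "\<dots> = ennreal C * ennreal (indicator {0..} t * (t powr (x - 1) * (t + p) powr (- (x + y))))"
    proof (cases "t > 0")
      case True
      have "(\<integral>\<^sup>+u. ?F u \<partial>PiR (pair_with b ` A)) = ennreal (vec_const (card A) e * (p / (t * (t + p))) powr (- ?k / 2) * det S powr (1 / 2 - e))"
        using hyps(1) inj_on_pair_with S p True e w0 by (subst nn_integral_rank_one_update) auto
      then have "?c * (\<integral>\<^sup>+u. ?F u \<partial>PiR (pair_with b ` A)) =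
          ennreal ((im_const (card A) \<alpha> \<beta> * t powr \<alpha> * (t + p) powr (- \<beta>)) * (vec_const (card A) e * (p / (t * (t + p))) powr (- ?k / 2) * det S powr (1 / 2 - e)))"
        using True imc by (simp add: ennreal_mult'[symmetric])
      also have "(p / (t * (t + p))) powr (- ?k / 2) = p powr (- ?k / 2) * (t powr (?k / 2) * (t + p) powr (?k / 2))"
        using True p by (simp add: powr_divide powr_mult powr_minus_divide)
      also have "(im_const (card A) \<alpha> \<beta> * t powr \<alpha> * (t + p) powr (- \<beta>)) * (vec_const (card A) e * (p powr (- ?k / 2) * (t powr (?k / 2) * (t + p) powr (?k / 2))) * det S powr (1 / 2 - e)) =
          C * ((t powr \<alpha> * t powr (?k / 2)) * ((t + p) powr (- \<beta>) * (t + p) powr (?k / 2)))"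
        by (simp add: C_def)
      also have "t powr \<alpha> * t powr (?k / 2) = t powr (x - 1)"
        by (simp add: powr_add[symmetric] x_def)
      also have "(t + p) powr (- \<beta>) * (t + p) powr (?k / 2) = (t + p) powr (- (x + y))"
        unfolding xy(3) by (simp add: powr_add[symmetric])
      finally show ?thesis using True C0 by (simp add: ennreal_mult')
    next
      case False then show ?thesis by (cases "t = 0") auto
    qed
    finally show "(\<integral>\<^sup>+u. (\<integral>\<^sup>+x. g (insert b A) P (sym_pad A x + border b (vec_pad (pair_with b) A u) t) \<partial>PiR (pairs_on A)) \<partial>PiR (pair_with b ` A)) =
      ennreal C * ennreal (indicator {0..} t * (t powr (x - 1) * (t + p) powr (- (x + y))))" .
  qed
  also have "\<dots> = ennreal C * (\<integral>\<^sup>+t. ennreal (indicator {0..} t * (t powr (x - 1) * (t + p) powr (- (x + y)))) \<partial>lborel)"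
    by (rule nn_integral_cmult) measurable
  also have "\<dots> = ennreal C * ennreal (Beta x y * p powr (- y))"
    by (simp only: nn_integral_half_line[OF xy(1,2) p])
  also have "\<dots> = ennreal (C * (Beta x y * p powr (- y)))"
    using C0 by (rule ennreal_mult'[symmetric])
  also have "C * (Beta x y * p powr (- y)) =
      im_const (card (insert b A)) \<alpha> \<beta> * det P powr (\<alpha> - \<beta> + real (card (insert b A) + 1) / 2)"
  proof -
    have 2: "p powr (- ?k / 2) * p powr (- y) = p powr (\<alpha> - \<beta> + real (card (insert b A) + 1) / 2)"
      unfolding card y_def by (simp add: powr_add[symmetric] field_simps)
    have 3: "1 / 2 - e = \<alpha> - \<beta> + real (card (insert b A) + 1) / 2"
      unfolding card e_def by (simp add: field_simps)
    have "C * (Beta x y * p powr (- y)) =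
      im_const (card A) \<alpha> \<beta> * vec_const (card A) e * Beta x y * ((p powr (- ?k / 2) * p powr (- y)) * det S powr (1 / 2 - e))"
      unfolding C_def by simp
    then show ?thesis
      unfolding 2 3 detP by (simp add: card e_def powr_mult x_def y_def)
  qed
  finally show ?case unfolding g_def .
qed

section \<open>Hua's integral\<close>

lemma cpl_measurable:
  "(\<lambda>p. cpl (sym_pad A (fst p)) (sym_pad A (snd p))) \<in> borel_measurable (PiR (pairs_on A) \<Otimes>\<^sub>M PiR (pairs_on A))"
proof -
  have m: "(\<lambda>p. sym_pad A (fst p)) \<in> borel_measurable (PiR (pairs_on A) \<Otimes>\<^sub>M PiR (pairs_on A))"
    "(\<lambda>p. sym_pad A (snd p)) \<in> borel_measurable (PiR (pairs_on A) \<Otimes>\<^sub>M PiR (pairs_on A))"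
    by (rule measurable_compose[OF measurable_fst sym_pad_measurable], rule measurable_compose[OF measurable_snd sym_pad_measurable])
  have "(\<lambda>p. complex_of_real (sym_pad A (fst p) $ i $ j) + \<i> * complex_of_real (sym_pad A (snd p) $ i $ j))
      \<in> borel_measurable (PiR (pairs_on A) \<Otimes>\<^sub>M PiR (pairs_on A))" for i j
    using m by measurable
  then show ?thesis
    unfolding cpl_def Complex_eq
    by (intro borel_measurable_vecI) (simp only: vec_lambda_beta)
qed

text \<open>Regroups the coordinates into all real parts and all imaginary parts, so that Hua's
  integral can be iterated; a box becomes a product of two boxes.\<close>

lemma distr_cpl_sym_coords:
  defines "P \<equiv> pairs_on (UNIV :: 'n::{finite,linorder} set)"
  shows "distr (PiR P \<Otimes>\<^sub>M PiR P) borel (\<lambda>p. sym_coords (cpl (sym_pad UNIV (fst p)) (sym_pad UNIV (snd p)))) =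
    (lborel :: (real^'n sym_idx) measure)"
proof (rule lborel_eqI[symmetric])
  fix l u :: "real^'n sym_idx"
  assume lu: "\<And>b. b \<in> Basis \<Longrightarrow> l \<bullet> b \<le> u \<bullet> b"
  have le: "l $ i \<le> u $ i" for i
    using lu[of "axis i 1"] by (simp add: inner_axis axis_in_Basis_iff)
  let ?N = "PiR P \<Otimes>\<^sub>M PiR P"
  let ?f = "\<lambda>p. sym_coords (cpl (sym_pad UNIV (fst p)) (sym_pad UNIV (snd p))) :: real^'n sym_idx"
  let ?B = "\<lambda>b. Pi\<^sub>E P (\<lambda>p. {l $ sym_idx (fst p) (snd p) b <..< u $ sym_idx (fst p) (snd p) b})"
  have P: "P = {(r, s). r \<le> s}" by (simp add: P_def pairs_on_def)
  have fm: "?f \<in> borel_measurable ?N"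
    unfolding P_def by (rule measurable_compose[OF cpl_measurable sym_coords_measurable])
  interpret sf: sigma_finite_measure "PiR P" by (rule real_prod.sigma_finite) simp
  have eq: "?f -` box l u \<inter> space ?N = ?B False \<times> ?B True"
  proof (rule Set.set_eqI, clarsimp simp only: vimage_eq Int_iff mem_Times_iff fst_conv snd_conv split_paired_all)
    fix x y :: "'n \<times> 'n \<Rightarrow> real"
    have "sym_coords (cpl (sym_pad UNIV x) (sym_pad UNIV y)) \<in> box l u \<longleftrightarrow>
        (\<forall>i. l $ i < sym_coords (cpl (sym_pad UNIV x) (sym_pad UNIV y)) $ i \<and>
          sym_coords (cpl (sym_pad UNIV x) (sym_pad UNIV y)) $ i < u $ i)"
      by (simp add: mem_box_cart)
    also have "\<dots> \<longleftrightarrow> (\<forall>r s b. r \<le> s \<longrightarrow>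
        l $ sym_idx r s b < sym_coords (cpl (sym_pad UNIV x) (sym_pad UNIV y)) $ sym_idx r s b \<and>
        sym_coords (cpl (sym_pad UNIV x) (sym_pad UNIV y)) $ sym_idx r s b < u $ sym_idx r s b)"
      by (metis sym_idx_cases)
    also have "\<dots> \<longleftrightarrow> (\<forall>p\<in>P. x p \<in> {l $ sym_idx (fst p) (snd p) False <..< u $ sym_idx (fst p) (snd p) False}) \<and>
        (\<forall>p\<in>P. y p \<in> {l $ sym_idx (fst p) (snd p) True <..< u $ sym_idx (fst p) (snd p) True})"
      unfolding P all_bool_eq by (auto simp: cpl_def sym_pad_def)
    finally have *: "sym_coords (cpl (sym_pad UNIV x) (sym_pad UNIV y)) \<in> box l u \<longleftrightarrow>
        (\<forall>p\<in>P. x p \<in> {l $ sym_idx (fst p) (snd p) False <..< u $ sym_idx (fst p) (snd p) False}) \<and>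
        (\<forall>p\<in>P. y p \<in> {l $ sym_idx (fst p) (snd p) True <..< u $ sym_idx (fst p) (snd p) True})" .
    show "sym_coords (cpl (sym_pad UNIV x) (sym_pad UNIV y)) \<in> box l u \<and> (x, y) \<in> space ?N \<longleftrightarrow> x \<in> ?B False \<and> y \<in> ?B True"
      unfolding * space_pair_measure mem_Times_iff fst_conv snd_conv space_PiM PiE_iff by auto
  qed
  have "emeasure (distr ?N borel ?f) (box l u) = emeasure ?N (?B False \<times> ?B True)"
    using fm by (subst emeasure_distr) (auto simp: eq)
  also have "\<dots> = emeasure (PiR P) (?B False) * emeasure (PiR P) (?B True)"
    by (intro sf.emeasure_pair_measure_Times sets_PiM_I_finite) auto
  also have "\<dots> = (\<Prod>p\<in>P. ennreal ((u - l) $ sym_idx (fst p) (snd p) False)) * (\<Prod>p\<in>P. ennreal ((u - l) $ sym_idx (fst p) (snd p) True))"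
    by (simp add: real_prod.emeasure_PiM le)
  also have "\<dots> = ennreal (\<Prod>p\<in>P. (u - l) $ sym_idx (fst p) (snd p) False * (u - l) $ sym_idx (fst p) (snd p) True)"
    by (simp add: prod_ennreal le prod.distrib ennreal_mult'[symmetric] prod_nonneg)
  also have "(\<Prod>p\<in>P. (u - l) $ sym_idx (fst p) (snd p) False * (u - l) $ sym_idx (fst p) (snd p) True) =
      (\<Prod>i\<in>UNIV. (u - l) $ i)"
    unfolding prod_sym_idx P by (intro prod.cong refl) auto
  also have "\<dots> = (\<Prod>b\<in>Basis. (u - l) \<bullet> b)"
  proof -
    have B: "(Basis :: (real^'n sym_idx) set) = (\<lambda>i. axis i 1) ` UNIV"
      by (auto simp: Basis_vec_def)
    have inj: "inj (\<lambda>i. axis i (1::real) :: real^'n sym_idx)"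
      by (auto simp: inj_def axis_eq_axis)
    show ?thesis unfolding B prod.reindex[OF inj] o_def inner_axis by simp
  qed
  finally show "emeasure (distr ?N borel ?f) (box l u) = ennreal (\<Prod>b\<in>Basis. (u - l) \<bullet> b)" .
qed simp

lemma nn_integral_sym_lborel_re_im:
  fixes g :: "'n::{finite,linorder} cmat \<Rightarrow> ennreal"
  assumes g: "g \<in> borel_measurable borel"
  shows "(\<integral>\<^sup>+z. g z \<partial>sym_lborel) =
    (\<integral>\<^sup>+y. (\<integral>\<^sup>+x. g (cpl (sym_pad UNIV x) (sym_pad UNIV y)) \<partial>PiR (pairs_on UNIV)) \<partial>PiR (pairs_on UNIV))"
proof -
  let ?P = "PiR (pairs_on (UNIV :: 'n set))"
  let ?f = "\<lambda>p. cpl (sym_pad UNIV (fst p)) (sym_pad UNIV (snd p)) :: 'n cmat"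
  have sf: "sigma_finite_measure ?P" by (rule real_prod.sigma_finite) simp
  interpret pair_sigma_finite ?P ?P by (intro pair_sigma_finite.intro sf)
  have gf: "(\<lambda>p. g (?f p)) \<in> borel_measurable (?P \<Otimes>\<^sub>M ?P)"
    by (rule measurable_compose[OF cpl_measurable g])
  have T: "(\<lambda>p. sym_coords (?f p)) \<in> ?P \<Otimes>\<^sub>M ?P \<rightarrow>\<^sub>M borel"
    by (rule measurable_compose[OF cpl_measurable sym_coords_measurable])
  have G: "(\<lambda>x. g (sym_of x)) \<in> borel_measurable borel"
    by (rule measurable_compose[OF sym_of_measurable g])
  have tr: "transpose (?f p) = ?f p" for p
    by (simp add: vec_eq_iff transpose_def cpl_def sym_pad_sym[of UNIV "fst p"] sym_pad_sym[of UNIV "snd p"])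
  have "(\<integral>\<^sup>+z. g z \<partial>sym_lborel) = (\<integral>\<^sup>+x. g (sym_of x) \<partial>lborel)"
    by (rule nn_integral_sym_lborel[OF g])
  also have "\<dots> = (\<integral>\<^sup>+p. g (sym_of (sym_coords (?f p))) \<partial>(?P \<Otimes>\<^sub>M ?P))"
    unfolding distr_cpl_sym_coords[symmetric]
    by (rule nn_integral_distr[OF T]) (use G in simp)
  also have "\<dots> = (\<integral>\<^sup>+p. g (?f p) \<partial>(?P \<Otimes>\<^sub>M ?P))" by (simp only: sym_of_sym_coords[OF tr])
  also have "\<dots> = (\<integral>\<^sup>+x. (\<integral>\<^sup>+y. g (cpl (sym_pad UNIV x) (sym_pad UNIV y)) \<partial>?P) \<partial>?P)"
    using sigma_finite_measure.nn_integral_fst[OF sf gf] by simp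
  also have "\<dots> = (\<integral>\<^sup>+y. (\<integral>\<^sup>+x. g (cpl (sym_pad UNIV x) (sym_pad UNIV y)) \<partial>?P) \<partial>?P)"
    using gf by (intro Fubini'[symmetric]) (simp add: case_prod_beta)
  finally show ?thesis .
qed

text \<open>The argument s - n - 1 joins (det y)^s with the density (det y)^(-n-1) of the measure; 2
  s - (n+1)/2 is the exponent that the integral over the real part leaves on det (y + Im
  \<xi>).\<close>

definition hua_const :: "nat \<Rightarrow> real \<Rightarrow> real" where
  "hua_const n s = re_const n s * im_const n (s - real n - 1) (2 * s - real (n + 1) / 2)"

lemma hua_const_pos: "s > real n \<Longrightarrow> hua_const n s > 0"
  unfolding hua_const_def by (intro mult_pos_pos re_const_pos im_const_pos) (auto simp: field_simps)

lemma nn_integral_hua: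
  fixes \<xi> :: "'n::{finite,linorder} cmat"
  assumes \<xi>: "\<xi> \<in> siegel_space" and s: "s > real CARD('n)"
  shows "(\<integral>\<^sup>+z. ennreal (cmod (det (z - map_matrix cnj \<xi>)) powr (- 2 * s) * det (map_matrix Im z) powr s) \<partial>siegel_measure) =
    ennreal (hua_const CARD('n) s * det (map_matrix Im \<xi>) powr (- s))"
proof -
  let ?n = "CARD('n)"
  define \<alpha> where "\<alpha> = s - real ?n - 1"
  define \<beta> where "\<beta> = 2 * s - real (?n + 1) / 2"
  define X where "X = (\<chi> i j. Re (\<xi> $ i $ j))"
  define Y where "Y = map_matrix Im \<xi>"
  let ?g = "\<lambda>z. indicator siegel_space z * (ennreal (det (map_matrix Im z) powr \<alpha>) * ennreal (cmod (det (z - map_matrix cnj \<xi>)) powr (- 2 * s)))"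
  let ?P = "PiR (pairs_on (UNIV :: 'n set))"
  have Y: "pos_def_mat Y" using \<xi> by (simp add: Y_def siegel_space_def)
  have \<alpha>\<beta>: "\<alpha> > -1" "\<beta> - \<alpha> > real ?n" using s by (auto simp: \<alpha>_def \<beta>_def field_simps)
  have sn: "s > real ?n / 2" using s by simp
  have [measurable]: "(\<lambda>z. cmod (det (z - map_matrix cnj \<xi>))) \<in> borel_measurable borel"
    by (intro borel_measurable_continuous_onI continuous_intros)
  have gm: "?g \<in> borel_measurable borel" by measurable
  have fm: "(\<lambda>z. ennreal (cmod (det (z - map_matrix cnj \<xi>)) powr (- 2 * s) * det (map_matrix Im z) powr s)) \<in> borel_measurable borel"
    by measurable
  have w: "siegel_weight z * det (map_matrix Im z) powr s = det (map_matrix Im z) powr \<alpha>" if "z \<in> siegel_space" for z :: "'n cmat"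
  proof -
    have d: "det (map_matrix Im z) > 0" by (rule det_Im_pos[OF that])
    have "siegel_weight z = det (map_matrix Im z) powr (- real ?n - 1)"
      unfolding siegel_weight_def
      using d powr_real_of_int'[of "det (map_matrix Im z)" "- int ?n - 1"] by simp
    then show ?thesis by (simp add: \<alpha>_def powr_add[symmetric] algebra_simps)
  qed
  have "(\<integral>\<^sup>+z. ennreal (cmod (det (z - map_matrix cnj \<xi>)) powr (- 2 * s) * det (map_matrix Im z) powr s) \<partial>siegel_measure) = (\<integral>\<^sup>+z. ?g z \<partial>sym_lborel)"
    unfolding nn_integral_siegel_measure[OF fm]
  proof (rule nn_integral_cong)
    fix z :: "'n cmat"
    show "indicator siegel_space z * ennreal (siegel_weight z) * ennreal (cmod (det (z - map_matrix cnj \<xi>)) powr (- 2 * s) * det (map_matrix Im z) powr s) = ?g z"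
    proof (cases "z \<in> siegel_space")
      case True
      then show ?thesis
        using siegel_weight_pos[OF True] w[OF True]
        by (simp add: ennreal_mult'[symmetric] mult_ac)
    qed simp
  qed
  also have "\<dots> = (\<integral>\<^sup>+y. (\<integral>\<^sup>+x. ?g (cpl (sym_pad UNIV x) (sym_pad UNIV y)) \<partial>?P) \<partial>?P)"
    by (rule nn_integral_sym_lborel_re_im[OF gm])
  also have "\<dots> = (\<integral>\<^sup>+y. ennreal (re_const ?n s) * ennreal (indicator {y. pos_def_mat y} (sym_pad UNIV y + off_id UNIV) *
      (det (sym_pad UNIV y + off_id UNIV) powr \<alpha> * det (sym_pad UNIV y + Y) powr (- \<beta>))) \<partial>?P)"
  proof (rule nn_integral_cong)
    fix c :: "'n \<times> 'n \<Rightarrow> real"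
    define y where "y = sym_pad UNIV c"
    have off: "off_id UNIV = (0 :: ((real, 'n) vec, 'n) vec)" by (simp add: off_id_def vec_eq_iff)
    have ysym: "transpose y = y" by (simp add: vec_eq_iff transpose_def y_def sym_pad_sym[of UNIV c])
    have Im: "map_matrix Im (cpl x y) = y" for x by (simp add: vec_eq_iff cpl_def)
    have tr: "transpose (cpl (sym_pad UNIV x) y) = cpl (sym_pad UNIV x) y" for x
      by (simp add: vec_eq_iff transpose_def cpl_def y_def sym_pad_sym[of UNIV c] sym_pad_sym[of UNIV x])
    have mem: "cpl (sym_pad UNIV x) y \<in> siegel_space \<longleftrightarrow> pos_def_mat y" for x
      by (simp add: siegel_space_def Im tr)
    \<comment> \<open>Subtracting the conjugate adds imaginary parts. The translation by X
      disappears from the integral over x; y + Y is the parameter of the real-part integral, and Y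
      that of the imaginary-part integral.\<close>
    have diff: "cpl (sym_pad UNIV x) y - map_matrix cnj \<xi> = cpl (sym_pad UNIV x + (- X)) (y + Y)" for x
      by (simp add: vec_eq_iff cpl_def X_def Y_def complex_eq_iff)
    have "(\<integral>\<^sup>+x. ?g (cpl (sym_pad UNIV x) y) \<partial>?P) =
        ennreal (re_const ?n s) * ennreal (indicator {y. pos_def_mat y} y * (det y powr \<alpha> * det (y + Y) powr (- \<beta>)))"
    proof (cases "pos_def_mat y")
      case False
      then show ?thesis by (simp add: mem)
    next
      case True
      have YY: "pos_def_mat (y + Y)"
        using True Y by (auto simp: pos_def_mat_def transpose_add matrix_vector_mult_add_rdistrib inner_add_right intro!: add_pos_pos)
      have m: "(\<lambda>x. ennreal (cmod (det (cpl x (y + Y))) powr (- 2 * s))) \<in> borel_measurable borel" by measurable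
      have "(\<integral>\<^sup>+x. ?g (cpl (sym_pad UNIV x) y) \<partial>?P) =
          (\<integral>\<^sup>+x. ennreal (det y powr \<alpha>) * ennreal (cmod (det (cpl (sym_pad UNIV x + (- X)) (y + Y))) powr (- 2 * s)) \<partial>?P)"
        using True by (simp add: mem Im diff)
      also have "\<dots> = ennreal (det y powr \<alpha>) * (\<integral>\<^sup>+x. ennreal (cmod (det (cpl (sym_pad UNIV x + (- X)) (y + Y))) powr (- 2 * s)) \<partial>?P)"
      proof (rule nn_integral_cmult)
        have "(\<lambda>x. ennreal (cmod (det (cpl (x + (- X)) (y + Y))) powr (- 2 * s))) \<in> borel_measurable borel"
          by (rule measurable_compose[OF _ m]) (intro borel_measurable_continuous_onI continuous_intros)
        from measurable_compose[OF sym_pad_measurable this]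
        show "(\<lambda>x. ennreal (cmod (det (cpl (sym_pad UNIV x + (- X)) (y + Y))) powr (- 2 * s))) \<in> borel_measurable ?P" .
      qed
      also have "(\<integral>\<^sup>+x. ennreal (cmod (det (cpl (sym_pad UNIV x + (- X)) (y + Y))) powr (- 2 * s)) \<partial>?P) =
          (\<integral>\<^sup>+x. ennreal (cmod (det (cpl (sym_pad UNIV x) (y + Y))) powr (- 2 * s)) \<partial>?P)"
        by (rule nn_integral_sym_pad_shift[OF m]) (auto simp: X_def siegel_space_sym[OF \<xi>])
      also have "\<dots> = ennreal (re_const ?n s * det (y + Y) powr (real (?n + 1) / 2 - 2 * s))"
        using YY sn by (intro nn_integral_re_part) (auto simp: padded_def)
      also have "real (?n + 1) / 2 - 2 * s = - \<beta>" by (simp add: \<beta>_def)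
      finally show ?thesis
        using True re_const_pos[OF sn] by (simp add: ennreal_mult'[symmetric] mult_ac)
    qed
    then show "(\<integral>\<^sup>+x. ?g (cpl (sym_pad UNIV x) (sym_pad UNIV c)) \<partial>?P) =
        ennreal (re_const ?n s) * ennreal (indicator {y. pos_def_mat y} (sym_pad UNIV c + off_id UNIV) *
      (det (sym_pad UNIV c + off_id UNIV) powr \<alpha> * det (sym_pad UNIV c + Y) powr (- \<beta>)))"
      unfolding off y_def by simp
  qed
  also have "\<dots> = ennreal (re_const ?n s) * (\<integral>\<^sup>+y. ennreal (indicator {y. pos_def_mat y} (sym_pad UNIV y + off_id UNIV) *
      (det (sym_pad UNIV y + off_id UNIV) powr \<alpha> * det (sym_pad UNIV y + Y) powr (- \<beta>))) \<partial>?P)"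
  proof (rule nn_integral_cmult)
    have [measurable]: "(\<lambda>y. det (y + Q)) \<in> borel_measurable borel" for Q :: "((real, 'n) vec, 'n) vec"
      by (intro borel_measurable_continuous_onI continuous_intros)
    have ind [measurable]: "(\<lambda>y. indicator {y. pos_def_mat y} (y + off_id UNIV) :: real) \<in> borel_measurable (borel :: ((real, 'n) vec, 'n) vec measure)"
      by (rule measurable_compose[OF _ borel_measurable_indicator[OF pos_def_mat_borel]])
         (intro borel_measurable_continuous_onI continuous_intros)
    have "(\<lambda>y. ennreal (indicator {y. pos_def_mat y} (y + off_id UNIV) *
      (det (y + off_id UNIV) powr \<alpha> * det (y + Y) powr (- \<beta>)))) \<in> borel_measurable borel"
      by measurable
    from measurable_compose[OF sym_pad_measurable this]
    show "(\<lambda>y. ennreal (indicator {y. pos_def_mat y} (sym_pad UNIV y + off_id UNIV) *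
      (det (sym_pad UNIV y + off_id UNIV) powr \<alpha> * det (sym_pad UNIV y + Y) powr (- \<beta>)))) \<in> borel_measurable ?P" .
  qed
  also have "\<dots> = ennreal (re_const ?n s) * ennreal (im_const ?n \<alpha> \<beta> * det Y powr (\<alpha> - \<beta> + real (?n + 1) / 2))"
    using Y \<alpha>\<beta> by (subst nn_integral_im_part) (auto simp: padded_def)
  also have "\<alpha> - \<beta> + real (?n + 1) / 2 = - s" by (simp add: \<alpha>_def \<beta>_def field_simps)
  also have "ennreal (re_const ?n s) * ennreal (im_const ?n \<alpha> \<beta> * det Y powr (- s)) =
      ennreal (hua_const ?n s * det Y powr (- s))"
    using re_const_pos[OF sn] by (simp add: ennreal_mult'[symmetric] hua_const_def \<alpha>_def \<beta>_def mult_ac)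
  finally show ?thesis by (simp only: Y_def)
qed

lemma Gamma_duplication_real:
  assumes "(x::real) > 0"
  shows "Gamma x * Gamma (x + 1 / 2) = 2 powr (1 - 2 * x) * sqrt pi * Gamma (2 * x)"
proof -
  have nz: "complex_of_real y \<notin> \<int>\<^sub>\<le>\<^sub>0" if "y > 0" for y
    using that by (auto elim!: nonpos_Ints_cases simp: complex_eq_iff)
  have "complex_of_real (Gamma x * Gamma (x + 1 / 2)) = complex_of_real (2 powr (1 - 2 * x) * sqrt pi * Gamma (2 * x))"
    using Gamma_legendre_duplication[of "complex_of_real x"] nz[of x] nz[of "x + 1 / 2"] assms
    by (simp add: Gamma_complex_of_real[symmetric] powr_def exp_of_real[symmetric])
  then show ?thesis by (simp only: of_real_eq_iff)
qed

lemma prod_lessThan_add: "(\<Prod>j<n + (m::nat). f j) = (\<Prod>j<n. f j) * (\<Prod>k<m. (f (n + k) :: 'a::comm_monoid_mult))"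
  by (induction m) (simp_all add: mult_ac)

lemma prod_lessThan_double: "(\<Prod>j<n + (n::nat). f j) = (\<Prod>k<n. (f (2 * k) :: 'a::comm_monoid_mult)) * (\<Prod>k<n. f (2 * k + 1))"
  by (induction n) (simp_all add: mult_ac mult_2_right)

lemma prod_powr: "(c::real) > 0 \<Longrightarrow> (\<Prod>k<(n::nat). c powr f k) = c powr (\<Sum>k<n. f k)"
  by (induction n) (simp_all add: powr_add)

lemma sum_lessThan_real: "(\<Sum>k<n. real k) = real n * (real n - 1) / 2"
  by (induction n) (simp_all add: field_simps)

text \<open>The recursion unrolled, with each family of Gamma factors in a product of its own, so
  that the later cancellation is a matter of rearranging arguments.\<close>

lemma re_const_prod:
  "re_const n s = (\<Prod>k<n. pi powr (real k / 2) * sqrt pi) *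
     ((\<Prod>k<n. Gamma (2 * s - real k - 1 / 2)) * (\<Prod>k<n. Gamma (s - (real k + 1) / 2)) /
      ((\<Prod>k<n. Gamma (2 * s - (real k + 1) / 2)) * (\<Prod>k<n. Gamma (s - real k / 2))))"
proof (induction n)
  case (Suc n)
  have "2 * s - (real n + 1) / 2 - real n / 2 = 2 * s - real n - 1 / 2" "s - real n / 2 - 1 / 2 = s - (real n + 1) / 2"
    by (simp_all add: field_simps)
  then have "re_const (Suc n) s = re_const n s * (pi powr (real n / 2) * Gamma (2 * s - real n - 1 / 2) / Gamma (2 * s - (real n + 1) / 2)) *
      (sqrt pi * Gamma (s - (real n + 1) / 2) / Gamma (s - real n / 2))"
    by (simp only: re_const.simps vec_const_def line_const_def of_nat_add of_nat_1)
  then show ?case unfolding Suc by (simp add: mult_ac)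
qed simp

lemma im_const_prod:
  "im_const n \<alpha> \<beta> = (\<Prod>k<n. pi powr (real k / 2)) *
     ((\<Prod>k<n. Gamma (\<beta> - \<alpha> - real k - 1 / 2)) * (\<Prod>k<n. Gamma (\<beta> - \<alpha> - real k - 1)) * (\<Prod>k<n. Gamma (\<alpha> + real k / 2 + 1)) /
      ((\<Prod>k<n. Gamma (\<beta> - \<alpha> - (real k + 1) / 2)) * (\<Prod>k<n. Gamma (\<beta> - real k / 2))))"
proof (induction n)
  case (Suc n)
  have "\<beta> - \<alpha> - (real n + 1) / 2 - real n / 2 = \<beta> - \<alpha> - real n - 1 / 2"
     "\<alpha> + real n / 2 + 1 + (\<beta> - \<alpha> - real n - 1) = \<beta> - real n / 2"
    by (simp_all add: field_simps)
  then have "im_const (Suc n) \<alpha> \<beta> = im_const n \<alpha> \<beta> *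
      (pi powr (real n / 2) * Gamma (\<beta> - \<alpha> - real n - 1 / 2) / Gamma (\<beta> - \<alpha> - (real n + 1) / 2)) *
      (Gamma (\<alpha> + real n / 2 + 1) * Gamma (\<beta> - \<alpha> - real n - 1) / Gamma (\<beta> - real n / 2))"
    by (simp only: im_const.simps vec_const_def Beta_def of_nat_add of_nat_1)
  then show ?case unfolding Suc by (simp add: mult_ac)
qed simp

text \<open>The Gamma factors cancel after sorting the arguments \<open>2 s - j / 2\<close> and \<open>s + n / 2 - j / 2\<close>,
  \<open>j < 2 n\<close>, once by parity and once by halves.\<close>

lemma hua_const_eq:
  assumes s: "s > real n"
  shows "hua_const n s = 2 powr (- 2 * (real n * s)) * (2 powr (real (n * (n + 3)) / 2) * pi powr (real (n * (n + 1)) / 2) *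
     (\<Prod>r = 1..n. Gamma (s - real (n + r) / 2) / Gamma (s - (real r - 1) / 2)))"
proof -
  define \<alpha> where "\<alpha> = s - real n - 1"
  define \<beta> where "\<beta> = 2 * s - real (n + 1) / 2"
  let ?G = "Gamma :: real \<Rightarrow> real"
  define N1 where "N1 = (\<Prod>k<n. ?G (2 * s - real k - 1 / 2))"
  define N2 where "N2 = (\<Prod>k<n. ?G (s - (real k + 1) / 2))"
  define D1 where "D1 = (\<Prod>k<n. ?G (2 * s - (real k + 1) / 2))"
  define D2 where "D2 = (\<Prod>k<n. ?G (s - real k / 2))"
  define N3 where "N3 = (\<Prod>k<n. ?G (\<beta> - \<alpha> - real k - 1 / 2))"
  define N4 where "N4 = (\<Prod>k<n. ?G (\<beta> - \<alpha> - real k - 1))"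
  define N5 where "N5 = (\<Prod>k<n. ?G (\<alpha> + real k / 2 + 1))"
  define D3 where "D3 = (\<Prod>k<n. ?G (\<beta> - \<alpha> - (real k + 1) / 2))"
  define D4 where "D4 = (\<Prod>k<n. ?G (\<beta> - real k / 2))"
  define M1 where "M1 = (\<Prod>k<n. ?G (2 * s - real k - 1))"
  have ba: "\<beta> - \<alpha> = s + (real n + 1) / 2" by (simp add: \<alpha>_def \<beta>_def field_simps)
  have pos: "N1 > 0" "N2 > 0" "D1 > 0" "D2 > 0" "D3 > 0" "D4 > 0" "M1 > 0"
    unfolding N1_def N2_def D1_def D2_def D3_def D4_def M1_def ba
    unfolding \<beta>_def using s by (auto intro!: prod_pos Gamma_real_pos simp: field_simps)
  have 1: "D1 * D4 = N1 * M1"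
  proof -
    have "D1 * D4 = (\<Prod>j<n + n. ?G (2 * s - (real j + 1) / 2))"
      unfolding prod_lessThan_add D1_def D4_def \<beta>_def 
      by (intro arg_cong2[of _ _ _ _ "(*)"] prod.cong refl arg_cong[of _ _ Gamma]) (simp_all add: field_simps)
    also have "\<dots> = N1 * M1"
      unfolding prod_lessThan_double N1_def M1_def 
      by (intro arg_cong2[of _ _ _ _ "(*)"] prod.cong refl arg_cong[of _ _ Gamma]) (simp_all add: field_simps)
    finally show ?thesis .
  qed
  have 2: "N3 * N4 = D3 * D2"
  proof -
    have "N3 * N4 = (\<Prod>j<n + n. ?G (s + real n / 2 - real j / 2))"
      unfolding prod_lessThan_double N3_def N4_def ba 
      by (intro arg_cong2[of _ _ _ _ "(*)"] prod.cong refl arg_cong[of _ _ Gamma]) (simp_all add: field_simps)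
    also have "\<dots> = D3 * D2"
      unfolding prod_lessThan_add D3_def D2_def ba 
      by (intro arg_cong2[of _ _ _ _ "(*)"] prod.cong refl arg_cong[of _ _ Gamma]) (simp_all add: field_simps)
    finally show ?thesis .
  qed
  have 3: "N2 * D2 = (\<Prod>k<n. 2 powr (2 + real k - 2 * s) * sqrt pi) * M1"
    unfolding N2_def D2_def M1_def prod.distrib[symmetric]
  proof (rule prod.cong[OF refl])
    fix k assume "k \<in> {..<n}"
    then have "s - (real k + 1) / 2 > 0" using s by (simp add: field_simps)
    then have "?G (s - (real k + 1) / 2) * ?G (s - (real k + 1) / 2 + 1 / 2) =
        2 powr (1 - 2 * (s - (real k + 1) / 2)) * sqrt pi * ?G (2 * (s - (real k + 1) / 2))"
      by (rule Gamma_duplication_real)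
    moreover have "s - (real k + 1) / 2 + 1 / 2 = s - real k / 2" "1 - 2 * (s - (real k + 1) / 2) = 2 + real k - 2 * s"
        "2 * (s - (real k + 1) / 2) = 2 * s - real k - 1"
      by (simp_all add: field_simps)
    ultimately show "?G (s - (real k + 1) / 2) * ?G (s - real k / 2) = 2 powr (2 + real k - 2 * s) * sqrt pi * ?G (2 * s - real k - 1)"
      by (simp only:)
  qed
  have N5: "N5 = (\<Prod>r=1..n. ?G (s - real (n + r) / 2))"
    unfolding N5_def \<alpha>_def
    by (rule prod.reindex_bij_witness[of _ "\<lambda>r. n - r" "\<lambda>k. n - k"]) (auto simp: of_nat_diff field_simps)
  have D2: "D2 = (\<Prod>r=1..n. ?G (s - (real r - 1) / 2))"
    unfolding D2_def
    by (rule prod.reindex_bij_witness[of _ "\<lambda>r. r - 1" "\<lambda>k. k + 1"]) (auto simp: of_nat_diff)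
  have "hua_const n s = (\<Prod>k<n. pi powr (real k / 2) * sqrt pi) * (\<Prod>k<n. pi powr (real k / 2)) *
      (N1 * N2 / (D1 * D2) * (N3 * N4 * N5 / (D3 * D4)))"
    unfolding hua_const_def \<alpha>_def[symmetric] \<beta>_def[symmetric] re_const_prod im_const_prod
    unfolding N1_def N2_def D1_def D2_def N3_def N4_def N5_def D3_def D4_def by simp
  also have "N1 * N2 / (D1 * D2) * (N3 * N4 * N5 / (D3 * D4)) = (N1 * N2 * N5) * (N3 * N4) / ((D1 * D4) * (D2 * D3))"
    by (simp add: mult_ac)
  also have "\<dots> = N2 * N5 / M1"
    unfolding 1 2 using pos by (simp add: field_simps)
  also have "\<dots> = (\<Prod>k<n. 2 powr (2 + real k - 2 * s) * sqrt pi) * (N5 / D2)"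
    using 3 pos by (simp add: field_simps)
  also have "(\<Prod>k<n. pi powr (real k / 2) * sqrt pi) * (\<Prod>k<n. pi powr (real k / 2)) * ((\<Prod>k<n. 2 powr (2 + real k - 2 * s) * sqrt pi) * (N5 / D2)) =
     (\<Prod>k<n. 2 powr (2 + real k - 2 * s)) * (\<Prod>k<n. pi powr (real k + 1)) * (N5 / D2)"
  proof -
    have "pi powr (real k / 2) * sqrt pi * pi powr (real k / 2) * sqrt pi = pi powr (real k + 1)" for k
      unfolding powr_half_sqrt[OF pi_ge_zero, symmetric] powr_add[symmetric] by (simp add: add.commute)
    then have "(\<Prod>k<n. pi powr (real k + 1)) = (\<Prod>k<n. pi powr (real k / 2) * sqrt pi * pi powr (real k / 2) * sqrt pi)"
      by simp
    then show ?thesis by (simp only: prod.distrib mult_ac)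
  qed
  also have "(\<Prod>k<n. 2 powr (2 + real k - 2 * s)) = 2 powr (- 2 * (real n * s)) * 2 powr (real (n * (n + 3)) / 2)"
    by (simp add: prod_powr powr_add[symmetric] sum.distrib sum_subtractf sum_lessThan_real field_simps)
  also have "(\<Prod>k<n. pi powr (real k + 1)) = pi powr (real (n * (n + 1)) / 2)"
    by (simp add: prod_powr sum.distrib sum_lessThan_real field_simps)
  also have "N5 / D2 = (\<Prod>r = 1..n. Gamma (s - real (n + r) / 2) / Gamma (s - (real r - 1) / 2))"
    unfolding N5 D2 by (simp only: prod_dividef)
  finally show ?thesis by (simp only: mult.assoc)
qed

text \<open>The power 4^(nm) is |2i|^(2nm), matching the factor 1/(2i) in the definition of
  \<open>f1\<close>; apart from it the constant of Hua's integral at s = m is the normalising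
  constant.\<close>

lemma hua_const_C_const:
  assumes "m > n"
  shows "hua_const n (real m) = C_const m n / 4 ^ (n * m)"
proof -
  have "(2::real) powr (- 2 * (real n * real m)) = inverse (4 ^ (n * m))"
  proof -
    have "(2::real) powr (- 2 * (real n * real m)) = (2 powr 2) powr (- real (n * m))"
      by (simp only: powr_powr) simp
    also have "\<dots> = inverse (4 powr real (n * m))" by (simp only: powr_minus) simp
    also have "\<dots> = inverse (4 ^ (n * m))" by (subst powr_realpow) simp_all
    finally show ?thesis .
  qed
  then show ?thesis using assms by (simp add: hua_const_eq C_const_def field_simps)
qed

section \<open>The Poincare series: uniform bounds, convergence and holomorphy\<close>

section \<open>Estimates for the kernel\<close>

lemma norm_det_le:
  fixes A :: "complex^'n^'n"
  assumes "\<And>i j. cmod (A $ i $ j) \<le> b"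
  shows "cmod (det A) \<le> fact CARD('n) * b ^ CARD('n)"
proof -
  have "cmod (det A) \<le> (\<Sum>p\<in>{p. p permutes UNIV}. cmod (of_int (sign p) * (\<Prod>i\<in>UNIV. A $ i $ p i)))"
    unfolding det_def by (rule norm_sum)
  also have "\<dots> \<le> (\<Sum>p\<in>{p :: 'n \<Rightarrow> 'n. p permutes UNIV}. b ^ CARD('n))"
  proof (rule sum_mono)
    fix p :: "'n \<Rightarrow> 'n"
    have "cmod (of_int (sign p) * (\<Prod>i\<in>UNIV. A $ i $ p i)) = (\<Prod>i\<in>UNIV. cmod (A $ i $ p i))"
      by (simp add: norm_mult sign_def prod_norm)
    also have "\<dots> \<le> (\<Prod>i\<in>(UNIV :: 'n set). b)" by (intro prod_mono) (auto intro: assms)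
    finally show "cmod (of_int (sign p) * (\<Prod>i\<in>UNIV. A $ i $ p i)) \<le> b ^ CARD('n)" by simp
  qed
  also have "\<dots> = fact CARD('n) * b ^ CARD('n)"
    by (simp add: card_permutations)
  finally show ?thesis .
qed

lemma norm_component_le: "cmod ((A :: complex^'n^'m) $ i $ j) \<le> norm A"
  by (rule order_trans[OF Finite_Cartesian_Product.norm_nth_le[of "A $ i" j] Finite_Cartesian_Product.norm_nth_le[of A i]])

lemma norm_matrix_mult_component_le:
  fixes A B :: "complex^'n^'n" and a b :: real
  assumes "\<And>i j. cmod (A $ i $ j) \<le> a" "\<And>i j. cmod (B $ i $ j) \<le> b" "0 \<le> a"
  shows "cmod ((A ** B) $ i $ j) \<le> CARD('n) * (a * b)"
proof -
  have "cmod ((A ** B) $ i $ j) \<le> (\<Sum>k\<in>UNIV. cmod (A $ i $ k * B $ k $ j))"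
    unfolding matrix_matrix_mult_def by (simp add: norm_sum)
  also have "\<dots> \<le> (\<Sum>k\<in>(UNIV :: 'n set). a * b)"
    by (intro sum_mono) (auto simp: norm_mult intro!: mult_mono assms)
  finally show ?thesis by simp
qed

text \<open>For u = (z - cnj w)^-1 e_j the coercivity of z gives |u|^2 \<le> k Im <u, z u>. The
  imaginary part of w can only enlarge the right side to k Im <u, e_j> \<le> k |u|. The bound does
  not involve w.\<close>

lemma norm_inverse_diff_cnj:
  assumes z: "z \<in> siegel_compact k" and w: "w \<in> siegel_space"
  shows "cmod (matrix_inv (z - map_matrix cnj w) $ i $ j) \<le> real k"
proof -
  let ?M = "z - map_matrix cnj w"
  have zs: "z \<in> siegel_space" using z siegel_compact_subset by blast
  define v :: "complex^'a" where "v = axis j 1"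
  define u where "u = matrix_inv ?M *v v"
  have Mu: "?M *v u = v"
    by (simp add: u_def matrix_vector_mul_assoc matrix_inv_right invertible_diff_cnj[OF zs w])
  have "(norm u)\<^sup>2 \<le> real k * Im (herm u (z *v u))" using z by (simp add: siegel_compact_def)
  also have "\<dots> \<le> real k * Im (herm u (?M *v u))"
    unfolding Im_herm_diff_cnj[OF siegel_space_transpose[OF w]]
    using siegel_space_pos_ge[OF w, of u] by (intro mult_left_mono) auto
  also have "\<dots> \<le> real k * (norm u * norm v)"
  proof (rule mult_left_mono)
    have "Im (herm u (?M *v u)) \<le> cmod (herm u (?M *v u))"
      by (rule order_trans[OF abs_ge_self abs_Im_le_cmod])
    also have "\<dots> \<le> norm u * norm (?M *v u)" by (rule norm_herm_le)
    finally show "Im (herm u (?M *v u)) \<le> norm u * norm v" by (simp only: Mu)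
  qed simp
  finally have "(norm u)\<^sup>2 \<le> real k * norm u" by (simp add: v_def)
  then have "norm u \<le> real k"
    by (cases "norm u = 0") (auto simp: power2_eq_square)
  moreover have "cmod (u $ i) \<le> norm u" by (rule Finite_Cartesian_Product.norm_nth_le)
  moreover have "u $ i = matrix_inv ?M $ i $ j" by (simp add: u_def v_def matrix_mult_axis)
  ultimately show ?thesis by simp
qed

text \<open>The factorisation z' - cnj w = (z - cnj w)(1 + R (z' - z)) with R bounded independently
  of w. Uniformity in w matters because w will run through a whole orbit.\<close>

lemma det_diff_cnj_harnack:
  obtains C where "C > 0"
    "\<And>z z' w. z \<in> siegel_compact k \<Longrightarrow> z' \<in> siegel_compact k \<Longrightarrow> w \<in> siegel_space \<Longrightarrow>
      cmod (det (z' - map_matrix cnj w)) \<le> C * cmod (det (z - map_matrix cnj (w :: 'n::finite cmat)))"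
proof
  let ?b = "1 + real CARD('n) * (real k * (2 * real k))"
  let ?C = "fact CARD('n) * ?b ^ CARD('n)"
  have "?b > 0" by (intro add_pos_nonneg) auto
  then show "?C > 0" by simp
  fix z z' w :: "'n cmat"
  assume z: "z \<in> siegel_compact k" and z': "z' \<in> siegel_compact k" and w: "w \<in> siegel_space"
  have zs: "z \<in> siegel_space" using z siegel_compact_subset by blast
  let ?M = "z - map_matrix cnj w" and ?R = "matrix_inv (z - map_matrix cnj w)"
  have "?M ** (mat 1 + ?R ** (z' - z)) = z' - map_matrix cnj w"
    by (simp add: matrix_add_ldistrib matrix_mul_assoc matrix_inv_right invertible_diff_cnj[OF zs w])
  then have "det (z' - map_matrix cnj w) = det ?M * det (mat 1 + ?R ** (z' - z))" by (metis det_mul)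
  moreover have "cmod (det (mat 1 + ?R ** (z' - z))) \<le> ?C"
  proof (rule norm_det_le)
    fix i j
    have "cmod ((z' - z) $ i $ j) \<le> 2 * real k" for i j
    proof -
      have "cmod ((z' - z) $ i $ j) \<le> norm (z' - z)" by (rule norm_component_le)
      also have "\<dots> \<le> norm z' + norm z" by (rule norm_triangle_ineq4)
      finally show ?thesis using z z' by (simp add: siegel_compact_def)
    qed
    then have "cmod ((?R ** (z' - z)) $ i $ j) \<le> CARD('n) * (real k * (2 * real k))"
      by (intro norm_matrix_mult_component_le norm_inverse_diff_cnj[OF z w]) auto
    moreover have "cmod ((mat 1 :: 'n cmat) $ i $ j) \<le> 1" by (simp add: mat_def)
    ultimately show "cmod ((mat 1 + ?R ** (z' - z)) $ i $ j) \<le> ?b"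
      unfolding vector_add_component by (intro norm_triangle_le add_mono)
  qed
  ultimately show "cmod (det (z' - map_matrix cnj w)) \<le> ?C * cmod (det ?M)"
    by (simp only: norm_mult mult.commute[of ?C] mult_left_mono norm_ge_zero)
qed

lemma det_diff_cnj_swap:
  "cmod (det (z - map_matrix cnj w)) = cmod (det (w - map_matrix cnj (z :: 'n::finite cmat)))"
proof -
  have "w - map_matrix cnj z = map_matrix (\<lambda>x. (-1) * x) (map_matrix cnj (z - map_matrix cnj w))"
    by (simp add: vec_eq_iff)
  then have "det (w - map_matrix cnj z) = (-1) ^ CARD('n) * cnj (det (z - map_matrix cnj w))"
    by (simp only: det_scale det_map_cnj)
  then show ?thesis by (simp add: norm_mult norm_power)
qed

section \<open>Proper discontinuity\<close>

lemma finite_bounded_integer_matrices: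
  "finite {g :: real^'m::finite^'n::finite. \<forall>i j. g $ i $ j \<in> \<int> \<and> \<bar>g $ i $ j\<bar> \<le> B}"
proof -
  let ?S = "{x \<in> \<int>. \<bar>x\<bar> \<le> B}"
  have "finite ?S" by (rule finite_abs_int_segment)
  then have "finite (Pi\<^sub>E (UNIV :: 'n set) (\<lambda>_. Pi\<^sub>E (UNIV :: 'm set) (\<lambda>_. ?S)))"
    by (intro finite_PiE) auto
  then have "finite ((\<lambda>f. \<chi> i j. f i j) ` Pi\<^sub>E (UNIV :: 'n set) (\<lambda>_. Pi\<^sub>E (UNIV :: 'm set) (\<lambda>_. ?S)))"
    by (rule finite_imageI)
  moreover have "{g :: real^'m^'n. \<forall>i j. g $ i $ j \<in> \<int> \<and> \<bar>g $ i $ j\<bar> \<le> B} \<subseteq>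
      (\<lambda>f. \<chi> i j. f i j) ` Pi\<^sub>E (UNIV :: 'n set) (\<lambda>_. Pi\<^sub>E (UNIV :: 'm set) (\<lambda>_. ?S))"
    by (rule subsetI, rule_tac x = "\<lambda>i j. x $ i $ j" in image_eqI) (auto simp: vec_eq_iff)
  ultimately show ?thesis by (rule finite_subset[rotated])
qed

lemma Sp_int_subset: "Sp_int \<subseteq> Sp_real" by (auto simp: Sp_int_def)

text \<open>Coercivity at g.z bounds the columns of Cz + D by the form of z, then Az + B = (g.z)(Cz
  + D) is bounded as well. Bounds on these give bounds on the integral blocks, hence finitely many
  g.\<close>

lemma finite_Sp_int_return:
  "finite {g \<in> Sp_int. \<exists>z\<in>siegel_compact k. sp_act g z \<in> (siegel_compact k :: 'n::finite cmat set)}"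
proof -
  let ?n = "real CARD('n)"
  let ?K = "real k"
  define b where "b = ?K + ?n * (?K * ?K)"
  define b1 where "b1 = ?n * (2 * b * ?K)"
  define B where "B = b + b1 + ?n * (b1 * ?K)"
  have b0: "b \<ge> 0" "b1 \<ge> 0" "B \<ge> 0" by (auto simp: b_def b1_def B_def)
  have bound: "\<bar>g $ i $ j\<bar> \<le> B"
    if g: "g \<in> Sp_int" and z: "z \<in> siegel_compact k" "sp_act g z \<in> siegel_compact k"
    for g and z :: "'n cmat" and i j
  proof -
    have gr: "g \<in> Sp_real" using g Sp_int_subset by blast
    have zs: "z \<in> siegel_space" using z siegel_compact_subset by blast
    let ?P = "aut_num g z" and ?Q = "aut_den g z" and ?w = "sp_act g z"
    have zb: "cmod (z $ i $ j) \<le> ?K" for i j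
      using z(1) order_trans[OF norm_component_le, of z] by (auto simp: siegel_compact_def)
    have wb: "cmod (?w $ i $ j) \<le> ?K" for i j
      using z(2) order_trans[OF norm_component_le, of ?w] by (auto simp: siegel_compact_def)
    have Qb: "cmod (?Q $ i $ j) \<le> ?K" for i j
    proof -
      define e :: "complex^'n" where "e = axis j 1"
      have "(norm (?Q *v e))\<^sup>2 \<le> ?K * Im (herm (?Q *v e) (?w *v (?Q *v e)))"
        using z(2) by (simp add: siegel_compact_def)
      also have "?w *v (?Q *v e) = ?P *v e"
        by (simp add: matrix_vector_mul_assoc sp_act_mult_den[OF gr zs])
      also have "Im (herm (?Q *v e) (?P *v e)) = Im (herm e (z *v e))" by (rule aut_den_pos[OF gr zs])
      also have "herm e (z *v e) = z $ j $ j"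
        by (simp add: herm_def e_def matrix_mult_axis) (simp add: axis_def if_distrib[of "\<lambda>x. x * _"] if_distrib[of cnj] cong: if_cong)
      also have "?K * Im (z $ j $ j) \<le> ?K * ?K"
        using abs_Im_le_cmod[of "z $ j $ j"] zb[of j j] by (intro mult_left_mono) auto
      finally have "norm (?Q *v e) \<le> ?K"
        using power2_le_imp_le[of "norm (?Q *v e)" ?K] by (simp add: power2_eq_square)
      moreover have "cmod ((?Q *v e) $ i) \<le> norm (?Q *v e)" by (rule Finite_Cartesian_Product.norm_nth_le)
      ultimately show ?thesis by (simp add: e_def matrix_mult_axis)
    qed
    have Pb: "cmod (?P $ i $ j) \<le> ?n * (?K * ?K)" for i j
      unfolding sp_act_mult_den[OF gr zs, symmetric]
      by (intro norm_matrix_mult_component_le wb Qb) auto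
    \<comment> \<open>A and D stand for either row of real blocks of g. Conjugation isolates the
      first one, M - cnj M = A (z - cnj z), and the second follows by subtraction.\<close>
    have blocks: "cmod (A $ i $ j) \<le> B" "cmod (D $ i $ j) \<le> B"
      if real: "map_matrix cnj A = A" "map_matrix cnj D = D" and M: "\<And>i j. cmod ((A ** z + D) $ i $ j) \<le> b"
      for A D :: "'n cmat" and i j
    proof -
      let ?M = "A ** z + D" and ?R = "matrix_inv (z - map_matrix cnj z)"
      have "?M - map_matrix cnj ?M = A ** (z - map_matrix cnj z)"
        by (simp add: map_matrix_cnj_add map_matrix_cnj_mult real matrix_diff_ldistrib)
      then have A: "A = (?M - map_matrix cnj ?M) ** ?R"
        by (simp add: matrix_mul_assoc[symmetric] matrix_inv_right invertible_diff_cnj[OF zs zs])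
      have hb: "cmod ((?M - map_matrix cnj ?M) $ i $ j) \<le> 2 * b" for i j
      proof -
        have "cmod ((?M - map_matrix cnj ?M) $ i $ j) \<le> cmod (?M $ i $ j) + cmod (cnj (?M $ i $ j))"
          by (simp only: vector_minus_component nth_map_matrix norm_triangle_ineq4)
        then show ?thesis using M[of i j] by (simp only: complex_mod_cnj)
      qed
      have Ab: "cmod (A $ i $ j) \<le> b1" for i j
        unfolding b1_def
        by (subst A, rule norm_matrix_mult_component_le[OF hb norm_inverse_diff_cnj[OF z(1) zs]]) (use b0 in simp)
      have Azb: "cmod ((A ** z) $ i $ j) \<le> ?n * (b1 * ?K)" for i j
        by (rule norm_matrix_mult_component_le[OF Ab zb b0(2)])
      have "cmod (D $ i $ j) \<le> cmod (?M $ i $ j) + cmod ((A ** z) $ i $ j)"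
        using norm_triangle_ineq4[of "?M $ i $ j" "(A ** z) $ i $ j"] by simp
      also have "\<dots> \<le> b + ?n * (b1 * ?K)" by (intro add_mono M Azb)
      finally show "cmod (D $ i $ j) \<le> B" using b0 by (simp add: B_def)
      show "cmod (A $ i $ j) \<le> B" using Ab[of i j] b0 by (simp add: B_def add_increasing add_increasing2)
    qed
    have Mb: "cmod (?P $ i $ j) \<le> b" "cmod (?Q $ i $ j) \<le> b" for i j
      using Pb[of i j] Qb[of i j] by (auto simp: b_def intro: add_increasing add_increasing2)
    have 1: "cmod (block_A g $ i $ j) \<le> B" "cmod (block_B g $ i $ j) \<le> B" for i j
      using blocks[of "block_A g" "block_B g"] Mb(1) by (simp_all add: block_real aut_num_def)
    have 2: "cmod (block_C g $ i $ j) \<le> B" "cmod (block_D g $ i $ j) \<le> B" for i j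
      using blocks[of "block_C g" "block_D g"] Mb(2) by (simp_all add: block_real aut_den_def)
    show ?thesis
      using 1 2 by (cases i; cases j) (auto simp: block_A_def block_B_def block_C_def block_D_def)
  qed
  show ?thesis
    by (rule finite_subset[OF _ finite_bounded_integer_matrices[of B]]) (use bound in \<open>auto simp: Sp_int_def\<close>)
qed

section \<open>Congruence subgroups\<close>

lemma congruence_subgroup_Sp_int: "congruence_subgroup \<Gamma> \<Longrightarrow> \<Gamma> \<subseteq> Sp_int"
  using subgroup.subset[of \<Gamma> Sp_int_group] by (auto simp: congruence_subgroup_def Sp_int_group_def)

lemma congruence_subgroup_Sp_real: "congruence_subgroup \<Gamma> \<Longrightarrow> \<gamma> \<in> \<Gamma> \<Longrightarrow> \<gamma> \<in> Sp_real"
  using congruence_subgroup_Sp_int Sp_int_subset by blast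

lemma congruence_subgroup_1: "congruence_subgroup \<Gamma> \<Longrightarrow> mat 1 \<in> \<Gamma>"
  using subgroup.one_closed[of \<Gamma> Sp_int_group] by (auto simp: congruence_subgroup_def Sp_int_group_def)

lemma congruence_subgroup_mult: "congruence_subgroup \<Gamma> \<Longrightarrow> g \<in> \<Gamma> \<Longrightarrow> h \<in> \<Gamma> \<Longrightarrow> g ** h \<in> \<Gamma>"
  using subgroup.m_closed[of \<Gamma> Sp_int_group g h] by (auto simp: congruence_subgroup_def Sp_int_group_def)

lemma congruence_subgroup_inverse:
  assumes \<Gamma>: "congruence_subgroup \<Gamma>" and g: "g \<in> \<Gamma>"
  shows "matrix_inv g \<in> \<Gamma>" "matrix_inv g ** g = mat 1" "g ** matrix_inv g = mat 1"
proof -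
  have "invertible g" using congruence_subgroup_Sp_real[OF assms] by (simp add: Sp_real_def)
  then show i: "matrix_inv g ** g = mat 1" "g ** matrix_inv g = mat 1"
    by (rule matrix_inv_left, rule matrix_inv_right)
  let ?h = "inv\<^bsub>Sp_int_group\<^esub> g"
  have h: "?h \<in> \<Gamma>"
    using \<Gamma> g by (auto simp: congruence_subgroup_def intro: subgroup.m_inv_closed)
  have "g \<in> carrier Sp_int_group"
    using g congruence_subgroup_Sp_int[OF \<Gamma>] by (auto simp: Sp_int_group_def)
  then have "?h ** g = mat 1"
    using group.l_inv[OF group_Sp_int, of g] by (simp add: Sp_int_group_def)
  then have "?h ** (g ** matrix_inv g) = matrix_inv g" by (simp add: matrix_mul_assoc)
  then show "matrix_inv g \<in> \<Gamma>" using h i by simp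
qed

lemma countable_Sp_int: "countable (Sp_int :: 'n::finite sp_mat set)"
proof -
  have "Sp_int \<subseteq> (\<Union>B::nat. {g :: 'n sp_mat. \<forall>i j. g $ i $ j \<in> \<int> \<and> \<bar>g $ i $ j\<bar> \<le> real B})"
  proof
    fix g :: "'n sp_mat" assume g: "g \<in> Sp_int"
    obtain B where B: "norm g \<le> real B" using real_arch_simple by blast
    have "\<bar>g $ i $ j\<bar> \<le> real B" for i j
    proof -
      have "norm (g $ i $ j) \<le> norm g" by (rule order_trans[OF Finite_Cartesian_Product.norm_nth_le[of "g $ i" j] Finite_Cartesian_Product.norm_nth_le[of g i]])
      then show ?thesis using B by simp
    qed
    then show "g \<in> (\<Union>B::nat. {g. \<forall>i j. g $ i $ j \<in> \<int> \<and> \<bar>g $ i $ j\<bar> \<le> real B})"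
      using g by (auto simp: Sp_int_def)
  qed
  moreover have "countable (\<Union>B::nat. {g :: 'n sp_mat. \<forall>i j. g $ i $ j \<in> \<int> \<and> \<bar>g $ i $ j\<bar> \<le> real B})"
    by (intro countable_UN countableI_type countable_finite finite_bounded_integer_matrices)
  ultimately show ?thesis by (rule countable_subset)
qed

lemma countable_congruence_subgroup: "congruence_subgroup \<Gamma> \<Longrightarrow> countable \<Gamma>"
  using countable_subset[OF congruence_subgroup_Sp_int countable_Sp_int] .

lemma sp_act_inverse:
  assumes "congruence_subgroup \<Gamma>" "g \<in> \<Gamma>" "z \<in> siegel_space"
  shows "sp_act (matrix_inv g) (sp_act g z) = z" "sp_act g (sp_act (matrix_inv g) z) = z"
  using assms congruence_subgroup_inverse[OF assms(1,2)] congruence_subgroup_Sp_real[OF assms(1)]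
  by (simp_all add: sp_act_mult[symmetric])

text \<open>If h.z lies in the compact set, right translation by h^-1 maps all such elements
  injectively into the finite set of elements returning that compact set to itself. The bound is
  therefore independent of z.\<close>

lemma card_return_le:
  fixes \<Gamma> :: "'n::finite sp_mat set"
  assumes \<Gamma>: "congruence_subgroup \<Gamma>" and z: "z \<in> siegel_space" and X: "X \<subseteq> \<Gamma>"
  shows "finite {g \<in> X. sp_act g z \<in> siegel_compact k}" (is "finite ?A")
    and "card {g \<in> X. sp_act g z \<in> siegel_compact k} \<le> card {g \<in> Sp_int. \<exists>z\<in>siegel_compact k. sp_act g z \<in> (siegel_compact k :: 'n cmat set)}"
      (is "_ \<le> card ?R")
proof -
  have "finite ?A \<and> card ?A \<le> card ?R"
  proof (cases "?A = {}")
    case False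
    then obtain h where h: "h \<in> X" "sp_act h z \<in> siegel_compact k" by blast
    let ?f = "\<lambda>g. g ** matrix_inv h"
    have hG: "h \<in> \<Gamma>" using h X by blast
    have inj: "inj_on ?f ?A"
    proof (rule inj_onI)
      fix a b assume "?f a = ?f b"
      then have "?f a ** h = ?f b ** h" by simp
      then show "a = b"
        using congruence_subgroup_inverse[OF \<Gamma> hG] by (simp add: matrix_mul_assoc[symmetric])
    qed
    have sub: "?f ` ?A \<subseteq> ?R"
    proof (clarify, intro conjI)
      fix g assume g: "g \<in> X" "sp_act g z \<in> siegel_compact k"
      then have gG: "g \<in> \<Gamma>" using X by blast
      note inv = congruence_subgroup_inverse[OF \<Gamma> hG]
      show "?f g \<in> Sp_int"
        using congruence_subgroup_mult[OF \<Gamma> gG inv(1)] congruence_subgroup_Sp_int[OF \<Gamma>] by blast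
      have "sp_act (?f g) (sp_act h z) = sp_act g z"
        using gG hG inv congruence_subgroup_Sp_real[OF \<Gamma>] z sp_act_inverse[OF \<Gamma> hG z]
        by (simp add: sp_act_mult sp_act_in_siegel)
      then show "\<exists>w\<in>siegel_compact k. sp_act (?f g) w \<in> siegel_compact k"
        using h g by metis
    qed
    show ?thesis
      using inj_on_finite[OF inj sub finite_Sp_int_return] card_inj_on_le[OF inj sub finite_Sp_int_return] by blast
  qed (metis card.empty finite.emptyI le0)
  then show "finite ?A" "card ?A \<le> card ?R" by auto
qed

section \<open>Convergence of the Poincare series\<close>

definition kern :: "real \<Rightarrow> 'n::finite cmat \<Rightarrow> 'n cmat \<Rightarrow> real" where
  "kern s z w = cmod (det (z - map_matrix cnj w)) powr (- 2 * s) *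
     det (map_matrix Im z) powr s * det (map_matrix Im w) powr s"

lemma kern_nonneg [simp]: "0 \<le> kern s z w" by (simp add: kern_def)

lemma kern_commute: "kern s z w = kern s w z"
  unfolding kern_def det_diff_cnj_swap[of z w] by simp

lemma kern_sp_act:
  assumes g: "g \<in> Sp_real" and z: "z \<in> siegel_space" and w: "w \<in> siegel_space"
  shows "kern s (sp_act g z) (sp_act g w) = kern s z w"
proof -
  let ?a = "cmod (det (aut_den g z))" and ?b = "cmod (det (aut_den g w))"
  have ab: "?a > 0" "?b > 0" using det_aut_den_nz[OF g] z w by auto
  have d: "cmod (det (z - map_matrix cnj w)) = ?b * cmod (det (sp_act g z - map_matrix cnj (sp_act g w))) * ?a"
    using arg_cong[OF det_sp_act_diff_cnj[OF g z w], of cmod] by (simp add: norm_mult)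
  have sq: "(x\<^sup>2) powr s = x powr (2 * s)" if "x > 0" for x :: real
  proof -
    have "x\<^sup>2 = x powr 2" using that by simp
    then show ?thesis by (simp only: powr_powr)
  qed
  have c: "?a powr (- 2 * s) * ?a powr (2 * s) = 1" "?b powr (- 2 * s) * ?b powr (2 * s) = 1"
    using ab by (simp_all add: powr_add[symmetric])
  have "kern s z w = (?b powr (- 2 * s) * ?b powr (2 * s)) * (?a powr (- 2 * s) * ?a powr (2 * s)) * kern s (sp_act g z) (sp_act g w)"
    unfolding kern_def d det_Im_sp_act[OF g z, symmetric] det_Im_sp_act[OF g w, symmetric]
    by (simp only: powr_mult sq[OF ab(1)] sq[OF ab(2)] mult_ac)
  then show ?thesis unfolding c by simp
qed

lemma kern_measurable [measurable]: "(\<lambda>w. kern s z w) \<in> borel_measurable borel"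
proof -
  have [measurable]: "(\<lambda>w. cmod (det (z - map_matrix cnj w))) \<in> borel_measurable borel"
    by (intro borel_measurable_continuous_onI continuous_intros continuous_on_map_matrix)
  show ?thesis unfolding kern_def by measurable
qed

lemma nn_integral_kern:
  fixes z :: "'n::{finite,linorder} cmat"
  assumes z: "z \<in> siegel_space" and s: "s > real CARD('n)"
  shows "(\<integral>\<^sup>+w. ennreal (kern s z w) \<partial>siegel_measure) = ennreal (hua_const CARD('n) s)"
proof -
  let ?y = "det (map_matrix Im z)"
  have y: "?y > 0" by (rule det_Im_pos[OF z])
  have [measurable]: "(\<lambda>w. cmod (det (w - map_matrix cnj z))) \<in> borel_measurable borel"
    by (intro borel_measurable_continuous_onI continuous_intros)
  have "(\<integral>\<^sup>+w. ennreal (kern s z w) \<partial>siegel_measure) =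
      (\<integral>\<^sup>+w. ennreal (?y powr s) * ennreal (cmod (det (w - map_matrix cnj z)) powr (- 2 * s) * det (map_matrix Im w) powr s) \<partial>siegel_measure)"
    unfolding kern_def det_diff_cnj_swap[of z] by (simp add: ennreal_mult'[symmetric] mult_ac)
  also have "\<dots> = ennreal (?y powr s) * (\<integral>\<^sup>+w. ennreal (cmod (det (w - map_matrix cnj z)) powr (- 2 * s) * det (map_matrix Im w) powr s) \<partial>siegel_measure)"
    by (rule nn_integral_cmult) measurable
  also have "\<dots> = ennreal (?y powr s) * ennreal (hua_const CARD('n) s * ?y powr (- s))"
    by (simp only: nn_integral_hua[OF z s])
  also have "\<dots> = ennreal (hua_const CARD('n) s * (?y powr s * ?y powr (- s)))"
    by (simp add: ennreal_mult'[symmetric] mult_ac)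
  also have "?y powr s * ?y powr (- s) = 1" using y by (simp add: powr_add[symmetric])
  finally show ?thesis by simp
qed

text \<open>If the whole exhaustion were null, the integral of the kernel would be 0, contradicting
  the positive value computed by Hua's formula.\<close>

lemma siegel_compact_positive_measure:
  fixes z :: "'n::{finite,linorder} cmat"
  assumes z: "z \<in> siegel_space"
  obtains k where "z \<in> siegel_compact k" "emeasure siegel_measure (siegel_compact k :: 'n cmat set) > 0"
proof -
  have "\<exists>k. emeasure siegel_measure (siegel_compact k :: 'n cmat set) > 0"
  proof (rule ccontr)
    assume "\<not> ?thesis"
    then have "emeasure siegel_measure (siegel_compact k :: 'n cmat set) = 0" for k by (simp add: zero_less_iff_neq_zero)
    then have "emeasure siegel_measure (\<Union>k. siegel_compact k :: 'n cmat set) = 0"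
      by (intro emeasure_UN_eq_0) auto
    then have "AE w in siegel_measure. w \<notin> (siegel_space :: 'n cmat set)"
      unfolding siegel_space_eq_UN[symmetric] by (intro AE_not_in) (auto simp: null_sets_def)
    with AE_siegel_space have "AE w in (siegel_measure :: 'n cmat measure). False" by eventually_elim auto
    then have "(\<integral>\<^sup>+w. ennreal (kern (real CARD('n) + 1) z w) \<partial>siegel_measure) = (\<integral>\<^sup>+w. 0 \<partial>(siegel_measure :: 'n cmat measure))"
      by (intro nn_integral_cong_AE) auto
    then have "ennreal (hua_const CARD('n) (real CARD('n) + 1)) = 0"
      using nn_integral_kern[OF z, of "real CARD('n) + 1"] by simp
    then show False using hua_const_pos[of "CARD('n)" "real CARD('n) + 1"] by (simp add: ennreal_eq_0_iff)
  qed
  then obtain k where k: "emeasure siegel_measure (siegel_compact k :: 'n cmat set) > 0" ..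
  obtain l where l: "{z} \<subseteq> siegel_compact l" using compact_subset_siegel_compact[of "{z}"] z by auto
  have "emeasure siegel_measure (siegel_compact k :: 'n cmat set) \<le> emeasure siegel_measure (siegel_compact (max k l) :: 'n cmat set)"
    by (intro emeasure_mono siegel_compact_mono) auto
  moreover have "z \<in> siegel_compact (max k l)" using l siegel_compact_mono[of l "max k l"] by auto
  ultimately show ?thesis using k that by (metis order.strict_trans2)
qed

text \<open>The kernel is comparable with its average over a compact neighbourhood of \<open>\<xi>\<close>; unfolding
  the sum of these averages gives an integral over the whole space.\<close>

lemma sum_kern_bounded:
  fixes \<xi> :: "'n::{finite,linorder} cmat"
  assumes \<Gamma>: "congruence_subgroup \<Gamma>" and \<xi>: "\<xi> \<in> siegel_space" and s: "s > real CARD('n)"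
  obtains B where "\<And>(z :: 'n cmat) X. z \<in> siegel_space \<Longrightarrow> finite X \<Longrightarrow> X \<subseteq> \<Gamma> \<Longrightarrow> (\<Sum>\<gamma>\<in>X. kern s (sp_act \<gamma> z) \<xi>) \<le> B"
proof -
  have s0: "s > 0" using s by (rule le_less_trans[rotated]) simp
  obtain k where k: "\<xi> \<in> siegel_compact k" "emeasure siegel_measure (siegel_compact k :: 'n cmat set) > 0"
    using siegel_compact_positive_measure[OF \<xi>] .
  let ?E = "siegel_compact k :: 'n cmat set"
  let ?M = "card {g \<in> Sp_int. \<exists>z\<in>?E. sp_act g z \<in> ?E}"
  obtain V where V: "emeasure siegel_measure ?E = ennreal V" "V > 0"
    using k(2) emeasure_siegel_compact_finite[of k, where 'n = 'n]
    by (cases "emeasure siegel_measure ?E") auto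
  obtain C where C: "C > 0" "\<And>z z' w. z \<in> ?E \<Longrightarrow> z' \<in> ?E \<Longrightarrow> w \<in> siegel_space \<Longrightarrow>
      cmod (det (z' - map_matrix cnj w)) \<le> C * cmod (det (z - map_matrix cnj w))"
    using det_diff_cnj_harnack[of k, where 'n = 'n] by blast
  obtain c where c: "c > 0" "\<And>w. w \<in> ?E \<Longrightarrow> c \<le> det (map_matrix Im w)"
  proof -
    have "continuous_on ?E (\<lambda>w. det (map_matrix Im w))"
      by (intro continuous_intros continuous_on_map_matrix)
    then obtain w where w: "w \<in> ?E" "\<And>v. v \<in> ?E \<Longrightarrow> det (map_matrix Im w) \<le> det (map_matrix Im v)"
      using continuous_attains_inf[OF compact_siegel_compact, of k] k(1) by blast
    then show thesis using that[of "det (map_matrix Im w)"] det_Im_pos siegel_compact_subset by blast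
  qed
  let ?y = "det (map_matrix Im \<xi>)"
  \<comment> \<open>The first factor comes from the comparison of determinants, after exchanging the
    two points; the second from the lower bound c for det Im w on the compact set.\<close>
  define C1 where "C1 = C powr (2 * s) * (?y powr s / c powr s)"
  have y: "?y > 0" by (rule det_Im_pos[OF \<xi>])
  have C1: "C1 > 0" using C(1) c(1) y by (simp add: C1_def)
  have comp: "kern s z \<xi> \<le> C1 * kern s z w" if z: "z \<in> siegel_space" and w: "w \<in> ?E" for z w
  proof -
    have ws: "w \<in> siegel_space" using w siegel_compact_subset by blast
    let ?a = "cmod (det (z - map_matrix cnj \<xi>))" and ?b = "cmod (det (z - map_matrix cnj w))"
    have a: "?a > 0" "?b > 0" using det_diff_cnj_nz z \<xi> ws by auto
    have "?b \<le> C * ?a" using C(2)[OF k(1) w z] by (simp only: det_diff_cnj_swap[of z])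
    then have "(C * ?a) powr (- 2 * s) \<le> ?b powr (- 2 * s)"
      using a s0 by (intro powr_mono2') auto
    then have "C powr (2 * s) * (C * ?a) powr (- 2 * s) \<le> C powr (2 * s) * ?b powr (- 2 * s)"
      by (intro mult_left_mono) auto
    moreover have "C powr (2 * s) * (C * ?a) powr (- 2 * s) = ?a powr (- 2 * s)"
    proof -
      have "C powr (2 * s) * C powr (- 2 * s) = 1" using C(1) by (simp add: powr_add[symmetric])
      then show ?thesis by (simp only: powr_mult mult.assoc[symmetric] mult_1_left)
    qed
    ultimately have 1: "?a powr (- 2 * s) \<le> C powr (2 * s) * ?b powr (- 2 * s)" by (simp only:)
    have "c powr s \<le> det (map_matrix Im w) powr s" using c w s0 by (intro powr_mono2) auto
    then have 2: "?y powr s \<le> ?y powr s / c powr s * det (map_matrix Im w) powr s"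
      using c(1) y by (simp add: field_simps)
    have "kern s z \<xi> \<le> (C powr (2 * s) * ?b powr (- 2 * s)) * det (map_matrix Im z) powr s * (?y powr s / c powr s * det (map_matrix Im w) powr s)"
      unfolding kern_def by (intro mult_mono 1 2 order_refl) auto
    then show ?thesis by (simp add: C1_def kern_def mult_ac)
  qed
  \<comment> \<open>Each term times the volume V is at most C1 times the integral of the kernel over
    the preimage of the compact set under \<gamma>, and a point lies in at most \<open>?M\<close> of
    these preimages.\<close>
  define B where "B = C1 * real ?M * hua_const CARD('n) s / V"
  show ?thesis
  proof (rule that[of B])
     fix z :: "'n cmat" and X assume z: "z \<in> siegel_space" and X: "finite X" "X \<subseteq> \<Gamma>"
    have single: "ennreal (kern s (sp_act \<gamma> z) \<xi>) * ennreal V \<le>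
        (\<integral>\<^sup>+w. ennreal C1 * (indicator ?E (sp_act \<gamma> w) * ennreal (kern s z w)) \<partial>siegel_measure)"
      if \<gamma>: "\<gamma> \<in> X" for \<gamma>
    proof -
      have g: "\<gamma> \<in> Sp_real" using \<gamma> X congruence_subgroup_Sp_real[OF \<Gamma>] by blast
      have gz: "sp_act \<gamma> z \<in> siegel_space" by (rule sp_act_in_siegel[OF g z])
      have "ennreal (kern s (sp_act \<gamma> z) \<xi>) * ennreal V = (\<integral>\<^sup>+w. ennreal (kern s (sp_act \<gamma> z) \<xi>) * indicator ?E w \<partial>siegel_measure)"
        by (simp add: nn_integral_cmult V(1))
      also have "\<dots> \<le> (\<integral>\<^sup>+w. ennreal C1 * (indicator ?E w * ennreal (kern s (sp_act \<gamma> z) w)) \<partial>siegel_measure)"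
        using comp[OF gz] C1 by (intro nn_integral_mono) (auto simp: indicator_def ennreal_mult'[symmetric] intro!: ennreal_leI)
      also have "\<dots> = (\<integral>\<^sup>+w. ennreal C1 * (indicator ?E (sp_act \<gamma> w) * ennreal (kern s (sp_act \<gamma> z) (sp_act \<gamma> w))) \<partial>siegel_measure)"
        by (rule nn_integral_siegel_sp_act[OF g, symmetric]) measurable
      also have "\<dots> = (\<integral>\<^sup>+w. ennreal C1 * (indicator ?E (sp_act \<gamma> w) * ennreal (kern s z w)) \<partial>siegel_measure)"
        by (rule nn_integral_cong_AE, use AE_siegel_space in eventually_elim) (simp add: kern_sp_act[OF g z])
      finally show ?thesis .
    qed
    have meas: "(\<lambda>w. ennreal C1 * (indicator ?E (sp_act0 \<gamma> w) * ennreal (kern s z w))) \<in> borel_measurable borel"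
      if "\<gamma> \<in> X" for \<gamma>
    proof -
      have [measurable]: "sp_act0 \<gamma> \<in> borel_measurable borel"
        using that X congruence_subgroup_Sp_real[OF \<Gamma>] by (intro sp_act0_measurable) blast
      show ?thesis by measurable
    qed
    have "ennreal (\<Sum>\<gamma>\<in>X. kern s (sp_act \<gamma> z) \<xi>) * ennreal V = (\<Sum>\<gamma>\<in>X. ennreal (kern s (sp_act \<gamma> z) \<xi>) * ennreal V)"
      by (subst sum_ennreal[symmetric]) (simp_all only: sum_distrib_right kern_nonneg)
    also have "\<dots> \<le> (\<Sum>\<gamma>\<in>X. \<integral>\<^sup>+w. ennreal C1 * (indicator ?E (sp_act \<gamma> w) * ennreal (kern s z w)) \<partial>siegel_measure)"
      by (intro sum_mono single)
    also have "\<dots> = (\<Sum>\<gamma>\<in>X. \<integral>\<^sup>+w. ennreal C1 * (indicator ?E (sp_act0 \<gamma> w) * ennreal (kern s z w)) \<partial>siegel_measure)"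
      by (intro sum.cong refl nn_integral_cong_AE, use AE_siegel_space in eventually_elim) (simp add: sp_act0_def)
    also have "\<dots> = (\<integral>\<^sup>+w. (\<Sum>\<gamma>\<in>X. ennreal C1 * (indicator ?E (sp_act0 \<gamma> w) * ennreal (kern s z w))) \<partial>siegel_measure)"
      using meas by (intro nn_integral_sum[symmetric]) auto
    also have "\<dots> \<le> (\<integral>\<^sup>+w. ennreal (C1 * real ?M) * ennreal (kern s z w) \<partial>siegel_measure)"
    proof (rule nn_integral_mono_AE, use AE_siegel_space in eventually_elim)
      fix w :: "'n cmat" assume w: "w \<in> siegel_space"
      have "(\<Sum>\<gamma>\<in>X. indicator ?E (sp_act0 \<gamma> w) :: real) = real (card {\<gamma> \<in> X. sp_act \<gamma> w \<in> ?E})"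
        using X(1) w by (simp add: sp_act0_def indicator_def sum.If_cases Int_def)
      also have "\<dots> \<le> real ?M" using card_return_le(2)[OF \<Gamma> w X(2)] by simp
      finally have le: "(\<Sum>\<gamma>\<in>X. indicator ?E (sp_act0 \<gamma> w) :: real) \<le> real ?M" .
      have "(\<Sum>\<gamma>\<in>X. ennreal C1 * (indicator ?E (sp_act0 \<gamma> w) * ennreal (kern s z w))) =
          ennreal (\<Sum>\<gamma>\<in>X. C1 * (indicator ?E (sp_act0 \<gamma> w) * kern s z w))"
      proof (subst sum_ennreal[symmetric])
        show "0 \<le> C1 * (indicator ?E (sp_act0 \<gamma> w) * kern s z w)" for \<gamma> using C1 by simp
        show "(\<Sum>\<gamma>\<in>X. ennreal C1 * (indicator ?E (sp_act0 \<gamma> w) * ennreal (kern s z w))) =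
            (\<Sum>\<gamma>\<in>X. ennreal (C1 * (indicator ?E (sp_act0 \<gamma> w) * kern s z w)))"
          using C1 by (intro sum.cong refl) (simp add: ennreal_mult' ennreal_indicator)
      qed
      also have "(\<Sum>\<gamma>\<in>X. C1 * (indicator ?E (sp_act0 \<gamma> w) * kern s z w)) = C1 * (\<Sum>\<gamma>\<in>X. indicator ?E (sp_act0 \<gamma> w)) * kern s z w"
        by (simp add: sum_distrib_left sum_distrib_right mult_ac)
      also have "ennreal \<dots> \<le> ennreal (C1 * real ?M * kern s z w)"
        using C1 le by (intro ennreal_leI mult_right_mono mult_left_mono) auto
      finally show "(\<Sum>\<gamma>\<in>X. ennreal C1 * (indicator ?E (sp_act0 \<gamma> w) * ennreal (kern s z w))) \<le> ennreal (C1 * real ?M) * ennreal (kern s z w)"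
        using C1 by (subst ennreal_mult'[of "C1 * real ?M", symmetric]) (simp_all only: mult_nonneg_nonneg less_imp_le of_nat_0_le_iff)
    qed
    also have "\<dots> = ennreal (C1 * real ?M) * ennreal (hua_const CARD('n) s)"
      by (simp add: nn_integral_cmult nn_integral_kern[OF z s])
    also have "\<dots> = ennreal (B * V)"
      using C1 V(2) hua_const_pos[OF s] by (simp add: ennreal_mult'[symmetric] B_def)
    finally have "ennreal ((\<Sum>\<gamma>\<in>X. kern s (sp_act \<gamma> z) \<xi>) * V) \<le> ennreal (B * V)"
      using V(2) by (simp add: ennreal_mult sum_nonneg)
    then have "(\<Sum>\<gamma>\<in>X. kern s (sp_act \<gamma> z) \<xi>) * V \<le> B * V"
      using C1 V(2) hua_const_pos[OF s] by (subst (asm) ennreal_le_iff) (auto simp: B_def)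
    then show "(\<Sum>\<gamma>\<in>X. kern s (sp_act \<gamma> z) \<xi>) \<le> B" using V(2) by simp
  qed
qed

definition f1_coeff :: "nat \<Rightarrow> nat \<Rightarrow> complex" where
  "f1_coeff m n = inverse (of_real (C_const m n)) * (2 * \<i>) ^ (n * m)"

lemma f1_eq:
  "f1 m \<xi> z = f1_coeff m CARD('n) * inverse (det (z - map_matrix cnj \<xi>) ^ m)"
  for z :: "'n::finite cmat"
proof -
  have "det (map_matrix (\<lambda>w. 1 / (2 * \<i>) * w) (z - map_matrix cnj \<xi>)) powi (- int m) =
      inverse (((1 / (2 * \<i>)) ^ CARD('n) * det (z - map_matrix cnj \<xi>)) ^ m)"
    unfolding det_scale by (simp only: power_int_minus power_int_of_nat)
  also have "\<dots> = (2 * \<i>) ^ (CARD('n) * m) * inverse (det (z - map_matrix cnj \<xi>) ^ m)"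
    by (simp only: power_mult_distrib power_mult[symmetric] inverse_mult_distrib power_inverse[symmetric])
       (simp add: power_inverse[symmetric] divide_inverse del: inverse_mult_distrib)
  finally show ?thesis by (simp add: f1_def f1_coeff_def)
qed

text \<open>Pulling the base point back by g concentrates the dependence on z in det (z - cnj
  w)^(-m); the other factors depend on g and w alone. Estimates uniform in w thus treat all terms of
  the series alike.\<close>

lemma slash_f1:
  fixes z w :: "'n::finite cmat"
  assumes g: "g \<in> Sp_real" and z: "z \<in> siegel_space" and w: "w \<in> siegel_space"
  shows "slash m (f1 m (sp_act g w)) g z =
    f1_coeff m CARD('n) * cnj (det (aut_den g w)) ^ m * inverse (det (z - map_matrix cnj w) ^ m)"
proof -
  let ?j = "det (aut_den g z)" and ?jw = "cnj (det (aut_den g w))"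
  let ?d = "det (sp_act g z - map_matrix cnj (sp_act g w))"
  have nz: "?jw \<noteq> 0" using det_aut_den_nz[OF g w] by simp
  have "slash m (f1 m (sp_act g w)) g z = inverse (?j ^ m) * (f1_coeff m CARD('n) * inverse (?d ^ m))"
    by (simp add: slash_eq f1_eq power_int_minus)
  moreover have "inverse (det (z - map_matrix cnj w) ^ m) = inverse (?jw ^ m) * inverse (?d ^ m) * inverse (?j ^ m)"
    unfolding det_sp_act_diff_cnj[OF g z w, symmetric] by (simp only: power_mult_distrib inverse_mult_distrib)
  ultimately show ?thesis using nz by simp
qed

lemma norm_slash_f1:
  fixes z \<xi> :: "'n::finite cmat"
  assumes g: "g \<in> Sp_real" and z: "z \<in> siegel_space" and \<xi>: "\<xi> \<in> siegel_space" and m: "m > 0"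
  shows "cmod (slash m (f1 m \<xi>) g z) * det (map_matrix Im z) powr (real m / 2) =
    cmod (f1_coeff m CARD('n)) * det (map_matrix Im \<xi>) powr (- (real m / 2)) * kern (real m / 2) (sp_act g z) \<xi>"
proof -
  let ?j = "cmod (det (aut_den g z))" and ?d = "cmod (det (sp_act g z - map_matrix cnj \<xi>))"
  let ?y = "det (map_matrix Im (sp_act g z))" and ?e = "det (map_matrix Im \<xi>)"
  have gz: "sp_act g z \<in> siegel_space" by (rule sp_act_in_siegel[OF g z])
  have j: "?j > 0" using det_aut_den_nz[OF g z] by simp
  have d: "?d > 0" using det_diff_cnj_nz[OF gz \<xi>] by simp
  have e: "?e > 0" by (rule det_Im_pos[OF \<xi>])
  have pw: "inverse (x ^ m) = x powr (- real m)" if "x > 0" for x :: real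
    using that by (simp add: powr_minus powr_realpow)
  have sl: "cmod (slash m (f1 m \<xi>) g z) = ?j powr (- real m) * (cmod (f1_coeff m CARD('n)) * ?d powr (- real m))"
    by (simp add: slash_eq f1_eq power_int_minus norm_mult norm_inverse norm_power pw[OF j, symmetric] pw[OF d, symmetric])
  have sq: "(?j\<^sup>2) powr (real m / 2) = ?j powr real m"
  proof -
    have "?j\<^sup>2 = ?j powr 2" using j by simp
    then show ?thesis by (simp only: powr_powr) simp
  qed
  have y: "det (map_matrix Im z) powr (real m / 2) = ?j powr real m * ?y powr (real m / 2)"
    unfolding det_Im_sp_act[OF g z, symmetric] powr_mult sq ..
  have c: "?j powr (- real m) * ?j powr real m = 1" "?e powr (- (real m / 2)) * ?e powr (real m / 2) = 1"
    using j e by (simp_all add: powr_add[symmetric])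
  have "cmod (slash m (f1 m \<xi>) g z) * det (map_matrix Im z) powr (real m / 2) =
      (?j powr (- real m) * ?j powr real m) * (cmod (f1_coeff m CARD('n)) * ?d powr (- real m) * ?y powr (real m / 2))"
    unfolding sl y by (simp only: mult_ac)
  also have "\<dots> = cmod (f1_coeff m CARD('n)) * ?d powr (- real m) * ?y powr (real m / 2) * (?e powr (- (real m / 2)) * ?e powr (real m / 2))"
    unfolding c by simp
  also have "\<dots> = cmod (f1_coeff m CARD('n)) * ?e powr (- (real m / 2)) * kern (real m / 2) (sp_act g z) \<xi>"
    by (simp add: kern_def)
  finally show ?thesis .
qed

lemma poincare_bounded:
  fixes \<xi> :: "'n::{finite,linorder} cmat"
  assumes \<Gamma>: "congruence_subgroup \<Gamma>" and \<xi>: "\<xi> \<in> siegel_space" and m: "m > 2 * CARD('n)"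
  obtains B where
    "\<And>z :: 'n cmat. z \<in> siegel_space \<Longrightarrow> (\<lambda>\<gamma>. cmod (slash m (f1 m \<xi>) \<gamma> z)) summable_on \<Gamma>"
    "\<And>z :: 'n cmat. z \<in> siegel_space \<Longrightarrow>
      (\<Sum>\<^sub>\<infinity>\<gamma>\<in>\<Gamma>. cmod (slash m (f1 m \<xi>) \<gamma> z)) * det (map_matrix Im z) powr (real m / 2) \<le> B"
proof -
  have s: "real m / 2 > real CARD('n)" using m by simp
  obtain B where B: "\<And>(z :: 'n cmat) X. z \<in> siegel_space \<Longrightarrow> finite X \<Longrightarrow> X \<subseteq> \<Gamma> \<Longrightarrow> (\<Sum>\<gamma>\<in>X. kern (real m / 2) (sp_act \<gamma> z) \<xi>) \<le> B"
    using sum_kern_bounded[OF \<Gamma> \<xi> s] by blast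
  define c where "c = cmod (f1_coeff m CARD('n)) * det (map_matrix Im \<xi>) powr (- (real m / 2))"
  have c: "c \<ge> 0" by (simp add: c_def)
  let ?f = "\<lambda>z \<gamma>. cmod (slash m (f1 m \<xi>) \<gamma> z)" and ?y = "\<lambda>z::'n cmat. det (map_matrix Im z) powr (real m / 2)"
  have fin: "(\<Sum>\<gamma>\<in>X. ?f z \<gamma>) \<le> c * B / ?y z" if z: "z \<in> siegel_space" and X: "finite X" "X \<subseteq> \<Gamma>" for z X
  proof -
    have y: "?y z > 0" using det_Im_pos[OF z] by simp
    have "?f z \<gamma> * ?y z = c * kern (real m / 2) (sp_act \<gamma> z) \<xi>" if "\<gamma> \<in> X" for \<gamma>
      unfolding c_def using that X m by (intro norm_slash_f1 congruence_subgroup_Sp_real[OF \<Gamma>] z \<xi>) auto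
    then have "(\<Sum>\<gamma>\<in>X. ?f z \<gamma>) * ?y z = c * (\<Sum>\<gamma>\<in>X. kern (real m / 2) (sp_act \<gamma> z) \<xi>)"
      by (simp add: sum_distrib_left sum_distrib_right)
    also have "\<dots> \<le> c * B" by (intro mult_left_mono B z X c)
    finally show ?thesis using y by (simp add: field_simps)
  qed
  have sm: "?f z summable_on \<Gamma>" if z: "z \<in> siegel_space" for z
    by (rule nonneg_bdd_above_summable_on) (auto intro!: bdd_aboveI[where M = "c * B / ?y z"] fin[OF z])
  have "(\<Sum>\<^sub>\<infinity>\<gamma>\<in>\<Gamma>. ?f z \<gamma>) * ?y z \<le> c * B" if z: "z \<in> siegel_space" for z
  proof -
    have y: "?y z > 0" using det_Im_pos[OF z] by simp
    have "(\<Sum>\<^sub>\<infinity>\<gamma>\<in>\<Gamma>. ?f z \<gamma>) \<le> c * B / ?y z"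
      by (rule infsum_le_finite_sums[OF sm[OF z] fin[OF z]])
    then show ?thesis using y by (simp add: field_simps)
  qed
  with sm show ?thesis by (rule that)
qed

text \<open>With w = \<gamma>^-1 \<xi> every term is a constant multiple of det (z - cnj w)^(-m),
  and the comparison of determinants is uniform in w. Summability at one point of a compact set thus
  yields a Weierstrass majorant on all of it.\<close>

lemma slash_f1_harnack:
  fixes \<xi> :: "'n::{finite,linorder} cmat"
  assumes \<Gamma>: "congruence_subgroup \<Gamma>" and \<xi>: "\<xi> \<in> siegel_space"
  obtains C where "C > 0" "\<And>(z :: 'n cmat) z' \<gamma>. z \<in> siegel_compact k \<Longrightarrow> z' \<in> siegel_compact k \<Longrightarrow> \<gamma> \<in> \<Gamma> \<Longrightarrow>
    cmod (slash m (f1 m \<xi>) \<gamma> z) \<le> C * cmod (slash m (f1 m \<xi>) \<gamma> z')"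
proof -
  obtain C where C: "C > 0" "\<And>z z' w. z \<in> siegel_compact k \<Longrightarrow> z' \<in> siegel_compact k \<Longrightarrow> w \<in> siegel_space \<Longrightarrow>
      cmod (det (z' - map_matrix cnj w)) \<le> C * cmod (det (z - map_matrix cnj (w :: 'n cmat)))"
    using det_diff_cnj_harnack[of k, where 'n = 'n] by blast
  show ?thesis
  proof (rule that[of "C ^ m"])
    show "C ^ m > 0" using C(1) by simp
    fix z z' :: "'n cmat" and \<gamma> assume z: "z \<in> siegel_compact k" "z' \<in> siegel_compact k" and \<gamma>: "\<gamma> \<in> \<Gamma>"
    have zs: "z \<in> siegel_space" "z' \<in> siegel_space" using z siegel_compact_subset by blast+
    define w where "w = sp_act (matrix_inv \<gamma>) \<xi>"
    have w: "w \<in> siegel_space" "sp_act \<gamma> w = \<xi>"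
      unfolding w_def using congruence_subgroup_inverse[OF \<Gamma> \<gamma>] sp_act_inverse[OF \<Gamma> \<gamma> \<xi>]
      by (auto intro: sp_act_in_siegel congruence_subgroup_Sp_real[OF \<Gamma>] \<xi>)
    have g: "\<gamma> \<in> Sp_real" by (rule congruence_subgroup_Sp_real[OF \<Gamma> \<gamma>])
    let ?d = "\<lambda>z. cmod (det (z - map_matrix cnj w))"
    have d: "?d z > 0" "?d z' > 0" using det_diff_cnj_nz zs w by auto
    have "?d z' ^ m \<le> (C * ?d z) ^ m" using C(2)[OF z w(1)] by (intro power_mono) auto
    then have "inverse (?d z ^ m) \<le> C ^ m * inverse (?d z' ^ m)"
      using d by (simp add: power_mult_distrib field_simps)
    then have "cmod (f1_coeff m CARD('n) * cnj (det (aut_den \<gamma> w)) ^ m) * inverse (?d z ^ m) \<le>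
        cmod (f1_coeff m CARD('n) * cnj (det (aut_den \<gamma> w)) ^ m) * (C ^ m * inverse (?d z' ^ m))"
      by (intro mult_left_mono) auto
    then show "cmod (slash m (f1 m \<xi>) \<gamma> z) \<le> C ^ m * cmod (slash m (f1 m \<xi>) \<gamma> z')"
      using slash_f1[OF g zs(1) w(1), of m] slash_f1[OF g zs(2) w(1), of m]
      by (simp add: w(2) norm_mult norm_inverse norm_power mult_ac)
  qed
qed

lemma uniform_limit_poincare:
  fixes \<xi> :: "'n::{finite,linorder} cmat"
  assumes \<Gamma>: "congruence_subgroup \<Gamma>" and \<xi>: "\<xi> \<in> siegel_space" and m: "m > 2 * CARD('n)"
    and K: "compact K" "K \<subseteq> siegel_space"
  shows "uniform_limit K (\<lambda>X z. \<Sum>\<gamma>\<in>X. slash m (f1 m \<xi>) \<gamma> z) (Delta \<Gamma> m \<xi>) (finite_subsets_at_top \<Gamma>)"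
proof (cases "K = {}")
  case True then show ?thesis by simp
next
  case False
  then obtain z0 where z0: "z0 \<in> K" by blast
  obtain k where k: "K \<subseteq> siegel_compact k" using compact_subset_siegel_compact[OF K] .
  obtain C where C: "C > 0" "\<And>(z :: 'n cmat) z' \<gamma>. z \<in> siegel_compact k \<Longrightarrow> z' \<in> siegel_compact k \<Longrightarrow> \<gamma> \<in> \<Gamma> \<Longrightarrow>
    cmod (slash m (f1 m \<xi>) \<gamma> z) \<le> C * cmod (slash m (f1 m \<xi>) \<gamma> z')"
    using slash_f1_harnack[OF \<Gamma> \<xi>, of k m] by blast
  have "(\<lambda>\<gamma>. cmod (slash m (f1 m \<xi>) \<gamma> z0)) summable_on \<Gamma>"
    using poincare_bounded[OF \<Gamma> \<xi> m] z0 K by blast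
  then have M: "(\<lambda>\<gamma>. C * cmod (slash m (f1 m \<xi>) \<gamma> z0)) summable_on \<Gamma>"
    by (rule summable_on_cmult_right)
  have "uniform_limit K (\<lambda>X z. \<Sum>\<gamma>\<in>X. slash m (f1 m \<xi>) \<gamma> z) (\<lambda>z. \<Sum>\<^sub>\<infinity>\<gamma>\<in>\<Gamma>. slash m (f1 m \<xi>) \<gamma> z) (finite_subsets_at_top \<Gamma>)"
    by (rule Weierstrass_m_test_general[OF _ M]) (use C(2) k z0 in blast)
  then show ?thesis by (simp add: Delta_def poincare_series_def[abs_def])
qed

lemma slash_poincare:
  fixes \<xi> :: "'n::{finite,linorder} cmat"
  assumes \<Gamma>: "congruence_subgroup \<Gamma>" and g: "g \<in> \<Gamma>" and z: "z \<in> siegel_space"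
  shows "slash m (poincare_series m \<Gamma> f) g z = poincare_series m \<Gamma> f z"
proof -
  note inv = congruence_subgroup_inverse[OF \<Gamma> g]
  have bij: "bij_betw (\<lambda>h. h ** g) \<Gamma> \<Gamma>"
    by (rule bij_betwI[where g = "\<lambda>h. h ** matrix_inv g"])
       (use inv congruence_subgroup_mult[OF \<Gamma>] g in \<open>auto simp: matrix_mul_assoc[symmetric]\<close>)
  have "slash m (poincare_series m \<Gamma> f) g z = (\<Sum>\<^sub>\<infinity>h\<in>\<Gamma>. det (aut_den g z) powi (- int m) * slash m f h (sp_act g z))"
    by (simp add: slash_eq[of m "poincare_series m \<Gamma> f"] poincare_series_def infsum_cmult_right')
  also have "\<dots> = (\<Sum>\<^sub>\<infinity>h\<in>\<Gamma>. slash m f (h ** g) z)"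
    by (intro infsum_cong) (simp add: slash_mult congruence_subgroup_Sp_real[OF \<Gamma>] g z slash_eq[of m "slash m f _" g])
  also have "\<dots> = (\<Sum>\<^sub>\<infinity>h\<in>\<Gamma>. slash m f h z)"
    by (rule infsum_reindex_bij_betw[OF bij])
  finally show ?thesis by (simp add: poincare_series_def)
qed

section \<open>Complex differentiability\<close>

text \<open>Pointwise complex differentiability within a free set S: the local model of a term of
  the series is differentiated at 0 in the space of all matrices, the series itself within the
  half-space.\<close>

definition cdiff :: "('n::finite cmat \<Rightarrow> complex) \<Rightarrow> 'n cmat \<Rightarrow> 'n cmat set \<Rightarrow> bool" where
  "cdiff f z S \<longleftrightarrow> (\<exists>L. (f has_derivative L) (at z within S) \<and>
     (\<forall>c v. L (map_matrix (\<lambda>w. c * w) v) = c * L v))"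

lemma cdiff_const: "cdiff (\<lambda>_. c) z S"
  unfolding cdiff_def by (rule exI[of _ "\<lambda>_. 0"]) auto

lemma cdiff_nth: "cdiff (\<lambda>z. z $ i $ j) z S"
proof -
  have "bounded_linear (\<lambda>z::'a cmat. z $ i $ j)"
    by (rule bounded_linear_compose[OF bounded_linear_vec_nth bounded_linear_vec_nth])
  then show ?thesis
    unfolding cdiff_def by (intro exI[of _ "\<lambda>h. h $ i $ j"]) (auto intro: bounded_linear_imp_has_derivative)
qed

lemma cdiff_add: "cdiff f z S \<Longrightarrow> cdiff g z S \<Longrightarrow> cdiff (\<lambda>z. f z + g z) z S"
  unfolding cdiff_def
proof (elim exE conjE)
  fix L M assume "(f has_derivative L) (at z within S)" "(g has_derivative M) (at z within S)"
    "\<forall>c v. L (map_matrix (\<lambda>w. c * w) v) = c * L v" "\<forall>c v. M (map_matrix (\<lambda>w. c * w) v) = c * M v"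
  then show "\<exists>L. ((\<lambda>z. f z + g z) has_derivative L) (at z within S) \<and> (\<forall>c v. L (map_matrix (\<lambda>w. c * w) v) = c * L v)"
    by (intro exI[of _ "\<lambda>h. L h + M h"]) (auto simp: distrib_left intro: has_derivative_add)
qed

lemma cdiff_mult: "cdiff f z S \<Longrightarrow> cdiff g z S \<Longrightarrow> cdiff (\<lambda>z. f z * g z) z S"
  unfolding cdiff_def
proof (elim exE conjE)
  fix L M assume "(f has_derivative L) (at z within S)" "(g has_derivative M) (at z within S)"
    "\<forall>c v. L (map_matrix (\<lambda>w. c * w) v) = c * L v" "\<forall>c v. M (map_matrix (\<lambda>w. c * w) v) = c * M v"
  then show "\<exists>L. ((\<lambda>z. f z * g z) has_derivative L) (at z within S) \<and> (\<forall>c v. L (map_matrix (\<lambda>w. c * w) v) = c * L v)"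
    by (intro exI[of _ "\<lambda>h. f z * M h + L h * g z"] conjI has_derivative_mult) (auto simp: algebra_simps)
qed

lemma cdiff_sum: "finite I \<Longrightarrow> (\<And>i. i \<in> I \<Longrightarrow> cdiff (f i) z S) \<Longrightarrow> cdiff (\<lambda>z. \<Sum>i\<in>I. f i z) z S"
  by (induction I rule: finite_induct) (auto intro: cdiff_const cdiff_add)

lemma cdiff_prod: "finite I \<Longrightarrow> (\<And>i. i \<in> I \<Longrightarrow> cdiff (f i) z S) \<Longrightarrow> cdiff (\<lambda>z. \<Prod>i\<in>I. f i z) z S"
  by (induction I rule: finite_induct) (auto intro: cdiff_const cdiff_mult)

lemma cdiff_power: "cdiff f z S \<Longrightarrow> cdiff (\<lambda>z. f z ^ m) z S"
  by (induction m) (auto intro: cdiff_const cdiff_mult)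

lemma cdiff_inverse:
  assumes "cdiff f z S" "f z \<noteq> 0" shows "cdiff (\<lambda>z. inverse (f z)) z S"
proof -
  obtain L where L: "(f has_derivative L) (at z within S)" "\<forall>c v. L (map_matrix (\<lambda>w. c * w) v) = c * L v"
    using assms(1) by (auto simp: cdiff_def)
  from Deriv.has_derivative_inverse[OF assms(2) L(1)] L(2) show ?thesis
    unfolding cdiff_def by (intro exI[of _ "\<lambda>h. - (inverse (f z) * L h * inverse (f z))"]) auto
qed

lemma cdiff_det:
  assumes "\<And>i j. cdiff (\<lambda>z. F z $ i $ j) z S" shows "cdiff (\<lambda>z. det (F z)) z S"
  unfolding det_def by (intro cdiff_sum cdiff_mult cdiff_const cdiff_prod assms) auto

lemma norm_matrix_le:
  fixes A :: "complex^'n^'n"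
  assumes "\<And>i j. cmod (A $ i $ j) \<le> b"
  shows "norm A \<le> real CARD('n) * (real CARD('n) * b)"
proof -
  have row: "norm (A $ i) \<le> real CARD('n) * b" for i
  proof -
    have "norm (A $ i) \<le> (\<Sum>j\<in>UNIV. cmod (A $ i $ j))" by (simp add: norm_vec_def L2_set_le_sum)
    also have "\<dots> \<le> (\<Sum>j\<in>(UNIV :: 'n set). b)" by (intro sum_mono assms)
    finally show ?thesis by simp
  qed
  have "norm A \<le> (\<Sum>i\<in>UNIV. norm (A $ i))" by (simp add: norm_vec_def[of A] L2_set_le_sum)
  also have "\<dots> \<le> (\<Sum>i\<in>(UNIV :: 'n set). real CARD('n) * b)" by (intro sum_mono row)
  finally show ?thesis by simp
qed

lemma infsum_diff_complex:
  fixes f g :: "'a \<Rightarrow> complex"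
  assumes "f summable_on A" "g summable_on A"
  shows "(\<Sum>\<^sub>\<infinity>x\<in>A. f x - g x) = infsum f A - infsum g A" "(\<lambda>x. f x - g x) summable_on A"
  using infsum_add[OF assms(1) summable_on_cmult_right[OF assms(2), of "-1"]]
    summable_on_add[OF assms(1) summable_on_cmult_right[OF assms(2), of "-1"]]
  by (simp_all add: infsum_uminus)

text \<open>With \<open>R = (z\<^sub>0 - \<omega>\<^sup>*)\<^sup>-\<^sup>1\<close>, bounded uniformly in \<open>\<omega>\<close>, every term of the series is
  \<open>\<phi> (z\<^sub>0) det (1 + R (z - z\<^sub>0))\<^sup>-\<^sup>m\<close>, so that a single first order expansion serves all terms.\<close>

lemma siegel_holomorphic_Delta:
  fixes \<xi> :: "'n::{finite,linorder} cmat"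
  assumes \<Gamma>: "congruence_subgroup \<Gamma>" and \<xi>: "\<xi> \<in> siegel_space" and m: "m > 2 * CARD('n)"
  shows "siegel_holomorphic (Delta \<Gamma> m \<xi>)"
  unfolding siegel_holomorphic_def
proof
  fix z0 :: "'n cmat" assume z0: "z0 \<in> siegel_space"
  define \<psi> where "\<psi> M = inverse (det (mat 1 + M) ^ m)" for M :: "'n cmat"
  have "cdiff \<psi> 0 UNIV"
    unfolding \<psi>_def
  proof (intro cdiff_inverse cdiff_power cdiff_det)
    show "cdiff (\<lambda>z :: 'n cmat. (mat 1 + z) $ i $ j) 0 UNIV" for i j
      unfolding vector_add_component by (intro cdiff_add cdiff_const cdiff_nth)
  qed simp
  then obtain l where l: "(\<psi> has_derivative l) (at 0)" "\<And>c v. l (map_matrix (\<lambda>w. c * w) v) = c * l v"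
    by (auto simp: cdiff_def)
  have bl: "bounded_linear l" using l(1) by (rule has_derivative_bounded_linear)
  obtain \<Lambda> where \<Lambda>: "\<Lambda> > 0" "\<And>M. norm (l M) \<le> norm M * \<Lambda>" using bounded_linear.pos_bounded[OF bl] by blast
  obtain k where "{z0} \<subseteq> siegel_compact k" using compact_subset_siegel_compact[of "{z0}"] z0 by auto
  then have k: "z0 \<in> siegel_compact k" by simp
  define w where "w \<gamma> = sp_act (matrix_inv \<gamma>) \<xi>" for \<gamma>
  define R where "R \<gamma> = matrix_inv (z0 - map_matrix cnj (w \<gamma>))" for \<gamma>
  define \<phi> where "\<phi> \<gamma> = slash m (f1 m \<xi>) \<gamma>" for \<gamma>
  have w: "w \<gamma> \<in> siegel_space" "sp_act \<gamma> (w \<gamma>) = \<xi>" if "\<gamma> \<in> \<Gamma>" for \<gamma>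
    unfolding w_def using congruence_subgroup_inverse[OF \<Gamma> that] sp_act_inverse[OF \<Gamma> that \<xi>]
    by (auto intro: sp_act_in_siegel congruence_subgroup_Sp_real[OF \<Gamma>] \<xi>)
  have expand: "\<phi> \<gamma> z = \<phi> \<gamma> z0 * \<psi> (R \<gamma> ** (z - z0))" if \<gamma>: "\<gamma> \<in> \<Gamma>" and z: "z \<in> siegel_space" for \<gamma> z
  proof -
    let ?M = "z0 - map_matrix cnj (w \<gamma>)"
    have g: "\<gamma> \<in> Sp_real" by (rule congruence_subgroup_Sp_real[OF \<Gamma> \<gamma>])
    have "?M ** (mat 1 + R \<gamma> ** (z - z0)) = z - map_matrix cnj (w \<gamma>)"
      unfolding R_def by (simp add: matrix_add_ldistrib matrix_mul_assoc matrix_inv_right invertible_diff_cnj[OF z0 w(1)[OF \<gamma>]])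
    then have "det (z - map_matrix cnj (w \<gamma>)) = det ?M * det (mat 1 + R \<gamma> ** (z - z0))" by (metis det_mul)
    then show ?thesis
      using slash_f1[OF g z w(1)[OF \<gamma>], of m] slash_f1[OF g z0 w(1)[OF \<gamma>], of m]
      by (simp add: \<phi>_def \<psi>_def w(2)[OF \<gamma>] power_mult_distrib)
  qed
  define K where "K = real CARD('n) * (real CARD('n) * (real CARD('n) * real k))"
  have K: "K \<ge> 0" by (simp add: K_def)
  have Rb: "norm (R \<gamma> ** h) \<le> K * norm h" if \<gamma>: "\<gamma> \<in> \<Gamma>" for \<gamma> and h :: "'n cmat"
  proof -
    have "cmod ((R \<gamma> ** h) $ i $ j) \<le> real CARD('n) * (real k * norm h)" for i j
      unfolding R_def
      by (rule norm_matrix_mult_component_le[OF norm_inverse_diff_cnj[OF k w(1)[OF \<gamma>]] norm_component_le[of h]]) simp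
    from norm_matrix_le[OF this] show ?thesis by (simp add: K_def mult_ac)
  qed
  have sm: "(\<lambda>\<gamma>. cmod (\<phi> \<gamma> z)) summable_on \<Gamma>" if "z \<in> siegel_space" for z
    unfolding \<phi>_def using poincare_bounded[OF \<Gamma> \<xi> m] that by blast
  have sm': "\<phi>' summable_on \<Gamma>" if "\<And>\<gamma>. \<gamma> \<in> \<Gamma> \<Longrightarrow> cmod (\<phi>' \<gamma>) \<le> cmod (\<phi> \<gamma> z0) * c" for \<phi>' :: "_ \<Rightarrow> complex" and c
    by (rule abs_summable_summable, rule summable_on_comparison_test[OF summable_on_cmult_left[OF sm[OF z0]]])
       (use that in auto)
  define S where "S = (\<Sum>\<^sub>\<infinity>\<gamma>\<in>\<Gamma>. cmod (\<phi> \<gamma> z0))"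
  have S: "S \<ge> 0" unfolding S_def by (intro infsum_nonneg) simp
  have infb: "cmod (\<Sum>\<^sub>\<infinity>\<gamma>\<in>\<Gamma>. \<phi>' \<gamma>) \<le> S * c" if "\<And>\<gamma>. \<gamma> \<in> \<Gamma> \<Longrightarrow> cmod (\<phi>' \<gamma>) \<le> cmod (\<phi> \<gamma> z0) * c" for \<phi>' c
  proof -
    have sc: "(\<lambda>\<gamma>. cmod (\<phi> \<gamma> z0) * c) summable_on \<Gamma>" by (rule summable_on_cmult_left[OF sm[OF z0]])
    have sn: "(\<lambda>\<gamma>. cmod (\<phi>' \<gamma>)) summable_on \<Gamma>"
      by (rule summable_on_comparison_test[OF sc]) (use that in auto)
    have "cmod (\<Sum>\<^sub>\<infinity>\<gamma>\<in>\<Gamma>. \<phi>' \<gamma>) \<le> (\<Sum>\<^sub>\<infinity>\<gamma>\<in>\<Gamma>. cmod (\<phi>' \<gamma>))" by (rule norm_infsum_bound[OF sn])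
    also have "\<dots> \<le> (\<Sum>\<^sub>\<infinity>\<gamma>\<in>\<Gamma>. cmod (\<phi> \<gamma> z0) * c)" by (rule infsum_mono[OF sn sc that])
    also have "\<dots> = S * c" unfolding S_def by (rule infsum_cmult_left')
    finally show ?thesis .
  qed
  define L where "L h = (\<Sum>\<^sub>\<infinity>\<gamma>\<in>\<Gamma>. \<phi> \<gamma> z0 * l (R \<gamma> ** h))" for h :: "'n cmat"
  have lb: "cmod (\<phi> \<gamma> z0 * l (R \<gamma> ** h)) \<le> cmod (\<phi> \<gamma> z0) * (K * norm h * \<Lambda>)" if "\<gamma> \<in> \<Gamma>" for \<gamma> and h :: "'n cmat"
    unfolding norm_mult using \<Lambda> Rb[OF that, of h]
    by (intro mult_left_mono order_trans[OF \<Lambda>(2)] mult_right_mono) auto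
  have lsm: "(\<lambda>\<gamma>. \<phi> \<gamma> z0 * l (R \<gamma> ** h)) summable_on \<Gamma>" for h
    by (rule sm') (rule lb)
  have linL: "bounded_linear L"
  proof (rule bounded_linear_intro)
    show "L (x + y) = L x + L y" for x y
      unfolding L_def by (subst infsum_add[OF lsm lsm, symmetric])
        (simp add: matrix_add_ldistrib linear_add[OF bounded_linear.linear[OF bl]] distrib_left)
    show "L (r *\<^sub>R x) = r *\<^sub>R L x" for r x
      unfolding L_def by (subst infsum_scaleR_right[symmetric])
        (simp add: matrix_scaleR_right linear_scale[OF bounded_linear.linear[OF bl]])
    show "norm (L x) \<le> norm x * (S * K * \<Lambda>)" for x
      using infb[OF lb, of x] by (simp add: L_def mult_ac)
  qed
  have clin: "L (map_matrix (\<lambda>w. c * w) v) = c * L v" for c v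
  proof -
    have eq: "R \<gamma> ** map_matrix (\<lambda>w. c * w) v = map_matrix (\<lambda>w. c * w) (R \<gamma> ** v)" for \<gamma>
      by (simp add: vec_eq_iff matrix_matrix_mult_def sum_distrib_left mult_ac)
    show ?thesis
      unfolding L_def infsum_cmult_right'[symmetric] eq l(2) by (simp only: mult.left_commute)
  qed
  have "(Delta \<Gamma> m \<xi> has_derivative L) (at z0 within siegel_space)"
    unfolding has_derivative_within_alt
  proof (intro conjI linL allI impI)
    fix e :: real assume e: "e > 0"
    \<comment> \<open>Chosen so that S K e' \<le> e; the summand 1 keeps the denominator positive
      when S K = 0.\<close>
    define e' where "e' = e / (S * K + 1)"
    have SK: "S * K + 1 > 0" using S K by (simp add: add_nonneg_pos)
    have e': "e' > 0" using e SK by (simp add: e'_def)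
    have psi0: "\<psi> 0 = 1" by (simp add: \<psi>_def)
    obtain d where d: "d > 0" "\<And>M. norm M < d \<Longrightarrow> norm (\<psi> M - 1 - l M) \<le> e' * norm M"
    proof -
      have "\<exists>d>0. \<forall>y. norm (y - 0) < d \<longrightarrow> norm (\<psi> y - \<psi> 0 - l (y - 0)) \<le> e' * norm (y - 0)"
        using l(1) e' unfolding has_derivative_at_alt by blast
      then show thesis using that by (auto simp: psi0)
    qed
    show "\<exists>d>0. \<forall>y\<in>siegel_space. norm (y - z0) < d \<longrightarrow> norm (Delta \<Gamma> m \<xi> y - Delta \<Gamma> m \<xi> z0 - L (y - z0)) \<le> e * norm (y - z0)"
    proof (intro exI[of _ "d / (K + 1)"] conjI ballI impI)
      show "d / (K + 1) > 0" using d K by simp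
      fix z :: "'n cmat" assume z: "z \<in> siegel_space" and zd: "norm (z - z0) < d / (K + 1)"
      let ?h = "z - z0"
      have Kd: "K * norm ?h < d"
      proof -
        have "K * norm ?h \<le> (K + 1) * norm ?h" by (simp add: distrib_right)
        also have "\<dots> < d" using zd K by (simp add: field_simps)
        finally show ?thesis .
      qed
      have "Delta \<Gamma> m \<xi> z - Delta \<Gamma> m \<xi> z0 - L ?h = (\<Sum>\<^sub>\<infinity>\<gamma>\<in>\<Gamma>. \<phi> \<gamma> z - \<phi> \<gamma> z0 - \<phi> \<gamma> z0 * l (R \<gamma> ** ?h))"
        unfolding L_def Delta_def poincare_series_def \<phi>_def[symmetric]
        using abs_summable_summable[OF sm[OF z]] abs_summable_summable[OF sm[OF z0]] lsm[of ?h]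
        by (simp add: infsum_diff_complex)
      also have "cmod \<dots> \<le> S * (e' * (K * norm ?h))"
      proof (rule infb)
        fix \<gamma> assume \<gamma>: "\<gamma> \<in> \<Gamma>"
        have "\<phi> \<gamma> z - \<phi> \<gamma> z0 - \<phi> \<gamma> z0 * l (R \<gamma> ** ?h) = \<phi> \<gamma> z0 * (\<psi> (R \<gamma> ** ?h) - 1 - l (R \<gamma> ** ?h))"
          unfolding expand[OF \<gamma> z] by (simp add: algebra_simps)
        moreover have "norm (\<psi> (R \<gamma> ** ?h) - 1 - l (R \<gamma> ** ?h)) \<le> e' * norm (R \<gamma> ** ?h)"
          using Rb[OF \<gamma>, of ?h] Kd by (intro d(2)) simp
        moreover have "e' * norm (R \<gamma> ** ?h) \<le> e' * (K * norm ?h)"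
          using Rb[OF \<gamma>, of ?h] e' by (intro mult_left_mono) auto
        ultimately show "cmod (\<phi> \<gamma> z - \<phi> \<gamma> z0 - \<phi> \<gamma> z0 * l (R \<gamma> ** ?h)) \<le> cmod (\<phi> \<gamma> z0) * (e' * (K * norm ?h))"
          by (simp add: norm_mult mult_left_mono)
      qed
      also have "\<dots> = (S * K) * e' * norm ?h" by (simp add: mult_ac)
      also have "\<dots> \<le> (S * K + 1) * e' * norm ?h" using e' by (intro mult_right_mono) auto
      also have "\<dots> = e * norm ?h" using SK by (simp add: e'_def)
      finally show "norm (Delta \<Gamma> m \<xi> z - Delta \<Gamma> m \<xi> z0 - L ?h) \<le> e * norm ?h" .
    qed
  qed
  with clin show "\<exists>L. (Delta \<Gamma> m \<xi> has_derivative L) (at z0 within siegel_space) \<and> (\<forall>c v. L (map_matrix (\<lambda>w. c * w) v) = c * L v)"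
    by blast
qed

lemma Delta_cusp_form:
  fixes \<xi> :: "'n::{finite,linorder} cmat"
  assumes \<Gamma>: "congruence_subgroup \<Gamma>" and \<xi>: "\<xi> \<in> siegel_space" and m: "m > 2 * CARD('n)"
  shows "Delta \<Gamma> m \<xi> \<in> siegel_cusp_forms m \<Gamma>"
proof -
  obtain B where sm: "\<And>z :: 'n cmat. z \<in> siegel_space \<Longrightarrow> (\<lambda>\<gamma>. cmod (slash m (f1 m \<xi>) \<gamma> z)) summable_on \<Gamma>"
    and B: "\<And>z :: 'n cmat. z \<in> siegel_space \<Longrightarrow>
      (\<Sum>\<^sub>\<infinity>\<gamma>\<in>\<Gamma>. cmod (slash m (f1 m \<xi>) \<gamma> z)) * det (map_matrix Im z) powr (real m / 2) \<le> B"
    using poincare_bounded[OF \<Gamma> \<xi> m] by blast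
  have "cmod (Delta \<Gamma> m \<xi> z) * det (map_matrix Im z) powr (real m / 2) \<le> B" if z: "z \<in> siegel_space" for z
  proof -
    have "cmod (Delta \<Gamma> m \<xi> z) \<le> (\<Sum>\<^sub>\<infinity>\<gamma>\<in>\<Gamma>. cmod (slash m (f1 m \<xi>) \<gamma> z))"
      unfolding Delta_def poincare_series_def by (rule norm_infsum_bound[OF sm[OF z]])
    then show ?thesis using B[OF z] by (meson mult_right_mono order_trans powr_ge_zero)
  qed
  then have "bdd_above ((\<lambda>z. cmod (Delta \<Gamma> m \<xi> z) * det (map_matrix Im z) powr (real m / 2)) ` siegel_space)"
    by (intro bdd_aboveI) auto
  then show ?thesis
    using siegel_holomorphic_Delta[OF assms] slash_poincare[OF \<Gamma>, of _ _ m "f1 m \<xi>"]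
    by (auto simp: siegel_cusp_forms_def Delta_def)
qed

section \<open>The quotient: Borel orbit representatives, fixed points and unfolding\<close>

section \<open>A Borel set of orbit representatives\<close>

definition orbit :: "'n::finite sp_mat set \<Rightarrow> 'n cmat \<Rightarrow> 'n cmat set" where
  "orbit \<Gamma> z = (\<lambda>\<gamma>. sp_act \<gamma> z) ` \<Gamma>"

lemma orbit_refl: "congruence_subgroup \<Gamma> \<Longrightarrow> z \<in> siegel_space \<Longrightarrow> z \<in> orbit \<Gamma> z"
  unfolding orbit_def by (rule image_eqI[of _ _ "mat 1"]) (auto intro: congruence_subgroup_1)

lemma orbit_siegel: "congruence_subgroup \<Gamma> \<Longrightarrow> z \<in> siegel_space \<Longrightarrow> orbit \<Gamma> z \<subseteq> siegel_space"
  by (auto simp: orbit_def intro!: sp_act_in_siegel congruence_subgroup_Sp_real)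

lemma orbit_eq:
  assumes \<Gamma>: "congruence_subgroup \<Gamma>" and z: "z \<in> siegel_space" and w: "w \<in> orbit \<Gamma> z"
  shows "orbit \<Gamma> w = orbit \<Gamma> z"
proof -
  obtain g where g: "g \<in> \<Gamma>" "w = sp_act g z" using w by (auto simp: orbit_def)
  have sp: "h \<in> Sp_real" if "h \<in> \<Gamma>" for h using congruence_subgroup_Sp_real[OF \<Gamma> that] .
  have "sp_act h w \<in> orbit \<Gamma> z" if "h \<in> \<Gamma>" for h
    unfolding orbit_def using that g z sp
    by (intro image_eqI[of _ _ "h ** g"]) (auto simp: sp_act_mult intro: congruence_subgroup_mult[OF \<Gamma>])
  moreover have "sp_act h z \<in> orbit \<Gamma> w" if h: "h \<in> \<Gamma>" for h
    unfolding orbit_def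
  proof (rule image_eqI[of _ _ "h ** matrix_inv g"])
    note inv = congruence_subgroup_inverse[OF \<Gamma> g(1)]
    show "h ** matrix_inv g \<in> \<Gamma>" by (intro congruence_subgroup_mult[OF \<Gamma>] h inv)
    have "sp_act (h ** matrix_inv g) w = sp_act h (sp_act (matrix_inv g) w)"
      by (intro sp_act_mult sp h inv(1)) (simp add: g sp_act_in_siegel sp z)
    then show "sp_act h z = sp_act (h ** matrix_inv g) w"
      by (simp add: g(2) sp_act_inverse[OF \<Gamma> g(1) z])
  qed
  ultimately show ?thesis by (auto simp: orbit_def)
qed

definition finite_orbit_section :: "'n::finite sp_mat set \<Rightarrow> 'n cmat set \<Rightarrow> bool" where
  "finite_orbit_section \<Gamma> F \<longleftrightarrow> F \<in> sets borel \<and> F \<subseteq> siegel_space \<and>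
     (\<forall>z\<in>siegel_space. finite (F \<inter> orbit \<Gamma> z) \<and> F \<inter> orbit \<Gamma> z \<noteq> {})"

text \<open>The section consists of the points lying in the first set of the exhaustion by the compact sets
  \<open>siegel_compact k\<close> that their orbit meets. It meets every orbit in finitely many points, and keeping
  those with minimal entries, one real coordinate at a time, leaves one point per orbit.\<close>

lemma ex_finite_orbit_section:
  assumes \<Gamma>: "congruence_subgroup \<Gamma>"
  shows "\<exists>F. finite_orbit_section \<Gamma> (F :: 'n::finite cmat set)"
proof -
  let ?E = "siegel_compact :: nat \<Rightarrow> 'n cmat set"
  define F where "F = (\<Union>k. ?E k \<inter> (\<Inter>\<gamma>\<in>\<Gamma>. \<Inter>j\<in>{..<k}. siegel_space - {z \<in> siegel_space. sp_act \<gamma> z \<in> ?E j}))"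
  have ne: "\<Gamma> \<noteq> {}" using congruence_subgroup_1[OF \<Gamma>] by blast
  have sp: "h \<in> Sp_real" if "h \<in> \<Gamma>" for h using congruence_subgroup_Sp_real[OF \<Gamma> that] .
  have "?E k \<inter> (\<Inter>\<gamma>\<in>\<Gamma>. \<Inter>j\<in>{..<k}. siegel_space - {z \<in> siegel_space. sp_act \<gamma> z \<in> ?E j}) \<in> sets borel" for k
  \<comment> \<open>For k = 0 the intersection over j is empty, hence the whole space; closure under
    countable intersections is used for nonempty index sets only.\<close>
  proof (cases "k = 0")
    case False
    have A: "siegel_space - {z \<in> siegel_space. sp_act \<gamma> z \<in> ?E j} \<in> sets borel" if "\<gamma> \<in> \<Gamma>" for \<gamma> j
      by (intro sets.Diff siegel_space_borel sp_act0_vimage_borel sp that siegel_compact_borel)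
    have B: "(\<Inter>j\<in>{..<k}. siegel_space - {z \<in> siegel_space. sp_act \<gamma> z \<in> ?E j}) \<in> sets borel" if "\<gamma> \<in> \<Gamma>" for \<gamma>
    proof (rule sets.countable_INT')
      show "{..<k} \<noteq> {}" using False by auto
      show "(\<lambda>j. siegel_space - {z \<in> siegel_space. sp_act \<gamma> z \<in> ?E j}) ` {..<k} \<subseteq> sets borel"
        by (rule image_subsetI) (rule A[OF that])
    qed simp
    have "(\<Inter>\<gamma>\<in>\<Gamma>. \<Inter>j\<in>{..<k}. siegel_space - {z \<in> siegel_space. sp_act \<gamma> z \<in> ?E j}) \<in> sets borel"
    proof (rule sets.countable_INT'[OF countable_congruence_subgroup[OF \<Gamma>] ne])
      show "(\<lambda>\<gamma>. \<Inter>j\<in>{..<k}. siegel_space - {z \<in> siegel_space. sp_act \<gamma> z \<in> ?E j}) ` \<Gamma> \<subseteq> sets borel"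
        by (rule image_subsetI) (rule B)
    qed
    then show ?thesis by (intro sets.Int siegel_compact_borel)
  qed simp
  then have Fb: "F \<in> sets borel" unfolding F_def by (intro sets.countable_UN) auto
  have FH: "F \<subseteq> siegel_space" unfolding F_def using siegel_compact_subset by blast
  have memF: "w \<in> F \<longleftrightarrow> (\<exists>k. w \<in> ?E k \<and> (\<forall>v\<in>orbit \<Gamma> w. \<forall>j<k. v \<notin> ?E j))" if "w \<in> siegel_space" for w
    using that by (auto simp: F_def orbit_def)
  have "finite (F \<inter> orbit \<Gamma> z) \<and> F \<inter> orbit \<Gamma> z \<noteq> {}" if z: "z \<in> siegel_space" for z
  proof -
    have "\<exists>k. \<exists>w\<in>orbit \<Gamma> z. w \<in> ?E k"
      using orbit_refl[OF \<Gamma> z] z unfolding siegel_space_eq_UN by blast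
    define k where "k = (LEAST k. \<exists>w\<in>orbit \<Gamma> z. w \<in> ?E k)"
    have k: "\<exists>w\<in>orbit \<Gamma> z. w \<in> ?E k" unfolding k_def by (rule LeastI_ex) fact
    have least: "w \<notin> ?E j" if "j < k" "w \<in> orbit \<Gamma> z" for j w
      using not_less_Least[OF that(1)[unfolded k_def]] that(2) by blast
    obtain w where w: "w \<in> orbit \<Gamma> z" "w \<in> ?E k" using k by blast
    have "w \<in> F"
      using w orbit_siegel[OF \<Gamma> z] least orbit_eq[OF \<Gamma> z w(1)] by (subst memF) auto
    moreover have "F \<inter> orbit \<Gamma> z \<subseteq> (\<lambda>\<gamma>. sp_act \<gamma> z) ` {\<gamma> \<in> \<Gamma>. sp_act \<gamma> z \<in> ?E k}"
    proof
      fix v assume v: "v \<in> F \<inter> orbit \<Gamma> z"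
      then have "v \<in> siegel_space" "orbit \<Gamma> v = orbit \<Gamma> z" using FH orbit_eq[OF \<Gamma> z] by auto
      then obtain l where l: "v \<in> ?E l" "\<forall>u\<in>orbit \<Gamma> z. \<forall>j<l. u \<notin> ?E j"
        using v memF by auto
      have "l \<le> k" using l(2) w by (meson not_le_imp_less)
      then have "v \<in> ?E k" using l(1) siegel_compact_mono by blast
      then show "v \<in> (\<lambda>\<gamma>. sp_act \<gamma> z) ` {\<gamma> \<in> \<Gamma>. sp_act \<gamma> z \<in> ?E k}" using v by (auto simp: orbit_def)
    qed
    then have "finite (F \<inter> orbit \<Gamma> z)"
      by (rule finite_subset) (intro finite_imageI card_return_le(1)[OF \<Gamma> z order_refl])
    ultimately show ?thesis using w by blast
  qed
  with Fb FH show ?thesis unfolding finite_orbit_section_def by blast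
qed

text \<open>Being minimal for \<phi> on the part of the orbit in F is a countable conjunction of
  Borel conditions, as \<Gamma> is countable; finiteness of that part ensures that a minimum is
  attained.\<close>

lemma refine_orbit_section:
  fixes \<phi> :: "'n::finite cmat \<Rightarrow> real"
  assumes \<Gamma>: "congruence_subgroup \<Gamma>" and F: "finite_orbit_section \<Gamma> F" and \<phi>: "\<phi> \<in> borel_measurable borel"
  obtains F' where "finite_orbit_section \<Gamma> F'" "F' \<subseteq> F"
    "\<And>z w. z \<in> F' \<Longrightarrow> w \<in> F' \<Longrightarrow> w \<in> orbit \<Gamma> z \<Longrightarrow> \<phi> z = \<phi> w"
proof -
  have Fb: "F \<in> sets borel" and FH: "F \<subseteq> siegel_space"
    and Ff: "\<And>z. z \<in> siegel_space \<Longrightarrow> finite (F \<inter> orbit \<Gamma> z)" "\<And>z. z \<in> siegel_space \<Longrightarrow> F \<inter> orbit \<Gamma> z \<noteq> {}"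
    using F by (auto simp: finite_orbit_section_def)
  have sp: "h \<in> Sp_real" if "h \<in> \<Gamma>" for h using congruence_subgroup_Sp_real[OF \<Gamma> that] .
  have ne: "\<Gamma> \<noteq> {}" using congruence_subgroup_1[OF \<Gamma>] by blast
  define F' where "F' = F \<inter> (\<Inter>\<gamma>\<in>\<Gamma>. (UNIV - {z \<in> siegel_space. sp_act \<gamma> z \<in> F}) \<union> {z. \<phi> z \<le> \<phi> (sp_act0 \<gamma> z)})"
  have mem: "z \<in> F' \<longleftrightarrow> z \<in> F \<and> (\<forall>w\<in>F \<inter> orbit \<Gamma> z. \<phi> z \<le> \<phi> w)" for z
  proof (cases "z \<in> F")
    case True
    then have "z \<in> siegel_space" using FH by blast
    then show ?thesis using True by (auto simp: F'_def orbit_def sp_act0_def)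
  qed (simp add: F'_def)
  have "(UNIV - {z \<in> siegel_space. sp_act \<gamma> z \<in> F}) \<union> {z. \<phi> z \<le> \<phi> (sp_act0 \<gamma> z)} \<in> sets borel" if "\<gamma> \<in> \<Gamma>" for \<gamma>
  proof -
    have "(\<lambda>z. \<phi> (sp_act0 \<gamma> z)) \<in> borel_measurable borel"
      by (rule measurable_compose[OF sp_act0_measurable[OF sp[OF that]] \<phi>])
    from borel_measurable_le[OF \<phi> this] have "{z. \<phi> z \<le> \<phi> (sp_act0 \<gamma> z)} \<in> sets borel" by simp
    then show ?thesis
      by (intro sets.Un sets.Diff sp_act0_vimage_borel sp that Fb) auto
  qed
  then have "(\<Inter>\<gamma>\<in>\<Gamma>. (UNIV - {z \<in> siegel_space. sp_act \<gamma> z \<in> F}) \<union> {z. \<phi> z \<le> \<phi> (sp_act0 \<gamma> z)}) \<in> sets borel"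
    using ne by (intro sets.countable_INT' countable_congruence_subgroup[OF \<Gamma>]) auto
  then have F'b: "F' \<in> sets borel" unfolding F'_def by (rule sets.Int[OF Fb])
  have sub: "F' \<subseteq> F" by (auto simp: F'_def)
  have ne': "F' \<inter> orbit \<Gamma> z \<noteq> {}" if z: "z \<in> siegel_space" for z
  proof -
    let ?O = "F \<inter> orbit \<Gamma> z"
    have "Min (\<phi> ` ?O) \<in> \<phi> ` ?O" using Ff[OF z] by (intro Min_in) auto
    then obtain w where w: "w \<in> ?O" "\<phi> w = Min (\<phi> ` ?O)" by fastforce
    have "\<phi> w \<le> \<phi> v" if "v \<in> ?O" for v unfolding w(2) using Ff[OF z] that by (intro Min_le) auto
    then have "w \<in> F'" using w(1) orbit_eq[OF \<Gamma> z, of w] by (simp add: mem)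
    with w(1) show ?thesis by blast
  qed
  have eq: "\<phi> z = \<phi> w" if "z \<in> F'" "w \<in> F'" "w \<in> orbit \<Gamma> z" for z w
  proof -
    have zs: "z \<in> siegel_space" using that(1) sub FH by blast
    have "z \<in> orbit \<Gamma> w" using orbit_eq[OF \<Gamma> zs that(3)] orbit_refl[OF \<Gamma> zs] by simp
    then show ?thesis using that by (intro antisym) (auto simp: mem)
  qed
  have "finite_orbit_section \<Gamma> F'"
    unfolding finite_orbit_section_def using F'b sub FH ne' Ff(1)
    by (blast intro: finite_subset[of "F' \<inter> _" "F \<inter> _"])
  then show ?thesis using sub eq that by blast
qed

text \<open>Refinement by one coordinate keeps the agreement in the earlier ones, since sections
  only shrink. After all real and imaginary parts of entries, two points of one orbit in the section
  coincide.\<close>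

lemma ex_orbit_representatives:
  assumes \<Gamma>: "congruence_subgroup \<Gamma>"
  shows "\<exists>F. orbit_representatives \<Gamma> (F :: 'n::finite cmat set)"
proof -
  define \<phi> where "\<phi> = (\<lambda>(i, j, b) (z::'n cmat). if b then Im (z $ i $ j) else Re (z $ i $ j))"
  have \<phi>: "\<phi> p \<in> borel_measurable borel" for p
  proof -
    obtain i j b where "p = (i, j, b)" by (cases p)
    then show ?thesis unfolding \<phi>_def
      by (cases b) (auto intro!: borel_measurable_continuous_onI continuous_intros)
  qed
  have "\<exists>F. finite_orbit_section \<Gamma> F \<and> (\<forall>z\<in>F. \<forall>w\<in>F. w \<in> orbit \<Gamma> z \<longrightarrow> (\<forall>p\<in>I. \<phi> p z = \<phi> p w))" if "finite I" for I
    using that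
  proof (induction I rule: finite_induct)
    case empty
    then show ?case using ex_finite_orbit_section[OF \<Gamma>] by auto
  next
    case (insert p I)
    then obtain F where F: "finite_orbit_section \<Gamma> F" "\<forall>z\<in>F. \<forall>w\<in>F. w \<in> orbit \<Gamma> z \<longrightarrow> (\<forall>p\<in>I. \<phi> p z = \<phi> p w)"
      by blast
    obtain F' where "finite_orbit_section \<Gamma> F'" "F' \<subseteq> F"
      "\<And>z w. z \<in> F' \<Longrightarrow> w \<in> F' \<Longrightarrow> w \<in> orbit \<Gamma> z \<Longrightarrow> \<phi> p z = \<phi> p w"
      using refine_orbit_section[OF \<Gamma> F(1) \<phi>] by blast
    with F(2) show ?case by (intro exI[of _ F']) blast
  qed
  from this[of UNIV] obtain F where F: "finite_orbit_section \<Gamma> F"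
    "\<And>z w p. z \<in> F \<Longrightarrow> w \<in> F \<Longrightarrow> w \<in> orbit \<Gamma> z \<Longrightarrow> \<phi> p z = \<phi> p w" by auto
  have FH: "F \<subseteq> siegel_space" using F(1) by (simp add: finite_orbit_section_def)
  have inj: "z = w" if "z \<in> F" "w \<in> F" "w \<in> orbit \<Gamma> z" for z w
  proof -
    have "Re (z $ i $ j) = Re (w $ i $ j)" "Im (z $ i $ j) = Im (w $ i $ j)" for i j
      using F(2)[OF that, of "(i, j, False)"] F(2)[OF that, of "(i, j, True)"] by (simp_all add: \<phi>_def)
    then show ?thesis by (simp add: vec_eq_iff complex_eq_iff)
  qed
  have "\<exists>!w. w \<in> F \<and> w \<in> orbit \<Gamma> z" if z: "z \<in> siegel_space" for z
  proof -
    obtain w where w: "w \<in> F" "w \<in> orbit \<Gamma> z" using F(1) z by (auto simp: finite_orbit_section_def)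
    have "v = w" if "v \<in> F" "v \<in> orbit \<Gamma> z" for v
      using inj[OF w(1) that(1)] orbit_eq[OF \<Gamma> z w(2)] that(2) by simp
    with w show ?thesis by blast
  qed
  then have "orbit_representatives \<Gamma> F"
    using F(1) unfolding orbit_representatives_def finite_orbit_section_def orbit_def by blast
  then show ?thesis ..
qed

section \<open>Fixed points form a null set\<close>

text \<open>By translation invariance the measure of T is the average of the measures of its
  translates along t h for t in [0, 1]. Exchanging the integrals replaces it by the lengths of the
  intersections with lines, which are finite sets.\<close>

lemma sym_lborel_null_if_lines_finite:
  fixes T :: "'n::{finite,linorder} cmat set"
  assumes T: "T \<in> sets borel" and h: "transpose h = h" and fin: "\<And>z. finite {t::real. z + t *\<^sub>R h \<in> T}"
  shows "emeasure sym_lborel T = 0"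
proof -
  define T' where "T' = sym_of -` T"
  define h' where "h' = sym_coords h"
  have T': "T' \<in> sets borel" using measurable_sets[OF sym_of_measurable T] by (simp add: T'_def)
  have eq: "emeasure sym_lborel T = emeasure lborel T'"
    unfolding sym_lborel_eq_sym_of using T by (subst emeasure_distr) (auto simp: T'_def)
  have line: "finite {t::real. x + t *\<^sub>R h' \<in> T'}" for x
  proof -
    have "sym_of (x + t *\<^sub>R h') = sym_of x + t *\<^sub>R h" for t
      by (simp add: linear_add[OF linear_sym_of] linear_scale[OF linear_sym_of] h'_def sym_of_sym_coords[OF h])
    then show ?thesis using fin[of "sym_of x"] by (simp add: T'_def)
  qed
  have m: "(\<lambda>p. indicator {0..1} (fst p) * indicator T' (snd p + fst p *\<^sub>R h') :: ennreal) \<in> borel_measurable (lborel \<Otimes>\<^sub>M lborel)"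
  proof -
    have "(\<lambda>p. snd p + fst p *\<^sub>R h') \<in> borel_measurable (lborel \<Otimes>\<^sub>M lborel)" by measurable
    from measurable_compose[OF this borel_measurable_indicator[OF T']] show ?thesis by measurable
  qed
  have shift: "(\<integral>\<^sup>+x. indicator T' (x + d) \<partial>lborel) = emeasure lborel T'" for d
  proof -
    have "(\<integral>\<^sup>+x. indicator T' (x + d) \<partial>lborel) = (\<integral>\<^sup>+x. indicator T' x \<partial>distr lborel borel ((+) d))"
      using T' by (subst nn_integral_distr) (auto simp: add.commute)
    then show ?thesis using T' by (simp add: lborel_distr_plus)
  qed
  have "emeasure lborel T' = (\<integral>\<^sup>+t. indicator {0..1} t * emeasure lborel T' \<partial>(lborel :: real measure))"
    by (simp add: nn_integral_multc)
  also have "\<dots> = (\<integral>\<^sup>+t. (\<integral>\<^sup>+x. indicator {0..1} t * indicator T' (x + t *\<^sub>R h') \<partial>lborel) \<partial>(lborel :: real measure))"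
  proof (rule nn_integral_cong)
    fix t :: real
    have "(\<lambda>x. indicator T' (x + t *\<^sub>R h') :: ennreal) \<in> borel_measurable borel"
      by (rule measurable_compose[OF _ borel_measurable_indicator[OF T']]) measurable
    then show "indicator {0..1} t * emeasure lborel T' = (\<integral>\<^sup>+x. indicator {0..1} t * indicator T' (x + t *\<^sub>R h') \<partial>lborel)"
      by (subst nn_integral_cmult) (simp_all add: shift)
  qed
  also have "\<dots> = (\<integral>\<^sup>+x. (\<integral>\<^sup>+t. indicator {0..1} t * indicator T' (x + t *\<^sub>R h') \<partial>(lborel :: real measure)) \<partial>lborel)"
    by (rule lborel_pair.Fubini'[symmetric]) (use m in \<open>simp add: case_prod_beta\<close>)
  also have "\<dots> = (\<integral>\<^sup>+x. 0 \<partial>(lborel :: (real^'n sym_idx) measure))"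
  proof (rule nn_integral_cong)
    fix x
    have "AE t in lborel. t \<notin> {t::real. x + t *\<^sub>R h' \<in> T'}"
      by (intro AE_not_in finite_imp_null_set_lborel line)
    then have "AE t in lborel. indicator {0..1} t * indicator T' (x + t *\<^sub>R h') = (0 :: ennreal)"
      by eventually_elim (simp add: indicator_def)
    then show "(\<integral>\<^sup>+t. indicator {0..1} t * indicator T' (x + t *\<^sub>R h') \<partial>(lborel :: real measure)) = 0"
      by (subst nn_integral_cong_AE[where v = "\<lambda>_. 0"]) auto
  qed
  finally show ?thesis by (simp add: eq)
qed

lemma finite_real_quadratic_roots:
  fixes a b c :: complex
  assumes "b \<noteq> 0 \<or> c \<noteq> 0"
  shows "finite {t::real. a + of_real t * b + of_real t ^ 2 * c = 0}"
proof -
  have "[:a, b, c:] \<noteq> 0" using assms by auto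
  then have "finite {x. poly [:a, b, c:] x = 0}" by (rule poly_roots_finite)
  then have "finite (complex_of_real -` {x. poly [:a, b, c:] x = 0})"
    by (rule finite_vimageI) (simp add: inj_def)
  then show ?thesis by (rule finite_subset[rotated]) (auto simp: algebra_simps power2_eq_square)
qed

text \<open>Commuting with the symmetric matrices E_rs + E_sr, read as E_rr for r = s, kills the
  off-diagonal entries and equates the diagonal ones.\<close>

lemma commute_symmetric_imp_scalar:
  fixes A :: "complex^'n^'n"
  assumes "\<And>h :: complex^'n^'n. transpose h = h \<Longrightarrow> (\<forall>i j. h $ i $ j \<in> \<real>) \<Longrightarrow> h ** A = A ** h"
  shows "A = diag_mat (\<lambda>_. A $ k $ k)"
proof -
  define h :: "'n \<Rightarrow> 'n \<Rightarrow> complex^'n^'n" where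
    "h r s = (\<chi> i j. if (i = r \<and> j = s) \<or> (i = s \<and> j = r) then 1 else 0)" for r s
  have comm: "h r s ** A = A ** h r s" for r s
    by (rule assms) (auto simp: h_def vec_eq_iff transpose_def)
  have left: "(h r s ** A) $ i $ j = (if i = r then A $ s $ j else if i = s then A $ r $ j else 0)" for r s i j
  proof -
    have "(\<Sum>k\<in>UNIV. h r s $ i $ k * A $ k $ j) = (\<Sum>k\<in>UNIV. if k = (if i = r then s else r) then (if i = r \<or> i = s then A $ k $ j else 0) else 0)"
      by (intro sum.cong refl) (auto simp: h_def)
    then show ?thesis by (simp add: matrix_matrix_mult_def)
  qed
  have right: "(A ** h r s) $ i $ j = (if j = r then A $ i $ s else if j = s then A $ i $ r else 0)" for r s i j
  proof -
    have "(\<Sum>k\<in>UNIV. A $ i $ k * h r s $ k $ j) = (\<Sum>k\<in>UNIV. if k = (if j = r then s else r) then (if j = r \<or> j = s then A $ i $ k else 0) else 0)"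
      by (intro sum.cong refl) (auto simp: h_def)
    then show ?thesis by (simp add: matrix_matrix_mult_def)
  qed
  have key: "(if i = r then A $ s $ j else if i = s then A $ r $ j else 0) = (if j = r then A $ i $ s else if j = s then A $ i $ r else 0)" for i j r s
    using left[of r s i j] right[of r s i j] comm[of r s] by simp
  have off: "A $ i $ j = 0" if "i \<noteq> j" for i j
    using key[of j j j i] key[of i i i j] that key[of i i j j] key[of j i i i] by (auto split: if_splits)
  have dg: "A $ i $ i = A $ k $ k" for i
    using key[of i i k k] key[of i k k i] by (auto split: if_splits)
  show ?thesis using off dg by (auto simp: vec_eq_iff diag_mat_def)
qed

text \<open>Fixed points solve the quadratic equation \<open>z (C z + D) = A z + B\<close>, which is not identically zero
  on the lines in a suitable symmetric direction unless it is inconsistent.\<close>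

lemma siegel_fixed_points_null:
  fixes g :: "'n::{finite,linorder} sp_mat"
  assumes g: "g \<in> Sp_real" and ne: "g \<noteq> mat 1" "g \<noteq> - mat 1"
  shows "{z \<in> siegel_space. sp_act g z = z} \<in> null_sets siegel_measure"
proof -
  let ?A = "block_A g" and ?B = "block_B g" and ?C = "block_C g" and ?D = "block_D g"
  define Q where "Q z = z ** (?C ** z + ?D) - (?A ** z + ?B)" for z
  have sub: "{z \<in> siegel_space. sp_act g z = z} \<subseteq> {z. Q z = 0}"
    using sp_act_mult_den[OF g] by (fastforce simp: Q_def aut_num_def aut_den_def)
  have Qb: "{z. Q z = 0} \<in> sets borel"
    unfolding Q_def by (intro borel_closed closed_Collect_eq continuous_intros)
  have expand: "Q (z + t *\<^sub>R h) = Q z + t *\<^sub>R (z ** ?C ** h + h ** ?C ** z + h ** ?D - ?A ** h) + (t ^ 2) *\<^sub>R (h ** ?C ** h)" for z h t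
    by (simp add: Q_def matrix_add_ldistrib matrix_add_rdistrib' matrix_scaleR_left matrix_scaleR_right
        matrix_mul_assoc power2_eq_square algebra_simps)
  have ent: "Q (z + t *\<^sub>R h) $ i $ j = Q z $ i $ j + of_real t * (z ** ?C ** h + h ** ?C ** z + h ** ?D - ?A ** h) $ i $ j
      + of_real t ^ 2 * (h ** ?C ** h) $ i $ j" for z t h i j
    unfolding expand vector_add_component vector_scaleR_component by (simp only: scaleR_conv_of_real of_real_power)
  have lines: "finite {t::real. z + t *\<^sub>R h \<in> {z. Q z = 0}}"
    if "(z ** ?C ** h + h ** ?C ** z + h ** ?D - ?A ** h) $ i $ j \<noteq> 0 \<or> (h ** ?C ** h) $ i $ j \<noteq> 0" for z h i j
  proof (rule finite_subset[OF _ finite_real_quadratic_roots[OF that]])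
    show "{t. z + t *\<^sub>R h \<in> {z. Q z = 0}} \<subseteq> {t. Q z $ i $ j + of_real t * (z ** ?C ** h + h ** ?C ** z + h ** ?D - ?A ** h) $ i $ j
      + of_real t ^ 2 * (h ** ?C ** h) $ i $ j = 0}"
      unfolding ent[symmetric] by auto
  qed
  have "emeasure sym_lborel ({z. Q z = 0} :: 'n cmat set) = 0 \<or> {z \<in> siegel_space. sp_act g z = z} = {}"
  proof (cases "?C = 0")
    case False
    then obtain i j where "?C $ i $ j \<noteq> 0" by (auto simp: vec_eq_iff)
    \<comment> \<open>Along the identity matrix the coefficient of t^2 is C itself.\<close>
    then have "emeasure sym_lborel ({z. Q z = 0} :: 'n cmat set) = 0"
      by (intro sym_lborel_null_if_lines_finite[OF Qb, of "mat 1"] lines[of _ "mat 1" i j]) auto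
    then show ?thesis ..
  next
    case C: True
    show ?thesis
    proof (cases "\<exists>h. transpose h = h \<and> h ** ?D \<noteq> ?A ** h")
      case True
      then obtain h where h: "transpose h = h" "h ** ?D \<noteq> ?A ** h" by blast
      then obtain i j where "(h ** ?D) $ i $ j \<noteq> (?A ** h) $ i $ j" by (auto simp: vec_eq_iff)
      then have "emeasure sym_lborel ({z. Q z = 0} :: 'n cmat set) = 0"
        by (intro sym_lborel_null_if_lines_finite[OF Qb h(1)] lines[of _ h i j]) (simp add: C)
      then show ?thesis ..
    next
      case False
      then have all: "h ** ?D = ?A ** h" if "transpose h = h" for h using that by blast
      \<comment> \<open>Now every linear coefficient h D - A h vanishes as well. Then A commutes
        with all symmetric matrices, so it is a scalar a, and the symplectic relation gives a^2 = 1: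
        up to sign g is a translation.\<close>
      have DA: "?D = ?A" using all[of "mat 1"] by simp
      define a where "a = ?A $ undefined $ undefined"
      have A: "?A = diag_mat (\<lambda>_. a)"
        unfolding a_def by (rule commute_symmetric_imp_scalar) (use all DA in simp)
      have "transpose ?A ** ?D - transpose ?C ** ?B = mat 1" by (rule Sp_real_block(3)[OF g])
      then have "(diag_mat (\<lambda>_. a * a) :: 'n cmat) = mat 1"
        by (simp add: C DA A diag_mat_mult) (simp add: transpose_def vec_eq_iff matrix_matrix_mult_def)
      then have "(diag_mat (\<lambda>_. a * a) :: 'n cmat) $ undefined $ undefined = (mat 1 :: 'n cmat) $ undefined $ undefined" by (simp only:)
      then have "a * a = 1" by (simp add: diag_mat_def mat_def)
      then have a: "a = 1 \<or> a = -1" by (simp add: square_eq_1_iff)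
      have Q: "Q z = - ?B" for z
      proof -
        have "z ** diag_mat (\<lambda>_. a) = diag_mat (\<lambda>_. a) ** z"
          by (simp add: vec_eq_iff diag_mat_mult_left diag_mat_mult_right)
        then show ?thesis by (simp add: Q_def C DA A)
      qed
      \<comment> \<open>For B = 0 the matrix g would be 1 or -1. A nonzero B makes the fixed point
        equation inconsistent.\<close>
      have "?B \<noteq> 0"
      proof
        assume B: "?B = 0"
        have neg: "block_A (- mat 1) = - (mat 1 :: 'n cmat)" "block_B (- mat 1) = (0 :: 'n cmat)"
          "block_C (- mat 1) = (0 :: 'n cmat)" "block_D (- mat 1) = - (mat 1 :: 'n cmat)"
          by (simp_all add: vec_eq_iff block_A_def block_B_def block_C_def block_D_def mat_def)
        have "diag_mat (\<lambda>_. -1) = - (mat 1 :: 'n cmat)" by (simp add: vec_eq_iff diag_mat_def mat_def)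
        with a ne B C DA A block_eqI[of g "mat 1"] block_eqI[of g "- mat 1"] show False
          by (auto simp: neg diag_mat_1)
      qed
      then have "{z. Q z = 0} = {}" by (simp add: Q)
      then show ?thesis using sub by blast
    qed
  qed
  then show ?thesis
  proof
    assume 0: "emeasure sym_lborel ({z. Q z = 0} :: 'n cmat set) = 0"
    have "{z. Q z = 0} \<in> null_sets siegel_measure"
    proof -
      have "AE z in sym_lborel. z \<notin> {z :: 'n cmat. Q z = 0}"
        using 0 Qb by (intro AE_not_in) (auto simp: null_sets_def)
      then have "AE z in siegel_measure. z \<notin> {z :: 'n cmat. Q z = 0}"
        unfolding siegel_measure_eq by (subst AE_density) auto
      then show ?thesis using Qb by (subst (asm) AE_iff_null_sets[symmetric]) auto
    qed
    moreover have "{z \<in> siegel_space. sp_act g z = z} \<in> sets siegel_measure"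
    proof -
      have "{z \<in> siegel_space. sp_act g z = z} = siegel_space \<inter> {z. sp_act0 g z = z}"
        by (auto simp: sp_act0_def)
      moreover have "{z. sp_act0 g z = z} \<in> sets borel"
      proof -
        have "(\<lambda>z. sp_act0 g z - z) \<in> borel_measurable borel" using sp_act0_measurable[OF g] by measurable
        from measurable_sets[OF this, of "{0}"] have "(\<lambda>z. sp_act0 g z - z) -` {0} \<in> sets borel" by simp
        moreover have "(\<lambda>z. sp_act0 g z - z) -` {0} = {z. sp_act0 g z = z}" by auto
        ultimately show ?thesis by simp
      qed
      ultimately show ?thesis by auto
    qed
    ultimately show ?thesis using sub by (rule null_sets_subset)
  next
    assume E: "{z \<in> siegel_space. sp_act g z = z} = {}"
    show ?thesis unfolding E by simp
  qed
qed

section \<open>Unfolding\<close>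

lemma sp_act_minus_1:
  assumes "(- mat 1 :: 'n::finite sp_mat) \<in> Sp_real" and z: "z \<in> siegel_space"
  shows "sp_act (- mat 1) z = (z :: 'n cmat)"
proof (rule sp_actI[OF assms])
  have neg: "block_A (- mat 1) = diag_mat (\<lambda>_. -1)" "block_B (- mat 1) = (0 :: 'n cmat)"
    "block_C (- mat 1) = (0 :: 'n cmat)" "block_D (- mat 1) = diag_mat (\<lambda>_. -1)"
    by (simp_all add: vec_eq_iff block_A_def block_B_def block_C_def block_D_def mat_def diag_mat_def)
  show "z ** aut_den (- mat 1) z = aut_num (- mat 1) z"
    by (simp add: aut_num_def aut_den_def neg vec_eq_iff diag_mat_mult_left diag_mat_mult_right)
qed

text \<open>If w = \<delta>.z is the representative of the orbit, then \<gamma>^-1 z = w means that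
  \<gamma> \<delta> fixes z. The elements in question thus form the coset of \<delta>^-1 under the
  stabiliser, here \<Gamma> \<inter> {1, -1}.\<close>

lemma card_orbit_hits:
  fixes \<Gamma> :: "'n::finite sp_mat set"
  assumes \<Gamma>: "congruence_subgroup \<Gamma>" and F: "orbit_representatives \<Gamma> F" and z: "z \<in> siegel_space"
    and triv: "\<And>\<gamma>. \<gamma> \<in> \<Gamma> \<Longrightarrow> sp_act \<gamma> z = z \<Longrightarrow> \<gamma> = mat 1 \<or> \<gamma> = - mat 1"
  shows "finite {\<gamma> \<in> \<Gamma>. sp_act (matrix_inv \<gamma>) z \<in> F}"
    "card {\<gamma> \<in> \<Gamma>. sp_act (matrix_inv \<gamma>) z \<in> F} = card (\<Gamma> \<inter> {mat 1, - mat 1})"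
proof -
  note sp = congruence_subgroup_Sp_real[OF \<Gamma>] and mult = congruence_subgroup_mult[OF \<Gamma>]
    and inv = congruence_subgroup_inverse[OF \<Gamma>]
  let ?U = "\<Gamma> \<inter> {mat 1, - mat 1}" and ?S = "{\<gamma> \<in> \<Gamma>. sp_act (matrix_inv \<gamma>) z \<in> F}"
  obtain w where w: "w \<in> F" "w \<in> orbit \<Gamma> z"
    and uniq: "\<And>v. v \<in> F \<Longrightarrow> v \<in> orbit \<Gamma> z \<Longrightarrow> v = w"
    using F z unfolding orbit_representatives_def orbit_def by blast
  obtain \<delta> where \<delta>: "\<delta> \<in> \<Gamma>" "w = sp_act \<delta> z" using w(2) by (auto simp: orbit_def)
  have U1: "sp_act \<epsilon> v = v" if "\<epsilon> \<in> ?U" "v \<in> siegel_space" for \<epsilon> v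
    using that sp_act_minus_1 sp by auto
  define \<gamma>0 where "\<gamma>0 = matrix_inv \<delta>"
  have \<gamma>0: "\<gamma>0 \<in> \<Gamma>" "sp_act \<gamma>0 w = z"
    using inv(1)[OF \<delta>(1)] sp_act_inverse(1)[OF \<Gamma> \<delta>(1) z] by (simp_all add: \<gamma>0_def \<delta>)
  have wH: "w \<in> siegel_space" using sp_act_in_siegel[OF sp[OF \<delta>(1)] z] by (simp add: \<delta>(2))
  have "?S = (\<lambda>\<epsilon>. \<epsilon> ** \<gamma>0) ` ?U"
  proof (rule equalityI; rule subsetI)
    fix \<gamma> assume "\<gamma> \<in> ?S"
    then have \<gamma>: "\<gamma> \<in> \<Gamma>" "sp_act (matrix_inv \<gamma>) z \<in> F" by auto
    have "sp_act (matrix_inv \<gamma>) z = w" by (intro uniq \<gamma>) (auto simp: orbit_def inv(1)[OF \<gamma>(1)])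
    then have gw: "sp_act \<gamma> w = z" using sp_act_inverse(2)[OF \<Gamma> \<gamma>(1) z] by simp
    have "sp_act (\<gamma> ** \<delta>) z = z"
      using gw by (simp add: sp_act_mult[OF sp[OF \<gamma>(1)] sp[OF \<delta>(1)] z] \<delta>(2)[symmetric])
    then have "\<gamma> ** \<delta> \<in> ?U" using triv mult \<gamma>(1) \<delta>(1) by blast
    moreover have "\<gamma> = (\<gamma> ** \<delta>) ** \<gamma>0"
      by (simp add: \<gamma>0_def matrix_mul_assoc[symmetric] inv(3)[OF \<delta>(1)])
    ultimately show "\<gamma> \<in> (\<lambda>\<epsilon>. \<epsilon> ** \<gamma>0) ` ?U" by (rule rev_image_eqI)
  next
    fix \<gamma> assume "\<gamma> \<in> (\<lambda>\<epsilon>. \<epsilon> ** \<gamma>0) ` ?U"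
    then obtain \<epsilon> where \<epsilon>: "\<epsilon> \<in> ?U" "\<gamma> = \<epsilon> ** \<gamma>0" by blast
    then have \<gamma>: "\<gamma> \<in> \<Gamma>" using mult \<gamma>0(1) by blast
    have "sp_act \<gamma> w = z"
      using \<epsilon>(1) by (simp add: \<epsilon>(2) sp_act_mult[OF sp sp[OF \<gamma>0(1)] wH] \<gamma>0(2) U1[OF \<epsilon>(1) z])
    then have "sp_act (matrix_inv \<gamma>) z = w" using sp_act_inverse(1)[OF \<Gamma> \<gamma> wH] by simp
    then show "\<gamma> \<in> ?S" using \<gamma> w by simp
  qed
  moreover have "inj_on (\<lambda>\<epsilon>. \<epsilon> ** \<gamma>0) ?U"
  proof (rule inj_onI)
    fix a b assume "a ** \<gamma>0 = b ** \<gamma>0"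
    then have "a ** (\<gamma>0 ** \<delta>) = b ** (\<gamma>0 ** \<delta>)" by (simp add: matrix_mul_assoc)
    then show "a = b" by (simp add: \<gamma>0_def inv(2)[OF \<delta>(1)])
  qed
  ultimately show "finite ?S" "card ?S = card ?U" by (simp_all add: card_image)
qed

lemma sigma_finite_siegel_measure: "sigma_finite_measure (siegel_measure :: 'n::{finite,linorder} cmat measure)"
proof
  have "- siegel_space \<in> null_sets (siegel_measure :: 'n cmat measure)"
    using AE_siegel_space by (subst AE_iff_null_sets) auto
  then have "emeasure siegel_measure (- siegel_space :: 'n cmat set) = 0" by auto
  then show "\<exists>A. countable A \<and> A \<subseteq> sets (siegel_measure :: 'n cmat measure) \<and> \<Union> A = space siegel_measure \<and> (\<forall>a\<in>A. emeasure siegel_measure a \<noteq> \<infinity>)"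
    using emeasure_siegel_compact_finite[where 'n = 'n]
    by (intro exI[of _ "insert (- siegel_space) (range siegel_compact)"])
       (auto simp: siegel_space_eq_UN less_top)
qed

lemma AE_only_trivial_fixing:
  fixes \<Gamma> :: "'n::{finite,linorder} sp_mat set"
  assumes \<Gamma>: "congruence_subgroup \<Gamma>"
  shows "AE z in siegel_measure. \<forall>\<gamma>\<in>\<Gamma>. z \<in> siegel_space \<longrightarrow> sp_act \<gamma> z = z \<longrightarrow> \<gamma> = mat 1 \<or> \<gamma> = - mat 1"
proof (subst AE_ball_countable[OF countable_congruence_subgroup[OF \<Gamma>]], rule ballI)
  fix \<gamma> assume \<gamma>: "\<gamma> \<in> \<Gamma>"
  show "AE z in siegel_measure. z \<in> siegel_space \<longrightarrow> sp_act \<gamma> z = z \<longrightarrow> \<gamma> = mat 1 \<or> \<gamma> = - mat 1"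
  proof (cases "\<gamma> = mat 1 \<or> \<gamma> = - mat 1")
    case False
    then have "AE z in siegel_measure. z \<notin> {z \<in> siegel_space. sp_act \<gamma> z = z}"
      using \<gamma> by (intro AE_not_in siegel_fixed_points_null congruence_subgroup_Sp_real[OF \<Gamma>]) auto
    then show ?thesis by eventually_elim auto
  qed simp
qed

text \<open>Exchanging sum and integral is justified after moving the group element from G to F:
  then the sum over \<gamma> counts hits of F and equals a fixed multiple of |G| almost everywhere.
  Invariance of the measure carries integrability back.\<close>

lemma integral_unfold:
  fixes \<Gamma> :: "'n::{finite,linorder} sp_mat set" and G :: "'n cmat \<Rightarrow> complex"
  assumes \<Gamma>: "congruence_subgroup \<Gamma>" and F: "orbit_representatives \<Gamma> F"
    and G: "integrable siegel_measure G"
    and summable: "\<And>z. z \<in> siegel_space \<Longrightarrow> (\<lambda>\<gamma>. norm (G (sp_act \<gamma> z))) summable_on \<Gamma>"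
  shows "(LINT z:F|siegel_measure. (\<Sum>\<^sub>\<infinity>\<gamma>\<in>\<Gamma>. G (sp_act \<gamma> z))) =
    of_nat (card (\<Gamma> \<inter> {mat 1, - mat 1})) * (LINT z|siegel_measure. G z)"
proof -
  let ?c = "card (\<Gamma> \<inter> {mat 1, - mat 1})"
  note sp = congruence_subgroup_Sp_real[OF \<Gamma>] and inv = congruence_subgroup_inverse[OF \<Gamma>]
  have cnt: "countable \<Gamma>" by (rule countable_congruence_subgroup[OF \<Gamma>])
  have Fb [measurable]: "F \<in> sets borel" and FH: "F \<subseteq> siegel_space"
    using F by (auto simp: orbit_representatives_def)
  have [measurable]: "G \<in> borel_measurable borel" using borel_measurable_integrable[OF G] by simp
  interpret N: sigma_finite_measure "count_space \<Gamma>" by (rule sigma_finite_measure_count_space_countable[OF cnt])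
  interpret M: sigma_finite_measure "siegel_measure :: 'n cmat measure" by (rule sigma_finite_siegel_measure)
  interpret P: pair_sigma_finite "count_space \<Gamma>" "siegel_measure :: 'n cmat measure" ..
  \<comment> \<open>The two forms of the summand, with the translation on G or on F. They satisfy a
    \<gamma> = b \<gamma> composed with \<gamma> on the half-space, so their integrals agree for
    each \<gamma>.\<close>
  define a where "a \<gamma> z = indicator F z *\<^sub>R G (sp_act0 \<gamma> z)" for \<gamma> z
  define b where "b \<gamma> z = indicator F (sp_act0 (matrix_inv \<gamma>) z) *\<^sub>R G z" for \<gamma> z
  have am [measurable]: "a \<gamma> \<in> borel_measurable borel" and bm [measurable]: "b \<gamma> \<in> borel_measurable borel" if "\<gamma> \<in> \<Gamma>" for \<gamma>
    using sp_act0_measurable[OF sp[OF that]] sp_act0_measurable[OF sp[OF inv(1)[OF that]]]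
    unfolding a_def[abs_def] b_def[abs_def] by measurable
  have ap: "case_prod a \<in> borel_measurable (count_space \<Gamma> \<Otimes>\<^sub>M siegel_measure)"
    and bp: "case_prod b \<in> borel_measurable (count_space \<Gamma> \<Otimes>\<^sub>M siegel_measure)"
    by (auto intro!: measurable_pair_measure_countable1[OF cnt])
  have ab: "a \<gamma> z = b \<gamma> (sp_act0 \<gamma> z)" if "\<gamma> \<in> \<Gamma>" "z \<in> siegel_space" for \<gamma> z
    using that by (simp add: a_def b_def sp_act0_def sp_act_in_siegel[OF sp] sp_act_inverse[OF \<Gamma>])
  have nn: "(\<integral>\<^sup>+z. ennreal (norm (a \<gamma> z)) \<partial>siegel_measure) = (\<integral>\<^sup>+z. ennreal (norm (b \<gamma> z)) \<partial>siegel_measure)" if \<gamma>: "\<gamma> \<in> \<Gamma>" for \<gamma>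
  proof -
    have "(\<integral>\<^sup>+z. ennreal (norm (a \<gamma> z)) \<partial>siegel_measure) = (\<integral>\<^sup>+z. ennreal (norm (b \<gamma> (sp_act \<gamma> z))) \<partial>siegel_measure)"
      using AE_siegel_space by (intro nn_integral_cong_AE) (auto elim!: eventually_mono simp: ab[OF \<gamma>] sp_act0_def)
    also have "\<dots> = (\<integral>\<^sup>+z. ennreal (norm (b \<gamma> z)) \<partial>siegel_measure)"
      by (rule nn_integral_siegel_sp_act[OF sp[OF \<gamma>]]) (use bm[OF \<gamma>] in measurable)
    finally show ?thesis .
  qed
  have li: "(LINT z|siegel_measure. a \<gamma> z) = (LINT z|siegel_measure. b \<gamma> z)" if \<gamma>: "\<gamma> \<in> \<Gamma>" for \<gamma>
  proof -
    have "(LINT z|siegel_measure. a \<gamma> z) = (LINT z|siegel_measure. b \<gamma> (sp_act0 \<gamma> z))"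
      using AE_siegel_space sp_act0_measurable[OF sp[OF \<gamma>]] am[OF \<gamma>] bm[OF \<gamma>]
      by (intro integral_cong_AE) (auto elim!: eventually_mono simp: ab[OF \<gamma>])
    also have "\<dots> = (LINT z|siegel_measure. b \<gamma> z)"
      by (rule integral_siegel_sp_act(2)[OF sp[OF \<gamma>] bm[OF \<gamma>]])
    finally show ?thesis .
  qed
  have good: "AE z in siegel_measure. finite {\<gamma> \<in> \<Gamma>. sp_act (matrix_inv \<gamma>) z \<in> F} \<and>
      card {\<gamma> \<in> \<Gamma>. sp_act (matrix_inv \<gamma>) z \<in> F} = ?c \<and> z \<in> siegel_space"
    using AE_only_trivial_fixing[OF \<Gamma>] AE_siegel_space
  proof eventually_elim
    case (elim z)
    then show ?case using card_orbit_hits[OF \<Gamma> F] by blast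
  qed
  have bsum: "(\<integral>\<^sup>+\<gamma>. ennreal (norm (b \<gamma> z)) \<partial>count_space \<Gamma>) = ennreal (real ?c * norm (G z))"
    "(LINT \<gamma>|count_space \<Gamma>. b \<gamma> z) = of_nat ?c * G z"
    if fin: "finite {\<gamma> \<in> \<Gamma>. sp_act (matrix_inv \<gamma>) z \<in> F}" and card: "card {\<gamma> \<in> \<Gamma>. sp_act (matrix_inv \<gamma>) z \<in> F} = ?c"
      and z: "z \<in> siegel_space" for z
  proof -
    let ?S = "{\<gamma> \<in> \<Gamma>. sp_act (matrix_inv \<gamma>) z \<in> F}"
    have b: "b \<gamma> z = (if \<gamma> \<in> ?S then G z else 0)" if "\<gamma> \<in> \<Gamma>" for \<gamma>
      using that z by (simp add: b_def sp_act0_def indicator_def)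
    have "(\<integral>\<^sup>+\<gamma>. ennreal (norm (b \<gamma> z)) \<partial>count_space \<Gamma>) = (\<integral>\<^sup>+\<gamma>. ennreal (norm (G z)) * indicator ?S \<gamma> \<partial>count_space \<Gamma>)"
      by (intro nn_integral_cong) (auto simp: b)
    also have "\<dots> = ennreal (norm (G z)) * of_nat ?c"
      using fin card by (subst nn_integral_cmult_indicator) (auto simp: emeasure_count_space)
    finally show "(\<integral>\<^sup>+\<gamma>. ennreal (norm (b \<gamma> z)) \<partial>count_space \<Gamma>) = ennreal (real ?c * norm (G z))"
      by (simp add: ennreal_mult' ennreal_of_nat_eq_real_of_nat mult.commute)
    have "(LINT \<gamma>|count_space \<Gamma>. b \<gamma> z) = (LINT \<gamma>|count_space \<Gamma>. indicator ?S \<gamma> *\<^sub>R G z)"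
      by (intro Bochner_Integration.integral_cong) (auto simp: b)
    also have "\<dots> = measure (count_space \<Gamma>) ?S *\<^sub>R G z"
      using fin by (intro has_bochner_integral_integral_eq has_bochner_integral_indicator) (auto simp: of_nat_less_top)
    also have "\<dots> = of_nat ?c * G z"
      using fin card by (simp add: scaleR_conv_of_real)
    finally show "(LINT \<gamma>|count_space \<Gamma>. b \<gamma> z) = of_nat ?c * G z" .
  qed
  have fin: "(\<integral>\<^sup>+z. ennreal (real ?c * norm (G z)) \<partial>siegel_measure) < \<infinity>"
    using conjunct2[OF integrable_mult_right[OF integrable_norm[OF G], of "real ?c", unfolded integrable_iff_bounded]]
    by (simp add: abs_mult)
  have ib: "(\<integral>\<^sup>+p. ennreal (norm (case_prod b p)) \<partial>(count_space \<Gamma> \<Otimes>\<^sub>M siegel_measure)) < \<infinity>"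
  proof -
    have "(\<integral>\<^sup>+p. ennreal (norm (case_prod b p)) \<partial>(count_space \<Gamma> \<Otimes>\<^sub>M siegel_measure)) =
        (\<integral>\<^sup>+z. (\<integral>\<^sup>+\<gamma>. ennreal (norm (case_prod b (\<gamma>, z))) \<partial>count_space \<Gamma>) \<partial>siegel_measure)"
      by (rule P.nn_integral_snd[symmetric]) (use bp in measurable)
    also have "\<dots> = (\<integral>\<^sup>+z. ennreal (real ?c * norm (G z)) \<partial>siegel_measure)"
      by (intro nn_integral_cong_AE eventually_mono[OF good]) (simp add: bsum)
    finally show ?thesis using fin by simp
  qed
  have ia: "(\<integral>\<^sup>+p. ennreal (norm (case_prod a p)) \<partial>(count_space \<Gamma> \<Otimes>\<^sub>M siegel_measure)) < \<infinity>"
  proof -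
    have "(\<integral>\<^sup>+p. ennreal (norm (case_prod a p)) \<partial>(count_space \<Gamma> \<Otimes>\<^sub>M siegel_measure)) =
        (\<integral>\<^sup>+\<gamma>. (\<integral>\<^sup>+z. ennreal (norm (case_prod a (\<gamma>, z))) \<partial>siegel_measure) \<partial>count_space \<Gamma>)"
      by (rule M.nn_integral_fst[symmetric]) (use ap in measurable)
    also have "\<dots> = (\<integral>\<^sup>+\<gamma>. (\<integral>\<^sup>+z. ennreal (norm (case_prod b (\<gamma>, z))) \<partial>siegel_measure) \<partial>count_space \<Gamma>)"
      by (intro nn_integral_cong[where M = "count_space \<Gamma>"]) (simp add: nn)
    also have "\<dots> = (\<integral>\<^sup>+p. ennreal (norm (case_prod b p)) \<partial>(count_space \<Gamma> \<Otimes>\<^sub>M siegel_measure))"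
      by (rule M.nn_integral_fst) (use bp in measurable)
    finally show ?thesis using ib by simp
  qed
  have a_int: "integrable (count_space \<Gamma> \<Otimes>\<^sub>M siegel_measure) (case_prod a)"
    and b_int: "integrable (count_space \<Gamma> \<Otimes>\<^sub>M siegel_measure) (case_prod b)"
    using ap bp ia ib by (simp_all add: integrable_iff_bounded)
  have eq: "(LINT \<gamma>|count_space \<Gamma>. a \<gamma> z) = indicator F z *\<^sub>R (\<Sum>\<^sub>\<infinity>\<gamma>\<in>\<Gamma>. G (sp_act \<gamma> z))" for z
  proof (cases "z \<in> F")
    case True
    then have a: "a \<gamma> z = G (sp_act \<gamma> z)" for \<gamma> using FH by (auto simp: a_def sp_act0_def)
    have "infsetsum (\<lambda>\<gamma>. a \<gamma> z) \<Gamma> = (\<Sum>\<^sub>\<infinity>\<gamma>\<in>\<Gamma>. a \<gamma> z)"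
      using summable[of z] True FH by (intro infsetsum_infsum) (auto simp: a abs_summable_equivalent[symmetric])
    then show ?thesis using True by (simp add: infsetsum_def a)
  qed (simp add: a_def)
  have "(LINT z:F|siegel_measure. (\<Sum>\<^sub>\<infinity>\<gamma>\<in>\<Gamma>. G (sp_act \<gamma> z))) = (LINT z|siegel_measure. indicator F z *\<^sub>R (\<Sum>\<^sub>\<infinity>\<gamma>\<in>\<Gamma>. G (sp_act \<gamma> z)))"
    by (simp add: set_lebesgue_integral_def)
  also have "\<dots> = (LINT z|siegel_measure. (LINT \<gamma>|count_space \<Gamma>. a \<gamma> z))"
    by (simp only: eq)
  also have "\<dots> = (LINT \<gamma>|count_space \<Gamma>. (LINT z|siegel_measure. a \<gamma> z))"
    using P.integral_fst[OF a_int] P.integral_snd[OF a_int] by simp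
  also have "\<dots> = (LINT \<gamma>|count_space \<Gamma>. (LINT z|siegel_measure. b \<gamma> z))"
    by (intro Bochner_Integration.integral_cong[where M = "count_space \<Gamma>"]) (auto simp: li)
  also have "\<dots> = (LINT z|siegel_measure. (LINT \<gamma>|count_space \<Gamma>. b \<gamma> z))"
    using P.integral_fst[OF b_int] P.integral_snd[OF b_int] by simp
  also have "\<dots> = (LINT z|siegel_measure. of_nat ?c * G z)"
    using borel_measurable_integrable[OF P.integrable_snd[OF b_int]]
    by (intro integral_cong_AE eventually_mono[OF good]) (simp_all add: bsum)
  also have "\<dots> = of_nat ?c * (LINT z|siegel_measure. G z)" by simp
  finally show ?thesis .
qed

section \<open>Rotations about the base point and the reproducing property\<close>

section \<open>The disc through a point and its rotations\<close>

definition matrix_scale :: "'a::comm_ring_1 \<Rightarrow> 'a^'n^'m \<Rightarrow> 'a^'n^'m" where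
  "matrix_scale c A = map_matrix (\<lambda>w. c * w) A"

lemma matrix_scale_nth [simp]: "matrix_scale c A $ i $ j = c * A $ i $ j"
  by (simp add: matrix_scale_def)

lemma matrix_scale_mult_left: "matrix_scale c A ** B = matrix_scale c (A ** B)"
  by (simp add: vec_eq_iff matrix_matrix_mult_def sum_distrib_left mult.assoc)

lemma matrix_scale_mult_right: "A ** matrix_scale c B = matrix_scale c (A ** B)"
  by (simp add: vec_eq_iff matrix_matrix_mult_def sum_distrib_left mult_ac)

lemma matrix_scale_add: "matrix_scale c (A + B) = matrix_scale c A + matrix_scale c B"
  by (simp add: vec_eq_iff distrib_left)

lemma matrix_scale_scale: "matrix_scale c (matrix_scale d A) = matrix_scale (c * d) A"
  by (simp add: vec_eq_iff mult.assoc)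

lemma matrix_scale_vector: "matrix_scale c A *v v = c *s (A *v v)"
  by (simp add: vec_eq_iff matrix_vector_mult_def sum_distrib_left mult.assoc)

lemma transpose_matrix_scale: "transpose (matrix_scale c A) = matrix_scale c (transpose A)"
  by (simp add: vec_eq_iff transpose_def)

lemma continuous_on_matrix_scale [continuous_intros]:
  fixes A :: "'a::topological_space \<Rightarrow> 'b::real_normed_field^'n^'m"
  assumes "continuous_on S c" "continuous_on S A"
  shows "continuous_on S (\<lambda>x. matrix_scale (c x) (A x))"
  unfolding matrix_scale_def map_matrix_def by (intro continuous_intros assms)

lemma matrix_inv_eqI:
  fixes A :: "'a::field^'n^'n"
  assumes "A ** B = mat 1" shows "matrix_inv A = B"
proof -
  have "invertible A" using assms matrix_left_right_inverse[of A B] invertible_def by blast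
  then have "matrix_inv A ** (A ** B) = B" by (simp only: matrix_mul_assoc matrix_inv_left matrix_mul_lid)
  then show ?thesis by (simp add: assms)
qed

lemma transpose_matrix_inv:
  fixes A :: "'a::field^'n^'n"
  assumes "invertible A" shows "transpose (matrix_inv A) = matrix_inv (transpose A)"
  by (rule matrix_inv_eqI[symmetric])
     (simp add: matrix_transpose_mul[symmetric] matrix_inv_left assms transpose_mat)

text \<open>The points of the disc are \<open>\<xi>\<^sup>* + M\<^sup>-\<^sup>1\<close>, where \<open>\<xi>\<^sup>*\<close> is the conjugate of \<open>\<xi>\<close> and \<open>M\<close> runs through
  the affine combinations of \<open>(\<xi> - \<xi>\<^sup>*)\<^sup>-\<^sup>1\<close> and \<open>(z - \<xi>\<^sup>*)\<^sup>-\<^sup>1\<close>. In this parameter the centre \<open>\<xi>\<close> is \<open>0\<close>, the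
  point \<open>z\<close> is \<open>1\<close>, and a one-parameter group fixing \<open>\<xi>\<close> acts by rotations.\<close>

definition disc_mat :: "'n::finite cmat \<Rightarrow> 'n cmat \<Rightarrow> complex \<Rightarrow> 'n cmat" where
  "disc_mat \<xi> z \<zeta> = matrix_scale (1 - \<zeta>) (matrix_inv (\<xi> - map_matrix cnj \<xi>)) +
     matrix_scale \<zeta> (matrix_inv (z - map_matrix cnj \<xi>))"

definition disc_point :: "'n::finite cmat \<Rightarrow> 'n cmat \<Rightarrow> complex \<Rightarrow> 'n cmat" where
  "disc_point \<xi> z \<zeta> = map_matrix cnj \<xi> + matrix_inv (disc_mat \<xi> z \<zeta>)"

lemma herm_add_left: "herm (v + u) w = herm v w + herm u w"
  by (simp add: herm_def algebra_simps sum.distrib)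

lemma herm_scale: "herm (c *s v) w = cnj c * herm v w" "herm v (c *s w) = c * herm v w"
  by (simp_all add: herm_def sum_distrib_left mult_ac)

lemma herm_cnj_matrix:
  assumes "transpose \<xi> = \<xi>" shows "herm v (map_matrix cnj \<xi> *v w) = cnj (herm w (\<xi> *v v))"
  unfolding herm_cnj by (subst herm_matrix) (simp add: map_matrix_cnj_transpose[symmetric] assms)

text \<open>Because p = (\<xi> - cnj \<xi>) k, the terms mixing k and e cancel. The left side, which
  decides positivity at a point of the disc, thus depends on e only through the form of \<xi> at
  e.\<close>

lemma disc_form:
  assumes \<xi>: "transpose \<xi> = \<xi>" and p: "(\<xi> - map_matrix cnj \<xi>) *v k = p"
  shows "Im (herm (k + e) p) - Im (herm (k + e) (\<xi> *v (k + e))) =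
    Im (herm k (\<xi> *v k)) - Im (herm e (\<xi> *v e))"
proof -
  have p': "herm v p = herm v (\<xi> *v k) - cnj (herm k (\<xi> *v v))" for v
    unfolding p[symmetric] by (simp add: matrix_vector_mult_diff_rdistrib herm_diff_right herm_cnj_matrix[OF \<xi>])
  show ?thesis unfolding p' by (simp add: herm_add_left herm_add_right matrix_vector_right_distrib)
qed

text \<open>At p the disc matrix takes the value k + \<zeta> e, and by \<open>disc_form\<close> the
  difference of the two sides is P(k) - |\<zeta>|^2 P(e), with P the form of \<xi>. For \<zeta> = 1
  it is positive since z lies in the half-space, and shrinking |\<zeta>| only increases it.\<close>

lemma disc_mat_pos:
  fixes \<xi> z :: "'n::finite cmat"
  assumes \<xi>: "\<xi> \<in> siegel_space" and z: "z \<in> siegel_space" and \<zeta>: "cmod \<zeta> \<le> 1" and p: "p \<noteq> 0"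
  shows "Im (herm (disc_mat \<xi> z \<zeta> *v p) (\<xi> *v (disc_mat \<xi> z \<zeta> *v p))) < Im (herm (disc_mat \<xi> z \<zeta> *v p) p)"
proof -
  let ?P = "\<lambda>v. Im (herm v (\<xi> *v v))"
  have sym: "transpose \<xi> = \<xi>" using \<xi> by (rule siegel_space_transpose)
  define k where "k = matrix_inv (\<xi> - map_matrix cnj \<xi>) *v p"
  define u where "u = matrix_inv (z - map_matrix cnj \<xi>) *v p"
  define e where "e = u - k"
  have k: "(\<xi> - map_matrix cnj \<xi>) *v k = p" and u: "(z - map_matrix cnj \<xi>) *v u = p"
    by (simp_all add: k_def u_def matrix_vector_mul_assoc matrix_inv_right invertible_diff_cnj \<xi> z)
  have Mp: "disc_mat \<xi> z \<zeta> *v p = k + \<zeta> *s e"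
    by (simp add: disc_mat_def matrix_vector_mult_add_rdistrib matrix_scale_vector k_def[symmetric] u_def[symmetric])
       (simp add: e_def vec_eq_iff algebra_simps)
  have form: "Im (herm (k + v) p) - ?P (k + v) = ?P k - ?P v" for v by (rule disc_form[OF sym k])
  have "u \<noteq> 0" using u p by auto
  then have "0 < Im (herm u (z *v u))" by (rule siegel_space_pos[OF z])
  also have "\<dots> = Im (herm u p) - ?P u" unfolding u[symmetric] Im_herm_diff_cnj[OF sym] by simp
  also have "\<dots> = ?P k - ?P e" using form[of e] by (simp add: e_def)
  finally have "?P e < ?P k" by simp
  moreover have "?P (\<zeta> *s e) \<le> ?P e"
  proof -
    have "herm (\<zeta> *s e) (\<xi> *v (\<zeta> *s e)) = (\<zeta> * cnj \<zeta>) * herm e (\<xi> *v e)"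
      by (simp add: herm_scale vector_scalar_commute mult_ac)
    also have "\<dots> = complex_of_real ((cmod \<zeta>)\<^sup>2) * herm e (\<xi> *v e)" by (simp only: complex_norm_square)
    finally have "?P (\<zeta> *s e) = (cmod \<zeta>)\<^sup>2 * ?P e" by (simp only: Im_complex_of_real Re_complex_of_real times_complex.sel mult_zero_left add_0_right)
    moreover have "(cmod \<zeta>)\<^sup>2 \<le> 1" using \<zeta> by (simp add: power_le_one)
    ultimately show ?thesis using siegel_space_pos_ge[OF \<xi>, of e] by (simp add: mult_left_le_one_le)
  qed
  ultimately show ?thesis using form[of "\<zeta> *s e"] unfolding Mp by linarith
qed

lemma invertible_disc_mat:
  fixes \<xi> z :: "'n::finite cmat"
  assumes "\<xi> \<in> siegel_space" "z \<in> siegel_space" "cmod \<zeta> \<le> 1"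
  shows "invertible (disc_mat \<xi> z \<zeta>)"
proof (rule invertible_if_kernel_0, rule ccontr)
  fix v assume "disc_mat \<xi> z \<zeta> *v v = 0" "v \<noteq> 0"
  then show False using disc_mat_pos[OF assms, of v] by simp
qed

lemma disc_point_siegel:
  fixes \<xi> z :: "'n::finite cmat"
  assumes \<xi>: "\<xi> \<in> siegel_space" and z: "z \<in> siegel_space" and \<zeta>: "cmod \<zeta> \<le> 1"
  shows "disc_point \<xi> z \<zeta> \<in> siegel_space"
proof -
  let ?M = "disc_mat \<xi> z \<zeta>"
  note inv = invertible_disc_mat[OF assms]
  have sym: "transpose \<xi> = \<xi>" "transpose z = z" using \<xi> z by (simp_all add: siegel_space_transpose)
  have symc: "transpose (map_matrix cnj \<xi>) = map_matrix cnj \<xi>"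
    by (simp add: map_matrix_cnj_transpose[symmetric] sym)
  have "transpose ?M = ?M"
    by (simp add: disc_mat_def transpose_add transpose_matrix_scale transpose_matrix_inv invertible_diff_cnj \<xi> z
        transpose_diff sym symc)
  then have "transpose (disc_point \<xi> z \<zeta>) = disc_point \<xi> z \<zeta>"
    by (simp add: disc_point_def transpose_add symc transpose_matrix_inv inv)
  moreover have "0 < Im (herm v (disc_point \<xi> z \<zeta> *v v))" if "v \<noteq> 0" for v
  proof -
    define p where "p = matrix_inv ?M *v v"
    have v: "?M *v p = v" by (simp add: p_def matrix_vector_mul_assoc matrix_inv_right inv)
    then have "p \<noteq> 0" using that by auto
    from disc_mat_pos[OF assms this] show ?thesis
      unfolding v by (simp add: disc_point_def matrix_vector_mult_add_rdistrib herm_add_right herm_cnj_matrix[OF sym(1)] p_def)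
  qed
  ultimately show ?thesis by (simp add: siegel_space_iff)
qed

lemma disc_point_0:
  assumes "\<xi> \<in> siegel_space" shows "disc_point \<xi> z 0 = \<xi>"
proof -
  have "disc_mat \<xi> z 0 = matrix_inv (\<xi> - map_matrix cnj \<xi>)" by (simp add: disc_mat_def vec_eq_iff)
  moreover have "matrix_inv \<dots> = \<xi> - map_matrix cnj \<xi>"
    by (rule matrix_inv_eqI) (simp add: matrix_inv_left invertible_diff_cnj assms)
  ultimately show ?thesis by (simp add: disc_point_def)
qed

lemma disc_point_center:
  assumes "\<xi> \<in> siegel_space" shows "disc_point \<xi> \<xi> \<zeta> = \<xi>"
proof -
  have "disc_mat \<xi> \<xi> \<zeta> = disc_mat \<xi> \<xi> 0" by (simp add: disc_mat_def vec_eq_iff algebra_simps)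
  then show ?thesis using disc_point_0[OF assms] by (simp add: disc_point_def)
qed

definition sp_block :: "real^'n^'n \<Rightarrow> real^'n^'n \<Rightarrow> real^'n^'n \<Rightarrow> real^'n^'n \<Rightarrow> 'n::finite sp_mat" where
  "sp_block A B C D = (\<chi> i j. case (i, j) of (Inl r, Inl s) \<Rightarrow> A $ r $ s | (Inl r, Inr s) \<Rightarrow> B $ r $ s
     | (Inr r, Inl s) \<Rightarrow> C $ r $ s | (Inr r, Inr s) \<Rightarrow> D $ r $ s)"

abbreviation cmat_of :: "real^'n^'n \<Rightarrow> 'n::finite cmat" where
  "cmat_of \<equiv> map_matrix complex_of_real"

lemma block_sp_block:
  "block_A (sp_block A B C D) = cmat_of A" "block_B (sp_block A B C D) = cmat_of B"
  "block_C (sp_block A B C D) = cmat_of C" "block_D (sp_block A B C D) = cmat_of D"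
  by (simp_all add: vec_eq_iff block_A_def block_B_def block_C_def block_D_def sp_block_def)

lemma cmat_of_scaleR: "cmat_of (c *\<^sub>R A) = matrix_scale (of_real c) (cmat_of A)"
  by (simp add: vec_eq_iff)

lemma cmat_of_mult: "cmat_of (A ** B) = cmat_of A ** cmat_of B"
  by (simp add: vec_eq_iff matrix_matrix_mult_def)

lemma cmat_of_1: "cmat_of (mat 1) = mat 1"
  by (simp add: vec_eq_iff mat_def)

lemma cmat_of_transpose: "transpose (cmat_of A) = cmat_of (transpose A)"
  by (simp add: vec_eq_iff transpose_def)

definition sp_shift :: "real^'n^'n \<Rightarrow> 'n::finite sp_mat" where
  "sp_shift x = sp_block (mat 1) x 0 (mat 1)"

lemma sp_shift:
  assumes x: "transpose x = x"
  shows "sp_shift x \<in> Sp_real"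
    and "z \<in> siegel_space \<Longrightarrow> sp_act (sp_shift x) z = z + cmat_of x"
proof -
  have b: "block_A (sp_shift x) = mat 1" "block_B (sp_shift x) = cmat_of x" "block_C (sp_shift x) = 0" "block_D (sp_shift x) = mat 1"
    by (simp_all add: sp_shift_def block_sp_block cmat_of_1) (simp add: vec_eq_iff)
  have t0: "transpose 0 = (0 :: 'a cmat)" by (simp add: vec_eq_iff transpose_def)
  show g: "sp_shift x \<in> Sp_real"
    by (rule Sp_realI) (simp add: symplectic_iff_block b transpose_mat t0 cmat_of_transpose x)
  show "sp_act (sp_shift x) z = z + cmat_of x" if "z \<in> siegel_space"
    by (rule sp_actI[OF g that]) (simp add: aut_num_def aut_den_def b)
qed

text \<open>The rotation by \<theta> conjugated by the diagonal blocks y^(1/2) and y^(-1/2),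
  multiplied out so that no square root appears. It fixes the point i y.\<close>

definition sp_turn :: "real^'n^'n \<Rightarrow> real \<Rightarrow> 'n::finite sp_mat" where
  "sp_turn y \<theta> = sp_block (cos \<theta> *\<^sub>R mat 1) ((- sin \<theta>) *\<^sub>R y) (sin \<theta> *\<^sub>R matrix_inv y) (cos \<theta> *\<^sub>R mat 1)"

lemma block_sp_turn:
  "block_A (sp_turn y \<theta>) = matrix_scale (of_real (cos \<theta>)) (mat 1)"
  "block_B (sp_turn y \<theta>) = matrix_scale (- of_real (sin \<theta>)) (cmat_of y)"
  "block_C (sp_turn y \<theta>) = matrix_scale (of_real (sin \<theta>)) (cmat_of (matrix_inv y))"
  "block_D (sp_turn y \<theta>) = matrix_scale (of_real (cos \<theta>)) (mat 1)"
  by (simp_all only: sp_turn_def block_sp_block cmat_of_scaleR cmat_of_1 of_real_minus)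

lemma sp_turn_Sp_real:
  assumes y: "invertible y" "transpose y = y"
  shows "sp_turn y \<theta> \<in> Sp_real"
proof (rule Sp_realI, unfold symplectic_iff_block block_sp_turn, intro conjI)
  have inv: "cmat_of (matrix_inv y) ** cmat_of y = mat 1"
    by (simp add: cmat_of_mult[symmetric] matrix_inv_left y cmat_of_1)
  have t: "transpose (cmat_of y) = cmat_of y" "transpose (cmat_of (matrix_inv y)) = cmat_of (matrix_inv y)"
    by (simp_all add: cmat_of_transpose y transpose_matrix_inv)
  have sc: "complex_of_real (cos \<theta>) * complex_of_real (cos \<theta>) + complex_of_real (sin \<theta>) * complex_of_real (sin \<theta>) = 1"
    by (metis add.commute of_real_1 of_real_add of_real_mult power2_eq_square sin_cos_squared_add)
  show "transpose (matrix_scale (complex_of_real (cos \<theta>)) (mat 1)) ** matrix_scale (complex_of_real (sin \<theta>)) (cmat_of (matrix_inv y)) =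
      transpose (matrix_scale (complex_of_real (sin \<theta>)) (cmat_of (matrix_inv y))) ** matrix_scale (complex_of_real (cos \<theta>)) (mat 1)"
    "transpose (matrix_scale (- complex_of_real (sin \<theta>)) (cmat_of y)) ** matrix_scale (complex_of_real (cos \<theta>)) (mat 1) =
      transpose (matrix_scale (complex_of_real (cos \<theta>)) (mat 1)) ** matrix_scale (- complex_of_real (sin \<theta>)) (cmat_of y)"
    "transpose (matrix_scale (complex_of_real (cos \<theta>)) (mat 1)) ** matrix_scale (complex_of_real (cos \<theta>)) (mat 1) -
      transpose (matrix_scale (complex_of_real (sin \<theta>)) (cmat_of (matrix_inv y))) ** matrix_scale (- complex_of_real (sin \<theta>)) (cmat_of y) = mat 1"
    by (simp_all add: transpose_matrix_scale transpose_mat t matrix_scale_mult_left matrix_scale_mult_right inv)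
       (simp_all add: vec_eq_iff mat_def sc)
qed

text \<open>Cz + D equals cis \<theta> times \<open>disc_mat\<close> at cis (-2 \<theta>) times z -
  cnj \<eta>, with \<eta> = i y; the formulas \<open>e1\<close> and \<open>e2\<close> compare the
  coefficients. The angle doubles because the Cayley coordinate is multiplied by cis (-\<theta>) /
  cis \<theta>.\<close>

lemma sp_turn_act:
  fixes z :: "'n::finite cmat"
  assumes y: "invertible y" "transpose y = y" and z: "z \<in> siegel_space"
    and \<eta>: "matrix_scale \<i> (cmat_of y) \<in> siegel_space"
  shows "sp_act (sp_turn y \<theta>) z = disc_point (matrix_scale \<i> (cmat_of y)) z (cis (- (2 * \<theta>)))"
proof (rule sp_actI[OF sp_turn_Sp_real[OF y] z])
  let ?\<eta> = "matrix_scale \<i> (cmat_of y)" and ?Y = "cmat_of y" and ?Y' = "cmat_of (matrix_inv y)" and ?\<zeta> = "cis (- (2 * \<theta>))"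
  have inv: "?Y ** ?Y' = mat 1" "?Y' ** ?Y = mat 1"
    by (simp_all add: cmat_of_mult[symmetric] matrix_inv_left matrix_inv_right y cmat_of_1)
  have T0: "?\<eta> - map_matrix cnj ?\<eta> = matrix_scale (2 * \<i>) ?Y" by (simp add: vec_eq_iff)
  have T0': "matrix_inv (?\<eta> - map_matrix cnj ?\<eta>) = matrix_scale (1 / (2 * \<i>)) ?Y'"
    unfolding T0 by (rule matrix_inv_eqI) (simp add: matrix_scale_mult_left matrix_scale_mult_right inv, simp add: vec_eq_iff)
  have a: "z - map_matrix cnj ?\<eta> = z + matrix_scale \<i> ?Y" by (simp add: vec_eq_iff)
  define a where "a = z - map_matrix cnj ?\<eta>"
  define d where "d = aut_den (sp_turn y \<theta>) z"
  have ia: "matrix_inv a ** a = mat 1" unfolding a_def by (intro matrix_inv_left invertible_diff_cnj z \<eta>)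
  have d: "d = matrix_scale (of_real (sin \<theta>)) (?Y' ** z) + matrix_scale (of_real (cos \<theta>)) (mat 1)"
    by (simp add: d_def aut_den_def block_sp_turn matrix_scale_mult_left)
  have e1: "cis \<theta> * (1 - ?\<zeta>) * (1 / (2 * \<i>)) = of_real (sin \<theta>)"
  proof -
    have "cis \<theta> * (1 - ?\<zeta>) = cis \<theta> - cis (- \<theta>)" by (simp add: algebra_simps cis_mult)
    also have "\<dots> = 2 * \<i> * of_real (sin \<theta>)" by (simp add: complex_eq_iff)
    finally have "cis \<theta> * (1 - ?\<zeta>) = 2 * \<i> * of_real (sin \<theta>)" .
    then show ?thesis by (simp only:) (simp add: complex_eq_iff)
  qed
  have e2: "cis \<theta> * ((1 - ?\<zeta>) / 2 + ?\<zeta>) = of_real (cos \<theta>)"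
  proof -
    have "cis \<theta> * ((1 - ?\<zeta>) / 2 + ?\<zeta>) = (cis \<theta> + cis (- \<theta>)) / 2" by (simp add: field_simps cis_mult)
    also have "\<dots> = of_real (cos \<theta>)" by (simp add: complex_eq_iff)
    finally show ?thesis .
  qed
  have "disc_mat ?\<eta> z ?\<zeta> ** a = matrix_scale ((1 - ?\<zeta>) * (1 / (2 * \<i>))) (?Y' ** z) + matrix_scale ((1 - ?\<zeta>) / 2 + ?\<zeta>) (mat 1)"
    unfolding disc_mat_def T0' a_def[symmetric] matrix_add_rdistrib' matrix_scale_mult_left ia
    unfolding a_def a by (simp add: matrix_add_ldistrib matrix_scale_mult_right inv) (simp add: vec_eq_iff field_simps)
  then have den: "d = matrix_scale (cis \<theta>) (disc_mat ?\<eta> z ?\<zeta> ** a)"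
    unfolding d e1[symmetric] e2[symmetric]
    by (simp only: matrix_scale_add matrix_scale_scale mult.assoc)
  have "matrix_inv (disc_mat ?\<eta> z ?\<zeta>) ** d = matrix_scale (cis \<theta>) a"
    unfolding den matrix_scale_mult_right matrix_mul_assoc
    by (simp add: matrix_inv_left invertible_disc_mat \<eta> z)
  moreover have "map_matrix cnj ?\<eta> ** d = matrix_scale (- \<i> * of_real (sin \<theta>)) z + matrix_scale (- \<i> * of_real (cos \<theta>)) ?Y"
  proof -
    have "map_matrix cnj ?\<eta> = matrix_scale (- \<i>) ?Y" by (simp add: vec_eq_iff)
    then show ?thesis
      by (simp add: d matrix_add_ldistrib matrix_scale_mult_left matrix_scale_mult_right matrix_mul_assoc inv)
         (simp add: vec_eq_iff)
  qed
  ultimately have "disc_point ?\<eta> z ?\<zeta> ** d = matrix_scale (cis \<theta>) a +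
      (matrix_scale (- \<i> * of_real (sin \<theta>)) z + matrix_scale (- \<i> * of_real (cos \<theta>)) ?Y)"
    by (simp add: disc_point_def matrix_add_rdistrib')
  also have "\<dots> = matrix_scale (of_real (cos \<theta>)) z + matrix_scale (- of_real (sin \<theta>)) ?Y"
    unfolding a_def a by (simp add: vec_eq_iff complex_eq_iff algebra_simps)
  also have "\<dots> = aut_num (sp_turn y \<theta>) z"
    by (simp add: aut_num_def block_sp_turn matrix_scale_mult_left)
  finally show "disc_point ?\<eta> z ?\<zeta> ** aut_den (sp_turn y \<theta>) z = aut_num (sp_turn y \<theta>) z" by (simp add: d_def)
qed

lemma disc_point_shift: "disc_point (\<xi> + cmat_of x) (z + cmat_of x) \<zeta> = disc_point \<xi> z \<zeta> + cmat_of x"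
proof -
  have "map_matrix cnj (\<xi> + cmat_of x) = map_matrix cnj \<xi> + cmat_of x" by (simp add: vec_eq_iff)
  then show ?thesis by (simp add: disc_point_def disc_mat_def)
qed

lemma ex_rotation:
  fixes \<xi> :: "'n::finite cmat"
  assumes \<xi>: "\<xi> \<in> siegel_space"
  obtains g where "g \<in> Sp_real" "sp_act g \<xi> = \<xi>"
    "\<And>z. z \<in> siegel_space \<Longrightarrow> sp_act g z = disc_point \<xi> z (cis (- (2 * \<theta>)))"
proof -
  define x where "x = map_matrix Re \<xi>"
  define y where "y = map_matrix Im \<xi>"
  have sym: "transpose \<xi> = \<xi>" using \<xi> by (rule siegel_space_transpose)
  have tr: "transpose (map_matrix h \<xi>) = map_matrix h \<xi>" for h :: "complex \<Rightarrow> real"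
    using sym by (simp add: vec_eq_iff transpose_def)
  have x: "transpose x = x" "transpose (- x) = - x" and y: "transpose y = y"
    using tr[of Re] tr[of Im] by (simp_all add: x_def y_def vec_eq_iff transpose_def)
  have yi: "invertible y" using det_Im_pos[OF \<xi>] by (simp add: y_def invertible_det_nz)
  let ?\<eta> = "matrix_scale \<i> (cmat_of y)"
  have nx: "w + cmat_of (- x) + cmat_of x = w" for w by (simp add: vec_eq_iff)
  have \<xi>\<eta>: "\<xi> + cmat_of (- x) = ?\<eta>" by (simp add: vec_eq_iff x_def y_def complex_eq_iff)
  have shift: "w + cmat_of (- x) \<in> siegel_space" if "w \<in> siegel_space" for w
    using sp_act_in_siegel[OF sp_shift(1)[OF x(2)] that] sp_shift(2)[OF x(2) that] by simp
  have \<eta>: "?\<eta> \<in> siegel_space" using shift[OF \<xi>] unfolding \<xi>\<eta> .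
  let ?t = "sp_turn y \<theta>"
  have t: "?t \<in> Sp_real" by (rule sp_turn_Sp_real[OF yi y])
  \<comment> \<open>Real translations move \<xi> to i y and back; the disc construction commutes
    with them.\<close>
  define g where "g = sp_shift x ** (?t ** sp_shift (- x))"
  have g: "g \<in> Sp_real" unfolding g_def by (intro Sp_real_mult sp_shift(1) x t)
  have act: "sp_act g z = disc_point \<xi> z (cis (- (2 * \<theta>)))" if z: "z \<in> siegel_space" for z
  proof -
    let ?z = "z + cmat_of (- x)"
    have "sp_act g z = sp_act (sp_shift x) (sp_act ?t (sp_act (sp_shift (- x)) z))"
      unfolding g_def using z by (simp add: sp_act_mult Sp_real_mult sp_shift(1) x t)
    also have "\<dots> = sp_act ?t ?z + cmat_of x"
      by (simp add: sp_shift(2) x z sp_act_in_siegel t shift del: map_matrix_def)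
    also have "\<dots> = disc_point ?\<eta> ?z (cis (- (2 * \<theta>))) + cmat_of x"
      by (simp only: sp_turn_act[OF yi y shift[OF z] \<eta>])
    also have "\<dots> = disc_point (\<xi> + cmat_of (- x) + cmat_of x) (?z + cmat_of x) (cis (- (2 * \<theta>)))"
      unfolding \<xi>\<eta> disc_point_shift ..
    finally show ?thesis unfolding nx .
  qed
  show ?thesis by (rule that[OF g _ act]) (simp_all add: act \<xi> disc_point_center)
qed

lemma holomorphic_on_det:
  assumes "\<And>i j. (\<lambda>\<zeta>. F \<zeta> $ i $ j) holomorphic_on S"
  shows "(\<lambda>\<zeta>. det (F \<zeta> :: complex^'n^'n)) holomorphic_on S"
  unfolding det_def by (intro holomorphic_intros assms)

lemma disc_mat_holomorphic: "(\<lambda>\<zeta>. disc_mat \<xi> z \<zeta> $ i $ j) holomorphic_on S"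
  unfolding disc_mat_def vector_add_component matrix_scale_nth by (intro holomorphic_intros)

lemma disc_point_holomorphic:
  fixes \<xi> z :: "'n::finite cmat"
  assumes \<xi>: "\<xi> \<in> siegel_space" and z: "z \<in> siegel_space"
  shows "(\<lambda>\<zeta>. disc_point \<xi> z \<zeta> $ i $ j) holomorphic_on ball 0 1"
proof -
  have nz: "det (disc_mat \<xi> z \<zeta>) \<noteq> 0" if "\<zeta> \<in> ball 0 1" for \<zeta>
    using invertible_disc_mat[OF \<xi> z, of \<zeta>] that invertible_det_nz by auto
  let ?N = "\<lambda>\<zeta>. \<chi> k l. if l = i then (if k = j then 1 else 0) else disc_mat \<xi> z \<zeta> $ k $ l"
  have "(\<lambda>\<zeta>. map_matrix cnj \<xi> $ i $ j + det (?N \<zeta>) / det (disc_mat \<xi> z \<zeta>)) holomorphic_on ball 0 1"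
  proof (intro holomorphic_intros holomorphic_on_det disc_mat_holomorphic nz)
    fix k l show "(\<lambda>\<zeta>. ?N \<zeta> $ k $ l) holomorphic_on ball 0 1"
      by (cases "l = i"; cases "k = j") (simp_all add: disc_mat_holomorphic)
  qed
  then show ?thesis
    by (rule holomorphic_transform) (simp add: disc_point_def matrix_inv_component nz)
qed

text \<open>The disc stays in the half-space, so the derivative within the half-space is enough for
  the chain rule. Its complex linearity turns the composite derivative into multiplication by a
  number.\<close>

lemma siegel_holomorphic_disc:
  fixes \<xi> z :: "'n::finite cmat"
  assumes f: "siegel_holomorphic f" and \<xi>: "\<xi> \<in> siegel_space" and z: "z \<in> siegel_space"
  shows "(\<lambda>\<zeta>. f (disc_point \<xi> z \<zeta>)) holomorphic_on ball 0 1"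
proof (rule holomorphic_onI)
  let ?Z = "disc_point \<xi> z"
  fix \<zeta> :: complex assume \<zeta>: "\<zeta> \<in> ball 0 1"
  have sub: "?Z ` ball 0 1 \<subseteq> siegel_space" using disc_point_siegel[OF \<xi> z] by auto
  obtain L where L: "(f has_derivative L) (at (?Z \<zeta>) within siegel_space)"
    and Lc: "\<And>c v. L (map_matrix (\<lambda>w. c * w) v) = c * L v"
    using f sub \<zeta> unfolding siegel_holomorphic_def by blast
  define D where "D = (\<chi> i j. deriv (\<lambda>\<zeta>. ?Z \<zeta> $ i $ j) \<zeta>)"
  have "(?Z has_derivative (\<lambda>h. map_matrix (\<lambda>w. h * w) D)) (at \<zeta> within ball 0 1)"
  proof (intro has_derivative_vecI)
    fix i j
    have "((\<lambda>\<zeta>. ?Z \<zeta> $ i $ j) has_field_derivative D $ i $ j) (at \<zeta> within ball 0 1)"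
      unfolding D_def using holomorphic_derivI[OF disc_point_holomorphic[OF \<xi> z] _ \<zeta>, of i j]
      by (simp add: has_field_derivative_at_within)
    then show "((\<lambda>\<zeta>. ?Z \<zeta> $ i $ j) has_derivative (\<lambda>h. map_matrix (\<lambda>w. h * w) D $ i $ j)) (at \<zeta> within ball 0 1)"
      by (simp add: has_field_derivative_def mult.commute[of _ "D $ i $ j"] cong: if_cong)
  qed
  from has_derivative_in_compose[OF this has_derivative_subset[OF L sub]]
  have "((\<lambda>\<zeta>. f (?Z \<zeta>)) has_derivative (\<lambda>h. h * L D)) (at \<zeta> within ball 0 1)" by (simp add: Lc)
  then have "((\<lambda>\<zeta>. f (?Z \<zeta>)) has_field_derivative L D) (at \<zeta> within ball 0 1)"
    by (simp add: has_field_derivative_def mult.commute[of _ "L D"])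
  then show "(\<lambda>\<zeta>. f (?Z \<zeta>)) field_differentiable at \<zeta> within ball 0 1"
    unfolding field_differentiable_def ..
qed

lemma siegel_holomorphic_continuous_on:
  assumes "siegel_holomorphic f" shows "continuous_on siegel_space f"
  using assms unfolding siegel_holomorphic_def continuous_on_eq_continuous_within
  by (blast intro: has_derivative_continuous)

lemma continuous_on_disc_point:
  fixes \<xi> :: "'n::finite cmat"
  assumes \<xi>: "\<xi> \<in> siegel_space"
    and S: "continuous_on S c" "continuous_on S Z" "\<And>x. x \<in> S \<Longrightarrow> cmod (c x) \<le> 1" "\<And>x. x \<in> S \<Longrightarrow> Z x \<in> siegel_space"
  shows "continuous_on S (\<lambda>x. disc_point \<xi> (Z x) (c x))"
  unfolding disc_point_def
proof (intro continuous_intros continuous_on_matrix_inv)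
  show "continuous_on S (\<lambda>x. disc_mat \<xi> (Z x) (c x))"
    unfolding disc_mat_def
    using det_diff_cnj_nz[OF S(4) \<xi>] by (intro continuous_intros continuous_on_matrix_inv S) auto
  show "det (disc_mat \<xi> (Z x) (c x)) \<noteq> 0" if "x \<in> S" for x
    using invertible_disc_mat[OF \<xi> S(4)[OF that] S(3)[OF that]] invertible_det_nz by blast
qed

text \<open>Cauchy's formula at the centre, with the unit circle parametrised over [0, 1].
  Continuity up to the boundary suffices, which matches the disc: its boundary circle is the orbit
  itself.\<close>

lemma has_integral_circle_mean:
  assumes "continuous_on (cball 0 1) f" "f holomorphic_on ball 0 1"
  shows "((\<lambda>t. f (cis (2 * pi * t))) has_integral f 0) {0..1}"
proof -
  have "((\<lambda>u. f u / (u - 0)) has_contour_integral (2 * of_real pi * \<i> * f 0)) (circlepath 0 1)"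
    by (rule Cauchy_integral_circlepath) (use assms in auto)
  then have "((\<lambda>t. f (circlepath 0 1 t) / (circlepath 0 1 t) * vector_derivative (circlepath 0 1) (at t within {0..1}))
      has_integral (2 * of_real pi * \<i> * f 0)) {0..1}"
    by (simp add: has_contour_integral_def)
  then have "((\<lambda>t. 2 * of_real pi * \<i> * f (cis (2 * pi * t))) has_integral (2 * of_real pi * \<i> * f 0)) {0..1}"
  proof (rule has_integral_eq[rotated])
    fix t :: real assume t: "t \<in> {0..1}"
    have c: "circlepath 0 1 t = cis (2 * pi * t)"
      by (simp add: circlepath cis_conv_exp mult_ac)
    have "vector_derivative (circlepath 0 1) (at t within {0..1}) = 2 * of_real pi * \<i> * cis (2 * pi * t)"
      using t by (subst vector_derivative_circlepath01) (auto simp: cis_conv_exp mult_ac)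
    then show "f (circlepath 0 1 t) / circlepath 0 1 t * vector_derivative (circlepath 0 1) (at t within {0..1}) =
        2 * of_real pi * \<i> * f (cis (2 * pi * t))"
      by (simp add: c)
  qed
  from has_integral_mult_right[OF this, of "1 / (2 * of_real pi * \<i>)"] show ?thesis by simp
qed

text \<open>The power of the determinant is the holomorphic form that the automorphy factor of a
  rotation takes along the disc; with it, f becomes a function to which the mean value property
  applies.\<close>

lemma disc_mean_value:
  fixes \<xi> z :: "'n::finite cmat" and m :: nat
  assumes f: "siegel_holomorphic f" and \<xi>: "\<xi> \<in> siegel_space" and z: "z \<in> siegel_space"
  defines "H \<equiv> \<lambda>\<zeta>. f (disc_point \<xi> z \<zeta>) * det (disc_point \<xi> z \<zeta> - map_matrix cnj \<xi>) ^ m"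
  shows "(LINT t:{0..1}|lborel. H (cis (2 * pi * t))) = f \<xi> * det (\<xi> - map_matrix cnj \<xi>) ^ m"
proof -
  have cp: "continuous_on (cball 0 1) (disc_point \<xi> z)"
    by (intro continuous_on_disc_point continuous_intros) (auto simp: \<xi> z)
  have cf: "continuous_on (cball 0 1) (\<lambda>\<zeta>. f (disc_point \<xi> z \<zeta>))"
    by (rule continuous_on_compose2[OF siegel_holomorphic_continuous_on[OF f] cp]) (auto intro: disc_point_siegel \<xi> z)
  have c: "continuous_on (cball 0 1) H"
    unfolding H_def by (intro continuous_intros cf cp)
  have h: "H holomorphic_on ball 0 1"
  proof -
    have "(\<lambda>\<zeta>. det (disc_point \<xi> z \<zeta> - map_matrix cnj \<xi>)) holomorphic_on ball 0 1"
      by (intro holomorphic_on_det) (simp add: holomorphic_on_diff disc_point_holomorphic \<xi> z)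
    then show ?thesis
      unfolding H_def using siegel_holomorphic_disc[OF f \<xi> z] by (intro holomorphic_on_mult holomorphic_on_power)
  qed
  have "continuous_on {0..1} (\<lambda>t. H (cis (2 * pi * t)))"
    by (rule continuous_on_compose2[OF c]) (auto intro!: continuous_intros)
  then have si: "set_integrable lborel {0..1} (\<lambda>t. H (cis (2 * pi * t)))"
    by (rule borel_integrable_atLeastAtMost')
  show ?thesis
    using set_borel_integral_eq_integral(2)[OF si] integral_unique[OF has_integral_circle_mean[OF c h]]
    by (simp add: H_def disc_point_0 \<xi>)
qed

section \<open>The reproducing property\<close>

lemma petersson_integrand_sp_act:
  fixes z :: "'n::finite cmat"
  assumes g: "g \<in> Sp_real" and z: "z \<in> siegel_space"
  shows "f (sp_act g z) * cnj (h (sp_act g z)) * of_real (det (map_matrix Im (sp_act g z)) ^ m) =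
    slash m f g z * cnj (slash m h g z) * of_real (det (map_matrix Im z) ^ m)"
proof -
  let ?j = "det (aut_den g z)"
  have j: "?j \<noteq> 0" by (rule det_aut_den_nz[OF g z])
  have "complex_of_real (det (map_matrix Im z)) = ?j * cnj ?j * of_real (det (map_matrix Im (sp_act g z)))"
    unfolding det_Im_sp_act[OF g z, symmetric] of_real_mult complex_norm_square ..
  then have "of_real (det (map_matrix Im z) ^ m) = ?j ^ m * cnj ?j ^ m * of_real (det (map_matrix Im (sp_act g z)) ^ m)"
    by (simp add: power_mult_distrib)
  then show ?thesis using j by (simp add: slash_eq power_int_minus field_simps)
qed

text \<open>Distributing (det y)^m evenly, one half bounds f by the growth condition and the other
  turns f_1 into the invariant kernel with s = m/2, integrable because m > 2 n.\<close>

lemma integrable_petersson_f1: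
  fixes \<xi> :: "'n::{finite,linorder} cmat"
  assumes \<xi>: "\<xi> \<in> siegel_space" and m: "m > 2 * CARD('n)" and f: "siegel_holomorphic f"
    and bdd: "bdd_above ((\<lambda>z. cmod (f z) * det (map_matrix Im z) powr (real m / 2)) ` siegel_space)"
  shows "integrable siegel_measure (\<lambda>z. if z \<in> siegel_space then f z * cnj (f1 m \<xi> z) * of_real (det (map_matrix Im z) ^ m) else 0)"
    (is "integrable _ ?G")
proof (rule integrableI_bounded)
  obtain B where B: "\<And>z. z \<in> siegel_space \<Longrightarrow> cmod (f z) * det (map_matrix Im z) powr (real m / 2) \<le> B"
    using bdd by (auto simp: bdd_above_def)
  have nz: "det (z - map_matrix cnj \<xi>) ^ m \<noteq> 0" if "z \<in> siegel_space" for z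
    using det_diff_cnj_nz[OF that \<xi>] by simp
  show "?G \<in> borel_measurable siegel_measure"
    unfolding measurable_cong_sets[OF sets_siegel_measure refl] f1_eq
    by (intro borel_measurable_continuous_on_if continuous_intros siegel_holomorphic_continuous_on f siegel_space_borel
        continuous_on_map_matrix) (use nz in simp)
  define c where "c = B * cmod (f1_coeff m CARD('n)) * det (map_matrix Im \<xi>) powr (- (real m / 2))"
  have bound: "cmod (?G z) \<le> c * kern (real m / 2) z \<xi>" if z: "z \<in> siegel_space" for z
  proof -
    let ?y = "det (map_matrix Im z) powr (real m / 2)"
    have y: "det (map_matrix Im z) ^ m = ?y * ?y"
      using det_Im_pos[OF z] by (simp add: powr_add[symmetric] powr_realpow)
    have m0: "m > 0" using m by simp
    have "cmod (f1 m \<xi> z) * ?y = cmod (f1_coeff m CARD('n)) * det (map_matrix Im \<xi>) powr (- (real m / 2)) * kern (real m / 2) z \<xi>"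
      using norm_slash_f1[OF Sp_real_1 z \<xi> m0] z by (simp add: slash_eq aut_den_def)
    then have "cmod (?G z) = (cmod (f z) * ?y) * (cmod (f1_coeff m CARD('n)) * det (map_matrix Im \<xi>) powr (- (real m / 2)) * kern (real m / 2) z \<xi>)"
      using z by (simp add: norm_mult y del: of_real_power)
    also have "\<dots> \<le> B * (cmod (f1_coeff m CARD('n)) * det (map_matrix Im \<xi>) powr (- (real m / 2)) * kern (real m / 2) z \<xi>)"
      by (intro mult_right_mono B z mult_nonneg_nonneg) auto
    finally show ?thesis by (simp add: c_def mult.assoc)
  qed
  have km: "(\<lambda>z. kern (real m / 2) z \<xi>) \<in> borel_measurable borel"
    unfolding kern_commute[of _ _ \<xi>] by (rule kern_measurable)
  have s: "real CARD('n) < real m / 2" using m by simp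
  have "(\<integral>\<^sup>+z. ennreal (cmod (?G z)) \<partial>siegel_measure) \<le> (\<integral>\<^sup>+z. ennreal \<bar>c\<bar> * ennreal (kern (real m / 2) z \<xi>) \<partial>siegel_measure)"
  proof (rule nn_integral_mono)
    fix z :: "'n cmat"
    show "ennreal (cmod (?G z)) \<le> ennreal \<bar>c\<bar> * ennreal (kern (real m / 2) z \<xi>)"
    proof (cases "z \<in> siegel_space")
      case True
      have "c * kern (real m / 2) z \<xi> \<le> \<bar>c\<bar> * kern (real m / 2) z \<xi>" by (intro mult_right_mono) auto
      with bound[OF True] show ?thesis by (simp add: ennreal_mult'[symmetric] ennreal_leI del: ennreal_le_iff)
    qed simp
  qed
  also have "\<dots> = ennreal \<bar>c\<bar> * (\<integral>\<^sup>+z. ennreal (kern (real m / 2) \<xi> z) \<partial>siegel_measure)"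
    unfolding kern_commute[of _ _ \<xi>] by (rule nn_integral_cmult) measurable
  also have "\<dots> < \<infinity>" unfolding nn_integral_kern[OF \<xi> s] by (simp add: ennreal_mult'[symmetric])
  finally show "(\<integral>\<^sup>+z. ennreal (cmod (?G z)) \<partial>siegel_measure) < \<infinity>" .
qed

text \<open>Division by det (z - cnj \<xi>)^m completes the conjugate of f_1 to a multiple of |det
  (z - cnj \<xi>)|^(-2m), so this is Hua's integral with s = m; the constant C_{m,n} is what
  normalises the result to 1.\<close>

lemma integral_det_hua:
  fixes \<xi> :: "'n::{finite,linorder} cmat"
  assumes \<xi>: "\<xi> \<in> siegel_space" and m: "m > 2 * CARD('n)"
  shows "(LINT z|siegel_measure. (if z \<in> siegel_space then
      cnj (f1 m \<xi> z) * of_real (det (map_matrix Im z) ^ m) / det (z - map_matrix cnj \<xi>) ^ m else 0)) *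
    det (\<xi> - map_matrix cnj \<xi>) ^ m = 1"
    (is "(LINT z|_. ?K z) * _ = _")
proof -
  let ?n = "CARD('n)" and ?C = "C_const m CARD('n)"
  let ?h = "\<lambda>z. cmod (det (z - map_matrix cnj \<xi>)) powr (- 2 * real m) * det (map_matrix Im z) powr real m"
  let ?Y = "det (map_matrix Im \<xi>)"
  have mn: "m > ?n" and s: "real m > real ?n" using m by auto
  have [measurable]: "(\<lambda>w. cmod (det (w - map_matrix cnj \<xi>))) \<in> borel_measurable borel"
    by (intro borel_measurable_continuous_onI continuous_intros)
  have hb: "has_bochner_integral siegel_measure ?h (?C / 4 ^ (?n * m) * ?Y powr (- real m))"
  proof (rule has_bochner_integral_nn_integral)
    show "(\<integral>\<^sup>+z. ennreal (?h z) \<partial>siegel_measure) = ennreal (?C / 4 ^ (?n * m) * ?Y powr (- real m))"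
      unfolding nn_integral_hua[OF \<xi> s] hua_const_C_const[OF mn] ..
    show "0 \<le> ?C / 4 ^ (?n * m) * ?Y powr (- real m)"
      unfolding hua_const_C_const[OF mn, symmetric] using hua_const_pos[OF s] by simp
  qed (auto intro!: AE_I2, measurable)
  have C0: "?C \<noteq> 0"
    using hua_const_pos[OF s] unfolding hua_const_C_const[OF mn] by auto
  have K: "?K z = cnj (f1_coeff m ?n) * of_real (?h z)" if z: "z \<in> siegel_space" for z
  proof -
    let ?d = "det (z - map_matrix cnj \<xi>)"
    have d: "?d \<noteq> 0" by (rule det_diff_cnj_nz[OF z \<xi>])
    have "cmod ?d powr (- 2 * real m) = inverse ((cmod ?d)\<^sup>2 ^ m)"
    proof -
      have "cmod ?d powr (- 2 * real m) = cmod ?d powr (- real (2 * m))" by simp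
      also have "\<dots> = inverse (cmod ?d ^ (2 * m))" using d by (simp add: powr_minus powr_realpow del: of_nat_mult)
      finally show ?thesis by (simp add: power_mult)
    qed
    then have "complex_of_real (?h z) = inverse ((?d * cnj ?d) ^ m) * of_real (det (map_matrix Im z) ^ m)"
      using det_Im_pos[OF z] by (simp add: powr_realpow complex_norm_square[symmetric])
    then show ?thesis
      using z by (simp add: f1_eq power_mult_distrib divide_inverse mult_ac)
  qed
  have "(LINT z|siegel_measure. ?K z) = (LINT z|siegel_measure. cnj (f1_coeff m ?n) * of_real (?h z))"
  proof (rule integral_cong_AE)
    have "?K \<in> borel_measurable borel"
      unfolding f1_eq using det_diff_cnj_nz[OF _ \<xi>]
      by (intro borel_measurable_continuous_on_if continuous_intros siegel_space_borel continuous_on_map_matrix) auto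
    then show "?K \<in> borel_measurable siegel_measure" by simp
    show "AE z in siegel_measure. ?K z = cnj (f1_coeff m ?n) * of_real (?h z)"
      by (rule eventually_mono[OF AE_siegel_space]) (rule K)
  qed measurable
  also have "\<dots> = cnj (f1_coeff m ?n) * of_real (?C / 4 ^ (?n * m) * ?Y powr (- real m))"
    by (simp only: integral_mult_right_zero integral_complex_of_real has_bochner_integral_integral_eq[OF hb])
  also have "\<dots> * det (\<xi> - map_matrix cnj \<xi>) ^ m = 1"
  proof -
    have Y: "?Y powr (- real m) = inverse (?Y ^ m)" "?Y \<noteq> 0"
      using det_Im_pos[OF \<xi>] by (simp_all add: powr_minus powr_realpow)
    define p where "p = complex_of_real (?Y ^ m)"
    define q where "q = (4 :: complex) ^ (?n * m)"
    define c where "c = complex_of_real ?C"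
    define u where "u = (2 * \<i>) ^ (?n * m)"
    define u' where "u' = (- (2 * \<i>)) ^ (?n * m)"
    have nz: "p \<noteq> 0" "q \<noteq> 0" "c \<noteq> 0" using Y(2) C0 by (simp_all add: p_def q_def c_def)
    \<comment> \<open>One power of 2i comes from det (\<xi> - cnj \<xi>)^m, the conjugate one from
      f_1; together they give the 4^(nm) by which Hua's constant is divided.\<close>
    have "u' * u = q" unfolding u'_def u_def q_def by (subst power_mult_distrib[symmetric]) simp
    have 1: "cnj (f1_coeff m ?n) = inverse c * u'"
      by (simp only: f1_coeff_def c_def u'_def complex_cnj_mult complex_cnj_power complex_cnj_inverse
          complex_cnj_complex_of_real complex_cnj_i complex_cnj_numeral mult_minus_right)
    have 2: "complex_of_real (?C / 4 ^ (?n * m) * ?Y powr (- real m)) = c * inverse q * inverse p"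
      unfolding Y(1) by (simp add: c_def q_def p_def divide_inverse)
    have 3: "det (\<xi> - map_matrix cnj \<xi>) ^ m = u * p"
      unfolding det_diff_cnj_Im by (simp only: power_mult_distrib power_mult u_def p_def of_real_power)
    have "inverse c * u' * (c * inverse q * inverse p) * (u * p) = (inverse c * c) * (inverse q * (u' * u)) * (inverse p * p)"
      by (simp only: mult_ac)
    also have "\<dots> = 1" unfolding \<open>u' * u = q\<close> using nz by simp
    finally show ?thesis unfolding 1 2 3 .
  qed
  finally show ?thesis .
qed

lemma integral_petersson_f1:
  fixes \<xi> :: "'n::{finite,linorder} cmat"
  assumes \<xi>: "\<xi> \<in> siegel_space" and m: "m > 2 * CARD('n)" and f: "siegel_holomorphic f"
    and bdd: "bdd_above ((\<lambda>z. cmod (f z) * det (map_matrix Im z) powr (real m / 2)) ` siegel_space)"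
  shows "(LINT z|siegel_measure. (if z \<in> siegel_space then f z * cnj (f1 m \<xi> z) * of_real (det (map_matrix Im z) ^ m) else 0)) = f \<xi>"
    (is "(LINT z|_. ?G z) = _")
proof -
  define H where "H z \<zeta> = f (disc_point \<xi> z \<zeta>) * det (disc_point \<xi> z \<zeta> - map_matrix cnj \<xi>) ^ m" for z \<zeta>
  define K where "K z = (if z \<in> siegel_space then
      cnj (f1 m \<xi> z) * of_real (det (map_matrix Im z) ^ m) / det (z - map_matrix cnj \<xi>) ^ m else 0)" for z
  let ?c = "\<lambda>t::real. cis (2 * pi * t)"
  \<comment> \<open>The integrand along rotated orbits as a function of the parameter t and of z,
    cut off to t in [0, 1], so that Fubini can be used with Lebesgue measure on the line.\<close>
  define \<Psi> where "\<Psi> t z = indicator {0..1} t *\<^sub>R (if z \<in> siegel_space then H z (?c t) * K z else 0)" for t z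
  note G = integrable_petersson_f1[OF assms]
  have rot: "\<exists>g\<in>Sp_real. \<forall>z\<in>siegel_space. sp_act g z \<in> siegel_space \<and> ?G (sp_act g z) = H z (?c t) * K z" for t
  proof -
    obtain g where g: "g \<in> Sp_real" "sp_act g \<xi> = \<xi>"
      "\<And>z. z \<in> siegel_space \<Longrightarrow> sp_act g z = disc_point \<xi> z (?c t)"
      using ex_rotation[OF \<xi>, of "- (pi * t)"] by (auto simp: mult_ac)
    have "?G (sp_act g z) = H z (?c t) * K z" if z: "z \<in> siegel_space" for z
    proof -
      let ?j = "det (aut_den g z)" and ?jx = "det (aut_den g \<xi>)" and ?d = "det (z - map_matrix cnj \<xi>)"
      have gz: "sp_act g z \<in> siegel_space" by (rule sp_act_in_siegel[OF g(1) z])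
      have nz: "?j \<noteq> 0" "?d \<noteq> 0" using det_aut_den_nz[OF g(1) z] det_diff_cnj_nz[OF z \<xi>] by auto
      \<comment> \<open>The rotation fixes \<xi>, hence preserves det Im \<xi>, and the automorphy
        factor at \<xi> is a mere phase. In \<open>q\<close> this phase and the factor at z combine
        into a quotient of the determinants at the rotated point and at z.\<close>
      have "(cmod ?jx)\<^sup>2 = 1" using det_Im_sp_act[OF g(1) \<xi>] det_Im_pos[OF \<xi>] by (simp add: g(2))
      then have jx: "?jx * cnj ?jx = 1" by (metis complex_norm_square of_real_1)
      have "?d = cnj ?jx * det (disc_point \<xi> z (?c t) - map_matrix cnj \<xi>) * ?j"
        using det_sp_act_diff_cnj[OF g(1) z \<xi>] by (simp add: g(2) g(3)[OF z])
      then have "?jx * ?d = (?jx * cnj ?jx) * (det (disc_point \<xi> z (?c t) - map_matrix cnj \<xi>) * ?j)"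
        by (simp add: mult_ac)
      then have jd: "?jx * ?d = det (disc_point \<xi> z (?c t) - map_matrix cnj \<xi>) * ?j" by (simp add: jx)
      have q: "inverse (?j ^ m) * ?jx ^ m = det (disc_point \<xi> z (?c t) - map_matrix cnj \<xi>) ^ m * inverse (?d ^ m)"
      proof -
        have cancel: "inverse j * a = D * inverse d" if "a * d = D * j" "j \<noteq> 0" "d \<noteq> 0" for a d D j :: complex
          using that by (simp add: field_simps)
        show ?thesis
          using nz by (intro cancel) (simp_all only: power_mult_distrib[symmetric] jd power_not_zero not_False_eq_True)
      qed
      have s1: "slash m f g z = inverse (?j ^ m) * f (disc_point \<xi> z (?c t))"
        by (simp add: slash_eq power_int_minus g(3)[OF z])
      have s2: "slash m (f1 m \<xi>) g z = cnj ?jx ^ m * f1 m \<xi> z"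
        using slash_f1[OF g(1) z \<xi>, of m] by (simp add: g(2) f1_eq mult_ac)
      have "?G (sp_act g z) = slash m f g z * cnj (slash m (f1 m \<xi>) g z) * of_real (det (map_matrix Im z) ^ m)"
        using petersson_integrand_sp_act[OF g(1) z, of f "f1 m \<xi>" m] gz by simp
      also have "\<dots> = (inverse (?j ^ m) * ?jx ^ m) * f (disc_point \<xi> z (?c t)) * cnj (f1 m \<xi> z) * of_real (det (map_matrix Im z) ^ m)"
        by (simp only: s1 s2 complex_cnj_mult complex_cnj_power complex_cnj_cnj mult_ac)
      also have "\<dots> = H z (?c t) * K z"
        unfolding q H_def K_def using z by (simp add: divide_inverse mult_ac)
      finally show ?thesis .
    qed
    then show ?thesis using g(1) sp_act_in_siegel[OF g(1)] by blast
  qed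
  have Gm: "?G \<in> borel_measurable borel" using borel_measurable_integrable[OF G] by simp
  have \<Psi>m: "case_prod \<Psi> \<in> borel_measurable (lborel \<Otimes>\<^sub>M siegel_measure)"
  proof -
    let ?A = "UNIV \<times> siegel_space :: (real \<times> 'n cmat) set"
    have A: "?A \<in> sets borel" by (intro borel_Times siegel_space_borel) simp
    have cp: "continuous_on ?A (\<lambda>p. disc_point \<xi> (snd p) (?c (fst p)))"
      by (intro continuous_on_disc_point \<xi> continuous_intros) auto
    have cf: "continuous_on ?A (\<lambda>p. f (disc_point \<xi> (snd p) (?c (fst p))))"
      by (rule continuous_on_compose2[OF siegel_holomorphic_continuous_on[OF f] cp]) (auto intro!: disc_point_siegel \<xi>)
    have "(\<lambda>p. if p \<in> ?A then H (snd p) (?c (fst p)) * (cnj (f1 m \<xi> (snd p)) * of_real (det (map_matrix Im (snd p)) ^ m) / det (snd p - map_matrix cnj \<xi>) ^ m) else 0) \<in> borel_measurable borel"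
      unfolding H_def f1_eq
      by (intro borel_measurable_continuous_on_if A continuous_intros cf cp continuous_on_map_matrix)
         (use det_diff_cnj_nz[OF _ \<xi>] in auto)
    then have "(\<lambda>p. if snd p \<in> siegel_space then H (snd p) (?c (fst p)) * K (snd p) else 0) \<in> borel_measurable borel"
      by (rule measurable_cong[THEN iffD1, rotated]) (auto simp: K_def)
    then have [measurable]: "(\<lambda>p. if snd p \<in> siegel_space then H (snd p) (?c (fst p)) * K (snd p) else 0) \<in> borel_measurable (lborel \<Otimes>\<^sub>M siegel_measure)"
      by (subst measurable_cong_sets[OF _ refl, where N = borel]) (simp_all add: borel_prod[symmetric] cong: sets_pair_measure_cong)
    have "(\<lambda>p. indicator {0..1} (fst p) *\<^sub>R (if snd p \<in> siegel_space then H (snd p) (?c (fst p)) * K (snd p) else 0)) \<in> borel_measurable (lborel \<Otimes>\<^sub>M siegel_measure)"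
      by measurable
    then show ?thesis by (simp add: \<Psi>_def case_prod_beta')
  qed
  have nn: "(\<integral>\<^sup>+z. ennreal (norm (\<Psi> t z)) \<partial>siegel_measure) = indicator {0..1} t * (\<integral>\<^sup>+z. ennreal (norm (?G z)) \<partial>siegel_measure)"
    and li: "(LINT z|siegel_measure. \<Psi> t z) = indicator {0..1} t *\<^sub>R (LINT z|siegel_measure. ?G z)" for t
  proof -
    obtain g where g: "g \<in> Sp_real" "\<And>z. z \<in> siegel_space \<Longrightarrow> ?G (sp_act g z) = H z (?c t) * K z"
      using rot[of t] by blast
    have \<Psi>: "AE z in siegel_measure. \<Psi> t z = indicator {0..1} t *\<^sub>R ?G (sp_act0 g z)"
      by (rule eventually_mono[OF AE_siegel_space]) (simp add: \<Psi>_def g(2)[symmetric] sp_act0_def)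
    have \<Psi>': "AE z in siegel_measure. \<Psi> t z = indicator {0..1} t *\<^sub>R ?G (sp_act g z)"
      by (rule eventually_mono[OF AE_siegel_space]) (simp add: \<Psi>_def g(2)[symmetric])
    have "(\<integral>\<^sup>+z. ennreal (norm (\<Psi> t z)) \<partial>siegel_measure) = (\<integral>\<^sup>+z. indicator {0..1} t * ennreal (norm (?G (sp_act g z))) \<partial>siegel_measure)"
      by (intro nn_integral_cong_AE eventually_mono[OF \<Psi>']) (simp add: indicator_def)
    also have "\<dots> = (\<integral>\<^sup>+z. indicator {0..1} t * ennreal (norm (?G z)) \<partial>siegel_measure)"
      by (rule nn_integral_siegel_sp_act[OF g(1)]) (use Gm in measurable)
    also have "\<dots> = indicator {0..1} t * (\<integral>\<^sup>+z. ennreal (norm (?G z)) \<partial>siegel_measure)"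
      by (rule nn_integral_cmult) (use Gm in measurable)
    finally show "(\<integral>\<^sup>+z. ennreal (norm (\<Psi> t z)) \<partial>siegel_measure) = indicator {0..1} t * (\<integral>\<^sup>+z. ennreal (norm (?G z)) \<partial>siegel_measure)" .
    have "\<Psi> t \<in> borel_measurable siegel_measure"
      using measurable_Pair2[OF \<Psi>m, of t] by simp
    moreover have "(\<lambda>z. indicator {0..1} t *\<^sub>R ?G (sp_act0 g z)) \<in> borel_measurable siegel_measure"
      using measurable_compose[OF sp_act0_measurable[OF g(1)] Gm] by simp
    ultimately have "(LINT z|siegel_measure. \<Psi> t z) = (LINT z|siegel_measure. indicator {0..1} t *\<^sub>R ?G (sp_act0 g z))"
      by (intro integral_cong_AE \<Psi>)
    also have "\<dots> = indicator {0..1} t *\<^sub>R (LINT z|siegel_measure. ?G (sp_act0 g z))" by simp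
    also have "\<dots> = indicator {0..1} t *\<^sub>R (LINT z|siegel_measure. ?G z)"
      by (simp only: integral_siegel_sp_act(2)[OF g(1) Gm])
    finally show "(LINT z|siegel_measure. \<Psi> t z) = indicator {0..1} t *\<^sub>R (LINT z|siegel_measure. ?G z)" .
  qed
  interpret M: sigma_finite_measure "siegel_measure :: 'n cmat measure" by (rule sigma_finite_siegel_measure)
  interpret P: pair_sigma_finite "lborel :: real measure" "siegel_measure :: 'n cmat measure" ..
  have "(\<integral>\<^sup>+p. ennreal (norm (case_prod \<Psi> p)) \<partial>(lborel \<Otimes>\<^sub>M siegel_measure)) =
      (\<integral>\<^sup>+t. (\<integral>\<^sup>+z. ennreal (norm (case_prod \<Psi> (t, z))) \<partial>siegel_measure) \<partial>lborel)"
    by (rule M.nn_integral_fst[symmetric]) (use \<Psi>m in measurable)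
  also have "\<dots> = (\<integral>\<^sup>+t. indicator {0..1} t * (\<integral>\<^sup>+z. ennreal (norm (?G z)) \<partial>siegel_measure) \<partial>(lborel :: real measure))"
    by (simp only: prod.case nn)
  also have "\<dots> = (\<integral>\<^sup>+z. ennreal (norm (?G z)) \<partial>siegel_measure)"
    by (simp add: nn_integral_multc)
  also have "\<dots> < \<infinity>" using G by (simp only: integrable_iff_bounded)
  finally have \<Psi>i: "integrable (lborel \<Otimes>\<^sub>M siegel_measure) (case_prod \<Psi>)"
    using \<Psi>m by (simp only: integrable_iff_bounded simp_thms)
  \<comment> \<open>Every rotation leaves the integral unchanged, so it equals its mean over t. The
    exchange of integrals brings this mean inside, onto the circle through each z.\<close>
  have "(LINT z|siegel_measure. ?G z) = (LINT t|lborel. (LINT z|siegel_measure. \<Psi> t z))"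
    by (simp add: li)
  also have "\<dots> = (LINT z|siegel_measure. (LINT t|lborel. \<Psi> t z))"
    using P.integral_fst[OF \<Psi>i] P.integral_snd[OF \<Psi>i] by simp
  also have "\<dots> = (LINT z|siegel_measure. f \<xi> * det (\<xi> - map_matrix cnj \<xi>) ^ m * K z)"
  proof (rule Bochner_Integration.integral_cong[OF refl])
    fix z :: "'n cmat"
    show "(LINT t|lborel. \<Psi> t z) = f \<xi> * det (\<xi> - map_matrix cnj \<xi>) ^ m * K z"
    proof (cases "z \<in> siegel_space")
      case True
      have "(LINT t|lborel. \<Psi> t z) = (LINT t:{0..1}|lborel. H z (?c t) * K z)"
        using True by (simp add: \<Psi>_def set_lebesgue_integral_def del: set_integral_mult_left)
      also have "\<dots> = (LINT t:{0..1}|lborel. H z (?c t)) * K z" by (rule set_integral_mult_left)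
      also have "\<dots> = f \<xi> * det (\<xi> - map_matrix cnj \<xi>) ^ m * K z"
        unfolding H_def by (simp only: disc_mean_value[OF f \<xi> True])
      finally show ?thesis .
    qed (simp add: \<Psi>_def K_def)
  qed
  also have "\<dots> = f \<xi> * ((LINT z|siegel_measure. K z) * det (\<xi> - map_matrix cnj \<xi>) ^ m)" by simp
  also have "(LINT z|siegel_measure. K z) * det (\<xi> - map_matrix cnj \<xi>) ^ m = 1"
    unfolding K_def by (rule integral_det_hua[OF \<xi> m])
  finally show ?thesis by simp
qed

theorem theorem8p3:
  fixes m :: nat
    and \<xi> :: "'n::{finite,linorder} cmat"
    and \<Gamma> :: "'n::{finite,linorder} sp_mat set"
  assumes "m > 0" and "m > 2 * CARD('n)"
    and "\<xi> \<in> siegel_space"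
    and "congruence_subgroup \<Gamma>"
  shows "(\<forall>z\<in>siegel_space. (\<lambda>\<gamma>. norm (slash m (f1 m \<xi>) \<gamma> z)) summable_on \<Gamma>)
    \<and> (\<forall>K. compact K \<and> K \<subseteq> siegel_space \<longrightarrow>
          uniform_limit K (\<lambda>X z. \<Sum>\<gamma>\<in>X. slash m (f1 m \<xi>) \<gamma> z) (Delta \<Gamma> m \<xi>)
            (finite_subsets_at_top \<Gamma>))
    \<and> Delta \<Gamma> m \<xi> \<in> siegel_cusp_forms m \<Gamma>
    \<and> (\<forall>f\<in>siegel_cusp_forms m \<Gamma>. petersson m \<Gamma> f (Delta \<Gamma> m \<xi>) = f \<xi>)"
proof -
  note m = assms(2) and \<xi> = assms(3) and \<Gamma> = assms(4)
  have sm: "(\<lambda>\<gamma>. norm (slash m (f1 m \<xi>) \<gamma> z)) summable_on \<Gamma>" if "z \<in> siegel_space" for z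
    using poincare_bounded[OF \<Gamma> \<xi> m] that by blast
  have "petersson m \<Gamma> f (Delta \<Gamma> m \<xi>) = f \<xi>" if f: "f \<in> siegel_cusp_forms m \<Gamma>" for f
  proof -
    have hol: "siegel_holomorphic f" and inv: "\<And>\<gamma> z. \<gamma> \<in> \<Gamma> \<Longrightarrow> z \<in> siegel_space \<Longrightarrow> slash m f \<gamma> z = f z"
      and bdd: "bdd_above ((\<lambda>z. cmod (f z) * det (map_matrix Im z) powr (real m / 2)) ` siegel_space)"
      using f by (auto simp: siegel_cusp_forms_def)
    \<comment> \<open>This is the set over which \<open>quotient_integral\<close> integrates; that
      some Borel set of representatives exists is what gives the choice its properties.\<close>
    define F where "F = (SOME F. orbit_representatives \<Gamma> (F :: 'n cmat set))"
    have F: "orbit_representatives \<Gamma> F" unfolding F_def by (rule someI_ex[OF ex_orbit_representatives[OF \<Gamma>]])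
    then have FH: "F \<subseteq> siegel_space" and Fb: "F \<in> sets siegel_measure" by (auto simp: orbit_representatives_def)
    let ?c = "card (\<Gamma> \<inter> {mat 1, - mat 1})"
    define G where "G z = (if z \<in> siegel_space then f z * cnj (f1 m \<xi> z) * of_real (det (map_matrix Im z) ^ m) else 0)" for z
    \<comment> \<open>Invariance of f leaves \<gamma> in the slashed f_1 only, so the sum over
      \<Gamma> is f against the conjugate of the Poincare series.\<close>
    have G: "G (sp_act \<gamma> z) = f z * of_real (det (map_matrix Im z) ^ m) * cnj (slash m (f1 m \<xi>) \<gamma> z)"
      if "\<gamma> \<in> \<Gamma>" "z \<in> siegel_space" for \<gamma> z
      using petersson_integrand_sp_act[OF congruence_subgroup_Sp_real[OF \<Gamma> that(1)] that(2), of f "f1 m \<xi>" m]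
        sp_act_in_siegel[OF congruence_subgroup_Sp_real[OF \<Gamma> that(1)] that(2)]
      by (simp add: G_def inv that)
    have sums: "(\<Sum>\<^sub>\<infinity>\<gamma>\<in>\<Gamma>. G (sp_act \<gamma> z)) = f z * cnj (Delta \<Gamma> m \<xi> z) * of_real (det (map_matrix Im z) ^ m)"
      if z: "z \<in> siegel_space" for z
    proof -
      have "(\<Sum>\<^sub>\<infinity>\<gamma>\<in>\<Gamma>. G (sp_act \<gamma> z)) = (\<Sum>\<^sub>\<infinity>\<gamma>\<in>\<Gamma>. f z * of_real (det (map_matrix Im z) ^ m) * cnj (slash m (f1 m \<xi>) \<gamma> z))"
        by (rule infsum_cong) (rule G[OF _ z])
      also have "\<dots> = f z * of_real (det (map_matrix Im z) ^ m) * (\<Sum>\<^sub>\<infinity>\<gamma>\<in>\<Gamma>. cnj (slash m (f1 m \<xi>) \<gamma> z))"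
        by (rule infsum_cmult_right')
      also have "(\<Sum>\<^sub>\<infinity>\<gamma>\<in>\<Gamma>. cnj (slash m (f1 m \<xi>) \<gamma> z)) = cnj (Delta \<Gamma> m \<xi> z)"
        by (simp add: Delta_def poincare_series_def)
      finally show ?thesis by (simp add: mult_ac)
    qed
    have "quotient_integral \<Gamma> (\<lambda>z. f z * cnj (Delta \<Gamma> m \<xi> z) * of_real (det (map_matrix Im z) ^ m)) =
        (LINT z:F|siegel_measure. f z * cnj (Delta \<Gamma> m \<xi> z) * of_real (det (map_matrix Im z) ^ m))"
      by (simp add: quotient_integral_def F_def)
    also have "\<dots> = (LINT z:F|siegel_measure. (\<Sum>\<^sub>\<infinity>\<gamma>\<in>\<Gamma>. G (sp_act \<gamma> z)))"
      by (rule set_lebesgue_integral_cong[OF Fb]) (use sums FH in auto)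
    also have "\<dots> = of_nat ?c * (LINT z|siegel_measure. G z)"
    proof (rule integral_unfold[OF \<Gamma> F])
      show "integrable siegel_measure G"
        unfolding G_def[abs_def] by (rule integrable_petersson_f1[OF \<xi> m hol bdd])
      show "(\<lambda>\<gamma>. norm (G (sp_act \<gamma> z))) summable_on \<Gamma>" if z: "z \<in> siegel_space" for z
        using summable_on_cmult_right[OF sm[OF z], of "cmod (f z * of_real (det (map_matrix Im z) ^ m))"]
        by (rule summable_on_cong[THEN iffD1, rotated]) (simp add: G z norm_mult)
    qed
    also have "(LINT z|siegel_measure. G z) = f \<xi>"
      unfolding G_def by (rule integral_petersson_f1[OF \<xi> m hol bdd])
    finally have "quotient_integral \<Gamma> (\<lambda>z. f z * cnj (Delta \<Gamma> m \<xi> z) * of_real (det (map_matrix Im z) ^ m)) = of_nat ?c * f \<xi>" .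
    moreover have "?c \<noteq> 0" using congruence_subgroup_1[OF \<Gamma>] by auto
    ultimately show ?thesis by (simp add: petersson_def)
  qed
  then show ?thesis
    using sm uniform_limit_poincare[OF \<Gamma> \<xi> m] Delta_cusp_form[OF \<Gamma> \<xi> m] by blast
qed

end
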